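(* Let $E$ and $F$ be strongly connected finite directed graphs such that $L_{\mathbb{Z}}(E)\otimes M_\infty(\mathbb{Z})$ and $L_{\mathbb{Z}}(F)\otimes M_\infty(\mathbb{Z})$ are $^*$-isomorphic (isomorphic as $^*$-rings). Then $\det(1-A_E^t)=\det(1-A_F^t)$. In particular, $L_{\mathbb{Z}}(E_2)\otimes M_\infty(\mathbb{Z})$ and $L_{\mathbb{Z}}(E_{2-})\otimes M_\infty(\mathbb{Z})$ are not $^*$-isomorphic.
   Context: A directed graph $E=(E^0,E^1,r,s)$ has vertices $E^0$, edges $E^1$ and range and source maps $r,s$. It is strongly connected if for all vertices $v,w$ there is a path from $v$ to $w$. $A_E$ is the adjacency matrix: $A_E(v,w)$ is the number of edges with source $v$ and range $w$. $E_2$ is the graph with one vertex and two loops at it. $E_{2-}$ is the graph with three vertices $w_1,w_2,w_3$, two loops at $w_1$, one loop at $w_2$, one loop at $w_3$, and exactly one edge in each direction between $w_1$ and $w_2$ and between $w_2$ and $w_3$ (no other edges). For a commutative ring $R$ with $1$, $L_R(E)$ is the universal $R$-algebra generated by mutually orthogonal idempotents $\{p_v:v\in E^0\}$ and elements $\{s_e,s_{e^*}:e\in E^1\}$ with $p_{s(e)}s_e=s_e=s_ep_{r(e)}$, $p_{r(e)}s_{e^*}=s_{e^*}=s_{e^*}p_{s(e)}$, $s_{e^*}s_f=\delta_{e,f}p_{r(e)}$, and $p_v=\sum_{s(e)=v}s_es_{e^*}$ whenever $0<|s^{-1}(v)|<\infty$. It carries the $R$-linear involution with $p_v^*=p_v$,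 $s_e^*=s_{e^*}$. $M_\infty(R)$ is the ring of finitely supported $\mathbb{N}\times\mathbb{N}$ matrices over $R$, with transpose as involution; the tensor product (over $R$) carries the tensor product involution. *)

theory Defs
  imports
    "HOL-Library.Poly_Mapping"
    "Graph_Theory.Digraph"
    "Jordan_Normal_Form.Determinant"
begin

section \<open>Star-semigroups and star-algebras\<close>

text \<open>
  Algebras need not have a unit. The records only carry the operations; for all structures
  built below the laws of an algebra with involution hold by construction.
\<close>

record 'a star_semigroup =
  elems :: "'a set"
  mul :: "'a \<Rightarrow> 'a \<Rightarrow> 'a"
  star :: "'a \<Rightarrow> 'a"

record ('r, 'a) star_algebra = "'a star_semigroup" +
  nul :: "'a"
  add :: "'a \<Rightarrow> 'a \<Rightarrow> 'a"
  scale :: "'r \<Rightarrow> 'a \<Rightarrow> 'a"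

text \<open>Isomorphism of star-rings: scalar multiplication plays no role.\<close>

definition star_ring_isomorphic :: "('r, 'a) star_algebra \<Rightarrow> ('s, 'b) star_algebra \<Rightarrow> bool" where
  "star_ring_isomorphic A B \<longleftrightarrow>
    (\<exists>\<phi>. bij_betw \<phi> (elems A) (elems B) \<and>
      (\<forall>x\<in>elems A. \<forall>y\<in>elems A. \<phi> (add A x y) = add B (\<phi> x) (\<phi> y)) \<and>
      (\<forall>x\<in>elems A. \<forall>y\<in>elems A. \<phi> (mul A x y) = mul B (\<phi> x) (\<phi> y)) \<and>
      (\<forall>x\<in>elems A. \<phi> (star A x) = star B (\<phi> x)))"

text \<open>
  The semigroup algebra \<open>R[S]\<close>: the free \<open>R\<close>-module on \<open>S\<close>, with the product and the involution
  extending those of \<open>S\<close> linearly.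
\<close>

definition semigroup_algebra ::
    "('x, 'z) star_semigroup_scheme \<Rightarrow> ('r::comm_ring_1, 'x \<Rightarrow>\<^sub>0 'r) star_algebra" where
  "semigroup_algebra S =
    \<lparr> elems = {f. Poly_Mapping.keys f \<subseteq> elems S},
      mul = (\<lambda>f g. \<Sum>x\<in>Poly_Mapping.keys f. \<Sum>y\<in>Poly_Mapping.keys g.
        Poly_Mapping.single (mul S x y) (Poly_Mapping.lookup f x * Poly_Mapping.lookup g y)),
      star = (\<lambda>f. \<Sum>x\<in>Poly_Mapping.keys f.
        Poly_Mapping.single (star S x) (Poly_Mapping.lookup f x)),
      nul = 0,
      add = (+),
      scale = (\<lambda>c. Poly_Mapping.map (\<lambda>a. c * a)) \<rparr>"

inductive_set span_in :: "('r, 'a) star_algebra \<Rightarrow> 'a set \<Rightarrow> 'a set"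
  for A :: "('r, 'a) star_algebra" and X :: "'a set" where
  span_nul: "nul A \<in> span_in A X"
| span_base: "x \<in> X \<Longrightarrow> x \<in> span_in A X"
| span_add: "x \<in> span_in A X \<Longrightarrow> y \<in> span_in A X \<Longrightarrow> add A x y \<in> span_in A X"
| span_scale: "x \<in> span_in A X \<Longrightarrow> scale A c x \<in> span_in A X"

text \<open>As \<open>A\<close> may lack a unit, the ideal generated by \<open>X\<close> is the span of \<open>X \<union> AX \<union> XA \<union> AXA\<close>.\<close>

definition ideal_generated :: "('r, 'a) star_algebra \<Rightarrow> 'a set \<Rightarrow> 'a set" where
  "ideal_generated A X = span_in A
    (X \<union> {mul A a x | a x. a \<in> elems A \<and> x \<in> X}
       \<union> {mul A x b | x b. x \<in> X \<and> b \<in> elems A}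
       \<union> {mul A (mul A a x) b | a x b. a \<in> elems A \<and> x \<in> X \<and> b \<in> elems A})"

definition coset :: "('r, 'a) star_algebra \<Rightarrow> 'a set \<Rightarrow> 'a \<Rightarrow> 'a set" where
  "coset A I x = add A x ` I"

text \<open>
  \<open>A / I\<close>. When \<open>I\<close> is a two-sided ideal closed under the involution, the cosets united below
  are all equal.
\<close>

definition quotient_algebra ::
    "('r, 'a) star_algebra \<Rightarrow> 'a set \<Rightarrow> ('r, 'a set) star_algebra" where
  "quotient_algebra A I =
    \<lparr> elems = coset A I ` elems A,
      mul = (\<lambda>X Y. \<Union>x\<in>X. \<Union>y\<in>Y. coset A I (mul A x y)),
      star = (\<lambda>X. \<Union>x\<in>X. coset A I (star A x)),
      nul = coset A I (nul A),
      add = (\<lambda>X Y. \<Union>x\<in>X. \<Union>y\<in>Y. coset A I (add A x y)),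
      scale = (\<lambda>c X. \<Union>x\<in>X. coset A I (scale A c x)) \<rparr>"


section \<open>Tensor products\<close>

text \<open>
  \<open>A \<otimes> B\<close> over \<open>R\<close> is the free \<open>R\<close>-module on \<open>A \<times> B\<close> modulo the submodule spanned by the
  bilinearity relations, with \<open>(a \<otimes> b)(c \<otimes> d) = ac \<otimes> bd\<close> and \<open>(a \<otimes> b)* = a* \<otimes> b*\<close>. With this
  product the free module is the semigroup algebra of \<open>A \<times> B\<close>, in which the submodule is an ideal.
\<close>

definition pair_semigroup ::
    "('r, 'a) star_algebra \<Rightarrow> ('r, 'b) star_algebra \<Rightarrow> ('a \<times> 'b) star_semigroup" where
  "pair_semigroup A B =
    \<lparr> elems = elems A \<times> elems B,
      mul = (\<lambda>(a, b) (c, d). (mul A a c, mul B b d)),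
      star = (\<lambda>(a, b). (star A a, star B b)) \<rparr>"

definition bilinear_relations ::
    "('r::comm_ring_1, 'a) star_algebra \<Rightarrow> ('r, 'b) star_algebra \<Rightarrow> ('a \<times> 'b \<Rightarrow>\<^sub>0 'r) set" where
  "bilinear_relations A B =
    {Poly_Mapping.single (add A a a', b) 1
        - Poly_Mapping.single (a, b) 1 - Poly_Mapping.single (a', b) 1
      | a a' b. a \<in> elems A \<and> a' \<in> elems A \<and> b \<in> elems B}
  \<union> {Poly_Mapping.single (a, add B b b') 1
        - Poly_Mapping.single (a, b) 1 - Poly_Mapping.single (a, b') 1
      | a b b'. a \<in> elems A \<and> b \<in> elems B \<and> b' \<in> elems B}
  \<union> {Poly_Mapping.single (scale A c a, b) 1 - Poly_Mapping.single (a, b) c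
      | c a b. a \<in> elems A \<and> b \<in> elems B}
  \<union> {Poly_Mapping.single (a, scale B c b) 1 - Poly_Mapping.single (a, b) c
      | c a b. a \<in> elems A \<and> b \<in> elems B}"

definition tensor_product ::
    "('r::comm_ring_1, 'a) star_algebra \<Rightarrow> ('r, 'b) star_algebra
      \<Rightarrow> ('r, ('a \<times> 'b \<Rightarrow>\<^sub>0 'r) set) star_algebra" where
  "tensor_product A B =
    quotient_algebra (semigroup_algebra (pair_semigroup A B))
      (span_in (semigroup_algebra (pair_semigroup A B)) (bilinear_relations A B))"


section \<open>Finitely supported infinite matrices\<close>

definition M_infinity :: "('r::comm_ring_1, nat \<Rightarrow> nat \<Rightarrow> 'r) star_algebra" where
  "M_infinity =
    \<lparr> elems = {M. finite {(i, j). M i j \<noteq> 0}},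
      mul = (\<lambda>M N i j. \<Sum>k | M i k \<noteq> 0. M i k * N k j),
      star = (\<lambda>M i j. M j i),
      nul = (\<lambda>i j. 0),
      add = (\<lambda>M N i j. M i j + N i j),
      scale = (\<lambda>c M i j. c * M i j) \<rparr>"


section \<open>Leavitt path algebras\<close>

text \<open>The source of an edge is its \<^const>\<open>tail\<close> and the range is its \<^const>\<open>head\<close>.\<close>

datatype ('v, 'e) leavitt_gen = Vertex 'v | Edge 'e | Ghost 'e

fun gen_star :: "('v, 'e) leavitt_gen \<Rightarrow> ('v, 'e) leavitt_gen" where
  "gen_star (Vertex v) = Vertex v"
| "gen_star (Edge e) = Ghost e"
| "gen_star (Ghost e) = Edge e"

text \<open>
  The semigroup algebra of the nonempty words in the generators is the free \<open>R\<close>-algebra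
  (without unit) on them.
\<close>

definition word_semigroup ::
    "('v, 'e) pre_digraph \<Rightarrow> ('v, 'e) leavitt_gen list star_semigroup" where
  "word_semigroup E =
    \<lparr> elems = {w. w \<noteq> [] \<and> set w \<subseteq> Vertex ` verts E \<union> Edge ` arcs E \<union> Ghost ` arcs E},
      mul = (@),
      star = (\<lambda>w. rev (map gen_star w)) \<rparr>"

abbreviation monomial :: "'x \<Rightarrow> 'x \<Rightarrow>\<^sub>0 'r::comm_ring_1" where
  "monomial w \<equiv> Poly_Mapping.single w 1"

definition leavitt_relations ::
    "('v, 'e) pre_digraph \<Rightarrow> (('v, 'e) leavitt_gen list \<Rightarrow>\<^sub>0 'r::comm_ring_1) set" where
  "leavitt_relations E =
    {monomial [Vertex v, Vertex w] - (if v = w then monomial [Vertex v] else 0)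
      | v w. v \<in> verts E \<and> w \<in> verts E}
  \<union> {monomial [Vertex (tail E e), Edge e] - monomial [Edge e] | e. e \<in> arcs E}
  \<union> {monomial [Edge e, Vertex (head E e)] - monomial [Edge e] | e. e \<in> arcs E}
  \<union> {monomial [Vertex (head E e), Ghost e] - monomial [Ghost e] | e. e \<in> arcs E}
  \<union> {monomial [Ghost e, Vertex (tail E e)] - monomial [Ghost e] | e. e \<in> arcs E}
  \<union> {monomial [Ghost e, Edge f] - (if e = f then monomial [Vertex (head E e)] else 0)
      | e f. e \<in> arcs E \<and> f \<in> arcs E}
  \<union> {monomial [Vertex v] - (\<Sum>e\<in>out_arcs E v. monomial [Edge e, Ghost e])
      | v. v \<in> verts E \<and> finite (out_arcs E v) \<and> out_arcs E v \<noteq> {}}"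

definition leavitt_path_algebra ::
    "('v, 'e) pre_digraph
      \<Rightarrow> ('r::comm_ring_1, (('v, 'e) leavitt_gen list \<Rightarrow>\<^sub>0 'r) set) star_algebra" where
  "leavitt_path_algebra E =
    quotient_algebra (semigroup_algebra (word_semigroup E))
      (ideal_generated (semigroup_algebra (word_semigroup E)) (leavitt_relations E))"

abbreviation leavitt_Z_stabilized ::
    "('v, 'e) pre_digraph
      \<Rightarrow> (int, ((('v, 'e) leavitt_gen list \<Rightarrow>\<^sub>0 int) set \<times> (nat \<Rightarrow> nat \<Rightarrow> int) \<Rightarrow>\<^sub>0 int) set)
          star_algebra" where
  "leavitt_Z_stabilized E \<equiv> tensor_product (leavitt_path_algebra E) M_infinity"


section \<open>Graphs\<close>

text \<open>
  Paths may have length zero. Unlike the definition of strong connectedness in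
  \<open>Graph_Theory.Digraph_Component\<close>, this one does not exclude the graph without vertices.
\<close>

definition strongly_connected_graph :: "('v, 'e) pre_digraph \<Rightarrow> bool" where
  "strongly_connected_graph E \<longleftrightarrow> (\<forall>v\<in>verts E. \<forall>w\<in>verts E. v \<rightarrow>\<^sup>*\<^bsub>E\<^esub> w)"

definition adjacency :: "('v, 'e) pre_digraph \<Rightarrow> 'v \<Rightarrow> 'v \<Rightarrow> nat" where
  "adjacency E v w = card {e \<in> arcs E. tail E e = v \<and> head E e = w}"

text \<open>\<open>A_E\<close> with rows and columns ordered by an enumeration \<open>vs\<close> of the vertices.\<close>

definition adjacency_mat :: "('v, 'e) pre_digraph \<Rightarrow> 'v list \<Rightarrow> int mat" where
  "adjacency_mat E vs =
    mat (length vs) (length vs) (\<lambda>(i, j). int (adjacency E (vs ! i) (vs ! j)))"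

text \<open>
  In the following two graphs, an edge is a triple consisting of its source, its range and a
  number that distinguishes parallel edges.
\<close>

definition E2 :: "(nat, nat \<times> nat \<times> nat) pre_digraph" where
  "E2 = \<lparr> verts = {1}, arcs = {(1, 1, 0), (1, 1, 1)},
          tail = (\<lambda>(v, w, k). v), head = (\<lambda>(v, w, k). w) \<rparr>"

definition E2_minus :: "(nat, nat \<times> nat \<times> nat) pre_digraph" where
  "E2_minus = \<lparr> verts = {1, 2, 3},
     arcs = {(1, 1, 0), (1, 1, 1), (2, 2, 0), (3, 3, 0),
             (1, 2, 0), (2, 1, 0), (2, 3, 0), (3, 2, 0)},
     tail = (\<lambda>(v, w, k). v), head = (\<lambda>(v, w, k). w) \<rparr>"

end

theory Submission
  imports
    Defs
    "HOL-Library.Omega_Words_Fun"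
    "HOL-Library.Function_Algebras"
    "HOL-Combinatorics.Cycles"
begin

text \<open>
  The stabilized algebra acts faithfully by integer matrices on \<open>\<nat> \<times> X \<times> \<int>\<close>, where \<open>X\<close> is the
  set of infinite paths, the \<open>\<int>\<close>-coordinate records the degree, and the involution is the transpose.
  Over the integers a projection satisfies \<open>p(x, x) = \<Sum>\<^sub>y p(y, x)\<^sup>2\<close>, so it is diagonal, and a partial
  isometry is a signed partial bijection: the projections of the algebra are exactly the compact open
  subsets, and a star-isomorphism respects them although it need not respect the grading by path length.

  The grading of \<open>F\<close> is transported to a second grading of \<open>E\<close>; with respect to it, every partial
  isometry is a finite orthogonal sum of homogeneous ones. At a sufficiently high level \<open>N\<close> the
  generators of the groupoid of \<open>E\<close> are homogeneous, which turns the transported grading into integer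
  weights \<open>c\<close> on the edges of the graph of paths of length \<open>N\<close>. With \<open>A\<^sub>c\<close> the matrix with entries
  \<open>t\<^sup>c\<close> in the Laurent polynomials, the class of a projection in the cokernel of \<open>1 - A\<^sub>c\<close> is determined by
  the graded algebra, so the presentations of the two graphs are compared by matrices over \<open>\<int>[t, 1/t]\<close>
  in both directions, and \<open>det (1 - A\<^sub>c)\<close> and its counterpart for \<open>F\<close> divide each other. A closed path
  is a partial isometry that shrinks its source, a property that forces positive degree, so all cycle
  weights are positive and both determinants are \<open>1\<close> plus terms of positive degree; hence they are
  equal. At \<open>t = 1\<close> they become the determinants of \<open>1 - A\<close>, since passing to the graph of paths of
  length \<open>N\<close> replaces \<open>1 - R S\<close> by \<open>1 - S R\<close>.

  Graphs without edges and single cycles are separated from the others by corners: a rank-one corner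
  consists of symmetric matrices if there are no edges, and single cycles have minimal projections.
\<close>

section \<open>Integer matrices with arbitrary index sets\<close>

text \<open>Over the integers, mutual divisibility would fix the determinants only up to sign, and
  the sign is exactly what separates \<open>E2\<close> from \<open>E2_minus\<close>: their
  determinants are -1 and 1. The variable t repairs this. The units of Z[t, 1/t] are plus or minus
  powers of t, and among them only 1 carries one polynomial with constant term 1 and otherwise
  positive exponents to another. So it is the positivity of the cycle weights that settles the sign.
  The obstacle is that the transported weights on \<open>E\<close> are unknown integers. Their
  positivity must come from a statement about products, transposes and projections alone, since
  nothing else is transported: a homogeneous partial isometry whose range is a proper part of its
  source has positive degree. For the length grading this is a counting fact. Properness needs two
  infinite paths from one vertex; on a single cycle a closed path gives a unitary of a corner and
  the argument says nothing, but there the determinant is 0. The matrices of the two graphs have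
  different sizes. Therefore only surjections between their cokernels are constructed, one in each
  direction, and each yields one divisibility.\<close>

type_synonym 'i imat = "'i \<Rightarrow> 'i \<Rightarrow> int"

text \<open>The sum runs over the support of a column of the right factor, so finiteness is a
  condition on \<open>B\<close>. A column with infinite support would give 0, the value of a sum
  over an infinite set.\<close>

definition mm :: "'i imat \<Rightarrow> 'i imat \<Rightarrow> 'i imat" where
  "mm A B = (\<lambda>a c. \<Sum>b | B b c \<noteq> 0. A a b * B b c)"

definition tr :: "'i imat \<Rightarrow> 'i imat" where
  "tr A = (\<lambda>a b. A b a)"

definition colfin :: "'i imat \<Rightarrow> bool" where
  "colfin A \<longleftrightarrow> (\<forall>c. finite {a. A a c \<noteq> 0})"

lemma sum_fun_apply: "(\<Sum>x\<in>X. f x) a = (\<Sum>x\<in>X. f x a)"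
  by (induction X rule: infinite_finite_induct) auto

lemma mm_superset:
  assumes "finite T" "{b. B b c \<noteq> 0} \<subseteq> T"
  shows "mm A B a c = (\<Sum>b\<in>T. A a b * B b c)"
  unfolding mm_def using assms by (intro sum.mono_neutral_left) auto

section \<open>Quotients of semigroup algebras\<close>

definition lin :: "('x \<Rightarrow> 'i imat) \<Rightarrow> ('x \<Rightarrow>\<^sub>0 int) \<Rightarrow> 'i imat" where
  "lin \<rho> f = (\<lambda>a b. \<Sum>x\<in>Poly_Mapping.keys f. Poly_Mapping.lookup f x * \<rho> x a b)"

lemma lin_superset:
  assumes "finite T" "Poly_Mapping.keys f \<subseteq> T"
  shows "lin \<rho> f a b = (\<Sum>x\<in>T. Poly_Mapping.lookup f x * \<rho> x a b)"
  unfolding lin_def using assms by (intro sum.mono_neutral_left) (auto simp: in_keys_iff)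

lemma lin_add: "lin \<rho> (f + g) = lin \<rho> f + lin \<rho> g"
proof (intro ext)
  fix a b
  let ?T = "Poly_Mapping.keys f \<union> Poly_Mapping.keys g"
  show "lin \<rho> (f + g) a b = (lin \<rho> f + lin \<rho> g) a b"
    using keys_add[of f g]
    by (simp add: lin_superset[where T = ?T] lookup_add distrib_right sum.distrib)
qed

lemma lin_zero [simp]: "lin \<rho> 0 = 0"
  by (simp add: lin_def fun_eq_iff)

lemma lin_cmul: "lin \<rho> (frag_cmul c f) = (\<lambda>a b. c * lin \<rho> f a b)"
proof (intro ext)
  fix a b
  have "lin \<rho> (frag_cmul c f) a b
      = (\<Sum>x\<in>Poly_Mapping.keys f. Poly_Mapping.lookup (frag_cmul c f) x * \<rho> x a b)"
    by (rule lin_superset) (simp_all add: keys_cmul)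
  then show "lin \<rho> (frag_cmul c f) a b = c * lin \<rho> f a b"
    by (simp add: lin_def sum_distrib_left mult.assoc)
qed

lemma lin_minus: "lin \<rho> (- f) = - lin \<rho> f"
  by (simp add: lin_def fun_eq_iff sum_negf)

lemma lin_diff: "lin \<rho> (f - g) = lin \<rho> f - lin \<rho> g"
  using lin_add[of \<rho> f "- g"] by (simp add: lin_minus)

lemma lin_single [simp]: "lin \<rho> (Poly_Mapping.single x c) = (\<lambda>a b. c * \<rho> x a b)"
  by (simp add: lin_def fun_eq_iff)

lemma lin_sum: "finite T \<Longrightarrow> lin \<rho> (\<Sum>x\<in>T. f x) = (\<Sum>x\<in>T. lin \<rho> (f x))"
  by (induction T rule: finite_induct) (simp_all add: lin_add)

lemma lin_frag_extend:
  "lin \<rho> (frag_extend g f) a b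
    = (\<Sum>x\<in>Poly_Mapping.keys f. Poly_Mapping.lookup f x * lin \<rho> (g x) a b)"
  by (simp add: frag_extend_def lin_sum sum_fun_apply lin_cmul)

lemma colfin_lin:
  assumes "\<And>x. x \<in> Poly_Mapping.keys f \<Longrightarrow> colfin (\<rho> x)"
  shows "colfin (lin \<rho> f)"
  unfolding colfin_def
proof
  fix c
  have "{a. lin \<rho> f a c \<noteq> 0} \<subseteq> (\<Union>x\<in>Poly_Mapping.keys f. {a. \<rho> x a c \<noteq> 0})"
    by (auto simp: lin_def elim!: sum.not_neutral_contains_not_neutral)
  then show "finite {a. lin \<rho> f a c \<noteq> 0}"
    by (rule finite_subset) (use assms in \<open>auto simp: colfin_def\<close>)
qed

lemma frag_cmul_single: "frag_cmul c (Poly_Mapping.single x d) = Poly_Mapping.single x (c * d)"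
  by (rule poly_mapping_eqI) (simp add: lookup_single when_def)

context
  fixes S :: "('x, 'z) star_semigroup_scheme"
begin

abbreviation "SA \<equiv> (semigroup_algebra S :: (int, 'x \<Rightarrow>\<^sub>0 int) star_algebra)"

text \<open>With integer coefficients the semigroup algebra is the free abelian group on the
  semigroup, so product and involution are additive extensions (\<open>frag_extend\<close>) of the
  operations on the basis.\<close>

lemma semigroup_algebra_simps:
  "elems SA = {f. Poly_Mapping.keys f \<subseteq> elems S}"
  "mul SA f g = frag_extend (\<lambda>x. frag_extend (\<lambda>y. Poly_Mapping.single (mul S x y) 1) g) f"
  "star SA f = frag_extend (\<lambda>x. Poly_Mapping.single (star S x) 1) f"
  "nul SA = 0"
  "add SA f g = f + g"
  "scale SA c f = frag_cmul c f"
proof -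
  show "scale SA c f = frag_cmul c f"
    by (rule poly_mapping_eqI)
      (simp add: semigroup_algebra_def Poly_Mapping.map.rep_eq when_def)
qed (simp_all add: semigroup_algebra_def frag_extend_def frag_cmul_sum frag_cmul_single)

end

text \<open>A star-representation given on the basis: products become matrix products and the
  involution becomes the transpose. \<open>lin \<rho>\<close> extends it to the semigroup
  algebra.\<close>

locale semigroup_rep =
  fixes S :: "('x, 'z) star_semigroup_scheme"
    and \<rho> :: "'x \<Rightarrow> 'i imat"
  assumes mul_closed: "x \<in> elems S \<Longrightarrow> y \<in> elems S \<Longrightarrow> mul S x y \<in> elems S"
    and star_closed: "x \<in> elems S \<Longrightarrow> star S x \<in> elems S"
    and colfin_rep: "x \<in> elems S \<Longrightarrow> colfin (\<rho> x)"
    and rep_mul: "x \<in> elems S \<Longrightarrow> y \<in> elems S \<Longrightarrow> \<rho> (mul S x y) = mm (\<rho> x) (\<rho> y)"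
    and rep_star: "x \<in> elems S \<Longrightarrow> \<rho> (star S x) = tr (\<rho> x)"
begin

abbreviation "A \<equiv> (semigroup_algebra S :: (int, 'x \<Rightarrow>\<^sub>0 int) star_algebra)"
lemma zero_in_A: "0 \<in> elems A" by (simp add: semigroup_algebra_simps)

lemmas A_simps = semigroup_algebra_simps[of S]

lemma A_closed:
  shows add_in_A: "f \<in> elems A \<Longrightarrow> g \<in> elems A \<Longrightarrow> f + g \<in> elems A"
    and diff_in_A: "f \<in> elems A \<Longrightarrow> g \<in> elems A \<Longrightarrow> f - g \<in> elems A"
    and cmul_in_A: "f \<in> elems A \<Longrightarrow> frag_cmul c f \<in> elems A"
  using keys_add[of f g] keys_diff[of f g] keys_cmul[of c f] by (auto simp: A_simps)

lemma star_in_A: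
  assumes "f \<in> elems A"
  shows "star A f \<in> elems A"
proof -
  have "Poly_Mapping.keys (star A f) \<subseteq> (\<Union>x\<in>Poly_Mapping.keys f. {star S x})"
    unfolding A_simps by (rule order_trans[OF keys_frag_extend]) auto
  also have "\<dots> \<subseteq> elems S" using assms star_closed by (auto simp: A_simps)
  finally show ?thesis by (simp add: A_simps)
qed

lemma mul_in_A:
  assumes "f \<in> elems A" "g \<in> elems A"
  shows "mul A f g \<in> elems A"
proof -
  have "Poly_Mapping.keys (mul A f g)
      \<subseteq> (\<Union>x\<in>Poly_Mapping.keys f. \<Union>y\<in>Poly_Mapping.keys g. {mul S x y})"
    unfolding A_simps
    by (rule order_trans[OF keys_frag_extend], rule UN_mono[OF order_refl],
        rule order_trans[OF keys_frag_extend]) auto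
  also have "\<dots> \<subseteq> elems S" using assms mul_closed by (auto simp: A_simps)
  finally show ?thesis by (simp add: A_simps)
qed

lemmas in_A = A_closed star_in_A mul_in_A

text \<open>Bilinearity, once all sums are finite: the finitely many matrices
  \<open>\<rho> y\<close> with \<open>y\<close> in the support of \<open>g\<close> have finite
  columns, so the entries in column \<open>c\<close> live on the common finite set \<open>?T\<close>
  and the sums may be interchanged.\<close>

lemma lin_mul:
  assumes f: "f \<in> elems A" and g: "g \<in> elems A"
  shows "lin \<rho> (mul A f g) = mm (lin \<rho> f) (lin \<rho> g)"
proof (intro ext)
  fix a c
  let ?F = "Poly_Mapping.keys f" and ?G = "Poly_Mapping.keys g"
  let ?T = "\<Union>y\<in>?G. {b. \<rho> y b c \<noteq> 0}"
  have T: "finite ?T" using g colfin_rep by (auto simp: A_simps colfin_def)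
  have m: "\<rho> (mul S x y) a c = (\<Sum>b\<in>?T. \<rho> x a b * \<rho> y b c)" if "x \<in> ?F" "y \<in> ?G" for x y
  proof -
    have "\<rho> (mul S x y) a c = mm (\<rho> x) (\<rho> y) a c"
      using that f g by (subst rep_mul) (auto simp: A_simps)
    also have "\<dots> = (\<Sum>b\<in>?T. \<rho> x a b * \<rho> y b c)"
      by (rule mm_superset[OF T]) (use that in auto)
    finally show ?thesis .
  qed
  have "lin \<rho> (mul A f g) a c = (\<Sum>x\<in>?F. \<Sum>y\<in>?G. Poly_Mapping.lookup f x *
      (Poly_Mapping.lookup g y * \<rho> (mul S x y) a c))"
    by (simp add: A_simps lin_frag_extend sum_distrib_left)
  also have "\<dots> = (\<Sum>x\<in>?F. \<Sum>y\<in>?G. \<Sum>b\<in>?T. (Poly_Mapping.lookup f x * \<rho> x a b) *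
      (Poly_Mapping.lookup g y * \<rho> y b c))"
    by (intro sum.cong refl) (simp add: m sum_distrib_left mult_ac)
  also have "\<dots> = (\<Sum>x\<in>?F. \<Sum>b\<in>?T. \<Sum>y\<in>?G. (Poly_Mapping.lookup f x * \<rho> x a b) *
      (Poly_Mapping.lookup g y * \<rho> y b c))"
    by (intro sum.cong refl sum.swap)
  also have "\<dots> = (\<Sum>b\<in>?T. \<Sum>x\<in>?F. \<Sum>y\<in>?G. (Poly_Mapping.lookup f x * \<rho> x a b) *
      (Poly_Mapping.lookup g y * \<rho> y b c))"
    by (rule sum.swap)
  also have "\<dots> = (\<Sum>b\<in>?T. lin \<rho> f a b * lin \<rho> g b c)"
    by (simp add: lin_def sum_product)
  also have "\<dots> = mm (lin \<rho> f) (lin \<rho> g) a c"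
    by (rule mm_superset[OF T, symmetric])
      (auto simp: lin_def elim!: sum.not_neutral_contains_not_neutral)
  finally show "lin \<rho> (mul A f g) a c = mm (lin \<rho> f) (lin \<rho> g) a c" .
qed

lemma lin_star:
  assumes f: "f \<in> elems A"
  shows "lin \<rho> (star A f) = tr (lin \<rho> f)"
proof (intro ext)
  fix a c
  have "lin \<rho> (star A f) a c = (\<Sum>x\<in>Poly_Mapping.keys f. Poly_Mapping.lookup f x * \<rho> (star S x) a c)"
    by (simp add: A_simps lin_frag_extend)
  also have "\<dots> = (\<Sum>x\<in>Poly_Mapping.keys f. Poly_Mapping.lookup f x * tr (\<rho> x) a c)"
    using f rep_star by (intro sum.cong refl) (auto simp: A_simps)
  finally show "lin \<rho> (star A f) a c = tr (lin \<rho> f) a c" by (simp add: tr_def lin_def)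
qed

end

text \<open>The ideal is required to be exactly the kernel. One inclusion is the validity of the
  defining relations, the other is faithfulness; together they identify the quotient with an algebra
  of matrices. The locale serves the Leavitt path algebra and its tensor product with
  \<open>M_infinity\<close>.\<close>

locale semigroup_algebra_rep = semigroup_rep S \<rho>
  for S :: "('x, 'z) star_semigroup_scheme" and \<rho> :: "'x \<Rightarrow> 'i imat" +
  fixes I :: "('x \<Rightarrow>\<^sub>0 int) set"
  assumes ideal_eq_kernel: "f \<in> I \<longleftrightarrow> f \<in> elems (semigroup_algebra S) \<and> lin \<rho> f = 0"
begin

abbreviation "Q \<equiv> quotient_algebra A I"

lemma coset_eq:
  assumes f: "f \<in> elems A"
  shows "coset A I f = {g \<in> elems A. lin \<rho> g = lin \<rho> f}"
proof (intro equalityI subsetI)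
  fix g assume "g \<in> coset A I f"
  then obtain i where "i \<in> I" "g = f + i" unfolding coset_def A_simps by blast
  then show "g \<in> {g \<in> elems A. lin \<rho> g = lin \<rho> f}"
    using f add_in_A[of f i] ideal_eq_kernel[of i] by (simp add: lin_add)
next
  fix g assume g: "g \<in> {g \<in> elems A. lin \<rho> g = lin \<rho> f}"
  then have "g - f \<in> I" using f diff_in_A[of g f] by (simp add: ideal_eq_kernel lin_diff)
  moreover have "g = f + (g - f)" by simp
  ultimately show "g \<in> coset A I f" unfolding coset_def A_simps by blast
qed

lemma coset_eq_iff:
  "f \<in> elems A \<Longrightarrow> g \<in> elems A \<Longrightarrow> coset A I f = coset A I g \<longleftrightarrow> lin \<rho> f = lin \<rho> g"
  by (auto simp only: coset_eq) 

lemma in_coset_iff: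
  "f \<in> elems A \<Longrightarrow> g \<in> coset A I f \<longleftrightarrow> g \<in> elems A \<and> lin \<rho> g = lin \<rho> f"
  by (simp add: coset_eq)

lemma elems_Q: "elems Q = coset A I ` elems A"
  by (simp add: quotient_algebra_def)

lemma UN_eq_const: "a \<in> X \<Longrightarrow> (\<And>x. x \<in> X \<Longrightarrow> F x = K) \<Longrightarrow> (\<Union>x\<in>X. F x) = K"
  by auto

text \<open>The quotient operations are unions of cosets over all representatives. Membership in a
  coset fixes the value of \<open>lin \<rho>\<close>, and this value fixes the coset of the result,
  so all the united cosets coincide.\<close>

lemma Q_simps:
  assumes f: "f \<in> elems A" and g: "g \<in> elems A"
  shows "mul Q (coset A I f) (coset A I g) = coset A I (mul A f g)"
    "add Q (coset A I f) (coset A I g) = coset A I (f + g)"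
    "star Q (coset A I f) = coset A I (star A f)"
    "scale Q c (coset A I f) = coset A I (frag_cmul c f)"
    "nul Q = coset A I 0"
proof -
  have ne: "f \<in> coset A I f" "g \<in> coset A I g" using f g by (simp_all add: in_coset_iff)
  have Q: "mul Q = (\<lambda>X Y. \<Union>x\<in>X. \<Union>y\<in>Y. coset A I (mul A x y))"
    "add Q = (\<lambda>X Y. \<Union>x\<in>X. \<Union>y\<in>Y. coset A I (add A x y))"
    "star Q = (\<lambda>X. \<Union>x\<in>X. coset A I (star A x))"
    "scale Q = (\<lambda>c X. \<Union>x\<in>X. coset A I (scale A c x))"
    "nul Q = coset A I (nul A)"
    by (simp_all only: quotient_algebra_def star_semigroup.simps star_algebra.simps)
  show "mul Q (coset A I f) (coset A I g) = coset A I (mul A f g)"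
    unfolding Q using f g
    by (intro UN_eq_const[OF ne(1)] UN_eq_const[OF ne(2)], subst coset_eq_iff)
       (simp_all only: in_coset_iff mul_in_A lin_mul)
  show "add Q (coset A I f) (coset A I g) = coset A I (f + g)"
    unfolding Q A_simps using f g
    by (intro UN_eq_const[OF ne(1)] UN_eq_const[OF ne(2)], subst coset_eq_iff)
       (simp_all only: in_coset_iff add_in_A lin_add)
  show "star Q (coset A I f) = coset A I (star A f)"
    unfolding Q using f
    by (intro UN_eq_const[OF ne(1)], subst coset_eq_iff)
       (simp_all only: in_coset_iff star_in_A lin_star)
  show "scale Q c (coset A I f) = coset A I (frag_cmul c f)"
    unfolding Q A_simps using f
    by (intro UN_eq_const[OF ne(1)], subst coset_eq_iff)
       (simp_all only: in_coset_iff cmul_in_A lin_cmul)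
  show "nul Q = coset A I 0" unfolding Q A_simps ..
qed

definition qrep :: "('x \<Rightarrow>\<^sub>0 int) set \<Rightarrow> 'i imat" where
  "qrep K = lin \<rho> (SOME f. f \<in> K)"

lemma qrep_coset: "f \<in> elems A \<Longrightarrow> qrep (coset A I f) = lin \<rho> f"
proof -
  assume f: "f \<in> elems A"
  then have "f \<in> coset A I f" by (simp add: in_coset_iff)
  then have "(SOME g. g \<in> coset A I f) \<in> coset A I f" by (rule someI)
  then show ?thesis using f by (simp add: qrep_def in_coset_iff)
qed

lemma Q_cases:
  assumes "K \<in> elems Q"
  obtains f where "f \<in> elems A" "K = coset A I f"
  using assms unfolding elems_Q by blast

lemma Q_closed:
  assumes "K \<in> elems Q" "L \<in> elems Q"
  shows "mul Q K L \<in> elems Q" "add Q K L \<in> elems Q" "star Q K \<in> elems Q"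
    "scale Q c K \<in> elems Q" "nul Q \<in> elems Q"
proof -
  obtain f g where fg: "f \<in> elems A" "g \<in> elems A" "K = coset A I f" "L = coset A I g"
    using assms Q_cases by metis
  then show "mul Q K L \<in> elems Q" "add Q K L \<in> elems Q" "star Q K \<in> elems Q"
    "scale Q c K \<in> elems Q" "nul Q \<in> elems Q"
    by (simp_all only: Q_simps elems_Q imageI in_A zero_in_A)
qed

lemma qrep_hom:
  assumes "K \<in> elems Q" "L \<in> elems Q"
  shows "qrep (mul Q K L) = mm (qrep K) (qrep L)"
    "qrep (add Q K L) = qrep K + qrep L"
    "qrep (star Q K) = tr (qrep K)"
    "qrep (scale Q c K) = (\<lambda>a b. c * qrep K a b)"
    "qrep (nul Q) = 0"
proof -
  obtain f g where fg: "f \<in> elems A" "g \<in> elems A" "K = coset A I f" "L = coset A I g"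
    using assms Q_cases by metis
  then show "qrep (mul Q K L) = mm (qrep K) (qrep L)"
    "qrep (add Q K L) = qrep K + qrep L"
    "qrep (star Q K) = tr (qrep K)"
    "qrep (scale Q c K) = (\<lambda>a b. c * qrep K a b)"
    "qrep (nul Q) = 0"
    by (simp_all only: Q_simps qrep_coset in_A zero_in_A lin_mul lin_add lin_star lin_cmul lin_zero)
qed

lemma qrep_inj: "inj_on qrep (elems Q)"
proof (rule inj_onI)
  fix K L assume KL: "K \<in> elems Q" "L \<in> elems Q" "qrep K = qrep L"
  then obtain f g where "f \<in> elems A" "g \<in> elems A" "K = coset A I f" "L = coset A I g"
    by (auto simp: elems_Q)
  with KL(3) show "K = L" by (simp add: qrep_coset coset_eq_iff)
qed

lemma qrep_image: "qrep ` elems Q = lin \<rho> ` elems A"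
  unfolding elems_Q image_image by (rule image_cong[OF refl]) (rule qrep_coset)

lemma colfin_qrep:
  assumes "K \<in> elems Q"
  shows "colfin (qrep K)"
proof -
  obtain f where "f \<in> elems A" "K = coset A I f" using assms Q_cases by metis
  then show ?thesis
    unfolding A_simps by (auto simp only: qrep_coset A_simps intro!: colfin_lin colfin_rep)
qed

end

section \<open>Leavitt path algebras act on infinite paths\<close>

text \<open>
  A graph without edges gets one dummy infinite path, so that the representation stays faithful
  when the graph is a single vertex.
\<close>

definition ipaths :: "('v, 'e) pre_digraph \<Rightarrow> (nat \<Rightarrow> 'e) set" where
  "ipaths E = (if arcs E = {} then {\<lambda>_. undefined}
     else {x. \<forall>n. x n \<in> arcs E \<and> head E (x n) = tail E (x (Suc n))})"

definition src :: "('v, 'e) pre_digraph \<Rightarrow> (nat \<Rightarrow> 'e) \<Rightarrow> 'v" where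
  "src E x = (if arcs E = {} then SOME v. v \<in> verts E else tail E (x 0))"

text \<open>The integer coordinate records the degree, which makes the representation faithful without
  any condition on cycles.\<close>

fun act :: "('v, 'e) pre_digraph \<Rightarrow> ('v, 'e) leavitt_gen
    \<Rightarrow> (nat \<Rightarrow> 'e) \<times> int \<Rightarrow> ((nat \<Rightarrow> 'e) \<times> int) option" where
  "act E (Vertex v) (x, k) = (if x \<in> ipaths E \<and> src E x = v then Some (x, k) else None)"
| "act E (Edge e) (x, k) =
    (if x \<in> ipaths E \<and> e \<in> arcs E \<and> src E x = head E e then Some (e ## x, k + 1) else None)"
| "act E (Ghost e) (x, k) =
    (if x \<in> ipaths E \<and> e \<in> arcs E \<and> x 0 = e then Some (suffix 1 x, k - 1) else None)"

fun wact :: "('v, 'e) pre_digraph \<Rightarrow> ('v, 'e) leavitt_gen list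
    \<Rightarrow> (nat \<Rightarrow> 'e) \<times> int \<Rightarrow> ((nat \<Rightarrow> 'e) \<times> int) option" where
  "wact E [] = Some"
| "wact E (g # w) = act E g \<circ>\<^sub>m wact E w"

definition pmat :: "('i \<Rightarrow> 'i option) \<Rightarrow> 'i imat" where
  "pmat f = (\<lambda>a b. if f b = Some a then 1 else 0)"

lemma mm_pmat: "mm (pmat f) (pmat g) = pmat (f \<circ>\<^sub>m g)"
proof (intro ext)
  fix a c
  have *: "{b. pmat g b c \<noteq> 0} = (case g c of None \<Rightarrow> {} | Some b \<Rightarrow> {b})"
    by (auto simp: pmat_def split: option.split)
  show "mm (pmat f) (pmat g) a c = pmat (f \<circ>\<^sub>m g) a c"
    unfolding mm_def * by (auto simp: pmat_def map_comp_def split: option.split)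
qed

lemma finite_set_option_aux: "finite (set_option x)"
  by (cases x) auto

lemma colfin_pmat: "colfin (pmat f)"
proof -
  have "{a. pmat f a c \<noteq> 0} \<subseteq> set_option (f c)" for c by (auto simp: pmat_def)
  then show ?thesis unfolding colfin_def by (metis finite_subset finite_set_option_aux)
qed

lemma wact_append: "wact E (u @ w) = wact E u \<circ>\<^sub>m wact E w"
  by (induction u) (auto simp: map_comp_def fun_eq_iff split: option.split)

lemma all_nat_split: "(\<forall>n. P n) \<longleftrightarrow> P 0 \<and> (\<forall>n. P (Suc n))"
  by (metis not0_implies_Suc)

lemma build_in_ipaths:
  "arcs E \<noteq> {} \<Longrightarrow> e ## x \<in> ipaths E \<longleftrightarrow> x \<in> ipaths E \<and> e \<in> arcs E \<and> head E e = src E x"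
  by (simp add: ipaths_def src_def
      all_nat_split[of "\<lambda>n. (e ## x) n \<in> arcs E \<and> head E ((e ## x) n) = x' n" for x']) auto

lemma suffix_in_ipaths: "x \<in> ipaths E \<Longrightarrow> suffix n x \<in> ipaths E"
  by (auto simp: ipaths_def suffix_def split: if_splits)

lemma suffix_build: "suffix (Suc 0) (e ## x) = x"
  by (simp add: fun_eq_iff)

text \<open>Removing a first edge \<open>e\<close> undoes prepending \<open>e\<close>, with the
  opposite change of degree. The two are mutually inverse partial maps, hence their 0-1 matrices are
  transposes of each other.\<close>

lemma act_Ghost_Edge: "act E (Ghost e) b = Some a \<longleftrightarrow> act E (Edge e) a = Some b"
proof (cases "arcs E = {}")
  case True
  then show ?thesis by (cases a; cases b) auto
next
  case False
  obtain x k y l where ab: "a = (x, k)" "b = (y, l)" by (cases a, cases b)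
  have "y \<in> ipaths E \<and> e \<in> arcs E \<and> y 0 = e \<and> suffix 1 y = x
      \<longleftrightarrow> x \<in> ipaths E \<and> e \<in> arcs E \<and> src E x = head E e \<and> e ## x = y"
  proof
    assume *: "y \<in> ipaths E \<and> e \<in> arcs E \<and> y 0 = e \<and> suffix 1 y = x"
    then have "e ## x = y" using build_split[of y] by metis
    with * show "x \<in> ipaths E \<and> e \<in> arcs E \<and> src E x = head E e \<and> e ## x = y"
      using build_in_ipaths[OF False, of e x] by simp
  next
    assume *: "x \<in> ipaths E \<and> e \<in> arcs E \<and> src E x = head E e \<and> e ## x = y"
    then have "y \<in> ipaths E" using build_in_ipaths[OF False, of e x] by simp
    moreover have "y 0 = e" "suffix 1 y = x" using * suffix_build by force+
    ultimately show "y \<in> ipaths E \<and> e \<in> arcs E \<and> y 0 = e \<and> suffix 1 y = x" using * by simp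
  qed
  then show ?thesis unfolding ab by auto
qed

lemma act_star: "act E (gen_star g) b = Some a \<longleftrightarrow> act E g a = Some b"
proof (cases g)
  case (Vertex v)
  then show ?thesis by (cases a; cases b) auto
qed (simp_all add: act_Ghost_Edge)

lemma wact_star: "wact E (rev (map gen_star w)) b = Some a \<longleftrightarrow> wact E w a = Some b"
proof (induction w arbitrary: a b)
  case (Cons g w)
  have "wact E (rev (map gen_star (g # w))) b = Some a
      \<longleftrightarrow> (\<exists>c. act E (gen_star g) b = Some c \<and> wact E (rev (map gen_star w)) c = Some a)"
    by (simp add: wact_append map_comp_Some_iff)
  then show ?case by (simp add: map_comp_Some_iff act_star Cons.IH) blast
qed auto

definition wrep :: "('v, 'e) pre_digraph \<Rightarrow> ('v, 'e) leavitt_gen list \<Rightarrow> ((nat \<Rightarrow> 'e) \<times> int) imat" where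
  "wrep E w = pmat (wact E w)"

lemma word_rep: "semigroup_rep (word_semigroup E) (wrep E)"
proof
  fix u w assume u: "u \<in> elems (word_semigroup E)" and w: "w \<in> elems (word_semigroup E)"
  show "mul (word_semigroup E) u w \<in> elems (word_semigroup E)"
    using u w by (auto simp: word_semigroup_def)
  have "gen_star g \<in> Vertex ` verts E \<union> Edge ` arcs E \<union> Ghost ` arcs E"
    if "g \<in> Vertex ` verts E \<union> Edge ` arcs E \<union> Ghost ` arcs E" for g
    using that by auto
  then show "star (word_semigroup E) u \<in> elems (word_semigroup E)"
  proof -
    assume *: "\<And>g. g \<in> Vertex ` verts E \<union> Edge ` arcs E \<union> Ghost ` arcs E
      \<Longrightarrow> gen_star g \<in> Vertex ` verts E \<union> Edge ` arcs E \<union> Ghost ` arcs E"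
    have "gen_star ` set u \<subseteq> Vertex ` verts E \<union> Edge ` arcs E \<union> Ghost ` arcs E"
      using u by (intro image_subsetI *) (auto simp: word_semigroup_def)
    then show ?thesis using u by (simp add: word_semigroup_def)
  qed
  show "colfin (wrep E u)" by (simp add: wrep_def colfin_pmat)
  show "wrep E (mul (word_semigroup E) u w) = mm (wrep E u) (wrep E w)"
    by (simp add: wrep_def mm_pmat wact_append word_semigroup_def)
  show "wrep E (star (word_semigroup E) u) = tr (wrep E u)"
    by (simp add: wrep_def tr_def pmat_def word_semigroup_def wact_star fun_eq_iff)
qed

lemma frag_extend_compose:
  "frag_extend f (frag_extend g r) = frag_extend (\<lambda>x. frag_extend f (g x)) r"
  by (simp add: frag_extend_def[of g] frag_extend_def[of "\<lambda>x. frag_extend f (g x)"]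
      frag_extend_sum frag_extend_cmul)

text \<open>A class of graphs on which the path representation is faithful: if every vertex emits an
  edge, then every vertex starts an infinite path, and without edges the dummy path belongs to the
  only vertex. Every strongly connected finite graph is of one of these kinds.\<close>

locale regular_graph = fin_digraph E for E :: "('v, 'e) pre_digraph" +
  assumes regular:
    "(arcs E = {} \<and> (\<exists>v. verts E \<subseteq> {v})) \<or> (\<forall>v\<in>verts E. out_arcs E v \<noteq> {})"
begin

abbreviation gens :: "('v, 'e) leavitt_gen set" where
  "gens \<equiv> Vertex ` verts E \<union> Edge ` arcs E \<union> Ghost ` arcs E"

sublocale words: semigroup_rep "word_semigroup E" "wrep E" by (rule word_rep)

abbreviation "WA \<equiv> (semigroup_algebra (word_semigroup E)
  :: (int, ('v, 'e) leavitt_gen list \<Rightarrow>\<^sub>0 int) star_algebra)"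
abbreviation "LR \<equiv> (leavitt_relations E :: (('v, 'e) leavitt_gen list \<Rightarrow>\<^sub>0 int) set)"
abbreviation "LI \<equiv> ideal_generated WA LR"

lemmas WA_simps = semigroup_algebra_simps[of "word_semigroup E"]

lemma WA_elems: "f \<in> elems WA \<longleftrightarrow> (\<forall>w\<in>Poly_Mapping.keys f. w \<noteq> [] \<and> set w \<subseteq> gens)"
  unfolding WA_simps by (auto simp: word_semigroup_def)

lemma tail_head_verts: "e \<in> arcs E \<Longrightarrow> tail E e \<in> verts E" "e \<in> arcs E \<Longrightarrow> head E e \<in> verts E"
  by auto

lemma src_edgeless: "arcs E = {} \<Longrightarrow> v \<in> verts E \<Longrightarrow> src E x = v"
  using regular by (auto simp: src_def out_arcs_def some_equality)

lemma src_build: "e \<in> arcs E \<Longrightarrow> src E (e ## x) = tail E e"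
  by (auto simp: src_def)

text \<open>All relations but the last compare two words, or a word with 0, and are checked on a
  single point. In the last one, \<open>[Edge e, Ghost e]\<close> acts as the projection onto the
  paths with first edge \<open>e\<close>; these sets partition the paths that start at
  \<open>v\<close>.\<close>

lemma relation_kernel:
  assumes "r \<in> LR"
  shows "r \<in> elems WA" "lin (wrep E) r = 0"
proof -
  have ns: "x 0 ## suffix (Suc 0) x = x" for x :: "nat \<Rightarrow> 'e" by simp
  have tl: "x \<in> ipaths E \<Longrightarrow> e \<in> arcs E \<Longrightarrow> x 0 = e \<Longrightarrow> src E x = tail E e" for x e
    by (auto simp: src_def)
  have sf: "x \<in> ipaths E \<Longrightarrow> e \<in> arcs E \<Longrightarrow> x 0 = e
      \<Longrightarrow> src E (suffix (Suc 0) x) = head E e" for x e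
    by (auto simp: src_def ipaths_def split: if_splits)
  have bp: "x \<in> ipaths E \<Longrightarrow> e \<in> arcs E \<Longrightarrow> src E x = head E e \<Longrightarrow> e ## x \<in> ipaths E" for x e
    using build_in_ipaths[of E e x] by auto
  note sp = suffix_in_ipaths[of _ E "Suc 0"]
  have mono: "lin (wrep E) (monomial u - monomial w) = 0"
    if "\<And>x k. wact E u (x, k) = wact E w (x, k)" for u w
  proof -
    have "wact E u = wact E w" using that by auto
    then show ?thesis by (simp add: lin_diff wrep_def)
  qed
  have mono0: "lin (wrep E) (monomial u) = 0" if "\<And>x k. wact E u (x, k) = None" for u
    using that by (auto simp: wrep_def pmat_def fun_eq_iff)
  from assms show "lin (wrep E) r = 0"
    unfolding leavitt_relations_def
  proof (elim UnE CollectE exE conjE)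
    fix v w assume r: "r = monomial [Vertex v, Vertex w] - (if v = w then monomial [Vertex v] else 0)"
    show ?thesis
    proof (cases "v = w")
      case True
      show ?thesis unfolding r if_P[OF True] by (rule mono) (simp add: map_comp_def True)
    next
      case False
      show ?thesis unfolding r if_not_P[OF False] diff_zero
        by (rule mono0) (use False in \<open>simp add: map_comp_def\<close>)
    qed
  next
    fix e assume r: "r = monomial [Vertex (tail E e), Edge e] - monomial [Edge e]" "e \<in> arcs E"
    show ?thesis unfolding r(1) by (rule mono) (use r in \<open>simp add: map_comp_def bp src_build\<close>)
  next
    fix e assume r: "r = monomial [Edge e, Vertex (head E e)] - monomial [Edge e]" "e \<in> arcs E"
    show ?thesis unfolding r(1) by (rule mono) (use r in \<open>simp add: map_comp_def\<close>)
  next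
    fix e assume r: "r = monomial [Vertex (head E e), Ghost e] - monomial [Ghost e]" "e \<in> arcs E"
    show ?thesis unfolding r(1) by (rule mono) (use r in \<open>simp add: map_comp_def sp sf\<close>)
  next
    fix e assume r: "r = monomial [Ghost e, Vertex (tail E e)] - monomial [Ghost e]" "e \<in> arcs E"
    show ?thesis unfolding r(1) by (rule mono) (use r tl in \<open>auto simp: map_comp_def\<close>)
  next
    fix e f assume r: "r = monomial [Ghost e, Edge f] - (if e = f then monomial [Vertex (head E e)] else 0)"
      and e: "e \<in> arcs E" and f: "f \<in> arcs E"
    show ?thesis
    proof (cases "e = f")
      case True
      show ?thesis unfolding r if_P[OF True]
        by (rule mono) (use e True in \<open>simp add: map_comp_def bp suffix_build\<close>)
    next
      case False
      show ?thesis unfolding r if_not_P[OF False] diff_zero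
        by (rule mono0) (use False in \<open>simp add: map_comp_def\<close>)
    qed
  next
    fix v assume r: "r = monomial [Vertex v] - (\<Sum>e\<in>out_arcs E v. monomial [Edge e, Ghost e])"
      and v: "v \<in> verts E" "finite (out_arcs E v)" "out_arcs E v \<noteq> {}"
    then have ne: "arcs E \<noteq> {}" by (auto simp: out_arcs_def)
    have *: "wrep E [Edge e, Ghost e] a b
        = (if a = b \<and> fst b \<in> ipaths E \<and> fst b 0 = e then 1 else 0)" if "e \<in> arcs E" for a b e
      using that ns sp sf by (cases a; cases b) (auto simp: wrep_def pmat_def map_comp_def)
    have "lin (wrep E) r a b = 0" for a b
    proof -
      have "(\<Sum>e\<in>out_arcs E v. wrep E [Edge e, Ghost e] a b)
          = (\<Sum>e\<in>out_arcs E v. if fst b 0 = e then (if a = b \<and> fst b \<in> ipaths E then 1 else 0) else 0)"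
        by (intro sum.cong refl) (auto simp: *)
      also have "\<dots> = (if fst b 0 \<in> out_arcs E v then (if a = b \<and> fst b \<in> ipaths E then 1 else 0) else 0)"
        using v(2) by simp
      also have "\<dots> = wrep E [Vertex v] a b"
        using ne by (cases a; cases b) (auto simp: wrep_def pmat_def map_comp_def src_def ipaths_def)
      finally show ?thesis
        using v(2) by (simp add: r lin_diff lin_sum sum_fun_apply)
    qed
    then show ?thesis by (simp add: fun_eq_iff)
  qed
  have gs: "[Vertex v] \<in> elems (word_semigroup E)" if "v \<in> verts E" for v
    using that by (auto simp: word_semigroup_def)
  have m: "monomial w \<in> elems WA" if "w \<noteq> []" "set w \<subseteq> gens" for w
    using that by (auto simp: WA_elems)
  note in_A = words.zero_in_A words.diff_in_A
  from assms show "r \<in> elems WA"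
    unfolding leavitt_relations_def
  proof (elim UnE CollectE exE conjE)
    fix v assume r: "r = monomial [Vertex v] - (\<Sum>e\<in>out_arcs E v. monomial [Edge e, Ghost e])"
      and v: "v \<in> verts E" "finite (out_arcs E v)" "out_arcs E v \<noteq> {}"
    have *: "(\<Sum>e\<in>X. monomial [Edge e, Ghost e]) \<in> elems WA" if "X \<subseteq> arcs E" for X
      using that by (induction X rule: infinite_finite_induct)
        (auto intro!: words.zero_in_A words.add_in_A m)
    have "(\<Sum>e\<in>out_arcs E v. monomial [Edge e, Ghost e]) \<in> elems WA" by (rule *) auto
    then show ?thesis unfolding r by (intro words.diff_in_A m) (use v in auto)
  qed (auto intro!: words.zero_in_A words.diff_in_A m tail_head_verts)
qed

section \<open>Congruence modulo the Leavitt ideal\<close>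

lemma LI_zero: "0 \<in> LI"
  using span_in.span_nul[of WA] by (simp add: ideal_generated_def WA_simps)

lemma LI_add: "f \<in> LI \<Longrightarrow> g \<in> LI \<Longrightarrow> f + g \<in> LI"
  unfolding ideal_generated_def by (drule span_in.span_add, assumption) (simp add: WA_simps)

lemma LI_cmul: "f \<in> LI \<Longrightarrow> frag_cmul c f \<in> LI"
  unfolding ideal_generated_def by (drule span_in.span_scale[where c = c]) (simp add: WA_simps)

lemma LI_uminus: "f \<in> LI \<Longrightarrow> - f \<in> LI"
  using LI_cmul[of f "-1"] by simp

lemma LI_sum: "(\<And>x. x \<in> X \<Longrightarrow> f x \<in> LI) \<Longrightarrow> sum f X \<in> LI"
  by (induction X rule: infinite_finite_induct) (auto intro: LI_zero LI_add)

lemma LI_kernel: "f \<in> LI \<Longrightarrow> f \<in> elems WA \<and> lin (wrep E) f = 0"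
  unfolding ideal_generated_def
proof (induction rule: span_in.induct)
  case span_nul
  then show ?case using words.zero_in_A by (simp add: WA_simps)
next
  case (span_base x)
  have z: "mm A (0 :: ((nat \<Rightarrow> 'e) \<times> int) imat) = 0" "mm 0 A = 0"
    for A :: "((nat \<Rightarrow> 'e) \<times> int) imat"
    by (auto simp: mm_def fun_eq_iff)
  show ?case using span_base
    by (elim UnE CollectE exE conjE)
       (simp_all only: relation_kernel words.mul_in_A words.lin_mul z simp_thms)
next
  case (span_add x y)
  then show ?case using words.add_in_A[of x y] by (simp add: WA_simps(5) lin_add)
next
  case (span_scale x c)
  then show ?case using words.cmul_in_A[of x c] by (simp add: WA_simps(6) lin_cmul fun_eq_iff)
qed

text \<open>Multiplication by words on both sides, where either word may be empty although the free
  algebra has no unit. This brings the four kinds of generators of an ideal into one form.\<close>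

definition sandwich :: "('v, 'e) leavitt_gen list \<Rightarrow> ('v, 'e) leavitt_gen list
    \<Rightarrow> (('v, 'e) leavitt_gen list \<Rightarrow>\<^sub>0 int) \<Rightarrow> ('v, 'e) leavitt_gen list \<Rightarrow>\<^sub>0 int" where
  "sandwich u w f = frag_extend (\<lambda>x. monomial (u @ x @ w)) f"

lemma sandwich_simps [simp]:
  "sandwich u w (monomial x) = monomial (u @ x @ w)" "sandwich u w 0 = 0"
  "sandwich u w (f - g) = sandwich u w f - sandwich u w g"
  "finite X \<Longrightarrow> sandwich u w (\<Sum>x\<in>X. h x) = (\<Sum>x\<in>X. sandwich u w (h x))"
  by (simp_all add: sandwich_def frag_extend_diff frag_extend_sum)

lemma sandwich_relation:
  assumes r: "r \<in> LR" and u: "set u \<subseteq> gens" and w: "set w \<subseteq> gens"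
  shows "sandwich u w r \<in> LI"
proof -
  have m: "monomial x \<in> elems WA" if "x \<noteq> []" "set x \<subseteq> gens" for x
    using that by (auto simp: WA_elems)
  have W: "mul (word_semigroup E) = (@)" by (simp add: word_semigroup_def)
  have 1: "mul WA (monomial u) r = sandwich u [] r" by (simp add: WA_simps W sandwich_def)
  have 2: "mul WA r (monomial w) = sandwich [] w r" by (simp add: WA_simps W sandwich_def)
  have 3: "mul WA (mul WA (monomial u) r) (monomial w) = sandwich u w r"
    unfolding 1 by (simp add: WA_simps W sandwich_def frag_extend_compose)
  have base: "x \<in> LI" if "x \<in> LR \<union> {mul WA a x | a x. a \<in> elems WA \<and> x \<in> LR}
       \<union> {mul WA x b | x b. x \<in> LR \<and> b \<in> elems WA}
       \<union> {mul WA (mul WA a x) b | a x b. a \<in> elems WA \<and> x \<in> LR \<and> b \<in> elems WA}" for x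
    unfolding ideal_generated_def by (rule span_in.span_base) (rule that)
  show ?thesis
  proof (cases "u = []"; cases "w = []")
    assume "u = []" "w = []"
    then have "sandwich u w r = r" by (simp add: sandwich_def frag_expansion[symmetric])
    then show ?thesis using r base by simp
  next
    assume uw: "u = []" "w \<noteq> []"
    have "mul WA r (monomial w) \<in> {mul WA x b | x b. x \<in> LR \<and> b \<in> elems WA}"
      using r m[OF uw(2) w] by blast
    then have "mul WA r (monomial w) \<in> LI" by (intro base UnI1 UnI2)
    then show ?thesis using 2 uw by simp
  next
    assume uw: "u \<noteq> []" "w = []"
    have "mul WA (monomial u) r \<in> {mul WA a x | a x. a \<in> elems WA \<and> x \<in> LR}"
      using r m[OF uw(1) u] by blast
    then have "mul WA (monomial u) r \<in> LI" by (intro base) simp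
    then show ?thesis using 1 uw by simp
  next
    assume uw: "u \<noteq> []" "w \<noteq> []"
    have "mul WA (mul WA (monomial u) r) (monomial w)
        \<in> {mul WA (mul WA a x) b | a x b. a \<in> elems WA \<and> x \<in> LR \<and> b \<in> elems WA}"
      using r m[OF uw(1) u] m[OF uw(2) w] by blast
    then have "mul WA (mul WA (monomial u) r) (monomial w) \<in> LI" by (intro base UnI2)
    then show ?thesis using 3 by simp
  qed
qed

lemma finite_out [simp]: "finite (out_arcs E v)"
  by (rule finite_subset[OF _ finite_arcs]) auto

lemma LR_intros:
  "v \<in> verts E \<Longrightarrow> w \<in> verts E
    \<Longrightarrow> monomial [Vertex v, Vertex w] - (if v = w then monomial [Vertex v] else 0) \<in> LR"
  "e \<in> arcs E \<Longrightarrow> monomial [Vertex (tail E e), Edge e] - monomial [Edge e] \<in> LR"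
  "e \<in> arcs E \<Longrightarrow> monomial [Edge e, Vertex (head E e)] - monomial [Edge e] \<in> LR"
  "e \<in> arcs E \<Longrightarrow> monomial [Vertex (head E e), Ghost e] - monomial [Ghost e] \<in> LR"
  "e \<in> arcs E \<Longrightarrow> monomial [Ghost e, Vertex (tail E e)] - monomial [Ghost e] \<in> LR"
  "e \<in> arcs E \<Longrightarrow> f \<in> arcs E
    \<Longrightarrow> monomial [Ghost e, Edge f] - (if e = f then monomial [Vertex (head E e)] else 0) \<in> LR"
  "v \<in> verts E \<Longrightarrow> out_arcs E v \<noteq> {}
    \<Longrightarrow> monomial [Vertex v] - (\<Sum>e\<in>out_arcs E v. monomial [Edge e, Ghost e]) \<in> LR"
  unfolding leavitt_relations_def using finite_out[of v] by blast+

text \<open>Equality in the Leavitt path algebra, written for representatives in the free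
  algebra.\<close>

definition cg (infix "\<approx>" 50) where "f \<approx> g \<longleftrightarrow> f - g \<in> LI"

lemma cg_refl [simp]: "f \<approx> f" by (simp add: cg_def LI_zero)

lemma cg_sym: "f \<approx> g \<Longrightarrow> g \<approx> f"
  unfolding cg_def using LI_uminus[of "f - g"] by simp

lemma cg_trans [trans]: "f \<approx> g \<Longrightarrow> g \<approx> h \<Longrightarrow> f \<approx> h"
  unfolding cg_def using LI_add[of "f - g" "g - h"] by simp

lemma cg_sum: "(\<And>x. x \<in> X \<Longrightarrow> f x \<approx> g x) \<Longrightarrow> sum f X \<approx> sum g X"
  unfolding cg_def by (simp add: sum_subtractf[symmetric] LI_sum)

lemma cg_sandwich:
  "f - g \<in> LR \<Longrightarrow> set u \<subseteq> gens \<Longrightarrow> set w \<subseteq> gens \<Longrightarrow> sandwich u w f \<approx> sandwich u w g"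
  unfolding cg_def using sandwich_relation[of "f - g" u w] by simp

context
  fixes u w :: "('v, 'e) leavitt_gen list"
  assumes u: "set u \<subseteq> gens" and w: "set w \<subseteq> gens"
begin

lemma cg_VV: "v \<in> verts E \<Longrightarrow> monomial (u @ Vertex v # Vertex v # w) \<approx> monomial (u @ Vertex v # w)"
  using cg_sandwich[OF LR_intros(1) u w, of v v] by simp

lemma cg_VV0: "v \<in> verts E \<Longrightarrow> v' \<in> verts E \<Longrightarrow> v \<noteq> v'
    \<Longrightarrow> monomial (u @ Vertex v # Vertex v' # w) \<approx> 0"
  using cg_sandwich[OF LR_intros(1) u w, of v v'] by simp

lemma cg_VE: "e \<in> arcs E
    \<Longrightarrow> monomial (u @ Vertex (tail E e) # Edge e # w) \<approx> monomial (u @ Edge e # w)"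
  using cg_sandwich[OF LR_intros(2) u w, of e] by simp

lemma cg_EV: "e \<in> arcs E
    \<Longrightarrow> monomial (u @ Edge e # Vertex (head E e) # w) \<approx> monomial (u @ Edge e # w)"
  using cg_sandwich[OF LR_intros(3) u w, of e] by simp

lemma cg_VG: "e \<in> arcs E
    \<Longrightarrow> monomial (u @ Vertex (head E e) # Ghost e # w) \<approx> monomial (u @ Ghost e # w)"
  using cg_sandwich[OF LR_intros(4) u w, of e] by simp

lemma cg_GV: "e \<in> arcs E
    \<Longrightarrow> monomial (u @ Ghost e # Vertex (tail E e) # w) \<approx> monomial (u @ Ghost e # w)"
  using cg_sandwich[OF LR_intros(5) u w, of e] by simp

lemma cg_GE: "e \<in> arcs E
    \<Longrightarrow> monomial (u @ Ghost e # Edge e # w) \<approx> monomial (u @ Vertex (head E e) # w)"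
  using cg_sandwich[OF LR_intros(6) u w, of e e] by simp

lemma cg_GE0: "e \<in> arcs E \<Longrightarrow> f \<in> arcs E \<Longrightarrow> e \<noteq> f
    \<Longrightarrow> monomial (u @ Ghost e # Edge f # w) \<approx> 0"
  using cg_sandwich[OF LR_intros(6) u w, of e f] by simp

lemma cg_V: "v \<in> verts E \<Longrightarrow> out_arcs E v \<noteq> {}
    \<Longrightarrow> monomial (u @ Vertex v # w) \<approx> (\<Sum>e\<in>out_arcs E v. monomial (u @ Edge e # Ghost e # w))"
  using cg_sandwich[OF LR_intros(7) u w, of v] by simp

end

end

section \<open>Normal forms in the Leavitt path algebra\<close>

fun pstart :: "('v, 'e) pre_digraph \<Rightarrow> 'e list \<Rightarrow> 'v \<Rightarrow> 'v" where
  "pstart E [] v = v"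
| "pstart E (e # p) v = tail E e"

text \<open>The vertex \<open>v\<close> is the end of the path and is given separately, so that a
  path of length zero still determines its vertex.\<close>

fun epath :: "('v, 'e) pre_digraph \<Rightarrow> 'e list \<Rightarrow> 'v \<Rightarrow> bool" where
  "epath E [] v \<longleftrightarrow> v \<in> verts E"
| "epath E (e # p) v \<longleftrightarrow> e \<in> arcs E \<and> head E e = pstart E p v \<and> epath E p v"

text \<open>The spanning element \<open>s_p s_q*\<close>. Keeping the vertex in the middle makes the
  word nonempty even if both paths have length zero.\<close>

definition nf :: "'e list \<Rightarrow> 'v \<Rightarrow> 'e list \<Rightarrow> ('v, 'e) leavitt_gen list" where
  "nf p v q = map Edge p @ Vertex v # map Ghost (rev q)"

lemma frag_cmul_diff_right: "frag_cmul c (a - b) = frag_cmul c a - frag_cmul c b"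
  by (rule poly_mapping_eqI) (simp add: lookup_minus right_diff_distrib)

context regular_graph
begin

lemma epath_verts: "epath E p v \<Longrightarrow> v \<in> verts E"
  by (induction p) auto

lemma epath_arcs: "epath E p v \<Longrightarrow> set p \<subseteq> arcs E"
  by (induction p) auto

lemma epath_pstart: "epath E p v \<Longrightarrow> pstart E p v \<in> verts E"
  by (cases p) auto

lemma epath_snoc: "epath E (p @ [e]) v \<longleftrightarrow> epath E p (tail E e) \<and> e \<in> arcs E \<and> head E e = v"
proof (induction p)
  case Nil
  then show ?case by auto
next
  case (Cons f p)
  have "pstart E (p @ [e]) v = pstart E p (tail E e)" by (cases p) auto
  then show ?case using Cons by auto
qed

lemma set_nf: "epath E p v \<Longrightarrow> epath E q v \<Longrightarrow> set (nf p v q) \<subseteq> gens"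
  using epath_arcs[of p v] epath_arcs[of q v] epath_verts[of p v] by (auto simp: nf_def)

lemma nf_Nil_snoc: "nf [] v (q @ [e]) = Vertex v # Ghost e # map Ghost (rev q)"
  by (simp add: nf_def)

lemma left_Vertex:
  assumes u: "set u \<subseteq> gens" and v': "v' \<in> verts E" and p: "epath E p v" and q: "epath E q v"
  shows "monomial (u @ Vertex v' # nf p v q)
    \<approx> (if v' = pstart E p v then monomial (u @ nf p v q) else 0)"
proof (cases p)
  case Nil
  have *: "set (map Ghost (rev q)) \<subseteq> gens" using epath_arcs[OF q] by auto
  have "v \<in> verts E" using epath_verts[OF p] .
  with cg_VV[OF u *, of v] cg_VV0[OF u * v', of v] show ?thesis
    by (auto simp: Nil nf_def)
next
  case (Cons e p')
  have e: "e \<in> arcs E" "tail E e \<in> verts E" using p by (auto simp: Cons)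
  let ?w = "nf p' v q"
  have nf: "nf p v q = Edge e # ?w" by (simp add: Cons nf_def)
  have w: "set ?w \<subseteq> gens" using set_nf[OF p q] by (auto simp: nf)
  have w': "set (Edge e # ?w) \<subseteq> gens" using w e by auto
  have u': "set (u @ [Vertex v']) \<subseteq> gens" using u v' by auto
  have "monomial (u @ Vertex v' # Edge e # ?w)
      \<approx> monomial (u @ Vertex v' # Vertex (tail E e) # Edge e # ?w)"
    using cg_sym[OF cg_VE[OF u' w e(1)]] by simp
  also have "\<dots> \<approx> (if v' = tail E e then monomial (u @ Vertex (tail E e) # Edge e # ?w) else 0)"
    using cg_VV[OF u w' e(2)] cg_VV0[OF u w' v' e(2)] by auto
  also have "\<dots> \<approx> (if v' = tail E e then monomial (u @ Edge e # ?w) else 0)"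
    using cg_VE[OF u w e(1)] by auto
  finally show ?thesis by (cases "v' = tail E e") (simp_all add: Cons nf[unfolded Cons])
qed

lemma left_Edge:
  assumes u: "set u \<subseteq> gens" and e: "e \<in> arcs E" and p: "epath E p v" and q: "epath E q v"
  shows "monomial (u @ Edge e # nf p v q)
    \<approx> (if head E e = pstart E p v then monomial (u @ nf (e # p) v q) else 0)"
proof -
  have "monomial (u @ Edge e # nf p v q) \<approx> monomial ((u @ [Edge e]) @ Vertex (head E e) # nf p v q)"
    using cg_sym[OF cg_EV[OF u set_nf[OF p q] e]] by simp
  also have "\<dots> \<approx> (if head E e = pstart E p v then monomial ((u @ [Edge e]) @ nf p v q) else 0)"
    using u e p q by (intro left_Vertex) auto
  finally show ?thesis by (cases "head E e = pstart E p v") (simp_all add: nf_def)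
qed

text \<open>A ghost edge cancels against the first edge of \<open>p\<close> or gives 0. If
  \<open>p\<close> is empty, it either gives 0 or joins the ghost part, where \<open>e\<close>
  becomes the last edge of \<open>q\<close>.\<close>

lemma left_Ghost:
  assumes u: "set u \<subseteq> gens" and e: "e \<in> arcs E" and p: "epath E p v" and q: "epath E q v"
  shows "monomial (u @ Ghost e # nf p v q) \<approx> 0
    \<or> (\<exists>p' v' q'. epath E p' v' \<and> epath E q' v'
        \<and> monomial (u @ Ghost e # nf p v q) \<approx> monomial (u @ nf p' v' q'))"
proof (cases p)
  case Nil
  let ?w = "map Ghost (rev q) :: ('v, 'e) leavitt_gen list"
  have w: "set ?w \<subseteq> gens" using epath_arcs[OF q] by auto
  have v: "v \<in> verts E" using epath_verts[OF p] .
  have vw: "set (Vertex v # ?w) \<subseteq> gens" using v w by auto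
  have ue: "set (u @ [Ghost e]) \<subseteq> gens" using u e by auto
  have t: "tail E e \<in> verts E" using e by simp
  have "monomial (u @ Ghost e # Vertex v # ?w)
      \<approx> monomial (u @ Ghost e # Vertex (tail E e) # Vertex v # ?w)"
    using cg_sym[OF cg_GV[OF u vw e]] by simp
  also have "\<dots> \<approx> (if v = tail E e then monomial (u @ Ghost e # Vertex v # ?w) else 0)"
    using cg_VV[OF ue w v] cg_VV0[OF ue w t v] by auto
  finally have 1: "monomial (u @ Ghost e # Vertex v # ?w)
      \<approx> (if v = tail E e then monomial (u @ Ghost e # Vertex v # ?w) else 0)" .
  show ?thesis
  proof (cases "v = tail E e")
    case True
    have "monomial (u @ Ghost e # nf p v q) \<approx> monomial (u @ Ghost e # ?w)"
      using cg_GV[OF u w e] by (simp add: Nil nf_def True)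
    also have "\<dots> \<approx> monomial (u @ nf [] (head E e) (q @ [e]))"
      using cg_sym[OF cg_VG[OF u w e]] by (simp add: nf_Nil_snoc)
    finally show ?thesis using e q True epath_snoc[of q e "head E e"]
      by (intro disjI2 exI[of _ "[]"] exI[of _ "head E e"] exI[of _ "q @ [e]"]) auto
  next
    case False
    then show ?thesis using 1 by (simp add: Nil nf_def)
  qed
next
  case (Cons f p')
  have f: "f \<in> arcs E" and p': "epath E p' v" "head E f = pstart E p' v" using p by (auto simp: Cons)
  let ?w = "nf p' v q"
  have nf: "nf p v q = Edge f # ?w" by (simp add: Cons nf_def)
  have w: "set ?w \<subseteq> gens" using set_nf[OF p'(1) q] .
  show ?thesis
  proof (cases "e = f")
    case True
    have h: "head E e \<in> verts E" using e by simp
    have "monomial (u @ Ghost e # nf p v q) \<approx> monomial (u @ Vertex (head E e) # ?w)"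
      using cg_GE[OF u w e] by (simp add: nf True)
    also have "\<dots> \<approx> monomial (u @ ?w)"
      using left_Vertex[OF u h p'(1) q] p'(2) True by simp
    finally show ?thesis using p'(1) q by blast
  next
    case False
    then show ?thesis using cg_GE0[OF u w e f] by (simp add: nf)
  qed
qed

text \<open>The letters of \<open>w\<close> are absorbed one by one from the right, each turning a
  normal form into a normal form or into 0.\<close>

lemma append_nf:
  assumes "set w \<subseteq> gens" "epath E p v" "epath E q v"
  shows "monomial (w @ nf p v q) \<approx> 0
    \<or> (\<exists>p' v' q'. epath E p' v' \<and> epath E q' v' \<and> monomial (w @ nf p v q) \<approx> monomial (nf p' v' q'))"
  using assms
proof (induction w arbitrary: p v q rule: rev_induct)
  case Nil
  then show ?case by (metis append_Nil cg_refl)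
next
  case (snoc g w)
  have w: "set w \<subseteq> gens" and g: "g \<in> gens" using snoc.prems by auto
  have step: "monomial (w @ g # nf p v q) \<approx> 0 \<or> (\<exists>p' v' q'. epath E p' v' \<and> epath E q' v'
        \<and> monomial (w @ g # nf p v q) \<approx> monomial (w @ nf p' v' q'))"
  proof (cases g)
    case (Vertex v')
    then show ?thesis using left_Vertex[OF w _ snoc.prems(2,3), of v'] g snoc.prems(2,3)
      by (auto split: if_splits)
  next
    case (Edge e)
    then have e: "e \<in> arcs E" using g by auto
    show ?thesis
    proof (cases "head E e = pstart E p v")
      case True
      then show ?thesis using left_Edge[OF w e snoc.prems(2,3)] Edge snoc.prems(2,3) e
        by (intro disjI2 exI[of _ "e # p"] exI[of _ v] exI[of _ q]) auto
    next
      case False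
      then show ?thesis using left_Edge[OF w e snoc.prems(2,3)] Edge by simp
    qed
  next
    case (Ghost e)
    then show ?thesis using left_Ghost[OF w _ snoc.prems(2,3), of e] g by auto
  qed
  then show ?case
  proof (elim disjE exE conjE)
    fix p' v' q' assume *: "epath E p' v'" "epath E q' v'"
      "monomial (w @ g # nf p v q) \<approx> monomial (w @ nf p' v' q')"
    from snoc.IH[OF w *(1,2)] have "monomial (w @ g # nf p v q) \<approx> 0
        \<or> (\<exists>p' v' q'. epath E p' v' \<and> epath E q' v'
          \<and> monomial (w @ g # nf p v q) \<approx> monomial (nf p' v' q'))"
      using cg_trans[OF *(3)] by blast
    then show ?case by simp
  qed simp
qed

lemma word_nf:
  assumes "w \<noteq> []" "set w \<subseteq> gens"
  shows "monomial w \<approx> 0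
    \<or> (\<exists>p v q. epath E p v \<and> epath E q v \<and> monomial w \<approx> monomial (nf p v q))"
proof -
  obtain u g where ug: "w = u @ [g]" using assms(1) by (meson rev_exhaust)
  have u: "set u \<subseteq> gens" and g: "g \<in> gens" using assms(2) ug by auto
  have "\<exists>p v q. epath E p v \<and> epath E q v \<and> monomial w \<approx> monomial (u @ nf p v q)"
  proof (cases g)
    case (Vertex v)
    then show ?thesis using g ug
      by (intro exI[of _ "[]"] exI[of _ v]) (auto simp: nf_def)
  next
    case (Edge e)
    then have e: "e \<in> arcs E" using g by auto
    have "monomial w \<approx> monomial (u @ nf [e] (head E e) [])"
      using cg_sym[OF cg_EV[of u "[]", OF u _ e]] by (simp add: nf_def ug Edge)
    then show ?thesis using e
      by (intro exI[of _ "[e]"] exI[of _ "head E e"] exI[of _ "[]"]) auto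
  next
    case (Ghost e)
    then have e: "e \<in> arcs E" using g by auto
    have "monomial w \<approx> monomial (u @ nf [] (head E e) [e])"
      using cg_sym[OF cg_VG[of u "[]", OF u _ e]] by (simp add: nf_def ug Ghost)
    then show ?thesis using e
      by (intro exI[of _ "[]"] exI[of _ "head E e"] exI[of _ "[e]"]) auto
  qed
  then obtain p v q where *: "epath E p v" "epath E q v" "monomial w \<approx> monomial (u @ nf p v q)"
    by blast
  from append_nf[OF u *(1,2)] show ?thesis
    using cg_trans[OF *(3)] by blast
qed

text \<open>The length of \<open>q\<close> is prescribed, that of \<open>p\<close> is only bounded
  below. With \<open>q\<close> of fixed length, different normal forms act by matrices with disjoint
  supports, and this makes the coefficients readable from the matrix.\<close>

definition nfs :: "nat \<Rightarrow> nat \<Rightarrow> ('v, 'e) leavitt_gen list set" where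
  "nfs M L = {nf p v q | p v q. epath E p v \<and> epath E q v \<and> length q = M \<and> L \<le> length p}"

definition level :: "nat \<Rightarrow> nat \<Rightarrow> (('v, 'e) leavitt_gen list \<Rightarrow>\<^sub>0 int) \<Rightarrow> bool" where
  "level M L f \<longleftrightarrow> (\<exists>g. f \<approx> g \<and> Poly_Mapping.keys g \<subseteq> nfs M L)"

lemma cg_frag_extend:
  assumes "\<And>w. w \<in> Poly_Mapping.keys f \<Longrightarrow> monomial w \<approx> \<phi> w"
  shows "f \<approx> frag_extend \<phi> f"
proof -
  have "f - frag_extend \<phi> f = (\<Sum>w\<in>Poly_Mapping.keys f.
      frag_cmul (Poly_Mapping.lookup f w) (monomial w - \<phi> w))"
    by (subst (1) frag_expansion[of f])
       (simp add: frag_extend_def sum_subtractf[symmetric] frag_cmul_diff_right)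
  also have "\<dots> \<in> LI"
    by (intro LI_sum LI_cmul) (use assms in \<open>simp add: cg_def\<close>)
  finally show ?thesis by (simp add: cg_def)
qed

lemma level_extend:
  assumes "\<And>w. w \<in> Poly_Mapping.keys f \<Longrightarrow> level M L (monomial w)"
  shows "level M L f"
proof -
  obtain \<phi> where \<phi>: "\<And>w. w \<in> Poly_Mapping.keys f
      \<Longrightarrow> monomial w \<approx> \<phi> w \<and> Poly_Mapping.keys (\<phi> w) \<subseteq> nfs M L"
    using assms unfolding level_def by metis
  then have "f \<approx> frag_extend \<phi> f" by (intro cg_frag_extend) simp
  moreover have "Poly_Mapping.keys (frag_extend \<phi> f) \<subseteq> nfs M L"
    using \<phi> keys_frag_extend[of \<phi> f] by fastforce
  ultimately show ?thesis by (auto simp: level_def)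
qed

lemma level_cong: "f \<approx> g \<Longrightarrow> level M L g \<Longrightarrow> level M L f"
  unfolding level_def using cg_trans by blast

text \<open>The vertex in the middle is replaced by the sum of \<open>s_e s_e*\<close> over its
  outgoing edges, which lengthens both paths by one edge.\<close>

lemma level_Suc_nf:
  assumes ns: "\<forall>v\<in>verts E. out_arcs E v \<noteq> {}" and w: "w \<in> nfs M L"
  shows "level (Suc M) (Suc L) (monomial w)"
proof -
  obtain p v q where pq: "epath E p v" "epath E q v" "length q = M" "L \<le> length p"
    and w: "w = nf p v q" using w by (auto simp: nfs_def)
  let ?u = "map Edge p :: ('v, 'e) leavitt_gen list"
  let ?w = "map Ghost (rev q) :: ('v, 'e) leavitt_gen list"
  have u: "set ?u \<subseteq> gens" and w': "set ?w \<subseteq> gens"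
    using epath_arcs[OF pq(1)] epath_arcs[OF pq(2)] by auto
  have v: "v \<in> verts E" using epath_verts[OF pq(1)] .
  have "monomial w \<approx> (\<Sum>e\<in>out_arcs E v. monomial (?u @ Edge e # Ghost e # ?w))"
    using cg_V[OF u w' v] ns v by (simp add: w nf_def)
  also have "\<dots> \<approx> (\<Sum>e\<in>out_arcs E v. monomial (nf (p @ [e]) (head E e) (q @ [e])))"
  proof (rule cg_sum)
    fix e assume "e \<in> out_arcs E v"
    then have e: "e \<in> arcs E" by auto
    then have gw: "set (Ghost e # ?w) \<subseteq> gens" using w' by auto
    show "monomial (?u @ Edge e # Ghost e # ?w) \<approx> monomial (nf (p @ [e]) (head E e) (q @ [e]))"
      using cg_sym[OF cg_EV[OF u gw e]] by (simp add: nf_def)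
  qed
  finally have 1: "monomial w
      \<approx> (\<Sum>e\<in>out_arcs E v. monomial (nf (p @ [e]) (head E e) (q @ [e])))" .
  have "nf (p @ [e]) (head E e) (q @ [e]) \<in> nfs (Suc M) (Suc L)" if "e \<in> out_arcs E v" for e
  proof -
    have "epath E (p @ [e]) (head E e)" "epath E (q @ [e]) (head E e)"
      using that pq by (auto simp: epath_snoc)
    with pq show ?thesis
      unfolding nfs_def by (intro CollectI exI[of _ "p @ [e]"] exI[of _ "head E e"] exI[of _ "q @ [e]"]) auto
  qed
  then have "Poly_Mapping.keys (\<Sum>e\<in>out_arcs E v. monomial (nf (p @ [e]) (head E e) (q @ [e])))
      \<subseteq> nfs (Suc M) (Suc L)"
    using keys_sum[of "\<lambda>e. monomial (nf (p @ [e]) (head E e) (q @ [e]))" "out_arcs E v"] by fastforce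
  with 1 show ?thesis unfolding level_def by blast
qed

lemma level_Suc:
  assumes ns: "\<forall>v\<in>verts E. out_arcs E v \<noteq> {}" and f: "level M L f"
  shows "level (Suc M) (Suc L) f"
proof -
  obtain g where g: "f \<approx> g" "Poly_Mapping.keys g \<subseteq> nfs M L" using f by (auto simp: level_def)
  have "level (Suc M) (Suc L) g"
    by (rule level_extend) (use g(2) level_Suc_nf[OF ns] in blast)
  with g(1) show ?thesis by (rule level_cong)
qed

lemma level_raise:
  assumes ns: "\<forall>v\<in>verts E. out_arcs E v \<noteq> {}" and f: "level M L f"
  shows "level (M + n) (L + n) f"
  by (induction n) (use f level_Suc[OF ns] in auto)

lemma level_mono: "level M L f \<Longrightarrow> L' \<le> L \<Longrightarrow> level M L' f"
  unfolding level_def nfs_def by fastforce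

text \<open>Each word has a normal form at some level, and levels can be raised, so the finitely
  many words of \<open>f\<close> meet at the maximum. Without edges nothing can be raised, but then
  \<open>q\<close> is empty in every normal form and the level is 0.\<close>

lemma ex_level:
  assumes f: "f \<in> elems WA"
  shows "\<exists>M. level M 0 f"
proof -
  have word: "\<exists>M. level M 0 (monomial w)" if "w \<in> Poly_Mapping.keys f" for w
  proof -
    have "w \<noteq> []" "set w \<subseteq> gens" using f that by (auto simp: WA_elems)
    from word_nf[OF this] show ?thesis
    proof (elim disjE exE conjE)
      assume "monomial w \<approx> 0"
      then have "level 0 0 (monomial w)" unfolding level_def by (intro exI[of _ 0]) simp
      then show ?thesis ..
    next
      fix p v q assume *: "epath E p v" "epath E q v" "monomial w \<approx> monomial (nf p v q)"
      then have "level (length q) 0 (monomial w)"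
        unfolding level_def by (intro exI[of _ "monomial (nf p v q)"]) (auto simp: nfs_def)
      then show ?thesis ..
    qed
  qed
  then obtain m where m: "\<And>w. w \<in> Poly_Mapping.keys f \<Longrightarrow> level (m w) 0 (monomial w)" by metis
  show ?thesis
  proof (cases "arcs E = {}")
    case True
    have "level 0 0 (monomial w)" if "w \<in> Poly_Mapping.keys f" for w
    proof -
      have "nfs (m w) 0 \<subseteq> nfs 0 0"
      proof
        fix x assume "x \<in> nfs (m w) 0"
        then obtain p v q where *: "x = nf p v q" "epath E p v" "epath E q v"
          by (auto simp: nfs_def)
        then have "q = []" using epath_arcs[OF *(3)] True by simp
        with * show "x \<in> nfs 0 0" unfolding nfs_def by blast
      qed
      then show ?thesis using m[OF that] unfolding level_def by blast
    qed
    then show ?thesis using level_extend by blast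
  next
    case False
    then have ns: "\<forall>v\<in>verts E. out_arcs E v \<noteq> {}" using regular by auto
    define M where "M = Max (insert 0 (m ` Poly_Mapping.keys f))"
    have "level M 0 (monomial w)" if "w \<in> Poly_Mapping.keys f" for w
    proof -
      have "m w \<le> M" unfolding M_def using that by (intro Max_ge) auto
      then have "level M (0 + (M - m w)) (monomial w)"
        using level_raise[OF ns m[OF that], of "M - m w"] by simp
      then show ?thesis by (rule level_mono) simp
    qed
    then show ?thesis using level_extend by blast
  qed
qed

section \<open>Faithfulness of the path representation\<close>

lemma ex_ipath:
  assumes v: "v \<in> verts E"
  obtains z where "z \<in> ipaths E" "src E z = v"
proof (cases "arcs E = {}")
  case True
  show ?thesis by (rule that[of "\<lambda>_. undefined"]) (simp_all add: True ipaths_def src_edgeless v)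
next
  case False
  then have "\<forall>v\<in>verts E. \<exists>e. e \<in> arcs E \<and> tail E e = v" using regular by (auto simp: out_arcs_def)
  then obtain f where f: "\<And>v. v \<in> verts E \<Longrightarrow> f v \<in> arcs E \<and> tail E (f v) = v" by metis
  define w where "w n = ((\<lambda>u. head E (f u)) ^^ n) v" for n
  have w: "w n \<in> verts E" for n
    by (induction n) (auto simp: w_def v f)
  have "(\<lambda>n. f (w n)) \<in> ipaths E"
    using False w f by (auto simp: ipaths_def) (simp add: w_def f w[unfolded w_def])
  moreover have "src E (\<lambda>n. f (w n)) = v" using False f[OF v] by (simp add: src_def w_def)
  ultimately show ?thesis by (rule that)
qed

lemma wact_Edges:
  "epath E p v \<Longrightarrow> z \<in> ipaths E \<Longrightarrow> src E z = v
    \<Longrightarrow> wact E (map Edge p) (z, k) = Some (p \<frown> z, k + int (length p))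
      \<and> p \<frown> z \<in> ipaths E \<and> src E (p \<frown> z) = pstart E p v"
proof (induction p)
  case (Cons e p)
  then have e: "e \<in> arcs E" by simp
  then have "arcs E \<noteq> {}" by auto
  with Cons show ?case
    by (auto simp: map_comp_def build_in_ipaths src_build)
qed simp

lemma wact_nf:
  assumes p: "epath E p v" and q: "epath E q v"
  shows "wact E (nf p v q) b = Some a \<longleftrightarrow> (\<exists>z\<in>ipaths E. src E z = v \<and> fst b = q \<frown> z
    \<and> fst a = p \<frown> z \<and> snd a - snd b = int (length p) - int (length q))"
proof -
  have G: "wact E (map Ghost (rev q)) b = Some c \<longleftrightarrow> wact E (map Edge q) c = Some b" for c
    using wact_star[of E "map Edge q" b c] by (simp add: rev_map comp_def)
  have V: "act E (Vertex v) c = Some d \<longleftrightarrow> c = d \<and> fst c \<in> ipaths E \<and> src E (fst c) = v" for c d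
    by (cases c) auto
  have "wact E (nf p v q) b = Some a \<longleftrightarrow> (\<exists>c. fst c \<in> ipaths E \<and> src E (fst c) = v
      \<and> wact E (map Edge q) c = Some b \<and> wact E (map Edge p) c = Some a)"
    unfolding nf_def by (auto simp: wact_append map_comp_Some_iff G V)
  also have "\<dots> \<longleftrightarrow> (\<exists>z\<in>ipaths E. src E z = v \<and> (\<exists>k. b = (q \<frown> z, k + int (length q))
      \<and> a = (p \<frown> z, k + int (length p))))"
    using wact_Edges[OF p] wact_Edges[OF q] by auto
  also have "\<dots> \<longleftrightarrow> (\<exists>z\<in>ipaths E. src E z = v \<and> fst b = q \<frown> z
    \<and> fst a = p \<frown> z \<and> snd a - snd b = int (length p) - int (length q))"
    by (cases a; cases b) (auto simp: algebra_simps intro!: exI[of _ "snd b - int (length q)"] bexI)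
  finally show ?thesis .
qed

text \<open>The chosen pair of points meets the support of only one normal form: cutting the second
  path after \<open>M\<close> edges recovers \<open>q\<close> and \<open>z\<close>, the difference
  of degrees recovers the length of \<open>p\<close>, and the first path then gives
  \<open>p\<close>. On periodic paths the degree is what tells different \<open>p\<close>
  apart.\<close>

lemma lin_nfs_coeff:
  assumes g: "Poly_Mapping.keys g \<subseteq> nfs M L" and p: "epath E p v" and q: "epath E q v"
    and M: "length q = M" and z: "z \<in> ipaths E" "src E z = v"
  shows "lin (wrep E) g (p \<frown> z, k + int (length p)) (q \<frown> z, k + int M) = Poly_Mapping.lookup g (nf p v q)"
proof -
  have "wrep E w (p \<frown> z, k + int (length p)) (q \<frown> z, k + int M) = (if w = nf p v q then 1 else 0)"
    if "w \<in> Poly_Mapping.keys g" for w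
  proof -
    have "w \<in> nfs M L" using g that by blast
    then obtain p' v' q' where w: "w = nf p' v' q'" "epath E p' v'" "epath E q' v'" "length q' = M"
      by (auto simp: nfs_def)
    have "wact E w (q \<frown> z, k + int M) = Some (p \<frown> z, k + int (length p)) \<longleftrightarrow> w = nf p v q"
    proof
      assume "wact E w (q \<frown> z, k + int M) = Some (p \<frown> z, k + int (length p))"
      then obtain z' where z': "src E z' = v'" "q \<frown> z = q' \<frown> z'" "p \<frown> z = p' \<frown> z'"
        "length p = length p'"
        unfolding w(1) wact_nf[OF w(2,3)] using w(4) by auto
      have "q = q'" "z = z'"
        using z'(2) M w(4) prefix_conc_length[of q z] prefix_conc_length[of q' z']
          suffix_conc_length[of q z] suffix_conc_length[of q' z'] by auto
      moreover have "p = p'"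
        using z'(3,4) prefix_conc_length[of p z] prefix_conc_length[of p' z'] by auto
      ultimately show "w = nf p v q" using z z'(1) w(1) by simp
    next
      assume w': "w = nf p v q"
      show "wact E w (q \<frown> z, k + int M) = Some (p \<frown> z, k + int (length p))"
        unfolding w' wact_nf[OF p q] using M z by auto
    qed
    then show ?thesis by (simp add: wrep_def pmat_def)
  qed
  then have "lin (wrep E) g (p \<frown> z, k + int (length p)) (q \<frown> z, k + int M)
      = (\<Sum>w\<in>Poly_Mapping.keys g. if w = nf p v q then Poly_Mapping.lookup g w else 0)"
    unfolding lin_def by (intro sum.cong refl) simp
  then show ?thesis by (simp add: in_keys_iff)
qed

lemma lin_cg: "f \<approx> g \<Longrightarrow> lin (wrep E) f = lin (wrep E) g"
  using LI_kernel[of "f - g"] by (simp add: cg_def lin_diff)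

text \<open>Faithfulness: an element of the kernel is congruent to a combination of normal forms of
  one level. Each of its coefficients is a matrix entry at an infinite path from the middle vertex,
  hence 0.\<close>

sublocale leavitt: semigroup_algebra_rep "word_semigroup E" "wrep E" LI
proof
  fix f
  show "f \<in> LI \<longleftrightarrow> f \<in> elems WA \<and> lin (wrep E) f = 0"
  proof
    assume f: "f \<in> elems WA \<and> lin (wrep E) f = 0"
    then obtain M g where g: "f \<approx> g" "Poly_Mapping.keys g \<subseteq> nfs M 0"
      using ex_level unfolding level_def by blast
    have "Poly_Mapping.lookup g w = 0" for w
    proof (cases "w \<in> Poly_Mapping.keys g")
      case True
      then obtain p v q where w: "w = nf p v q" "epath E p v" "epath E q v" "length q = M"
        using g(2) by (auto simp: nfs_def)
      obtain z where "z \<in> ipaths E" "src E z = v" using ex_ipath[OF epath_verts[OF w(2)]] .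
      from lin_nfs_coeff[OF g(2) w(2-4) this] lin_cg[OF g(1)] f w(1) show ?thesis by simp
    qed (simp add: in_keys_iff)
    then have "g = 0" by (intro poly_mapping_eqI) simp
    with g(1) show "f \<in> LI" by (simp add: cg_def)
  qed (rule LI_kernel)
qed

end

section \<open>The stabilized algebra as an algebra of matrices\<close>

text \<open>A row index of \<open>M_infinity\<close>, an infinite path and a degree.\<close>

type_synonym 'e pt = "nat \<times> (nat \<Rightarrow> 'e) \<times> int"

definition kron :: "'i imat \<Rightarrow> nat imat \<Rightarrow> (nat \<times> 'i) imat" where
  "kron A m = (\<lambda>(i, a) (j, b). A a b * m i j)"

lemma kron_apply: "kron A m a c = A (snd a) (snd c) * m (fst a) (fst c)"
  by (simp add: kron_def split_beta)

definition munit :: "nat \<times> nat \<Rightarrow> nat imat" where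
  "munit ij = (\<lambda>k l. if (k, l) = ij then 1 else 0)"

abbreviation MI :: "(int, nat imat) star_algebra" where
  "MI \<equiv> M_infinity"

lemma MI_simps:
  "m \<in> elems MI \<longleftrightarrow> finite {(i, j). m i j \<noteq> 0}"
  "star MI m = tr m" "nul MI = 0" "add MI m m' = m + m'" "scale MI c m = (\<lambda>i j. c * m i j)"
  by (auto simp: M_infinity_def tr_def fun_eq_iff)

lemma MI_finite:
  assumes "m \<in> elems MI"
  shows "finite {i. m i j \<noteq> 0}" "finite {j. m i j \<noteq> 0}"
proof -
  have fin: "finite {(i, j). m i j \<noteq> 0}" using assms by (simp add: MI_simps)
  have "{i. m i j \<noteq> 0} \<subseteq> fst ` {(i, j). m i j \<noteq> 0}" by force
  then show "finite {i. m i j \<noteq> 0}" using fin finite_surj by blast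
  have "{j. m i j \<noteq> 0} \<subseteq> snd ` {(i, j). m i j \<noteq> 0}" by force
  then show "finite {j. m i j \<noteq> 0}" using fin finite_surj by blast
qed

text \<open>The product of \<open>M_infinity\<close> sums over the support of a row of the left
  factor, \<open>mm\<close> over the support of a column of the right one. Both supports are finite,
  and the sums agree on their union.\<close>

lemma MI_mul:
  assumes "m \<in> elems MI" "m' \<in> elems MI"
  shows "mul MI m m' = mm m m'"
proof (intro ext)
  fix i j
  have "mul MI m m' i j = (\<Sum>k\<in>{k. m i k \<noteq> 0} \<union> {k. m' k j \<noteq> 0}. m i k * m' k j)"
    unfolding M_infinity_def using MI_finite[OF assms(1)] MI_finite[OF assms(2)]
    by (auto intro!: sum.mono_neutral_left)
  also have "\<dots> = mm m m' i j"
    using MI_finite[OF assms(1)] MI_finite[OF assms(2)]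
    by (intro mm_superset[symmetric]) auto
  finally show "mul MI m m' i j = mm m m' i j" .
qed

lemma MI_closed:
  assumes m: "m \<in> elems MI" and m': "m' \<in> elems MI"
  shows "mul MI m m' \<in> elems MI" "star MI m \<in> elems MI" "add MI m m' \<in> elems MI"
    "scale MI c m \<in> elems MI" "nul MI \<in> elems MI"
proof -
  have fm: "finite {(i, j). m i j \<noteq> 0}" and fm': "finite {(i, j). m' i j \<noteq> 0}"
    using m m' by (simp_all add: MI_simps)
  have "{(i, j). mm m m' i j \<noteq> 0}
      \<subseteq> fst ` {(i, j). m i j \<noteq> 0} \<times> snd ` {(i, j). m' i j \<noteq> 0}"
    by (force simp: mm_def elim!: sum.not_neutral_contains_not_neutral)
  then show "mul MI m m' \<in> elems MI"
    unfolding MI_mul[OF m m'] MI_simps by (rule finite_subset) (use fm fm' in simp)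
  have "{(i, j). tr m i j \<noteq> 0} = prod.swap ` {(i, j). m i j \<noteq> 0}"
    by (auto simp: tr_def image_iff)
  then show "star MI m \<in> elems MI" unfolding MI_simps using fm by simp
  have "{(i, j). (m + m') i j \<noteq> 0} \<subseteq> {(i, j). m i j \<noteq> 0} \<union> {(i, j). m' i j \<noteq> 0}" by auto
  then show "add MI m m' \<in> elems MI"
    unfolding MI_simps by (rule finite_subset) (use fm fm' in simp)
  have "{(i, j). c * m i j \<noteq> 0} \<subseteq> {(i, j). m i j \<noteq> 0}" by auto
  then show "scale MI c m \<in> elems MI"
    unfolding MI_simps by (rule finite_subset) (use fm in simp)
  show "nul MI \<in> elems MI" by (simp add: MI_simps)
qed

lemma munit_closed: "munit ij \<in> elems MI"
proof -
  have "{(i, j). munit ij i j \<noteq> 0} \<subseteq> {ij}" by (auto simp: munit_def)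
  then show ?thesis unfolding MI_simps using finite_subset by blast
qed

lemma colfin_kron:
  assumes "colfin A" "m \<in> elems MI"
  shows "colfin (kron A m)"
  unfolding colfin_def
proof
  fix c :: "nat \<times> 'a"
  have "{a. kron A m a c \<noteq> 0} \<subseteq> {i. m i (fst c) \<noteq> 0} \<times> {a. A a (snd c) \<noteq> 0}"
    by (auto simp: kron_apply)
  then show "finite {a. kron A m a c \<noteq> 0}"
    by (rule finite_subset) (use assms MI_finite in \<open>auto simp: colfin_def\<close>)
qed

lemma mm_kron:
  assumes "colfin B" "m' \<in> elems MI"
  shows "mm (kron A m) (kron B m') = kron (mm A B) (mm m m')"
proof (intro ext)
  fix a c :: "nat \<times> 'a"
  obtain i x j y where ac: "a = (i, x)" "c = (j, y)" by (cases a, cases c)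
  let ?S = "{k. m' k j \<noteq> 0}" and ?T = "{b. B b y \<noteq> 0}"
  have fin: "finite ?S" "finite ?T" using assms MI_finite by (auto simp: colfin_def)
  have "mm (kron A m) (kron B m') a c = (\<Sum>b\<in>?S \<times> ?T. kron A m a b * kron B m' b c)"
    using fin by (intro mm_superset) (auto simp: ac kron_apply)
  also have "\<dots> = (\<Sum>k\<in>?S. \<Sum>b\<in>?T. (m i k * m' k j) * (A x b * B b y))"
    unfolding sum.cartesian_product by (rule sum.cong) (auto simp: ac kron_apply)
  also have "\<dots> = (\<Sum>k\<in>?S. m i k * m' k j) * (\<Sum>b\<in>?T. A x b * B b y)"
    by (simp add: sum_product)
  also have "\<dots> = kron (mm A B) (mm m m') a c"
    by (simp add: mm_def ac kron_apply)
  finally show "mm (kron A m) (kron B m') a c = kron (mm A B) (mm m m') a c" .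
qed

section \<open>Faithfulness of the tensor product representation\<close>

context regular_graph
begin

abbreviation "LP \<equiv> leavitt.Q"
abbreviation "TS \<equiv> pair_semigroup LP MI"
abbreviation "TA \<equiv> (semigroup_algebra TS
  :: (int, ((('v, 'e) leavitt_gen list \<Rightarrow>\<^sub>0 int) set \<times> nat imat) \<Rightarrow>\<^sub>0 int) star_algebra)"
abbreviation "TR \<equiv> bilinear_relations LP MI"
abbreviation "TI \<equiv> span_in TA TR"

lemma leavitt_Q: "leavitt_path_algebra E = LP"
  by (simp add: leavitt_path_algebra_def)

lemma tensor_Q: "leavitt_Z_stabilized E = quotient_algebra TA TI"
  by (simp add: tensor_product_def leavitt_Q)

definition trep :: "(('v, 'e) leavitt_gen list \<Rightarrow>\<^sub>0 int) set \<times> nat imat \<Rightarrow> 'e pt imat" where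
  "trep = (\<lambda>(K, m). kron (leavitt.qrep K) m)"

lemma TS_simps:
  "elems TS = elems LP \<times> elems MI"
  "mul TS (K, m) (K', m') = (mul LP K K', mul MI m m')"
  "star TS (K, m) = (star LP K, star MI m)"
  by (simp_all add: pair_semigroup_def)

sublocale pairs: semigroup_rep TS trep
proof
  fix x y assume x: "x \<in> elems TS" and y: "y \<in> elems TS"
  obtain K m K' m' where xy: "x = (K, m)" "y = (K', m')" by (cases x, cases y)
  have K: "K \<in> elems LP" "K' \<in> elems LP" and m: "m \<in> elems MI" "m' \<in> elems MI"
    using x y by (auto simp: xy TS_simps)
  show "mul TS x y \<in> elems TS" "star TS x \<in> elems TS"
    using K m leavitt.Q_closed MI_closed by (auto simp: xy TS_simps)
  show "colfin (trep x)" using K m by (simp add: xy trep_def colfin_kron leavitt.colfin_qrep)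
  show "trep (mul TS x y) = mm (trep x) (trep y)"
    using K m by (simp add: xy trep_def TS_simps leavitt.qrep_hom MI_mul mm_kron leavitt.colfin_qrep)
  show "trep (star TS x) = tr (trep x)"
    using K m by (auto simp: xy trep_def TS_simps leavitt.qrep_hom MI_simps tr_def kron_apply fun_eq_iff)
qed

lemmas TA_simps = semigroup_algebra_simps[of TS]

lemma
  shows TI_zero: "0 \<in> TI"
    and TI_add: "f \<in> TI \<Longrightarrow> g \<in> TI \<Longrightarrow> f + g \<in> TI"
    and TI_cmul: "f \<in> TI \<Longrightarrow> frag_cmul c f \<in> TI"
  using span_in.span_nul[of TA TR] span_in.span_add[of f TA TR g] span_in.span_scale[of f TA TR c]
  by (simp_all add: TA_simps)

lemma TI_uminus: "f \<in> TI \<Longrightarrow> - f \<in> TI"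
  using TI_cmul[of f "-1"] by simp

definition tcg (infix "\<cong>\<^sub>T" 50) where "f \<cong>\<^sub>T g \<longleftrightarrow> f - g \<in> TI"

lemma tcg_refl [simp]: "f \<cong>\<^sub>T f" by (simp add: tcg_def TI_zero)

lemma tcg_sym: "f \<cong>\<^sub>T g \<Longrightarrow> g \<cong>\<^sub>T f"
  unfolding tcg_def using TI_uminus[of "f - g"] by simp

lemma tcg_trans [trans]: "f \<cong>\<^sub>T g \<Longrightarrow> g \<cong>\<^sub>T h \<Longrightarrow> f \<cong>\<^sub>T h"
  unfolding tcg_def using TI_add[of "f - g" "g - h"] by simp

lemma tcg_add: "f \<cong>\<^sub>T g \<Longrightarrow> f' \<cong>\<^sub>T g' \<Longrightarrow> f + f' \<cong>\<^sub>T g + g'"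
  unfolding tcg_def using TI_add[of "f - g" "f' - g'"] by (simp add: algebra_simps)

lemma tcg_sum: "(\<And>x. x \<in> X \<Longrightarrow> f x \<cong>\<^sub>T g x) \<Longrightarrow> sum f X \<cong>\<^sub>T sum g X"
  by (induction X rule: infinite_finite_induct) (auto intro: tcg_add)

lemma tcg_add_left:
  assumes "K \<in> elems LP" "K' \<in> elems LP" "m \<in> elems MI"
  shows "monomial (add LP K K', m) \<cong>\<^sub>T monomial (K, m) + monomial (K', m)"
proof -
  have "monomial (add LP K K', m) - monomial (K, m) - monomial (K', m) \<in> TR"
    using assms unfolding bilinear_relations_def by blast
  from span_in.span_base[OF this, of TA] show ?thesis unfolding tcg_def by (simp add: algebra_simps)
qed

lemma tcg_add_right:
  assumes "K \<in> elems LP" "m \<in> elems MI" "m' \<in> elems MI"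
  shows "monomial (K, m + m') \<cong>\<^sub>T monomial (K, m) + monomial (K, m')"
proof -
  have "monomial (K, add MI m m') - monomial (K, m) - monomial (K, m') \<in> TR"
    using assms unfolding bilinear_relations_def by blast
  from span_in.span_base[OF this, of TA] show ?thesis
    unfolding tcg_def MI_simps by (simp add: algebra_simps)
qed

lemma tcg_scale_left:
  assumes "K \<in> elems LP" "m \<in> elems MI"
  shows "monomial (scale LP c K, m) \<cong>\<^sub>T Poly_Mapping.single (K, m) c"
proof -
  have "monomial (scale LP c K, m) - Poly_Mapping.single (K, m) c \<in> TR"
    using assms unfolding bilinear_relations_def by blast
  from span_in.span_base[OF this, of TA] show ?thesis unfolding tcg_def .
qed

lemma tcg_scale_right:
  assumes "K \<in> elems LP" "m \<in> elems MI"
  shows "monomial (K, scale MI c m) \<cong>\<^sub>T Poly_Mapping.single (K, m) c"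
proof -
  have "monomial (K, scale MI c m) - Poly_Mapping.single (K, m) c \<in> TR"
    using assms unfolding bilinear_relations_def by blast
  from span_in.span_base[OF this, of TA] show ?thesis unfolding tcg_def .
qed

lemma nul_LP: "nul LP \<in> elems LP"
  unfolding leavitt.elems_Q leavitt.Q_simps(5)[OF words.zero_in_A words.zero_in_A]
  by (rule imageI) (rule words.zero_in_A)

lemma add_nul_LP:
  assumes "K \<in> elems LP"
  shows "add LP K (nul LP) = K" "add LP (nul LP) K = K"
proof -
  obtain f where f: "f \<in> elems WA" "K = coset WA LI f" using leavitt.Q_cases[OF assms] .
  note z = words.zero_in_A
  show "add LP K (nul LP) = K" "add LP (nul LP) K = K"
    using leavitt.Q_simps(2)[OF f(1) z] leavitt.Q_simps(2)[OF z f(1)]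
    by (simp_all add: f(2) leavitt.Q_simps(5)[OF z z])
qed

lemma tcg_zero_left: "m \<in> elems MI \<Longrightarrow> monomial (nul LP, m) \<cong>\<^sub>T 0"
proof -
  assume m: "m \<in> elems MI"
  from tcg_add_left[OF nul_LP nul_LP m] add_nul_LP[OF nul_LP] show ?thesis
    using TI_uminus[of "- monomial (nul LP, m)"] by (simp add: tcg_def)
qed

lemma tcg_zero_right: "K \<in> elems LP \<Longrightarrow> monomial (K, 0) \<cong>\<^sub>T 0"
proof -
  assume K: "K \<in> elems LP"
  have n: "(0 :: nat imat) \<in> elems MI" by (simp add: MI_simps)
  from tcg_add_right[OF K n n] show ?thesis
    using TI_uminus[of "- monomial (K, 0)"] by (simp add: tcg_def)
qed

lemma TI_kernel: "f \<in> TI \<Longrightarrow> f \<in> elems TA \<and> lin trep f = 0"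
proof (induction rule: span_in.induct)
  case span_nul
  then show ?case using pairs.zero_in_A by (simp add: TA_simps)
next
  case (span_base x)
  have s: "Poly_Mapping.single (K, m) c \<in> elems TA" if "K \<in> elems LP" "m \<in> elems MI" for K m c
    using that by (auto simp: TA_simps TS_simps)
  note cl = leavitt.Q_closed MI_closed MI_closed(3)[unfolded MI_simps(4)]
    MI_closed(4)[unfolded MI_simps(5)]
  from span_base show ?case
    unfolding bilinear_relations_def
  proof (elim UnE CollectE exE conjE)
    fix a a' b assume *: "x = monomial (add LP a a', b) - monomial (a, b) - monomial (a', b)"
      "a \<in> elems LP" "a' \<in> elems LP" "b \<in> elems MI"
    show ?thesis unfolding *(1) using *(2-)
      by (auto intro!: pairs.diff_in_A pairs.add_in_A s cl
          simp: lin_diff lin_add trep_def kron_apply leavitt.qrep_hom fun_eq_iff algebra_simps)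
  next
    fix a b b' assume *: "x = monomial (a, add MI b b') - monomial (a, b) - monomial (a, b')"
      "a \<in> elems LP" "b \<in> elems MI" "b' \<in> elems MI"
    show ?thesis unfolding *(1) using *(2-)
      by (auto intro!: pairs.diff_in_A pairs.add_in_A s cl
          simp: lin_diff lin_add trep_def kron_apply MI_simps(4) fun_eq_iff algebra_simps)
  next
    fix c a b assume *: "x = monomial (scale LP c a, b) - Poly_Mapping.single (a, b) c"
      "a \<in> elems LP" "b \<in> elems MI"
    show ?thesis unfolding *(1) using *(2-)
      by (auto intro!: pairs.diff_in_A pairs.add_in_A s cl
          simp: lin_diff lin_add trep_def kron_apply leavitt.qrep_hom fun_eq_iff algebra_simps)
  next
    fix c a b assume *: "x = monomial (a, scale MI c b) - Poly_Mapping.single (a, b) c"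
      "a \<in> elems LP" "b \<in> elems MI"
    show ?thesis unfolding *(1) using *(2-)
      by (auto intro!: pairs.diff_in_A pairs.add_in_A s cl
          simp: lin_diff lin_add trep_def kron_apply MI_simps(5) fun_eq_iff algebra_simps)
  qed
next
  case (span_add x y)
  then show ?case using pairs.add_in_A[of x y] by (simp add: TA_simps(5) lin_add)
next
  case (span_scale x c)
  then show ?case using pairs.cmul_in_A[of x c] by (simp add: TA_simps(6) lin_cmul fun_eq_iff)
qed

text \<open>The tensor \<open>f\<close> written as a finite sum of elements \<open>k ij\<close>
  times matrix units. Outside \<open>J\<close> the blocks are the zero class, so that
  \<open>k\<close> alone determines the represented matrix.\<close>

definition blocks where
  "blocks J k f \<longleftrightarrow> finite J \<and> (\<forall>ij. k ij \<in> elems LP) \<and> (\<forall>ij. ij \<notin> J \<longrightarrow> k ij = nul LP)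
    \<and> f \<cong>\<^sub>T (\<Sum>ij\<in>J. monomial (k ij, munit ij))"

lemma blocks_superset:
  assumes "blocks J k f" "J \<subseteq> J'" "finite J'"
  shows "blocks J' k f"
proof -
  have "(\<Sum>ij\<in>J'. monomial (k ij, munit ij))
      = (\<Sum>ij\<in>J. monomial (k ij, munit ij)) + (\<Sum>ij\<in>J' - J. monomial (k ij, munit ij))"
    using assms(2,3) by (simp add: sum.subset_diff)
  also have "\<dots> \<cong>\<^sub>T (\<Sum>ij\<in>J. monomial (k ij, munit ij)) + (\<Sum>ij\<in>J' - J. 0)"
    using assms(1) by (intro tcg_add tcg_sum) (auto simp: blocks_def tcg_zero_left munit_closed)
  finally have "(\<Sum>ij\<in>J'. monomial (k ij, munit ij)) \<cong>\<^sub>T (\<Sum>ij\<in>J. monomial (k ij, munit ij))"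
    by simp
  then show ?thesis
    using assms tcg_trans[OF _ tcg_sym] unfolding blocks_def by blast
qed

lemma blocks_add:
  assumes "blocks J k f" "blocks J' k' f'"
  shows "blocks (J \<union> J') (\<lambda>ij. add LP (k ij) (k' ij)) (f + f')"
proof -
  have J: "finite J" "finite J'" using assms by (auto simp: blocks_def)
  have 1: "blocks (J \<union> J') k f" "blocks (J \<union> J') k' f'"
    using assms J by (auto intro: blocks_superset)
  have "f + f' \<cong>\<^sub>T (\<Sum>ij\<in>J\<union>J'. monomial (k ij, munit ij)) + (\<Sum>ij\<in>J\<union>J'. monomial (k' ij, munit ij))"
    using 1 by (intro tcg_add) (auto simp: blocks_def)
  also have "\<dots> = (\<Sum>ij\<in>J\<union>J'. monomial (k ij, munit ij) + monomial (k' ij, munit ij))"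
    by (simp add: sum.distrib)
  also have "\<dots> \<cong>\<^sub>T (\<Sum>ij\<in>J\<union>J'. monomial (add LP (k ij) (k' ij), munit ij))"
    using 1 by (intro tcg_sum tcg_sym[OF tcg_add_left] munit_closed) (auto simp: blocks_def)
  finally show ?thesis
    using 1 leavitt.Q_closed(2) add_nul_LP nul_LP by (auto simp: blocks_def)
qed

lemma blocks_cong: "f \<cong>\<^sub>T g \<Longrightarrow> blocks J k g \<Longrightarrow> blocks J k f"
  unfolding blocks_def using tcg_trans by blast

lemma blocks_zero: "blocks {} (\<lambda>_. nul LP) 0"
  by (simp add: blocks_def nul_LP)

lemma blocks_unit:
  assumes "K \<in> elems LP"
  shows "blocks {ij} (\<lambda>ij'. if ij' = ij then K else nul LP) (monomial (K, munit ij))"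
  using assms nul_LP by (simp add: blocks_def)

text \<open>The nonzero entries of \<open>m\<close> are peeled off one at a time and each scalar is
  moved to the left tensor factor, so that only matrix units remain on the right.\<close>

lemma blocks_monomial:
  assumes K: "K \<in> elems LP" and m: "m \<in> elems MI"
  shows "\<exists>J k. blocks J k (Poly_Mapping.single (K, m) c)"
proof -
  have fin: "finite {(i, j). m i j \<noteq> 0}" using m by (simp add: MI_simps)
  define r where "r X = (\<lambda>i j. if (i, j) \<in> X then m i j else 0)" for X
  have r: "r X \<in> elems MI" for X
  proof -
    have "{(i, j). r X i j \<noteq> 0} \<subseteq> {(i, j). m i j \<noteq> 0}" by (auto simp: r_def)
    then show ?thesis unfolding MI_simps using fin finite_subset by blast
  qed
  have "\<exists>J k. blocks J k (monomial (K, r X))" if "finite X" "K \<in> elems LP" for X K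
    using that
  proof (induction X rule: finite_induct)
    case empty
    have "r {} = 0" by (simp add: r_def fun_eq_iff)
    then have "monomial (K, r {}) \<cong>\<^sub>T 0" using tcg_zero_right empty by simp
    then show ?case using blocks_cong[OF _ blocks_zero] by blast
  next
    case (insert ij X)
    let ?c = "m (fst ij) (snd ij)"
    have "r (insert ij X) = scale MI ?c (munit ij) + r X"
      using insert(2) by (auto simp: r_def fun_eq_iff munit_def MI_simps)
    then have "monomial (K, r (insert ij X)) \<cong>\<^sub>T monomial (K, scale MI ?c (munit ij)) + monomial (K, r X)"
      using tcg_add_right[OF insert.prems MI_closed(4)[OF munit_closed munit_closed] r] by simp
    also have "\<dots> \<cong>\<^sub>T Poly_Mapping.single (K, munit ij) ?c + monomial (K, r X)"
      by (intro tcg_add tcg_scale_right tcg_refl insert.prems munit_closed)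
    also have "\<dots> \<cong>\<^sub>T monomial (scale LP ?c K, munit ij) + monomial (K, r X)"
      by (intro tcg_add tcg_sym[OF tcg_scale_left] tcg_refl insert.prems munit_closed)
    finally have *: "monomial (K, r (insert ij X))
        \<cong>\<^sub>T monomial (scale LP ?c K, munit ij) + monomial (K, r X)" .
    obtain J k where "blocks J k (monomial (K, r X))" using insert by blast
    from blocks_cong[OF * blocks_add[OF blocks_unit this]] show ?case
      using leavitt.Q_closed(4)[OF insert.prems insert.prems] by blast
  qed
  from this[OF fin leavitt.Q_closed(4)[OF K K, of c]]
  have "\<exists>J k. blocks J k (monomial (scale LP c K, m))"
  proof -
    have "r {(i, j). m i j \<noteq> 0} = m" by (auto simp: r_def fun_eq_iff)
    then show ?thesis using \<open>\<exists>J k. blocks J k (monomial (scale LP c K, r {(i, j). m i j \<noteq> 0}))\<close> by simp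
  qed
  then show ?thesis using blocks_cong[OF tcg_sym[OF tcg_scale_left[OF K m]]] by blast
qed

lemma ex_blocks:
  assumes "f \<in> elems TA"
  shows "\<exists>J k. blocks J k f"
proof -
  have "\<exists>J k. blocks J k (\<Sum>x\<in>X. Poly_Mapping.single x (Poly_Mapping.lookup f x))"
    if "finite X" "X \<subseteq> elems TS" for X
    using that
  proof (induction X rule: finite_induct)
    case empty
    then show ?case using blocks_zero by auto
  next
    case (insert x X)
    obtain K m where x: "x = (K, m)" "K \<in> elems LP" "m \<in> elems MI"
      using insert.prems by (cases x) (auto simp: TS_simps)
    obtain J k where 1: "blocks J k (\<Sum>x\<in>X. Poly_Mapping.single x (Poly_Mapping.lookup f x))"
      using insert by auto
    obtain J' k' where 2: "blocks J' k' (Poly_Mapping.single x (Poly_Mapping.lookup f x))"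
      using blocks_monomial[OF x(2,3)] x(1) by blast
    show ?case using blocks_add[OF 2 1] insert(1,2) by auto
  qed
  from this[of "Poly_Mapping.keys f"] assms show ?thesis
    using frag_expansion[of f] by (simp add: TA_simps frag_extend_def frag_cmul_single)
qed

lemma lin_blocks:
  assumes "blocks J k f"
  shows "lin trep f (i, a) (j, b) = leavitt.qrep (k (i, j)) a b"
proof -
  have J: "finite J" and k: "\<And>ij. ij \<notin> J \<Longrightarrow> k ij = nul LP"
    and f: "f \<cong>\<^sub>T (\<Sum>ij\<in>J. monomial (k ij, munit ij))"
    using assms by (auto simp: blocks_def)
  have "lin trep f - lin trep (\<Sum>ij\<in>J. monomial (k ij, munit ij)) = 0"
    using TI_kernel f unfolding tcg_def lin_diff[symmetric] by blast
  then have "lin trep f (i, a) (j, b)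
      = (\<Sum>ij\<in>J. lin trep (monomial (k ij, munit ij)) (i, a) (j, b))"
    using J by (simp add: lin_sum sum_fun_apply)
  also have "\<dots> = (\<Sum>ij\<in>J. if ij = (i, j) then leavitt.qrep (k ij) a b else 0)"
    by (intro sum.cong refl) (auto simp: trep_def kron_apply munit_def)
  also have "\<dots> = leavitt.qrep (k (i, j)) a b"
    using J k[of "(i, j)"] leavitt.qrep_hom(5)[OF nul_LP nul_LP] by simp
  finally show ?thesis .
qed

text \<open>The matrix of a tensor displays its blocks by \<open>lin_blocks\<close>, and the Leavitt
  factor is represented faithfully, so a tensor in the kernel has only zero blocks.\<close>

sublocale stab: semigroup_algebra_rep TS trep TI
proof
  fix f
  show "f \<in> TI \<longleftrightarrow> f \<in> elems TA \<and> lin trep f = 0"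
  proof
    assume f: "f \<in> elems TA \<and> lin trep f = 0"
    then obtain J k where b: "blocks J k f" using ex_blocks by blast
    have "leavitt.qrep (k ij) = leavitt.qrep (nul LP)" for ij
      using lin_blocks[OF b, of "fst ij" _ "snd ij"] f leavitt.qrep_hom(5)[OF nul_LP nul_LP]
      by (auto simp: fun_eq_iff)
    then have k: "k ij = nul LP" for ij
      using b nul_LP leavitt.qrep_inj unfolding blocks_def inj_on_def by blast
    have "f \<cong>\<^sub>T (\<Sum>ij\<in>J. monomial (k ij, munit ij))" using b by (simp add: blocks_def)
    also have "\<dots> \<cong>\<^sub>T (\<Sum>ij\<in>J. 0)" by (rule tcg_sum) (simp add: k tcg_zero_left munit_closed)
    finally show "f \<in> TI" by (simp add: tcg_def)
  qed (rule TI_kernel)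
qed

lemma blocks_exist_inverse:
  assumes "finite J" "\<And>ij. f ij \<in> elems WA" "\<And>ij. ij \<notin> J \<Longrightarrow> f ij = 0"
  shows "(\<lambda>(i, a) (j, b). lin (wrep E) (f (i, j)) a b) \<in> lin trep ` elems TA"
proof -
  let ?k = "\<lambda>ij. coset WA LI (f ij)"
  let ?f = "\<Sum>ij\<in>J. monomial (?k ij, munit ij)"
  have k: "?k ij \<in> elems LP" for ij using assms(2) by (auto simp: leavitt.elems_Q)
  have "?k ij = nul LP" if "ij \<notin> J" for ij
    by (simp add: assms(3)[OF that] leavitt.Q_simps(5)[OF words.zero_in_A words.zero_in_A])
  with k assms(1) have b: "blocks J ?k ?f" by (simp add: blocks_def)
  have "monomial (?k ij, munit ij) \<in> elems TA" for ij
    using k munit_closed by (auto simp: TA_simps TS_simps)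
  then have "?f \<in> elems TA"
    by (induction J rule: infinite_finite_induct) (auto intro: pairs.zero_in_A pairs.add_in_A)
  moreover have "(\<lambda>(i, a) (j, b). lin (wrep E) (f (i, j)) a b) = lin trep ?f"
    using lin_blocks[OF b] leavitt.qrep_coset[OF assms(2)] by (auto simp: fun_eq_iff)
  ultimately show ?thesis by blast
qed

end

text \<open>The image of the stabilized algebra, a Steinberg algebra in concrete form.\<close>

definition stein :: "('v, 'e) pre_digraph \<Rightarrow> 'e pt imat set" where
  "stein E = {T. \<exists>J f. finite J
    \<and> (\<forall>ij. f ij \<in> elems (semigroup_algebra (word_semigroup E)))
    \<and> (\<forall>ij. ij \<notin> J \<longrightarrow> f ij = 0) \<and> T = (\<lambda>(i, a) (j, b). lin (wrep E) (f (i, j)) a b)}"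

context regular_graph
begin

lemma stein_image: "stein E = lin trep ` elems TA"
proof (intro equalityI subsetI)
  fix T assume "T \<in> stein E"
  then show "T \<in> lin trep ` elems TA"
    unfolding stein_def using blocks_exist_inverse by blast
next
  fix T assume "T \<in> lin trep ` elems TA"
  then obtain F where F: "F \<in> elems TA" "T = lin trep F" by blast
  then obtain J k where b: "blocks J k F" using ex_blocks by blast
  have "\<exists>g. g \<in> elems WA \<and> k ij = coset WA LI g \<and> (ij \<notin> J \<longrightarrow> g = 0)" for ij
  proof (cases "ij \<in> J")
    case True
    have "k ij \<in> elems LP" using b unfolding blocks_def by blast
    then show ?thesis using True leavitt.Q_cases by metis
  next
    case False
    then have "k ij = coset WA LI 0"
      using b leavitt.Q_simps(5)[OF words.zero_in_A words.zero_in_A] unfolding blocks_def by metis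
    then show ?thesis using words.zero_in_A by blast
  qed
  then obtain f where f: "\<And>ij. f ij \<in> elems WA \<and> k ij = coset WA LI (f ij) \<and> (ij \<notin> J \<longrightarrow> f ij = 0)"
    by metis
  have "T = (\<lambda>(i, a) (j, b). lin (wrep E) (f (i, j)) a b)"
    using lin_blocks[OF b] leavitt.qrep_coset f by (auto simp: F(2) fun_eq_iff)
  with f b show "T \<in> stein E" unfolding stein_def blocks_def by blast
qed

lemma stein_closed:
  assumes "S \<in> stein E" "T \<in> stein E"
  shows "mm S T \<in> stein E" "S + T \<in> stein E" "S - T \<in> stein E" "tr S \<in> stein E" "0 \<in> stein E"
    "colfin S" "colfin (tr S)"
proof -
  obtain F G where F: "F \<in> elems TA" "S = lin trep F" and G: "G \<in> elems TA" "T = lin trep G"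
    using assms unfolding stein_image by blast
  show "mm S T \<in> stein E" "S + T \<in> stein E" "S - T \<in> stein E" "tr S \<in> stein E"
    unfolding stein_image F(2) G(2) pairs.lin_mul[OF F(1) G(1), symmetric]
      lin_add[symmetric] lin_diff[symmetric] pairs.lin_star[OF F(1), symmetric]
    using F(1) G(1) by (auto intro!: imageI pairs.mul_in_A pairs.add_in_A pairs.diff_in_A pairs.star_in_A)
  show "0 \<in> stein E" unfolding stein_image using pairs.zero_in_A lin_zero by (metis image_eqI)
  have "colfin (lin trep F)" if "F \<in> elems TA" for F
    using that by (intro colfin_lin pairs.colfin_rep) (auto simp: TA_simps)
  from this[OF F(1)] this[OF pairs.star_in_A[OF F(1)]] show "colfin S" "colfin (tr S)"
    by (simp_all add: F(2) pairs.lin_star[OF F(1)])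
qed

theorem stein_representation:
  shows "bij_betw stab.qrep (elems (leavitt_Z_stabilized E)) (stein E)"
    and "K \<in> elems (leavitt_Z_stabilized E) \<Longrightarrow> L \<in> elems (leavitt_Z_stabilized E) \<Longrightarrow>
      stab.qrep (add (leavitt_Z_stabilized E) K L) = stab.qrep K + stab.qrep L"
    and "K \<in> elems (leavitt_Z_stabilized E) \<Longrightarrow> L \<in> elems (leavitt_Z_stabilized E) \<Longrightarrow>
      stab.qrep (mul (leavitt_Z_stabilized E) K L) = mm (stab.qrep K) (stab.qrep L)"
    and "K \<in> elems (leavitt_Z_stabilized E) \<Longrightarrow>
      stab.qrep (star (leavitt_Z_stabilized E) K) = tr (stab.qrep K)"
  unfolding tensor_Q bij_betw_def stein_image
  using stab.qrep_inj stab.qrep_image stab.qrep_hom by auto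

end

definition stein_iso :: "('e pt imat \<Rightarrow> 'f pt imat) \<Rightarrow> ('v, 'e) pre_digraph \<Rightarrow> ('w, 'f) pre_digraph \<Rightarrow> bool" where
  "stein_iso \<psi> E F \<longleftrightarrow> bij_betw \<psi> (stein E) (stein F)
    \<and> (\<forall>S\<in>stein E. \<forall>T\<in>stein E. \<psi> (S + T) = \<psi> S + \<psi> T)
    \<and> (\<forall>S\<in>stein E. \<forall>T\<in>stein E. \<psi> (mm S T) = mm (\<psi> S) (\<psi> T))
    \<and> (\<forall>S\<in>stein E. \<psi> (tr S) = tr (\<psi> S))"

text \<open>Conjugation with the two faithful representations. From here on the isomorphism is one
  between algebras of integer matrices with the transpose.\<close>

lemma stein_iso_exists:
  assumes E: "regular_graph E" and F: "regular_graph F"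
    and iso: "star_ring_isomorphic (leavitt_Z_stabilized E) (leavitt_Z_stabilized F)"
  shows "\<exists>\<psi>. stein_iso \<psi> E F"
proof -
  interpret E: regular_graph E by (rule E)
  interpret F: regular_graph F by (rule F)
  let ?A = "leavitt_Z_stabilized E" and ?B = "leavitt_Z_stabilized F"
  obtain \<phi> where \<phi>: "bij_betw \<phi> (elems ?A) (elems ?B)"
    "\<And>x y. x \<in> elems ?A \<Longrightarrow> y \<in> elems ?A \<Longrightarrow> \<phi> (add ?A x y) = add ?B (\<phi> x) (\<phi> y)"
    "\<And>x y. x \<in> elems ?A \<Longrightarrow> y \<in> elems ?A \<Longrightarrow> \<phi> (mul ?A x y) = mul ?B (\<phi> x) (\<phi> y)"
    "\<And>x. x \<in> elems ?A \<Longrightarrow> \<phi> (star ?A x) = star ?B (\<phi> x)"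
    using iso unfolding star_ring_isomorphic_def by blast
  define g where "g = the_inv_into (elems ?A) E.stab.qrep"
  have g: "bij_betw g (stein E) (elems ?A)"
    unfolding g_def by (rule bij_betw_the_inv_into[OF E.stein_representation(1)])
  have g_in: "g S \<in> elems ?A" if "S \<in> stein E" for S using bij_betwE[OF g] that by blast
  have qg: "E.stab.qrep (g S) = S" if "S \<in> stein E" for S
    unfolding g_def using E.stein_representation(1) that by (auto simp: bij_betw_def f_the_inv_into_f)
  have gq: "g (E.stab.qrep K) = K" if "K \<in> elems ?A" for K
    unfolding g_def using E.stein_representation(1) that by (auto simp: bij_betw_def the_inv_into_f_f)
  have cl: "add ?A K L \<in> elems ?A" "mul ?A K L \<in> elems ?A" "star ?A K \<in> elems ?A"
    if "K \<in> elems ?A" "L \<in> elems ?A" for K L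
    using that E.stab.Q_closed unfolding E.tensor_Q by auto
  have 1: "g (S + T) = add ?A (g S) (g T)" "g (mm S T) = mul ?A (g S) (g T)" "g (tr S) = star ?A (g S)"
    if "S \<in> stein E" "T \<in> stein E" for S T
  proof -
    note c = cl[OF g_in g_in, OF that]
    note r = E.stein_representation(2,3)[OF g_in g_in, OF that] E.stein_representation(4)[OF g_in[OF that(1)]]
    show "g (S + T) = add ?A (g S) (g T)"
      using gq[OF c(1)] r(1) qg that by simp
    show "g (mm S T) = mul ?A (g S) (g T)"
      using gq[OF c(2)] r(2) qg that by simp
    show "g (tr S) = star ?A (g S)"
      using gq[OF c(3)] r(3) qg that by simp
  qed
  have fi: "\<phi> K \<in> elems ?B" if "K \<in> elems ?A" for K using bij_betwE[OF \<phi>(1)] that by blast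
  have "bij_betw (F.stab.qrep \<circ> (\<phi> \<circ> g)) (stein E) (stein F)"
    by (intro bij_betw_trans[OF bij_betw_trans[OF g \<phi>(1)] F.stein_representation(1)])
  then have "stein_iso (F.stab.qrep \<circ> (\<phi> \<circ> g)) E F"
    unfolding stein_iso_def
    by (simp add: 1 \<phi>(2-4) g_in F.stein_representation(2-4) fi)
  then show ?thesis by (intro exI[of _ "F.stab.qrep \<circ> (\<phi> \<circ> g)"])
qed

section \<open>Projections and partial isometries over the integers\<close>

definition dg :: "'i set \<Rightarrow> 'i imat" where
  "dg Y = (\<lambda>a b. if a = b \<and> a \<in> Y then 1 else 0)"

definition isproj :: "'i imat \<Rightarrow> bool" where
  "isproj p \<longleftrightarrow> tr p = p \<and> mm p p = p"

lemma mm_dg: "mm A (dg Y) = (\<lambda>a c. if c \<in> Y then A a c else 0)"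
proof (intro ext)
  fix a c
  have "{b. dg Y b c \<noteq> 0} = (if c \<in> Y then {c} else {})" by (auto simp: dg_def)
  then show "mm A (dg Y) a c = (if c \<in> Y then A a c else 0)" by (simp add: mm_def) (simp add: dg_def)
qed

lemma dg_mm:
  assumes "colfin A"
  shows "mm (dg Y) A = (\<lambda>a c. if a \<in> Y then A a c else 0)"
proof (intro ext)
  fix a c
  have fin: "finite {b. A b c \<noteq> 0}" using assms by (simp add: colfin_def)
  have "mm (dg Y) A a c = (\<Sum>b\<in>{b. A b c \<noteq> 0}. if a = b then (if a \<in> Y then A a c else 0) else 0)"
    unfolding mm_def by (intro sum.cong refl) (auto simp: dg_def)
  then show "mm (dg Y) A a c = (if a \<in> Y then A a c else 0)" using fin by simp
qed

lemma tr_dg [simp]: "tr (dg Y) = dg Y"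
  by (auto simp: tr_def dg_def fun_eq_iff)

lemma dg_dg: "mm (dg Y) (dg Z) = dg (Y \<inter> Z)"
  unfolding mm_dg by (auto simp: dg_def fun_eq_iff)

lemma isproj_dg [simp]: "isproj (dg Y)"
  by (simp add: isproj_def dg_dg)

lemma dg_inj: "dg Y = dg Z \<longleftrightarrow> Y = Z"
proof
  assume *: "dg Y = dg Z"
  have "a \<in> Y \<longleftrightarrow> a \<in> Z" for a using fun_cong[OF fun_cong[OF *, of a], of a] by (simp add: dg_def split: if_splits)
  then show "Y = Z" by blast
qed simp

lemma dg_empty [simp]: "dg {} = 0"
  by (simp add: dg_def fun_eq_iff)

lemma dg_eq_0 [simp]: "dg Y = 0 \<longleftrightarrow> Y = {}"
  using dg_inj[of Y "{}"] by simp

lemma int_square_le: "(x::int) \<le> x ^ 2"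
proof (cases "x \<le> 0")
  case True
  then show ?thesis using zero_le_power2[of x] by linarith
next
  case False
  then show ?thesis using mult_left_mono[of 1 x x] by (simp add: power2_eq_square)
qed

text \<open>Integers satisfy \<open>x \<le> x ^ 2\<close>, so the hypothesis leaves no room for
  another nonzero square, and \<open>f a ^ 2 = f a\<close> admits only 0 and 1.\<close>

lemma int_sum_squares_single:
  fixes f :: "'a \<Rightarrow> int"
  assumes fin: "finite X" and a: "a \<in> X" and le: "(\<Sum>b\<in>X. f b ^ 2) \<le> f a"
  shows "f a = 0 \<or> f a = 1" "b \<in> X \<Longrightarrow> b \<noteq> a \<Longrightarrow> f b = 0"
proof -
  have s: "(\<Sum>b\<in>X. f b ^ 2) = f a ^ 2 + (\<Sum>b\<in>X - {a}. f b ^ 2)"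
    using fin a by (rule sum.remove)
  have nn: "0 \<le> (\<Sum>b\<in>X - {a}. f b ^ 2)" by (simp add: sum_nonneg)
  have z: "(\<Sum>b\<in>X - {a}. f b ^ 2) = 0" and e: "f a ^ 2 = f a"
    using s nn le int_square_le[of "f a"] by linarith+
  show "f a = 0 \<or> f a = 1" using e by (simp add: power2_eq_square)
  show "b \<in> X \<Longrightarrow> b \<noteq> a \<Longrightarrow> f b = 0"
    using z fin sum_nonneg_eq_0_iff[of "X - {a}" "\<lambda>b. f b ^ 2"] by auto
qed

text \<open>The diagonal entry of a projection is the sum of the squares of its column; over the
  integers this forces the column to vanish off the diagonal.\<close>

lemma isproj_diag:
  assumes p: "isproj p" and fin: "colfin p"
  shows "\<exists>Y. p = dg Y"
proof -
  have sym: "p a b = p b a" for a b using p fun_cong[OF fun_cong[of "tr p" p a], of b]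
    by (simp add: isproj_def tr_def)
  have col: "p c c = (\<Sum>b | p b c \<noteq> 0. p b c ^ 2)" for c
  proof -
    have "p c c = mm p p c c" using p by (simp add: isproj_def)
    also have "\<dots> = (\<Sum>b | p b c \<noteq> 0. p b c ^ 2)"
      unfolding mm_def power2_eq_square by (intro sum.cong refl arg_cong2[where f = "(*)"] sym)
    finally show ?thesis .
  qed
  have fc: "finite {b. p b c \<noteq> 0}" for c using fin by (simp add: colfin_def)
  have 1: "p c c = 0 \<or> p c c = 1" "b \<noteq> c \<Longrightarrow> p b c = 0" for b c
  proof -
    let ?X = "insert c {b. p b c \<noteq> 0}"
    have "(\<Sum>b\<in>?X. p b c ^ 2) = (\<Sum>b | p b c \<noteq> 0. p b c ^ 2)"
      using fc by (intro sum.mono_neutral_right) auto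
    then have le: "(\<Sum>b\<in>?X. p b c ^ 2) \<le> p c c" using col[of c] by simp
    show "p c c = 0 \<or> p c c = 1"
      using int_sum_squares_single(1)[OF _ _ le] fc by simp
    show "p b c = 0" if "b \<noteq> c"
      using int_sum_squares_single(2)[OF _ _ le, of b] fc that by (cases "p b c = 0") auto
  qed
  have "p = dg {c. p c c = 1}"
  proof (intro ext)
    fix a b show "p a b = dg {c. p c c = 1} a b"
      using 1(1)[of a] 1(2)[of a b] by (cases "a = b") (auto simp: dg_def)
  qed
  then show ?thesis ..
qed

lemma int_sum_squares_eq_1:
  fixes f :: "'a \<Rightarrow> int"
  assumes fin: "finite X" and s: "(\<Sum>b\<in>X. f b ^ 2) = 1"
  obtains a where "a \<in> X" "f a = 1 \<or> f a = -1" "\<And>b. b \<in> X \<Longrightarrow> b \<noteq> a \<Longrightarrow> f b = 0"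
proof -
  obtain a where a: "a \<in> X" "f a \<noteq> 0"
    using s by (metis (no_types, lifting) power_zero_numeral sum.neutral zero_neq_one)
  have "(\<Sum>b\<in>X. f b ^ 2) = f a ^ 2 + (\<Sum>b\<in>X - {a}. f b ^ 2)"
    using fin a(1) by (rule sum.remove)
  moreover have "0 \<le> (\<Sum>b\<in>X - {a}. f b ^ 2)" by (simp add: sum_nonneg)
  moreover have "1 \<le> f a ^ 2" using a(2) by (simp add: int_one_le_iff_zero_less)
  ultimately have z: "(\<Sum>b\<in>X - {a}. f b ^ 2) = 0" and e: "f a ^ 2 = 1" using s by linarith+
  have "b \<in> X \<Longrightarrow> b \<noteq> a \<Longrightarrow> f b = 0" for b
    using z fin sum_nonneg_eq_0_iff[of "X - {a}" "\<lambda>b. f b ^ 2"] by auto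
  moreover have "f a = 1 \<or> f a = -1" using e by (simp add: power2_eq_1_iff)
  ultimately show ?thesis using a(1) that by blast
qed

text \<open>The columns of \<open>u\<close> over \<open>Y\<close> are orthonormal. An integer vector
  of length one has a single nonzero entry, which is 1 or -1, and two orthogonal vectors of this
  kind cannot use the same row.\<close>

lemma partial_isometry:
  assumes fin: "colfin u" and u: "mm (tr u) u = dg Y"
  shows "c \<notin> Y \<Longrightarrow> u a c = 0"
    and "c \<in> Y \<Longrightarrow> \<exists>a. (u a c = 1 \<or> u a c = -1) \<and> (\<forall>b. b \<noteq> a \<longrightarrow> u b c = 0)"
    and "u a c \<noteq> 0 \<Longrightarrow> u a c' \<noteq> 0 \<Longrightarrow> c = c'"
    and "mm u (tr u) = dg {a. \<exists>c. u a c \<noteq> 0}"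
proof -
  have fc: "finite {b. u b c \<noteq> 0}" for c using fin by (simp add: colfin_def)
  have col: "(\<Sum>b | u b c \<noteq> 0. u b c ^ 2) = (if c \<in> Y then 1 else 0)" for c
    using fun_cong[OF fun_cong[OF u, of c], of c] by (simp add: mm_def tr_def dg_def power2_eq_square)
  show 1: "u a c = 0" if "c \<notin> Y" for a c
  proof (rule ccontr)
    assume "u a c \<noteq> 0"
    then show False
      using col[of c] that sum_nonneg_eq_0_iff[OF fc[of c], of "\<lambda>b. u b c ^ 2"] by auto
  qed
  show 2: "\<exists>a. (u a c = 1 \<or> u a c = -1) \<and> (\<forall>b. b \<noteq> a \<longrightarrow> u b c = 0)" if "c \<in> Y" for c
  proof -
    have "(\<Sum>b | u b c \<noteq> 0. u b c ^ 2) = 1" using col[of c] that by simp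
    from int_sum_squares_eq_1[OF fc this] obtain a
      where "u a c = 1 \<or> u a c = -1" "\<And>b. b \<in> {b. u b c \<noteq> 0} \<Longrightarrow> b \<noteq> a \<Longrightarrow> u b c = 0" by blast
    then show ?thesis by blast
  qed
  have nzY: "c \<in> Y" if "u b c \<noteq> 0" for b c using 1 that by blast
  have 21: "b = b'" if nz: "u b c \<noteq> 0" "u b' c \<noteq> 0" for b b' c
    using 2[OF nzY[OF nz(1)]] nz by metis
  have 22: "u b c = 1 \<or> u b c = -1" if nz: "u b c \<noteq> 0" for b c
    using 2[OF nzY[OF nz]] nz by metis
  show 3: "c = c'" if nz: "u a c \<noteq> 0" "u a c' \<noteq> 0" for a c c'
  proof (rule ccontr)
    assume ne: "c \<noteq> c'"
    have Y: "c \<in> Y" "c' \<in> Y" using nz 1 by blast+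
    have "{b. u b c' \<noteq> 0} = {a}" using 21[of _ c' a] nz(2) by blast
    then have "mm (tr u) u c c' = u a c * u a c'" by (simp add: mm_def tr_def)
    then show False using u ne nz by (simp add: dg_def)
  qed
  show "mm u (tr u) = dg {a. \<exists>c. u a c \<noteq> 0}"
  proof (intro ext)
    fix a b
    show "mm u (tr u) a b = dg {a. \<exists>c. u a c \<noteq> 0} a b"
    proof (cases "\<exists>c. u b c \<noteq> 0")
      case True
      then obtain c where c: "u b c \<noteq> 0" by blast
      have "{c. tr u c b \<noteq> 0} = {c}" using 3 c by (auto simp: tr_def)
      then have *: "mm u (tr u) a b = u a c * u b c" by (simp add: mm_def tr_def)
      have "a \<noteq> b \<Longrightarrow> u a c = 0" using 21[of a c b] c by blast
      moreover have "u b c * u b c = 1" using 22[OF c] by auto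
      ultimately show ?thesis using * c by (cases "a = b") (auto simp: dg_def)
    next
      case False
      then have "mm u (tr u) a b = 0" by (simp add: mm_def tr_def)
      then show ?thesis using False by (auto simp: dg_def)
    qed
  qed
qed

section \<open>Cylinders\<close>

locale shift_graph = fin_digraph E for E :: "('v, 'e) pre_digraph" +
  assumes no_sinks: "\<forall>v\<in>verts E. out_arcs E v \<noteq> {}" and has_arcs: "arcs E \<noteq> {}"

sublocale shift_graph \<subseteq> regular_graph E
  by unfold_locales (use no_sinks in blast)

context shift_graph
begin

abbreviation "X \<equiv> ipaths E"

lemma src_in_verts: "z \<in> X \<Longrightarrow> src E z \<in> verts E"
  using has_arcs by (auto simp: ipaths_def src_def)

lemma conc_in_X: "p \<frown> z \<in> X \<longleftrightarrow> z \<in> X \<and> epath E p (src E z)"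
proof -
  have "p \<frown> z \<in> X \<longleftrightarrow> z \<in> X \<and> epath E p (src E z)"
    and "p \<frown> z \<in> X \<longrightarrow> src E (p \<frown> z) = pstart E p (src E z)"
    by (induction p) (auto simp: build_in_ipaths[OF has_arcs] src_build src_in_verts)
  then show ?thesis by blast
qed

lemma src_conc: "p \<frown> z \<in> X \<Longrightarrow> src E (p \<frown> z) = pstart E p (src E z)"
  by (cases p) (auto simp: build_in_ipaths[OF has_arcs] src_build)

text \<open>The degree is left free, because the elements of the algebra are invariant under a
  simultaneous shift of both degrees. If \<open>snd s\<close> is no path ending at \<open>v\<close>,
  the tuples formed here are not points of the path space; the lemmas on membership in the algebra
  therefore assume \<open>epath\<close>.\<close>

definition cyl :: "'v \<Rightarrow> nat \<times> 'e list \<Rightarrow> 'e pt set" where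
  "cyl v s = {(fst s, snd s \<frown> z, k) | z k. z \<in> X \<and> src E z = v}"

text \<open>The matrix of \<open>s\<^sub>p s\<^sub>q\<^sup>*\<close> in the block \<open>(i, j)\<close>, where \<open>s = (i, p)\<close> and \<open>t = (j, q)\<close>.\<close>

definition bb :: "'v \<Rightarrow> nat \<times> 'e list \<Rightarrow> nat \<times> 'e list \<Rightarrow> 'e pt imat" where
  "bb v s t = (\<lambda>a c. if \<exists>z k. z \<in> X \<and> src E z = v \<and> a = (fst s, snd s \<frown> z, k + int (length (snd s)))
     \<and> c = (fst t, snd t \<frown> z, k + int (length (snd t))) then 1 else 0)"

lemma tr_bb: "tr (bb v s t) = bb v t s"
  unfolding tr_def bb_def by (intro ext if_cong refl) blast

lemma bb_nz:
  "bb v s t a c \<noteq> 0 \<longleftrightarrow> (\<exists>z k. z \<in> X \<and> src E z = v \<and> a = (fst s, snd s \<frown> z, k + int (length (snd s)))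
     \<and> c = (fst t, snd t \<frown> z, k + int (length (snd t))))"
  by (simp add: bb_def)

lemma bb_01: "bb v s t a c = 0 \<or> bb v s t a c = 1"
  by (simp add: bb_def)

lemma bb_eqI:
  "(bb v s t a c \<noteq> 0 \<longleftrightarrow> bb v' s' t' a' c' \<noteq> 0) \<Longrightarrow> bb v s t a c = bb v' s' t' a' c'"
  using bb_01[of v s t a c] bb_01[of v' s' t' a' c'] by argo

lemma mm_bb:
  assumes "z \<in> X" "src E z = v"
  shows "mm A (bb v s t) a (fst t, snd t \<frown> z, k + int (length (snd t)))
    = A a (fst s, snd s \<frown> z, k + int (length (snd s)))"
proof -
  let ?c = "(fst t, snd t \<frown> z, k + int (length (snd t)))"
  let ?b = "(fst s, snd s \<frown> z, k + int (length (snd s)))"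
  have *: "{b. bb v s t b ?c \<noteq> 0} = {?b}"
    using assms by (auto simp: bb_nz)
  have "bb v s t ?b ?c = 1" using assms unfolding bb_def by auto
  then show ?thesis unfolding mm_def * by simp
qed

lemma mm_bb_0: "c \<notin> cyl v t \<Longrightarrow> mm A (bb v s t) a c = 0"
proof -
  assume c: "c \<notin> cyl v t"
  have "bb v s t b c = 0" for b
    using c unfolding bb_def cyl_def by auto
  then show ?thesis by (simp add: mm_def)
qed

lemma cyl_cases:
  assumes "c \<in> cyl v t"
  obtains z k where "z \<in> X" "src E z = v" "c = (fst t, snd t \<frown> z, k + int (length (snd t)))"
proof -
  obtain z k where "z \<in> X" "src E z = v" "c = (fst t, snd t \<frown> z, k)"
    using assms by (auto simp: cyl_def)
  then show ?thesis by (intro that[of z "k - int (length (snd t))"]) auto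
qed

lemma bb_bb: "mm (bb v s t) (bb v t u) = bb v s u"
proof (intro ext)
  fix a c
  show "mm (bb v s t) (bb v t u) a c = bb v s u a c"
  proof (cases "c \<in> cyl v u")
    case True
    then obtain z k where z: "z \<in> X" "src E z = v" "c = (fst u, snd u \<frown> z, k + int (length (snd u)))"
      by (rule cyl_cases)
    show ?thesis unfolding z(3) mm_bb[OF z(1,2)] unfolding bb_def by (rule if_cong) auto
  next
    case False
    then have "bb v s u a c = 0" unfolding bb_def cyl_def by auto
    then show ?thesis using mm_bb_0[OF False] by simp
  qed
qed

lemma bb_diag: "bb v t t = dg (cyl v t)"
proof (intro ext)
  fix a c
  show "bb v t t a c = dg (cyl v t) a c"
  proof (cases "c \<in> cyl v t")
    case True
    then obtain z k where "z \<in> X" "src E z = v" "c = (fst t, snd t \<frown> z, k + int (length (snd t)))"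
      by (rule cyl_cases)
    with True show ?thesis by (auto simp: bb_def dg_def)
  next
    case False
    then show ?thesis by (auto simp: bb_def dg_def cyl_def)
  qed
qed

lemma cyl_nonempty: "v \<in> verts E \<Longrightarrow> cyl v t \<noteq> {}"
proof -
  assume "v \<in> verts E"
  then obtain z where "z \<in> X" "src E z = v" using ex_ipath by blast
  then have "(fst t, snd t \<frown> z, 0) \<in> cyl v t" unfolding cyl_def by blast
  then show ?thesis by blast
qed

text \<open>\<open>s_p s_q*\<close> exchanges prefixes and leaves the tail alone, so on the paths
  that begin with \<open>q @ \<eta>\<close> it agrees with the exchange of \<open>q @ \<eta>\<close>
  for \<open>p @ \<eta>\<close>.\<close>

lemma bb_extend:
  assumes \<eta>: "epath E \<eta> w" "pstart E \<eta> w = v"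
  shows "mm (bb v (i, p) (j, q)) (dg (cyl w (j, q @ \<eta>))) = bb w (i, p @ \<eta>) (j, q @ \<eta>)"
proof (intro ext)
  fix a c
  show "mm (bb v (i, p) (j, q)) (dg (cyl w (j, q @ \<eta>))) a c = bb w (i, p @ \<eta>) (j, q @ \<eta>) a c"
  proof (cases "c \<in> cyl w (j, q @ \<eta>)")
    case True
    then obtain z k where z: "z \<in> X" "src E z = w" "c = (j, q \<frown> \<eta> \<frown> z, k + int (length (q @ \<eta>)))"
      by (rule cyl_cases) (simp add: conc_conc)
    have ez: "\<eta> \<frown> z \<in> X" "src E (\<eta> \<frown> z) = v"
      using \<eta> z by (auto simp: conc_in_X src_conc)
    have 1: "bb v (i, p) (j, q) a c \<noteq> 0 \<longleftrightarrow> a = (i, p \<frown> \<eta> \<frown> z, k + int (length (p @ \<eta>)))"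
    proof -
      have "bb v (i, p) (j, q) a c \<noteq> 0
          \<longleftrightarrow> (\<exists>z' k'. z' \<in> X \<and> src E z' = v \<and> a = (i, p \<frown> z', k' + int (length p))
            \<and> \<eta> \<frown> z = z' \<and> k + int (length (q @ \<eta>)) = k' + int (length q))"
        unfolding bb_nz z(3) by (auto simp: conc_conc[symmetric] simp del: conc_conc)
      also have "\<dots> \<longleftrightarrow> a = (i, p \<frown> \<eta> \<frown> z, k + int (length (p @ \<eta>)))"
        using ez by (auto simp: conc_conc[symmetric] simp del: conc_conc
            intro!: exI[of _ "k + int (length \<eta>)"])
      finally show ?thesis .
    qed
    have 2: "bb w (i, p @ \<eta>) (j, q @ \<eta>) a c \<noteq> 0 \<longleftrightarrow> a = (i, p \<frown> \<eta> \<frown> z, k + int (length (p @ \<eta>)))"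
      unfolding bb_nz z(3) using z(1,2) by (auto simp: conc_conc[symmetric] simp del: conc_conc)
    have "bb v (i, p) (j, q) a c = bb w (i, p @ \<eta>) (j, q @ \<eta>) a c"
      by (rule bb_eqI) (use 1 2 in blast)
    then show ?thesis using True by (simp add: mm_dg)
  next
    case False
    then have "bb w (i, p @ \<eta>) (j, q @ \<eta>) a c = 0" unfolding bb_def cyl_def by auto
    with False show ?thesis by (simp add: mm_dg)
  qed
qed

lemma cyl_disjoint:
  assumes "length q = length q'" "cyl v (j, q) \<inter> cyl v' (j', q') \<noteq> {}"
  shows "v = v' \<and> j = j' \<and> q = q'"
proof -
  obtain z z' where z: "src E z = v" "src E z' = v'" "j = j'" "q \<frown> z = q' \<frown> z'"
    using assms(2) unfolding cyl_def by auto
  have "q = q'" using z(4) assms(1) prefix_conc_length[of q z] prefix_conc_length[of q' z'] by simp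
  with z show ?thesis by auto
qed

lemma cyl_append_subset:
  assumes "epath E \<eta> w" "pstart E \<eta> w = v"
  shows "cyl w (j, q @ \<eta>) \<subseteq> cyl v (j, q)"
proof
  fix c assume "c \<in> cyl w (j, q @ \<eta>)"
  then obtain z k where z: "z \<in> X" "src E z = w" "c = (j, q \<frown> \<eta> \<frown> z, k)"
    by (auto simp: cyl_def conc_conc)
  then have "\<eta> \<frown> z \<in> X" "src E (\<eta> \<frown> z) = v" using assms by (auto simp: conc_in_X src_conc)
  then show "c \<in> cyl v (j, q)"
    unfolding cyl_def using z(3) by (auto simp: conc_conc[symmetric] simp del: conc_conc)
qed

text \<open>The points are sorted by the edge that follows \<open>q\<close>: the set-theoretic form
  of the last Leavitt relation.\<close>

lemma cyl_split:
  "cyl v (j, q) = (\<Union>e\<in>out_arcs E v. cyl (head E e) (j, q @ [e]))"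
proof
  show "(\<Union>e\<in>out_arcs E v. cyl (head E e) (j, q @ [e])) \<subseteq> cyl v (j, q)"
    by (intro UN_least cyl_append_subset) auto
  show "cyl v (j, q) \<subseteq> (\<Union>e\<in>out_arcs E v. cyl (head E e) (j, q @ [e]))"
  proof
    fix c assume "c \<in> cyl v (j, q)"
    then obtain z k where z: "z \<in> X" "src E z = v" "c = (j, q \<frown> z, k)" by (auto simp: cyl_def)
    have "z = [z 0] \<frown> suffix 1 z" by simp
    then have 1: "q \<frown> z = (q @ [z 0]) \<frown> suffix 1 z" by (metis conc_conc)
    have "z 0 \<in> out_arcs E v" using z(1,2) has_arcs by (auto simp: ipaths_def src_def)
    moreover have "suffix 1 z \<in> X" by (rule suffix_in_ipaths[OF z(1)])
    moreover have "src E (suffix 1 z) = head E (z 0)"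
      using z(1) has_arcs by (auto simp: ipaths_def src_def)
    ultimately show "c \<in> (\<Union>e\<in>out_arcs E v. cyl (head E e) (j, q @ [e]))"
      unfolding cyl_def z(3) 1 by (auto simp del: build_append)
  qed
qed

end

section \<open>Local constancy\<close>

definition wdeg :: "('v, 'e) leavitt_gen list \<Rightarrow> int" where
  "wdeg w = (\<Sum>g\<leftarrow>w. case g of Vertex v \<Rightarrow> 0 | Edge e \<Rightarrow> 1 | Ghost e \<Rightarrow> -1)"

lemma wact_wdeg: "wact E w b = Some a \<Longrightarrow> snd a - snd b = wdeg w"
proof (induction w arbitrary: a)
  case Nil
  then show ?case by (simp add: wdeg_def)
next
  case (Cons g w)
  then obtain c where c: "wact E w b = Some c" "act E g c = Some a"
    by (auto simp: map_comp_Some_iff)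
  have "snd a - snd c = (case g of Vertex v \<Rightarrow> 0 | Edge e \<Rightarrow> 1 | Ghost e \<Rightarrow> -1)"
    using c(2) by (cases g; cases c; cases a) (auto split: if_splits)
  then show ?case using Cons.IH[OF c(1)] by (simp add: wdeg_def)
qed

definition degree_part :: "int \<Rightarrow> 'e pt imat \<Rightarrow> 'e pt imat" where
  "degree_part d T = (\<lambda>a c. if snd (snd a) - snd (snd c) = d then T a c else 0)"

context shift_graph
begin

lemma bb_stein:
  assumes "epath E p v" "epath E q v"
  shows "bb v (i, p) (j, q) \<in> stein E"
proof -
  let ?f = "\<lambda>ij. if ij = (i, j) then monomial (nf p v q) else (0 :: _ \<Rightarrow>\<^sub>0 int)"
  have W: "nf p v q \<noteq> []" by (simp add: nf_def)
  have "?f ij \<in> elems WA" for ij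
    using W set_nf[OF assms] by (auto simp: WA_elems)
  moreover have "bb v (i, p) (j, q) = (\<lambda>(i, a) (j, b). lin (wrep E) (?f (i, j)) a b)"
  proof (intro ext)
    fix a c :: "'e pt"
    obtain i' x k j' y l where ac: "a = (i', x, k)" "c = (j', y, l)" by (cases a, cases c)
    have "(\<exists>z k'. z \<in> X \<and> src E z = v \<and> a = (i, p \<frown> z, k' + int (length p)) \<and> c = (j, q \<frown> z, k' + int (length q)))
      \<longleftrightarrow> i' = i \<and> j' = j \<and> wact E (nf p v q) (y, l) = Some (x, k)"
      unfolding wact_nf[OF assms] ac by (auto intro!: exI[of _ "l - int (length q)"])
    then show "bb v (i, p) (j, q) a c
        = (\<lambda>(i, a) (j, b). lin (wrep E) (?f (i, j)) a b) a c"
      unfolding ac by (auto simp: bb_def wrep_def pmat_def)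
  qed
  ultimately show ?thesis
    unfolding stein_def by (intro CollectI exI[of _ "{(i, j)}"] exI[of _ ?f]) auto
qed

lemma cyl_stein: "epath E q v \<Longrightarrow> dg (cyl v (j, q)) \<in> stein E"
  using bb_stein[of q v q j j] by (simp add: bb_diag)

text \<open>Every word shifts the degree by the fixed amount \<open>wdeg w\<close>, so discarding
  the words of other degrees cuts out the homogeneous component.\<close>

lemma degree_part_stein:
  assumes "T \<in> stein E"
  shows "degree_part d T \<in> stein E"
proof -
  obtain J f where J: "finite J" "\<And>ij. f ij \<in> elems WA" "\<And>ij. ij \<notin> J \<Longrightarrow> f ij = 0"
    and T: "T = (\<lambda>(i, a) (j, b). lin (wrep E) (f (i, j)) a b)"
    using assms unfolding stein_def by blast
  let ?g = "\<lambda>ij. frag_extend (\<lambda>w. if wdeg w = d then monomial w else 0) (f ij)"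
  have "?g ij \<in> elems WA" for ij
  proof -
    have "Poly_Mapping.keys (?g ij) \<subseteq> (\<Union>w\<in>Poly_Mapping.keys (f ij).
        Poly_Mapping.keys (if wdeg w = d then monomial w else (0 :: _ \<Rightarrow>\<^sub>0 int)))"
      by (rule keys_frag_extend)
    also have "\<dots> \<subseteq> Poly_Mapping.keys (f ij)" by (auto split: if_splits)
    finally show ?thesis using J(2)[of ij] by (auto simp: WA_elems)
  qed
  moreover have "?g ij = 0" if "ij \<notin> J" for ij using J(3)[OF that] by simp
  moreover have "degree_part d T = (\<lambda>(i, a) (j, b). lin (wrep E) (?g (i, j)) a b)"
  proof (intro ext)
    fix a c :: "'e pt"
    obtain i a' j c' where ac: "a = (i, a')" "c = (j, c')" by (cases a, cases c)
    have w: "lin (wrep E) (if wdeg w = d then monomial w else 0) a' c'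
        = (if snd a' - snd c' = d then wrep E w a' c' else 0)" for w
      using wact_wdeg[of E w c' a'] by (auto simp: wrep_def pmat_def)
    have "lin (wrep E) (?g (i, j)) a' c' = (\<Sum>w\<in>Poly_Mapping.keys (f (i, j)).
        Poly_Mapping.lookup (f (i, j)) w * (if snd a' - snd c' = d then wrep E w a' c' else 0))"
      unfolding lin_frag_extend w ..
    then show "degree_part d T a c = (\<lambda>(i, a) (j, b). lin (wrep E) (?g (i, j)) a b) a c"
      by (simp add: degree_part_def T ac lin_def)
  qed
  ultimately show ?thesis using J(1) unfolding stein_def by (intro CollectI exI[of _ J] exI[of _ ?g]) auto
qed

text \<open>Local constancy: a nonzero entry lies in the support of some \<open>s_p s_q*\<close>
  with \<open>q\<close> of length \<open>M\<close>, and \<open>T\<close> is constant along that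
  support. The finite set \<open>J\<close> bounds the blocks that occur.\<close>

definition LC :: "nat \<Rightarrow> nat \<Rightarrow> 'e pt imat \<Rightarrow> bool" where
  "LC M L T \<longleftrightarrow> (\<exists>J. finite J \<and> (\<forall>a c. T a c \<noteq> 0 \<longrightarrow> fst a \<in> J \<and> fst c \<in> J \<and>
    (\<exists>p v q z k. epath E p v \<and> epath E q v \<and> length q = M \<and> L \<le> length p \<and> z \<in> X \<and> src E z = v \<and>
      a = (fst a, p \<frown> z, k + int (length p)) \<and> c = (fst c, q \<frown> z, k + int (length q)) \<and>
      (\<forall>z' k'. z' \<in> X \<longrightarrow> src E z' = v \<longrightarrow>
        T (fst a, p \<frown> z', k' + int (length p)) (fst c, q \<frown> z', k' + int (length q)) = T a c))))"

lemma stein_LC: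
  assumes "T \<in> stein E"
  shows "\<exists>M0. \<forall>M\<ge>M0. LC M L T"
proof -
  obtain J f where J: "finite J" "\<And>ij. f ij \<in> elems WA" "\<And>ij. ij \<notin> J \<Longrightarrow> f ij = 0"
    and T: "T = (\<lambda>(i, a) (j, b). lin (wrep E) (f (i, j)) a b)"
    using assms unfolding stein_def by blast
  obtain m where m: "\<And>ij. level (m ij) 0 (f ij)" using ex_level[OF J(2)] by metis
  \<comment> \<open>The summand \<open>L\<close> makes sure that every block is raised by at least
    \<open>L\<close> levels, so that \<open>p\<close> too has length at least
    \<open>L\<close>.\<close>
  define M0 where "M0 = Max (insert 0 (m ` J)) + L"
  have lev: "level M L (f ij)" if "M0 \<le> M" "ij \<in> J" for M ij
  proof -
    have "m ij \<le> Max (insert 0 (m ` J))" using that J(1) by (intro Max_ge) auto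
    then have "level M (0 + (M - m ij)) (f ij)" "L \<le> M - m ij"
      using level_raise[OF no_sinks m, of ij "M - m ij"] that(1) by (auto simp: M0_def)
    then show ?thesis using level_mono by fastforce
  qed
  have "LC M L T" if M: "M0 \<le> M" for M
    unfolding LC_def
  proof (intro exI[of _ "fst ` J \<union> snd ` J"] conjI allI impI)
    show "finite (fst ` J \<union> snd ` J)" using J(1) by simp
    fix a c assume nz: "T a c \<noteq> 0"
    obtain i a' j c' where ac: "a = (i, a')" "c = (j, c')" by (cases a, cases c)
    have ij: "(i, j) \<in> J"
    proof (rule ccontr)
      assume "(i, j) \<notin> J"
      then show False using nz J(3)[of "(i, j)"] by (simp add: T ac)
    qed
    then show "fst a \<in> fst ` J \<union> snd ` J" "fst c \<in> fst ` J \<union> snd ` J"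
      unfolding ac by force+
    obtain g where g: "f (i, j) \<approx> g" "Poly_Mapping.keys g \<subseteq> nfs M L"
      using lev[OF M ij] unfolding level_def by blast
    have lin: "lin (wrep E) (f (i, j)) = lin (wrep E) g" by (rule lin_cg[OF g(1)])
    have "lin (wrep E) g a' c' \<noteq> 0" using nz by (simp add: T ac lin)
    then obtain w where w: "w \<in> Poly_Mapping.keys g" "wrep E w a' c' \<noteq> 0"
      unfolding lin_def by (metis (no_types, lifting) mult_eq_0_iff sum.neutral)
    then obtain p v q where pq: "w = nf p v q" "epath E p v" "epath E q v" "length q = M" "L \<le> length p"
      using g(2) unfolding nfs_def by blast
    have "wact E (nf p v q) c' = Some a'" using w(2) pq(1) by (simp add: wrep_def pmat_def split: if_splits)
    then obtain z where z: "z \<in> X" "src E z = v" "fst c' = q \<frown> z" "fst a' = p \<frown> z"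
      "snd a' - snd c' = int (length p) - int (length q)"
      unfolding wact_nf[OF pq(2,3)] by blast
    let ?k = "snd c' - int (length q)"
    have a: "a = (fst a, p \<frown> z, ?k + int (length p))" and c: "c = (fst c, q \<frown> z, ?k + int (length q))"
      using z unfolding ac by (cases a', cases c', simp)+
    have v: "T (i, p \<frown> z', k' + int (length p)) (j, q \<frown> z', k' + int (length q))
        = Poly_Mapping.lookup g (nf p v q)" if "z' \<in> X" "src E z' = v" for z' k'
      unfolding T using lin_nfs_coeff[OF g(2) pq(2-4) that, of k'] pq(4) by (simp add: lin)
    have Tac: "T a c = Poly_Mapping.lookup g (nf p v q)"
      using v[OF z(1,2), of ?k] a c unfolding ac by simp
    show "\<exists>p v q z k. epath E p v \<and> epath E q v \<and> length q = M \<and> L \<le> length p \<and> z \<in> X \<and> src E z = v \<and>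
      a = (fst a, p \<frown> z, k + int (length p)) \<and> c = (fst c, q \<frown> z, k + int (length q)) \<and>
      (\<forall>z' k'. z' \<in> X \<longrightarrow> src E z' = v \<longrightarrow>
        T (fst a, p \<frown> z', k' + int (length p)) (fst c, q \<frown> z', k' + int (length q)) = T a c)"
      by (rule exI[of _ p], rule exI[of _ v], rule exI[of _ q], rule exI[of _ z], rule exI[of _ ?k])
         (use pq z a c v Tac in \<open>simp add: ac\<close>)
  qed
  then show ?thesis by blast
qed

section \<open>Finite unions of cylinders\<close>

definition labels :: "nat \<Rightarrow> ('v \<times> nat \<times> 'e list) set" where
  "labels M = {(v, j, q). epath E q v \<and> length q = M}"

definition lcyl :: "'v \<times> nat \<times> 'e list \<Rightarrow> 'e pt set" where
  "lcyl t = cyl (fst t) (snd t)"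

definition sublabels :: "nat \<Rightarrow> 'e pt set \<Rightarrow> ('v \<times> nat \<times> 'e list) set" where
  "sublabels M Y = {t \<in> labels M. lcyl t \<subseteq> Y}"

text \<open>The compact open sets that are visible at a resolution of \<open>M\<close> edges.
  Cylinders of one level are pairwise disjoint, so the union is a partition.\<close>

definition cylindrical :: "nat \<Rightarrow> 'e pt set \<Rightarrow> bool" where
  "cylindrical M Y \<longleftrightarrow> finite (sublabels M Y) \<and> Y = (\<Union>t\<in>sublabels M Y. lcyl t)"

text \<open>At a diagonal entry both points agree, so the degree forces \<open>p\<close> and
  \<open>q\<close> to have equal length and hence to be equal. Local constancy then puts the whole
  cylinder of \<open>q\<close> into \<open>Y\<close>. Only finitely many blocks and finitely many
  paths of length \<open>M\<close> occur.\<close>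

lemma stein_cylindrical:
  assumes "dg Y \<in> stein E"
  shows "\<exists>M0. \<forall>M\<ge>M0. cylindrical M Y"
proof -
  obtain M0 where M0: "\<And>M. M \<ge> M0 \<Longrightarrow> LC M 0 (dg Y)" using stein_LC[OF assms] by blast
  have "cylindrical M Y" if M: "M \<ge> M0" for M
  proof -
    obtain J where J: "finite J" "\<And>a c. dg Y a c \<noteq> 0 \<Longrightarrow> fst a \<in> J \<and> fst c \<in> J \<and>
    (\<exists>p v q z k. epath E p v \<and> epath E q v \<and> length q = M \<and> 0 \<le> length p \<and> z \<in> X \<and> src E z = v \<and>
      a = (fst a, p \<frown> z, k + int (length p)) \<and> c = (fst c, q \<frown> z, k + int (length q)) \<and>
      (\<forall>z' k'. z' \<in> X \<longrightarrow> src E z' = v \<longrightarrow>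
        dg Y (fst a, p \<frown> z', k' + int (length p)) (fst c, q \<frown> z', k' + int (length q)) = dg Y a c))"
      using M0[OF M] unfolding LC_def by blast
    have in_Y: "c \<in> Y \<longleftrightarrow> dg Y c c \<noteq> 0" for c by (simp add: dg_def)
    have ex: "\<exists>t\<in>sublabels M Y. c \<in> lcyl t" if "c \<in> Y" for c
    proof -
      obtain p v q z k where *: "epath E p v" "epath E q v" "length q = M" "z \<in> X" "src E z = v"
        "c = (fst c, p \<frown> z, k + int (length p))" "c = (fst c, q \<frown> z, k + int (length q))"
        "\<And>z' k'. z' \<in> X \<Longrightarrow> src E z' = v \<Longrightarrow>
        dg Y (fst c, p \<frown> z', k' + int (length p)) (fst c, q \<frown> z', k' + int (length q)) = dg Y c c"
        using J(2)[of c c] \<open>c \<in> Y\<close> unfolding in_Y by blast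
      have len: "length p = length q" "p \<frown> z = q \<frown> z" using *(6,7) by (metis prod.inject add_left_cancel of_nat_eq_iff)+
      then have pq: "p = q" by (metis prefix_conc_length)
      have "cyl v (fst c, q) \<subseteq> Y"
      proof
        fix b assume "b \<in> cyl v (fst c, q)"
        then obtain z' k' where "z' \<in> X" "src E z' = v" "b = (fst c, q \<frown> z', k' + int (length q))"
          by (rule cyl_cases) auto
        then show "b \<in> Y" using *(8)[of z' k'] \<open>c \<in> Y\<close> pq unfolding in_Y by simp
      qed
      then have "(v, fst c, q) \<in> sublabels M Y" using *(2,3) by (simp add: sublabels_def labels_def lcyl_def)
      moreover have "c \<in> lcyl (v, fst c, q)"
        unfolding lcyl_def cyl_def using *(4,5,7) by auto
      ultimately show ?thesis by blast
    qed
    have "sublabels M Y \<subseteq> verts E \<times> J \<times> {q. set q \<subseteq> arcs E \<and> length q = M}"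
    proof
      fix t assume t: "t \<in> sublabels M Y"
      obtain v j q where vjq: "t = (v, j, q)" by (cases t)
      have q: "epath E q v" "length q = M" "cyl v (j, q) \<subseteq> Y"
        using t by (auto simp: vjq sublabels_def labels_def lcyl_def)
      obtain c where c: "c \<in> cyl v (j, q)" using cyl_nonempty[OF epath_verts[OF q(1)]] by blast
      then have "fst c = j" by (auto simp: cyl_def)
      moreover have "fst c \<in> J" using J(2)[of c c] c q(3) unfolding in_Y[symmetric] by blast
      ultimately show "t \<in> verts E \<times> J \<times> {q. set q \<subseteq> arcs E \<and> length q = M}"
        using q epath_verts epath_arcs by (simp add: vjq)
    qed
    then have "finite (sublabels M Y)"
      by (rule finite_subset) (use J(1) finite_lists_length_eq[OF finite_arcs, of M] in auto)
    moreover have "Y = (\<Union>t\<in>sublabels M Y. lcyl t)"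
      using ex by (auto simp: sublabels_def)
    ultimately show ?thesis unfolding cylindrical_def by blast
  qed
  then show ?thesis by blast
qed

text \<open>On a cylinder of fine level, local constancy gives an entry 1 or -1 that is constant
  along some \<open>s_p s_q*\<close>. A column of a partial isometry has no room for a second
  nonzero entry, so this is all of \<open>u\<close> on that cylinder.\<close>

lemma partial_isometry_local:
  assumes u: "u \<in> stein E" "mm (tr u) u = dg Y"
  shows "\<exists>M0. \<forall>M\<ge>M0. \<forall>v j q. (v, j, q) \<in> sublabels M Y \<longrightarrow>
    (\<exists>i p. epath E p v \<and> L \<le> length p \<and>
      (mm u (dg (cyl v (j, q))) = bb v (i, p) (j, q) \<or> mm u (dg (cyl v (j, q))) = - bb v (i, p) (j, q)))"
proof -
  obtain M0 where M0: "\<And>M. M \<ge> M0 \<Longrightarrow> LC M L u" using stein_LC[OF u(1)] by blast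
  note pi = partial_isometry[OF stein_closed(6)[OF u(1) u(1)] u(2)]
  have "\<exists>i p. epath E p v \<and> L \<le> length p \<and>
      (mm u (dg (cyl v (j, q))) = bb v (i, p) (j, q) \<or> mm u (dg (cyl v (j, q))) = - bb v (i, p) (j, q))"
    if M: "M \<ge> M0" and t: "(v, j, q) \<in> sublabels M Y" for M v j q
  proof -
    have q: "epath E q v" "length q = M" "cyl v (j, q) \<subseteq> Y"
      using t by (auto simp: sublabels_def labels_def lcyl_def)
    obtain c where c: "c \<in> cyl v (j, q)" using cyl_nonempty[OF epath_verts[OF q(1)]] by blast
    then have cj: "fst c = j" by (auto simp: cyl_def)
    obtain a where a: "u a c = 1 \<or> u a c = -1" using pi(2)[of c] c q(3) by blast
    then have nz: "u a c \<noteq> 0" by auto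
    obtain p v' q' z k where *: "epath E p v'" "epath E q' v'" "length q' = M" "L \<le> length p"
      "z \<in> X" "src E z = v'"
      "a = (fst a, p \<frown> z, k + int (length p))" "c = (fst c, q' \<frown> z, k + int (length q'))"
      "\<And>z' k'. z' \<in> X \<Longrightarrow> src E z' = v' \<Longrightarrow>
        u (fst a, p \<frown> z', k' + int (length p)) (fst c, q' \<frown> z', k' + int (length q')) = u a c"
      using M0[OF M] nz unfolding LC_def by blast
    have "c \<in> cyl v' (j, q')" unfolding cyl_def using *(5,6,8) cj by auto
    with c have "cyl v (j, q) \<inter> cyl v' (j, q') \<noteq> {}" by blast
    with cyl_disjoint[of q q' v j v' j] q(2) *(3) have vq: "v' = v" "q' = q" by auto
    let ?s = "(fst a, p)"
    have ent: "mm u (dg (cyl v (j, q))) b d = u a c * bb v ?s (j, q) b d" for b d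
    proof (cases "d \<in> cyl v (j, q)")
      case False
      then have "bb v ?s (j, q) b d = 0" unfolding bb_def cyl_def by auto
      then show ?thesis using False by (simp add: mm_dg)
    next
      case True
      then obtain z' k' where z': "z' \<in> X" "src E z' = v" "d = (j, q \<frown> z', k' + int (length q))"
        by (rule cyl_cases) auto
      let ?b = "(fst a, p \<frown> z', k' + int (length p))"
      have ub: "u ?b d = u a c" using *(9)[of z' k'] z' vq cj by simp
      have b0: "u b d = 0" if "b \<noteq> ?b"
        using pi(2)[of d] True q(3) ub nz that by (metis subsetD)
      have "bb v ?s (j, q) b d = (if b = ?b then 1 else 0)"
        unfolding bb_def z'(3) using z'(1,2) by auto
      then show ?thesis using True ub b0 by (auto simp: mm_dg)
    qed
    have "mm u (dg (cyl v (j, q))) = bb v ?s (j, q) \<or> mm u (dg (cyl v (j, q))) = - bb v ?s (j, q)"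
      using a ent by (auto simp: fun_eq_iff)
    then show ?thesis using *(1,4) vq by blast
  qed
  then show ?thesis by blast
qed

end

context regular_graph
begin

lemma stein_zero: "0 \<in> stein E"
  unfolding stein_image using pairs.zero_in_A lin_zero by (metis image_eqI)

lemma stein_mm: "S \<in> stein E \<Longrightarrow> T \<in> stein E \<Longrightarrow> mm S T \<in> stein E"
  and stein_add: "S \<in> stein E \<Longrightarrow> T \<in> stein E \<Longrightarrow> S + T \<in> stein E"
  and stein_diff: "S \<in> stein E \<Longrightarrow> T \<in> stein E \<Longrightarrow> S - T \<in> stein E"
  and stein_tr: "S \<in> stein E \<Longrightarrow> tr S \<in> stein E"
  and stein_colfin: "S \<in> stein E \<Longrightarrow> colfin S"
  using stein_closed(1-4,6) by simp_all

end

lemma stein_iso_inverse: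
  assumes E: "regular_graph E" and iso: "stein_iso \<psi> E F"
  shows "stein_iso (the_inv_into (stein E) \<psi>) F E"
proof -
  interpret E: regular_graph E by (rule E)
  let ?\<phi> = "the_inv_into (stein E) \<psi>"
  have b: "bij_betw \<psi> (stein E) (stein F)" using iso by (simp add: stein_iso_def)
  have l: "?\<phi> (\<psi> S) = S" if "S \<in> stein E" for S
    using b that by (simp add: bij_betw_def the_inv_into_f_f)
  have *: "?\<phi> (S + T) = ?\<phi> S + ?\<phi> T" "?\<phi> (mm S T) = mm (?\<phi> S) (?\<phi> T)" "?\<phi> (tr S) = tr (?\<phi> S)"
    if ST: "S \<in> stein F" "T \<in> stein F" for S T
  proof -
    obtain S' T' where S': "S' \<in> stein E" "\<psi> S' = S" "T' \<in> stein E" "\<psi> T' = T"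
    proof -
      have "S \<in> \<psi> ` stein E" "T \<in> \<psi> ` stein E" using ST b by (simp_all add: bij_betw_def)
      then show ?thesis using that by blast
    qed
    have "\<psi> (S' + T') = S + T" "\<psi> (mm S' T') = mm S T" "\<psi> (tr S') = tr S"
      using S' iso by (auto simp: stein_iso_def)
    with S' show "?\<phi> (S + T) = ?\<phi> S + ?\<phi> T" "?\<phi> (mm S T) = mm (?\<phi> S) (?\<phi> T)" "?\<phi> (tr S) = tr (?\<phi> S)"
      using l E.stein_add E.stein_mm E.stein_tr by metis+
  qed
  show ?thesis unfolding stein_iso_def
    using bij_betw_the_inv_into[OF b] * by blast
qed

section \<open>Gradings\<close>

text \<open>The properties of the path-length grading that survive transport along a star-isomorphism.\<close>

locale graded = shift_graph E for E :: "('v, 'e) pre_digraph" +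
  fixes hmg :: "int \<Rightarrow> 'e pt imat \<Rightarrow> bool"
  assumes hom_mm: "S \<in> stein E \<Longrightarrow> T \<in> stein E \<Longrightarrow> hmg d S \<Longrightarrow> hmg d' T \<Longrightarrow> hmg (d + d') (mm S T)"
    and hom_tr: "S \<in> stein E \<Longrightarrow> hmg d S \<Longrightarrow> hmg (- d) (tr S)"
    and hom_uminus: "S \<in> stein E \<Longrightarrow> hmg d S \<Longrightarrow> hmg d (- S)"
    and hom_proj: "S \<in> stein E \<Longrightarrow> isproj S \<Longrightarrow> hmg 0 S"
    and hom_unique: "S \<in> stein E \<Longrightarrow> hmg d S \<Longrightarrow> hmg d' S \<Longrightarrow> S \<noteq> 0 \<Longrightarrow> d = d'"
    and hom_decomp: "u \<in> stein E \<Longrightarrow> isproj (mm (tr u) u) \<Longrightarrow>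
      \<exists>D q. finite D \<and> (\<forall>d\<in>D. q d \<in> stein E \<and> isproj (q d) \<and> hmg d (mm u (q d)))
        \<and> (\<Sum>d\<in>D. q d) = mm (tr u) u"
    and hom_contract: "u \<in> stein E \<Longrightarrow> isproj (mm (tr u) u) \<Longrightarrow> hmg d u \<Longrightarrow>
      mm (mm u (tr u)) (mm (tr u) u) = mm u (tr u) \<Longrightarrow> mm u (tr u) \<noteq> mm (tr u) u \<Longrightarrow> 0 < d"

definition deg_hom :: "int \<Rightarrow> 'e pt imat \<Rightarrow> bool" where
  "deg_hom d T \<longleftrightarrow> (\<forall>a c. T a c \<noteq> 0 \<longrightarrow> snd (snd a) - snd (snd c) = d)"

context shift_graph
begin

lemma ex_extension:
  assumes "v \<in> verts E"
  obtains \<eta> w where "epath E \<eta> w" "pstart E \<eta> w = v" "length \<eta> = n"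
proof -
  obtain z where z: "z \<in> X" "src E z = v" using ex_ipath[OF assms] .
  let ?\<eta> = "prefix n z" and ?z = "suffix n z"
  have eq: "?\<eta> \<frown> ?z = z" by (rule prefix_suffix[symmetric])
  have "epath E ?\<eta> (src E ?z)" using conc_in_X[of ?\<eta> ?z] z(1) unfolding eq by simp
  moreover have "pstart E ?\<eta> (src E ?z) = v" using src_conc[of ?\<eta> ?z] z unfolding eq by simp
  ultimately show ?thesis by (rule that) simp
qed

lemma isproj_stein: "S \<in> stein E \<Longrightarrow> isproj S \<Longrightarrow> \<exists>Y. S = dg Y"
  using isproj_diag stein_colfin by blast

lemma stein_uminus: "S \<in> stein E \<Longrightarrow> - S \<in> stein E"
  using stein_diff[OF stein_zero, of S] by simp

lemma stein_sum: "(\<And>d. d \<in> D \<Longrightarrow> f d \<in> stein E) \<Longrightarrow> sum f D \<in> stein E"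
  by (induction D rule: infinite_finite_induct) (auto intro: stein_add stein_zero)

text \<open>A partial isometry changes the degree by a constant on each of finitely many cylinders,
  and its source is split according to this change. The piece for \<open>d\<close> belongs to the
  algebra because it is the source projection of the homogeneous component
  \<open>degree_part d u\<close>.\<close>

lemma deg_decomp:
  assumes u: "u \<in> stein E" "isproj (mm (tr u) u)"
  shows "\<exists>D q. finite D \<and> (\<forall>d\<in>D. q d \<in> stein E \<and> isproj (q d) \<and> deg_hom d (mm u (q d)))
        \<and> (\<Sum>d\<in>D. q d) = mm (tr u) u"
proof -
  have tu: "tr u \<in> stein E" "mm (tr u) u \<in> stein E" by (simp_all add: u(1) stein_tr stein_mm)
  obtain Y where Y: "mm (tr u) u = dg Y" using isproj_stein[OF tu(2) u(2)] by blast
  note pi = partial_isometry[OF stein_colfin[OF u(1)] Y]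
  obtain M1 where M1: "\<And>M. M \<ge> M1 \<Longrightarrow> cylindrical M Y" using stein_cylindrical tu(2) Y by metis
  obtain M2 where M2: "\<forall>M\<ge>M2. \<forall>v j q. (v, j, q) \<in> sublabels M Y \<longrightarrow>
    (\<exists>i p. epath E p v \<and> 0 \<le> length p \<and>
      (mm u (dg (cyl v (j, q))) = bb v (i, p) (j, q) \<or> mm u (dg (cyl v (j, q))) = - bb v (i, p) (j, q)))"
    using partial_isometry_local[OF u(1) Y, of 0] by blast
  define M where "M = max M1 M2"
  have cY: "finite (sublabels M Y)" "Y = (\<Union>t\<in>sublabels M Y. lcyl t)"
    using M1[of M] by (auto simp: M_def cylindrical_def)
  let ?dg = "\<lambda>a c. snd (snd a) - snd (snd c) :: int"
  have "\<exists>d. \<forall>a. \<forall>c\<in>lcyl t. u a c \<noteq> 0 \<longrightarrow> ?dg a c = d" if t: "t \<in> sublabels M Y" for t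
  proof -
    obtain v j q where vjq: "t = (v, j, q)" by (cases t)
    obtain i p where ip: "mm u (dg (cyl v (j, q))) = bb v (i, p) (j, q)
        \<or> mm u (dg (cyl v (j, q))) = - bb v (i, p) (j, q)"
      using M2[rule_format, of M v j q] t unfolding vjq M_def by auto
    have "?dg a c = int (length p) - int (length q)" if c: "c \<in> lcyl t" and nz: "u a c \<noteq> 0" for a c
    proof -
      have "mm u (dg (cyl v (j, q))) a c = u a c" using c by (simp add: mm_dg lcyl_def vjq)
      with ip nz have "bb v (i, p) (j, q) a c \<noteq> 0" by auto
      then show ?thesis unfolding bb_nz by auto
    qed
    then show ?thesis by blast
  qed
  then obtain \<delta> where \<delta>: "\<And>t a c. t \<in> sublabels M Y \<Longrightarrow> c \<in> lcyl t \<Longrightarrow> u a c \<noteq> 0 \<Longrightarrow> ?dg a c = \<delta> t"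
    by metis
  define D where "D = \<delta> ` sublabels M Y"
  define Yd where "Yd d = {c. \<exists>a. u a c \<noteq> 0 \<and> ?dg a c = d}" for d
  have inD: "?dg a c \<in> D" if nz: "u a c \<noteq> 0" for a c
  proof -
    have "c \<in> Y" using pi(1) nz by blast
    then obtain t where t: "t \<in> sublabels M Y" "c \<in> lcyl t" using cY(2) by blast
    then show ?thesis using \<delta>[OF t nz] by (simp add: D_def)
  qed
  have u1: "a = b" if "u a c \<noteq> 0" "u b c \<noteq> 0" for a b c
    using pi(1)[of c a] pi(2)[of c] that by metis
  have u2: "u a c * u a c = 1" if "u a c \<noteq> 0" for a c
    using pi(1)[of c a] pi(2)[of c] that by (metis minus_mult_minus mult.right_neutral)
  have uY: "mm u (dg (Yd d)) = degree_part d u" for d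
  proof (intro ext)
    fix a c
    have "c \<in> Yd d \<longleftrightarrow> ?dg a c = d" if "u a c \<noteq> 0" unfolding Yd_def using u1 that by blast
    then show "mm u (dg (Yd d)) a c = degree_part d u a c"
      by (cases "u a c = 0") (simp_all add: mm_dg degree_part_def)
  qed
  have YdP: "dg (Yd d) = mm (tr (degree_part d u)) (degree_part d u)" for d
  proof (intro ext)
    fix a c
    show "dg (Yd d) a c = mm (tr (degree_part d u)) (degree_part d u) a c"
    proof (cases "c \<in> Yd d")
      case True
      then obtain b where b: "u b c \<noteq> 0" "?dg b c = d" by (auto simp: Yd_def)
      have "degree_part d u b' c \<noteq> 0 \<longleftrightarrow> b' = b" for b'
        using b u1[of b' c b] by (cases "b' = b") (auto simp: degree_part_def)
      then have "{b'. degree_part d u b' c \<noteq> 0} = {b}" by blast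
      then have *: "mm (tr (degree_part d u)) (degree_part d u) a c = degree_part d u b a * u b c"
        by (simp add: mm_def tr_def) (simp add: degree_part_def b)
      show ?thesis
      proof (cases "a = c")
        case True
        then show ?thesis using * \<open>c \<in> Yd d\<close> u2[OF b(1)] b by (simp add: dg_def degree_part_def)
      next
        case False
        then have "u b a = 0" using pi(3)[of b a c] b by blast
        then show ?thesis using * False by (simp add: dg_def degree_part_def)
      qed
    next
      case False
      have "degree_part d u b c = 0" for b
      proof (rule ccontr)
        assume "degree_part d u b c \<noteq> 0"
        then have "u b c \<noteq> 0" "?dg b c = d" by (simp_all add: degree_part_def split: if_splits)
        then show False using False unfolding Yd_def by blast
      qed
      then show ?thesis using False by (auto simp: dg_def mm_def)
    qed
  qed
  have "(\<Sum>d\<in>D. dg (Yd d)) = dg Y"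
  proof (intro ext)
    fix a c
    have fD: "finite D" using cY(1) by (simp add: D_def)
    show "(\<Sum>d\<in>D. dg (Yd d)) a c = dg Y a c"
    proof (cases "a = c \<and> c \<in> Y")
      case True
      then obtain b where b: "u b c \<noteq> 0" using pi(2)[of c] by (metis neg_equal_0_iff_equal zero_neq_one)
      have "c \<in> Yd d \<longleftrightarrow> d = ?dg b c" for d
        unfolding Yd_def using u1[OF b] b by blast
      then have "dg (Yd d) a c = (if d = ?dg b c then 1 else 0)" for d
        using True by (simp add: dg_def)
      then show ?thesis using fD inD[OF b] True by (simp add: sum_fun_apply) (simp add: dg_def)
    next
      case False
      have "Yd d \<subseteq> Y" for d using pi(1) unfolding Yd_def by blast
      then have "dg (Yd d) a c = 0" for d using False unfolding dg_def by (metis subsetD)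
      then show ?thesis using False by (auto simp: sum_fun_apply dg_def)
    qed
  qed
  moreover have "dg (Yd d) \<in> stein E" for d
    unfolding YdP by (intro stein_mm stein_tr degree_part_stein[OF u(1)])
  moreover have "deg_hom d (mm u (dg (Yd d)))" for d
    unfolding uY deg_hom_def degree_part_def by auto
  moreover have "finite D" using cY(1) by (simp add: D_def)
  ultimately show ?thesis using Y by (intro exI[of _ D] exI[of _ "\<lambda>d. dg (Yd d)"]) simp
qed

text \<open>If the degree were not positive, then every cylinder in the source would contain a cylinder of
  the same level inside the range, so counting shows that the range is everything.\<close>

lemma deg_contract:
  assumes u: "u \<in> stein E" "isproj (mm (tr u) u)" "deg_hom d u"
    and le: "mm (mm u (tr u)) (mm (tr u) u) = mm u (tr u)" and ne: "mm u (tr u) \<noteq> mm (tr u) u"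
  shows "0 < d"
proof (rule ccontr)
  assume d: "\<not> 0 < d"
  have tu: "tr u \<in> stein E" "mm (tr u) u \<in> stein E" by (simp_all add: u(1) stein_tr stein_mm)
  obtain Y where Y: "mm (tr u) u = dg Y" using isproj_stein[OF tu(2) u(2)] by blast
  note pi = partial_isometry[OF stein_colfin[OF u(1)] Y]
  define Y' where "Y' = {a. \<exists>c. u a c \<noteq> 0}"
  have Y': "mm u (tr u) = dg Y'" using pi(4) by (simp add: Y'_def)
  have sub: "Y' \<subseteq> Y" using le unfolding Y Y' dg_dg dg_inj by blast
  have neq: "Y' \<noteq> Y" using ne unfolding Y Y' dg_inj .
  obtain M1 where M1: "\<And>M. M \<ge> M1 \<Longrightarrow> cylindrical M Y" using stein_cylindrical tu(2) Y by metis
  obtain M2 where M2: "\<forall>M\<ge>M2. \<forall>v j q. (v, j, q) \<in> sublabels M Y \<longrightarrow>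
    (\<exists>i p. epath E p v \<and> 0 \<le> length p \<and>
      (mm u (dg (cyl v (j, q))) = bb v (i, p) (j, q) \<or> mm u (dg (cyl v (j, q))) = - bb v (i, p) (j, q)))"
    using partial_isometry_local[OF u(1) Y, of 0] by blast
  define M where "M = max M1 M2"
  have cY: "finite (sublabels M Y)" "Y = (\<Union>t\<in>sublabels M Y. lcyl t)"
    using M1[of M] by (auto simp: M_def cylindrical_def)
  have "\<exists>t'\<in>sublabels M Y. \<forall>a\<in>lcyl t'. \<exists>c\<in>lcyl t. u a c \<noteq> 0" if t: "t \<in> sublabels M Y" for t
  proof -
    obtain v j q where vjq: "t = (v, j, q)" by (cases t)
    have q: "epath E q v" "length q = M" using t by (auto simp: vjq sublabels_def labels_def)
    obtain i p where p: "epath E p v" and ip: "mm u (dg (cyl v (j, q))) = bb v (i, p) (j, q)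
        \<or> mm u (dg (cyl v (j, q))) = - bb v (i, p) (j, q)"
      using M2[rule_format, of M v j q] t unfolding vjq M_def by auto
    have img: "\<exists>c\<in>lcyl t. u a c \<noteq> 0 \<and> snd (snd a) - snd (snd c) = int (length p) - int (length q)"
      if a: "a \<in> cyl v (i, p)" for a
    proof -
      obtain z k where z: "z \<in> X" "src E z = v" "a = (i, p \<frown> z, k + int (length p))"
        using a by (rule cyl_cases) auto
      let ?c = "(j, q \<frown> z, k + int (length q))"
      have c: "?c \<in> lcyl t" using z by (auto simp: lcyl_def vjq cyl_def)
      have "bb v (i, p) (j, q) a ?c \<noteq> 0" unfolding bb_nz using z by auto
      then have "mm u (dg (cyl v (j, q))) a ?c \<noteq> 0" using ip by auto
      then have "u a ?c \<noteq> 0" by (auto simp: mm_dg split: if_splits)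
      with c z(3) show ?thesis by (intro bexI[of _ ?c]) auto
    qed
    obtain a0 where a0: "a0 \<in> cyl v (i, p)" using cyl_nonempty[OF epath_verts[OF p]] by blast
    then obtain c0 where c0: "u a0 c0 \<noteq> 0" "snd (snd a0) - snd (snd c0) = int (length p) - int (length q)"
      using img by blast
    then have "int (length p) - int (length q) = d"
      using u(3) unfolding deg_hom_def by metis
    \<comment> \<open>Here it enters that \<open>d\<close> is not positive: \<open>p\<close> is no
      longer than \<open>q\<close>, so it can be extended to a path of the common length
      \<open>M\<close>.\<close>
    with d q have len: "length p \<le> M" by simp
    obtain \<eta> w where \<eta>: "epath E \<eta> w" "pstart E \<eta> w = v" "length \<eta> = M - length p"
      using ex_extension[OF epath_verts[OF p]] .
    have ew: "epath E (p @ \<eta>) w"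
    proof -
      obtain z where z: "z \<in> X" "src E z = w" using ex_ipath[OF epath_verts[OF \<eta>(1)]] .
      then have "\<eta> \<frown> z \<in> X" "src E (\<eta> \<frown> z) = v" using \<eta> by (auto simp: conc_in_X src_conc)
      then have "p \<frown> \<eta> \<frown> z \<in> X" using p by (subst conc_in_X) simp
      then show ?thesis using conc_in_X[of "p @ \<eta>" z] z by simp
    qed
    have s: "cyl w (i, p @ \<eta>) \<subseteq> cyl v (i, p)" by (rule cyl_append_subset[OF \<eta>(1,2)])
    have "cyl v (i, p) \<subseteq> Y" using img sub unfolding Y'_def by blast
    with s ew \<eta>(3) len have "(w, i, p @ \<eta>) \<in> sublabels M Y"
      by (auto simp: sublabels_def labels_def lcyl_def)
    moreover have "\<forall>a\<in>lcyl (w, i, p @ \<eta>). \<exists>c\<in>lcyl t. u a c \<noteq> 0"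
      using s img by (fastforce simp: lcyl_def)
    ultimately show ?thesis by blast
  qed
  then obtain \<phi> where \<phi>: "\<And>t. t \<in> sublabels M Y \<Longrightarrow> \<phi> t \<in> sublabels M Y"
    "\<And>t a. t \<in> sublabels M Y \<Longrightarrow> a \<in> lcyl (\<phi> t) \<Longrightarrow> \<exists>c\<in>lcyl t. u a c \<noteq> 0" by metis
  have ne: "lcyl t \<noteq> {}" if "t \<in> sublabels M Y" for t
    using that cyl_nonempty epath_verts by (auto simp: sublabels_def labels_def lcyl_def)
  have "inj_on \<phi> (sublabels M Y)"
  proof (rule inj_onI)
    fix t t' assume t: "t \<in> sublabels M Y" "t' \<in> sublabels M Y" "\<phi> t = \<phi> t'"
    obtain a where a: "a \<in> lcyl (\<phi> t)" using ne[OF \<phi>(1)[OF t(1)]] by blast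
    obtain c c' where c: "c \<in> lcyl t" "u a c \<noteq> 0" "c' \<in> lcyl t'" "u a c' \<noteq> 0"
      using \<phi>(2)[OF t(1) a] \<phi>(2)[OF t(2)] a t(3) by metis
    have "c = c'" by (rule pi(3)[OF c(2,4)])
    obtain v j q v' j' q' where vjq: "t = (v, j, q)" "t' = (v', j', q')" by (cases t, cases t')
    have "cyl v (j, q) \<inter> cyl v' (j', q') \<noteq> {}" using c \<open>c = c'\<close> by (auto simp: vjq lcyl_def)
    with cyl_disjoint[of q q' v j v' j'] show "t = t'"
      using t by (simp add: vjq sublabels_def labels_def)
  qed
  \<comment> \<open>An injective map of a finite set of cylinders into itself is onto, so every
    cylinder of \<open>Y\<close> consists of points of the range.\<close>
  then have sur: "\<phi> ` sublabels M Y = sublabels M Y"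
    using \<phi>(1) cY(1) by (intro endo_inj_surj) auto
  have "Y \<subseteq> Y'"
  proof
    fix a assume "a \<in> Y"
    then obtain t where "t \<in> sublabels M Y" "a \<in> lcyl t" using cY(2) by blast
    then show "a \<in> Y'" using \<phi>(2) sur unfolding Y'_def by (metis (mono_tags, lifting) imageE mem_Collect_eq)
  qed
  with sub neq show False by blast
qed

lemma graded_deg: "graded E deg_hom"
proof
  fix S T :: "'e pt imat" and d d' :: int
  show "deg_hom (d + d') (mm S T)" if "deg_hom d S" "deg_hom d' T"
    unfolding deg_hom_def
  proof (intro allI impI)
    fix a c assume "mm S T a c \<noteq> 0"
    then obtain b where "S a b * T b c \<noteq> 0" unfolding mm_def
      by (metis (no_types, lifting) sum.neutral)
    then have "S a b \<noteq> 0" "T b c \<noteq> 0" by auto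
    then have "snd (snd a) - snd (snd b) = d" "snd (snd b) - snd (snd c) = d'"
      using that unfolding deg_hom_def by blast+
    then show "snd (snd a) - snd (snd c) = d + d'" by simp
  qed
  show "deg_hom (- d) (tr S)" if "deg_hom d S"
    unfolding deg_hom_def tr_def
  proof (intro allI impI)
    fix a c assume "S c a \<noteq> 0"
    then have "snd (snd c) - snd (snd a) = d" using that unfolding deg_hom_def by blast
    then show "snd (snd a) - snd (snd c) = - d" by simp
  qed
  show "deg_hom d (- S)" if "deg_hom d S" using that by (auto simp: deg_hom_def)
  show "deg_hom 0 S" if "S \<in> stein E" "isproj S"
    using isproj_stein[OF that] by (auto simp: deg_hom_def dg_def split: if_splits)
  show "d = d'" if S: "deg_hom d S" "deg_hom d' S" "S \<noteq> 0"
  proof -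
    obtain a c where "S a c \<noteq> 0" using S(3) by (metis ext zero_fun_apply)
    then show ?thesis using S(1,2) unfolding deg_hom_def by metis
  qed
qed (rule deg_decomp deg_contract; assumption)+

end

section \<open>Transport along star-isomorphisms\<close>

locale stein_isomorphism = E: shift_graph E + F: shift_graph F
  for E :: "('v, 'e) pre_digraph" and F :: "('w, 'f) pre_digraph" +
  fixes \<psi> :: "'e pt imat \<Rightarrow> 'f pt imat"
  assumes iso: "stein_iso \<psi> E F"
begin

lemma
  assumes "S \<in> stein E"
  shows \<psi>_in: "\<psi> S \<in> stein F" and \<psi>_tr: "\<psi> (tr S) = tr (\<psi> S)"
    and \<psi>_add: "T \<in> stein E \<Longrightarrow> \<psi> (S + T) = \<psi> S + \<psi> T"
    and \<psi>_mm: "T \<in> stein E \<Longrightarrow> \<psi> (mm S T) = mm (\<psi> S) (\<psi> T)"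
    and \<psi>_inj: "T \<in> stein E \<Longrightarrow> \<psi> S = \<psi> T \<longleftrightarrow> S = T"
  using iso assms unfolding stein_iso_def bij_betw_def inj_on_def by auto

lemma \<psi>_surj: "T \<in> stein F \<Longrightarrow> \<exists>S\<in>stein E. \<psi> S = T"
  using iso unfolding stein_iso_def bij_betw_def by (metis imageE)

lemma \<psi>_zero: "\<psi> 0 = 0"
proof -
  have "\<psi> (0 + 0) = \<psi> 0 + \<psi> 0" by (rule \<psi>_add) (rule E.stein_zero)+
  then show ?thesis by simp
qed

lemma \<psi>_uminus: "S \<in> stein E \<Longrightarrow> \<psi> (- S) = - \<psi> S"
  using \<psi>_add[OF E.stein_uminus, of S S] by (simp add: \<psi>_zero eq_neg_iff_add_eq_0)

lemma \<psi>_sum: "(\<And>d. d \<in> D \<Longrightarrow> f d \<in> stein E) \<Longrightarrow> \<psi> (sum f D) = (\<Sum>d\<in>D. \<psi> (f d))"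
  by (induction D rule: infinite_finite_induct) (auto simp: \<psi>_zero \<psi>_add E.stein_sum)

lemma \<psi>_isproj: "S \<in> stein E \<Longrightarrow> isproj (\<psi> S) \<longleftrightarrow> isproj S"
  unfolding isproj_def
  by (simp add: \<psi>_tr[symmetric] \<psi>_mm[symmetric] \<psi>_inj E.stein_tr E.stein_mm)

lemma iso_inverse: "stein_iso (the_inv_into (stein E) \<psi>) F E"
  by (rule stein_iso_inverse[OF E.regular_graph_axioms iso])

text \<open>The axioms of \<open>graded\<close> speak only of products, transposes, negation, finite
  sums and projections, and \<open>\<psi>\<close> preserves and reflects all of these. The resulting
  grading of \<open>E\<close> may differ from the one by path length.\<close>

lemma transport_graded:
  assumes "graded F hmg"
  shows "graded E (\<lambda>d S. hmg d (\<psi> S))"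
proof -
  interpret F: graded F hmg by (rule assms)
  show ?thesis
  proof
    fix S T :: "'e pt imat" and d d' :: int
    assume S: "S \<in> stein E"
    show "hmg (d + d') (\<psi> (mm S T))" if "T \<in> stein E" "hmg d (\<psi> S)" "hmg d' (\<psi> T)"
      using F.hom_mm[OF \<psi>_in \<psi>_in] S that by (simp add: \<psi>_mm)
    show "hmg (- d) (\<psi> (tr S))" if "hmg d (\<psi> S)"
      using F.hom_tr[OF \<psi>_in] S that by (simp add: \<psi>_tr)
    show "hmg d (\<psi> (- S))" if "hmg d (\<psi> S)"
      using F.hom_uminus[OF \<psi>_in] S that by (simp add: \<psi>_uminus)
    show "hmg 0 (\<psi> S)" if "isproj S"
      using F.hom_proj[OF \<psi>_in] S that by (simp add: \<psi>_isproj)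
    show "d = d'" if "hmg d (\<psi> S)" "hmg d' (\<psi> S)" "S \<noteq> 0"
      using F.hom_unique[OF \<psi>_in[OF S]] that \<psi>_inj[OF S E.stein_zero] by (simp add: \<psi>_zero)
    have c: "tr S \<in> stein E" "mm (tr S) S \<in> stein E" "mm S (tr S) \<in> stein E"
      "mm (mm S (tr S)) (mm (tr S) S) \<in> stein E"
      by (simp_all add: S E.stein_tr E.stein_mm)
    have e: "mm (tr (\<psi> S)) (\<psi> S) = \<psi> (mm (tr S) S)" "mm (\<psi> S) (tr (\<psi> S)) = \<psi> (mm S (tr S))"
      using c S by (simp_all add: \<psi>_mm \<psi>_tr)
    show "\<exists>D q. finite D \<and> (\<forall>d\<in>D. q d \<in> stein E \<and> isproj (q d) \<and> hmg d (\<psi> (mm S (q d))))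
        \<and> (\<Sum>d\<in>D. q d) = mm (tr S) S" if "isproj (mm (tr S) S)"
    proof -
      have "isproj (mm (tr (\<psi> S)) (\<psi> S))" using that c by (simp add: e \<psi>_isproj)
      then obtain D q where D: "finite D" "\<And>d. d \<in> D \<Longrightarrow> q d \<in> stein F \<and> isproj (q d) \<and> hmg d (mm (\<psi> S) (q d))"
        "(\<Sum>d\<in>D. q d) = mm (tr (\<psi> S)) (\<psi> S)"
        using F.hom_decomp[OF \<psi>_in[OF S]] by blast
      have "\<forall>d\<in>D. \<exists>S. S \<in> stein E \<and> \<psi> S = q d" using D(2) \<psi>_surj by blast
      from bchoice[OF this] obtain q' where q': "\<And>d. d \<in> D \<Longrightarrow> q' d \<in> stein E \<and> \<psi> (q' d) = q d"
        by blast
      have "\<psi> (\<Sum>d\<in>D. q' d) = (\<Sum>d\<in>D. \<psi> (q' d))" 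
      proof (rule \<psi>_sum)
        fix d assume "d \<in> D"
        then show "q' d \<in> stein E" using q' by blast
      qed
      also have "\<dots> = (\<Sum>d\<in>D. q d)" using q' by (intro sum.cong refl) blast
      also have "\<dots> = \<psi> (mm (tr S) S)" unfolding D(3) e ..
      finally have "\<psi> (\<Sum>d\<in>D. q' d) = \<psi> (mm (tr S) S)" .
      moreover have "(\<Sum>d\<in>D. q' d) \<in> stein E" using E.stein_sum[of D q'] q' by blast
      ultimately have "(\<Sum>d\<in>D. q' d) = mm (tr S) S" using \<psi>_inj c(2) by blast
      moreover have "q' d \<in> stein E \<and> isproj (q' d) \<and> hmg d (\<psi> (mm S (q' d)))" if "d \<in> D" for d
        using q'[OF that] D(2)[OF that] \<psi>_isproj[of "q' d"] \<psi>_mm[OF S, of "q' d"] by simp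
      ultimately show ?thesis using D(1) by blast
    qed
    show "0 < d" if "isproj (mm (tr S) S)" "hmg d (\<psi> S)"
      "mm (mm S (tr S)) (mm (tr S) S) = mm S (tr S)" "mm S (tr S) \<noteq> mm (tr S) S"
    proof -
      have 1: "mm (mm (\<psi> S) (tr (\<psi> S))) (mm (tr (\<psi> S)) (\<psi> S)) = mm (\<psi> S) (tr (\<psi> S))"
        unfolding e \<psi>_mm[OF c(3,2), symmetric] that(3) ..
      have 2: "mm (\<psi> S) (tr (\<psi> S)) \<noteq> mm (tr (\<psi> S)) (\<psi> S)"
        unfolding e \<psi>_inj[OF c(3,2)] by (rule that(4))
      have 3: "isproj (mm (tr (\<psi> S)) (\<psi> S))" unfolding e \<psi>_isproj[OF c(2)] by (rule that(1))
      show ?thesis by (rule F.hom_contract[OF \<psi>_in[OF S] 3 that(2) 1 2])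
    qed
  qed
qed

end

section \<open>Determinants\<close>

text \<open>On row vectors, \<open>rel\<close> makes \<open>X\<close> a map from the cokernel of
  \<open>M2\<close> to that of \<open>M1\<close>, and \<open>gen\<close> makes it surjective. A
  surjection enlarges the Fitting ideal, which is generated by the determinant. The identity
  \<open>?P * ?Q = ?S * ?T\<close> of block matrices expresses this directly: its determinant reads
  \<open>det M2 = det ?S * det M1\<close>.\<close>

lemma det_dvd_of_presentation:
  fixes M1 M2 :: "'a :: idom mat"
  assumes M1: "M1 \<in> carrier_mat n n" and M2: "M2 \<in> carrier_mat m m"
    and X: "X \<in> carrier_mat m n" and X': "X' \<in> carrier_mat m n"
    and Y: "Y \<in> carrier_mat n m" and Z: "Z \<in> carrier_mat n n"
    and rel: "M2 * X = X' * M1" and gen: "1\<^sub>m n = Y * X + Z * M1"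
  shows "det M1 dvd det M2"
proof -
  let ?P = "four_block_mat M2 (0\<^sub>m m n) (- Y) (1\<^sub>m n)"
  let ?Q = "four_block_mat (1\<^sub>m m) X (0\<^sub>m n m) (1\<^sub>m n)"
  let ?S = "four_block_mat M2 X' (- Y) Z"
  let ?T = "four_block_mat (1\<^sub>m m) (0\<^sub>m m n) (0\<^sub>m n m) M1"
  have 1: "(- Y) * X + 1\<^sub>m n * 1\<^sub>m n = Z * M1"
  proof -
    have *: "- A + (A + B) = B" if "A \<in> carrier_mat n n" "B \<in> carrier_mat n n" for A B :: "'a mat"
      using that by (intro eq_matI) auto
    have "(- Y) * X = - (Y * X)" using X Y by simp
    moreover have "1\<^sub>m n * 1\<^sub>m n = Y * X + Z * M1" unfolding gen[symmetric] by simp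
    ultimately have "(- Y) * X + 1\<^sub>m n * 1\<^sub>m n = - (Y * X) + (Y * X + Z * M1)" by (simp only:)
    also have "\<dots> = Z * M1" using X Y Z M1 by (intro *) auto
    finally show ?thesis .
  qed
  have "?P * ?Q = four_block_mat (M2 * 1\<^sub>m m + 0\<^sub>m m n * 0\<^sub>m n m) (M2 * X + 0\<^sub>m m n * 1\<^sub>m n)
      ((- Y) * 1\<^sub>m m + 1\<^sub>m n * 0\<^sub>m n m) ((- Y) * X + 1\<^sub>m n * 1\<^sub>m n)"
    using M2 X Y by (intro mult_four_block_mat) auto
  also have "\<dots> = four_block_mat M2 (X' * M1) (- Y) (Z * M1)"
    unfolding 1 rel using M1 M2 X' Y by (intro cong_four_block_mat) auto
  also have "\<dots> = four_block_mat (M2 * 1\<^sub>m m + X' * 0\<^sub>m n m) (M2 * 0\<^sub>m m n + X' * M1)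
      ((- Y) * 1\<^sub>m m + Z * 0\<^sub>m n m) ((- Y) * 0\<^sub>m m n + Z * M1)"
    using M1 M2 X' Y Z by (intro cong_four_block_mat) auto
  also have "\<dots> = ?S * ?T"
    using M1 M2 X' Y Z by (intro mult_four_block_mat[symmetric]) auto
  finally have eq: "?P * ?Q = ?S * ?T" .
  have c: "?P \<in> carrier_mat (m + n) (m + n)" "?Q \<in> carrier_mat (m + n) (m + n)"
    "?S \<in> carrier_mat (m + n) (m + n)" "?T \<in> carrier_mat (m + n) (m + n)"
    using M1 M2 X X' Y Z by auto
  have "det ?P = det M2" using M2 Y by (subst det_four_block_mat_upper_right_zero) auto
  moreover have "det ?Q = 1" using X by (subst det_four_block_mat_lower_left_zero) auto
  moreover have "det ?T = det M1" using M1 by (subst det_four_block_mat_lower_left_zero) auto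
  ultimately have "det M2 = det ?S * det M1"
    using arg_cong[OF eq, of det] det_mult[OF c(1,2)] det_mult[OF c(3,4)] by simp
  then show ?thesis by simp
qed

text \<open>Sylvester's identity: the block matrix with rows (1, R) and (S, 1) has the two
  triangular factorisations \<open>?L * ?U\<close> and \<open>?V * ?L\<close>.\<close>

lemma det_one_minus_mult_commute:
  fixes R S :: "'a :: idom mat"
  assumes R: "R \<in> carrier_mat m n" and S: "S \<in> carrier_mat n m"
  shows "det (1\<^sub>m m - R * S) = det (1\<^sub>m n - S * R)"
proof -
  let ?L = "four_block_mat (1\<^sub>m m) (0\<^sub>m m n) S (1\<^sub>m n)"
  let ?U = "four_block_mat (1\<^sub>m m) R (0\<^sub>m n m) (1\<^sub>m n - S * R)"
  let ?V = "four_block_mat (1\<^sub>m m - R * S) R (0\<^sub>m n m) (1\<^sub>m n)"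
  have SR: "S * R \<in> carrier_mat n n" "R * S \<in> carrier_mat m m" using R S by auto
  have "?L * ?U = four_block_mat (1\<^sub>m m * 1\<^sub>m m + 0\<^sub>m m n * 0\<^sub>m n m) (1\<^sub>m m * R + 0\<^sub>m m n * (1\<^sub>m n - S * R))
      (S * 1\<^sub>m m + 1\<^sub>m n * 0\<^sub>m n m) (S * R + 1\<^sub>m n * (1\<^sub>m n - S * R))"
    using R S SR by (intro mult_four_block_mat) auto
  also have "\<dots> = four_block_mat (1\<^sub>m m) R S (1\<^sub>m n)"
    using R S SR by (intro cong_four_block_mat eq_matI) (auto simp: minus_mult_distrib_mat)
  also have "\<dots> = four_block_mat ((1\<^sub>m m - R * S) * 1\<^sub>m m + R * S) ((1\<^sub>m m - R * S) * 0\<^sub>m m n + R * 1\<^sub>m n)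
      (0\<^sub>m n m * 1\<^sub>m m + 1\<^sub>m n * S) (0\<^sub>m n m * 0\<^sub>m m n + 1\<^sub>m n * 1\<^sub>m n)"
    using R S SR by (intro cong_four_block_mat eq_matI) auto
  also have "\<dots> = ?V * ?L"
    using R S SR by (intro mult_four_block_mat[symmetric]) auto
  finally have eq: "?L * ?U = ?V * ?L" .
  have c: "?L \<in> carrier_mat (m + n) (m + n)" "?U \<in> carrier_mat (m + n) (m + n)"
    "?V \<in> carrier_mat (m + n) (m + n)"
    using R S SR by auto
  have "det ?L = 1" using S by (subst det_four_block_mat_upper_right_zero) auto
  moreover have "det ?U = det (1\<^sub>m n - S * R)" 
    using det_four_block_mat_lower_left_zero[OF one_carrier_mat R refl, of "1\<^sub>m n - S * R"]
      minus_carrier_mat[OF SR(1), of "1\<^sub>m n"] by simp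
  moreover have "det ?V = det (1\<^sub>m m - R * S)"
    using det_four_block_mat_lower_left_zero[OF _ R refl, of "1\<^sub>m m - R * S" "1\<^sub>m n"]
      minus_carrier_mat[OF SR(2), of "1\<^sub>m m"] by simp
  ultimately show ?thesis
    using arg_cong[OF eq, of det] det_mult[OF c(1,2)] det_mult[OF c(3,1)] by simp
qed

text \<open>Rows and columns are indexed by paths or vertices; positions enter only through the
  enumerating lists.\<close>

definition fmat :: "'x list \<Rightarrow> 'y list \<Rightarrow> ('x \<Rightarrow> 'y \<Rightarrow> 'a) \<Rightarrow> 'a mat" where
  "fmat xs ys M = mat (length xs) (length ys) (\<lambda>(i, j). M (xs ! i) (ys ! j))"

definition idf :: "'x \<Rightarrow> 'x \<Rightarrow> 'a :: zero_neq_one" where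
  "idf x y = (if x = y then 1 else 0)"

lemma fmat_carrier [simp]: "fmat xs ys M \<in> carrier_mat (length xs) (length ys)"
  by (simp add: fmat_def)

lemma fmat_mult:
  assumes "distinct ys"
  shows "fmat xs ys A * fmat ys zs B = fmat xs zs (\<lambda>x z. \<Sum>y\<in>set ys. A x y * B y z)"
proof (rule eq_matI)
  fix i j assume "i < dim_row (fmat xs zs (\<lambda>x z. \<Sum>y\<in>set ys. A x y * B y z))"
    "j < dim_col (fmat xs zs (\<lambda>x z. \<Sum>y\<in>set ys. A x y * B y z))"
  then have ij: "i < length xs" "j < length zs" by (auto simp: fmat_def)
  have "(fmat xs ys A * fmat ys zs B) $$ (i, j)
      = (\<Sum>k = 0..<length ys. A (xs ! i) (ys ! k) * B (ys ! k) (zs ! j))"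
    using ij by (simp add: fmat_def scalar_prod_def)
  also have "\<dots> = (\<Sum>y\<in>set ys. A (xs ! i) y * B y (zs ! j))"
    using bij_betw_nth[OF assms refl refl] sum.reindex_bij_betw[of "(!) ys" "{..<length ys}" "set ys"]
    by (simp add: atLeast0LessThan)
  finally show "(fmat xs ys A * fmat ys zs B) $$ (i, j)
      = fmat xs zs (\<lambda>x z. \<Sum>y\<in>set ys. A x y * B y z) $$ (i, j)"
    using ij by (simp add: fmat_def)
qed (auto simp: fmat_def)

lemma fmat_diff: "fmat xs ys A - fmat xs ys B = fmat xs ys (\<lambda>x y. A x y - B x y)"
  and fmat_add: "fmat xs ys A + fmat xs ys B = fmat xs ys (\<lambda>x y. A x y + B x y)"
  by (auto simp: fmat_def)

lemma fmat_one: "distinct xs \<Longrightarrow> 1\<^sub>m (length xs) = fmat xs xs idf"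
  by (rule eq_matI) (auto simp: fmat_def idf_def nth_eq_iff_index_eq)

lemma fmat_cong:
  "(\<And>x y. x \<in> set xs \<Longrightarrow> y \<in> set ys \<Longrightarrow> A x y = B x y) \<Longrightarrow> fmat xs ys A = fmat xs ys B"
  by (auto simp: fmat_def)

lemma det_fmat_dvd:
  fixes M1 :: "'x \<Rightarrow> 'x \<Rightarrow> 'a :: idom"
  assumes d: "distinct xs" "distinct ys"
    and rel: "\<And>y x. y \<in> set ys \<Longrightarrow> x \<in> set xs
      \<Longrightarrow> (\<Sum>y'\<in>set ys. M2 y y' * X y' x) = (\<Sum>x'\<in>set xs. X' y x' * M1 x' x)"
    and gen: "\<And>x x'. x \<in> set xs \<Longrightarrow> x' \<in> set xs
      \<Longrightarrow> idf x x' = (\<Sum>y\<in>set ys. Y x y * X y x') + (\<Sum>x''\<in>set xs. Z x x'' * M1 x'' x')"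
  shows "det (fmat xs xs M1) dvd det (fmat ys ys M2)"
proof (rule det_dvd_of_presentation[where m = "length ys" and n = "length xs"])
  show "fmat ys ys M2 * fmat ys xs X = fmat ys xs X' * fmat xs xs M1"
    unfolding fmat_mult[OF d(1)] fmat_mult[OF d(2)] by (rule fmat_cong) (rule rel)
  show "1\<^sub>m (length xs) = fmat xs ys Y * fmat ys xs X + fmat xs xs Z * fmat xs xs M1"
    unfolding fmat_one[OF d(1)] fmat_mult[OF d(1)] fmat_mult[OF d(2)] fmat_add
    by (rule fmat_cong) (rule gen)
qed simp_all

lemma det_fmat_commute:
  fixes R :: "'x \<Rightarrow> 'y \<Rightarrow> 'a :: idom"
  assumes d: "distinct xs" "distinct ys"
  shows "det (fmat xs xs (\<lambda>x x'. idf x x' - (\<Sum>y\<in>set ys. R x y * S y x')))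
    = det (fmat ys ys (\<lambda>y y'. idf y y' - (\<Sum>x\<in>set xs. S y x * R x y')))"
  using det_one_minus_mult_commute[of "fmat xs ys R" "length xs" "length ys" "fmat ys xs S"]
  by (simp add: fmat_mult[OF d(1)] fmat_mult[OF d(2)] fmat_one[OF d(1)] fmat_one[OF d(2)] fmat_diff)

section \<open>Laurent polynomials\<close>

type_synonym laurent = "int \<Rightarrow>\<^sub>0 int"

text \<open>0 counts as positive. Thus \<open>pos (p - 1)\<close> says that \<open>p\<close> is 1
  plus terms of positive degree, a property that is stable under products.\<close>

definition pos :: "laurent \<Rightarrow> bool" where
  "pos p \<longleftrightarrow> (\<forall>k\<in>Poly_Mapping.keys p. 0 < k)"

lemma pos_zero [simp]: "pos 0" by (simp add: pos_def)

lemma pos_add: "pos p \<Longrightarrow> pos q \<Longrightarrow> pos (p + q)"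
  using keys_add[of p q] by (auto simp: pos_def)

lemma pos_uminus: "pos p \<Longrightarrow> pos (- p)"
  by (simp add: pos_def)

lemma pos_sum: "(\<And>x. x \<in> S \<Longrightarrow> pos (f x)) \<Longrightarrow> pos (sum f S)"
  by (induction S rule: infinite_finite_induct) (auto intro: pos_add)

lemma pos_mult: "pos p \<Longrightarrow> pos q \<Longrightarrow> pos (p * q)"
  using keys_mult[of p q] unfolding pos_def by fastforce

lemma pos_mult_unit: "pos p \<Longrightarrow> pos (q - 1) \<Longrightarrow> pos (p * q)"
  using pos_add[OF _ pos_mult, of p p "q - 1"] by (simp add: algebra_simps)

lemma unit_mult: "pos (p - 1) \<Longrightarrow> pos (q - 1) \<Longrightarrow> pos (p * q - 1)"
  using pos_add[OF pos_mult_unit[of "p - 1" q], of "q - 1"] by (simp add: algebra_simps)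

lemma unit_prod: "(\<And>x. x \<in> S \<Longrightarrow> pos (f x - 1)) \<Longrightarrow> pos (prod f S - 1)"
  by (induction S rule: infinite_finite_induct) (auto intro: unit_mult)

lemma prod_monomials:
  "finite S \<Longrightarrow> (\<Prod>x\<in>S. - Poly_Mapping.single (c x) (1::int))
    = (- 1) ^ card S * Poly_Mapping.single (\<Sum>x\<in>S. c x :: int) 1"
  by (induction S rule: finite_induct) (simp_all add: mult_single mult_ac)

text \<open>If only one pair of exponents can add up to \<open>m + n\<close>, no other terms
  contribute. This applies to the lowest and to the highest term of a product.\<close>

lemma lookup_mult_extreme:
  fixes p q :: laurent
  assumes "\<And>k l. k \<in> Poly_Mapping.keys p \<Longrightarrow> l \<in> Poly_Mapping.keys q \<Longrightarrow> k + l = m + n \<Longrightarrow> k = m \<and> l = n"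
  shows "Poly_Mapping.lookup (p * q) (m + n) = Poly_Mapping.lookup p m * Poly_Mapping.lookup q n"
proof -
  define p' where "p' = p - Poly_Mapping.single m (Poly_Mapping.lookup p m)"
  define q' where "q' = q - Poly_Mapping.single n (Poly_Mapping.lookup q n)"
  have kp: "k \<in> Poly_Mapping.keys p \<and> k \<noteq> m" if "k \<in> Poly_Mapping.keys p'" for k
    using that by (auto simp: p'_def in_keys_iff lookup_minus lookup_single when_def split: if_splits)
  have kq: "k \<in> Poly_Mapping.keys q \<and> k \<noteq> n" if "k \<in> Poly_Mapping.keys q'" for k
    using that by (auto simp: q'_def in_keys_iff lookup_minus lookup_single when_def split: if_splits)
  have "p * q = Poly_Mapping.single (m + n) (Poly_Mapping.lookup p m * Poly_Mapping.lookup q n)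
      + Poly_Mapping.single m (Poly_Mapping.lookup p m) * q' + p' * q"
    by (simp add: p'_def q'_def algebra_simps mult_single)
  moreover have "m + n \<notin> Poly_Mapping.keys (Poly_Mapping.single m (Poly_Mapping.lookup p m) * q')"
    using keys_mult[of "Poly_Mapping.single m (Poly_Mapping.lookup p m)" q'] kq
    by (auto split: if_splits dest!: subsetD dest: kq)
  moreover have "m + n \<notin> Poly_Mapping.keys (p' * q)"
    using keys_mult[of p' q] kp assms by force
  ultimately show ?thesis by (simp add: lookup_add in_keys_iff)
qed

text \<open>The two quotients \<open>g\<close> and \<open>h\<close> are inverse to each other.
  Lowest and highest exponents add under multiplication, so those of \<open>g\<close> coincide and
  \<open>g\<close> is a monomial. Comparison of the lowest terms of \<open>p\<close> and
  \<open>q\<close>, both equal to 1, leaves \<open>g = 1\<close>.\<close>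

lemma mutual_dvd_unit_eq:
  fixes p q :: laurent
  assumes p: "pos (p - 1)" and q: "pos (q - 1)" and "p dvd q" "q dvd p"
  shows "p = q"
proof -
  have key: "k = 0 \<or> 0 < k" if "pos (r - 1)" "k \<in> Poly_Mapping.keys r" for r :: laurent and k
    using that unfolding pos_def by (auto simp: in_keys_iff lookup_minus lookup_one when_def split: if_splits)
  have l0: "Poly_Mapping.lookup r 0 = 1" if "pos (r - 1)" for r :: laurent
  proof -
    have "0 \<notin> Poly_Mapping.keys (r - 1)" using that by (auto simp: pos_def)
    then show ?thesis by (simp add: in_keys_iff lookup_minus)
  qed
  obtain g where g: "q = p * g" using assms(3) by (rule dvdE)
  obtain h where h: "p = q * h" using assms(4) by (rule dvdE)
  have nz: "p \<noteq> 0" "q \<noteq> 0" using l0[OF p] l0[OF q] by auto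
  have nzg: "g \<noteq> 0" "h \<noteq> 0" using g h nz mult_zero_right by metis+
  have "p * (g * h) = q * h" unfolding g by (rule mult.assoc[symmetric])
  then have "p * (g * h) = p * 1" using h by simp
  then have gh: "g * h = 1" using nz by simp
  define lo hi where "lo r = Min (Poly_Mapping.keys r)" and "hi r = Max (Poly_Mapping.keys r)" for r :: laurent
  have lo: "lo r \<in> Poly_Mapping.keys r" "k \<in> Poly_Mapping.keys r \<Longrightarrow> lo r \<le> k" if "r \<noteq> 0" for r k
    using that by (simp_all add: lo_def)
  have hi: "hi r \<in> Poly_Mapping.keys r" "k \<in> Poly_Mapping.keys r \<Longrightarrow> k \<le> hi r" if "r \<noteq> 0" for r k
    using that by (simp_all add: hi_def)
  have eq1: "Poly_Mapping.lookup (r * s) (lo r + lo s) = Poly_Mapping.lookup r (lo r) * Poly_Mapping.lookup s (lo s)"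
    if "r \<noteq> 0" "s \<noteq> 0" for r s
    using lo(2)[OF that(1)] lo(2)[OF that(2)] by (intro lookup_mult_extreme) force
  have eq2: "Poly_Mapping.lookup (r * s) (hi r + hi s) = Poly_Mapping.lookup r (hi r) * Poly_Mapping.lookup s (hi s)"
    if "r \<noteq> 0" "s \<noteq> 0" for r s
    using hi(2)[OF that(1)] hi(2)[OF that(2)] by (intro lookup_mult_extreme) force
  have "Poly_Mapping.lookup g (lo g) * Poly_Mapping.lookup h (lo h) \<noteq> 0"
    "Poly_Mapping.lookup g (hi g) * Poly_Mapping.lookup h (hi h) \<noteq> 0"
    using lo(1) hi(1) nzg by (auto simp: in_keys_iff)
  then have "lo g + lo h = 0" "hi g + hi h = 0"
    using eq1[OF nzg] eq2[OF nzg] by (auto simp: gh lookup_one when_def split: if_splits)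
  moreover have "lo g \<le> hi g" "lo h \<le> hi h" using lo hi nzg by blast+
  ultimately have lg: "lo g = hi g" by linarith
  have "0 \<in> Poly_Mapping.keys p" using l0[OF p] by (simp add: in_keys_iff)
  then have lop: "lo p = 0" using lo(2)[OF nz(1)] key[OF p lo(1)[OF nz(1)]] by fastforce
  have *: "Poly_Mapping.lookup q (lo g) = Poly_Mapping.lookup g (lo g)"
    using eq1[OF nz(1) nzg(1)] unfolding g[symmetric] lop by (simp add: l0[OF p])
  then have "lo g \<in> Poly_Mapping.keys q" using lo(1)[OF nzg(1)] by (simp add: in_keys_iff)
  moreover have "\<not> 0 < lo g"
  proof
    assume "0 < lo g"
    have "Poly_Mapping.keys q \<subseteq> {a + b | a b. a \<in> Poly_Mapping.keys p \<and> b \<in> Poly_Mapping.keys g}"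
      unfolding g by (rule keys_mult)
    moreover have "0 \<in> Poly_Mapping.keys q" using l0[OF q] by (simp add: in_keys_iff)
    ultimately obtain a b where "a \<in> Poly_Mapping.keys p" "b \<in> Poly_Mapping.keys g" "a + b = 0" by auto
    then show False using key[OF p, of a] lo(2)[OF nzg(1), of b] \<open>0 < lo g\<close> by linarith
  qed
  ultimately have lo0: "lo g = 0" using key[OF q] by blast
  have "g = 1"
  proof (rule poly_mapping_eqI)
    fix k
    show "Poly_Mapping.lookup g k = Poly_Mapping.lookup 1 k"
    proof (cases "k = 0")
      case True
      then show ?thesis using * lo0 l0[OF q] by simp
    next
      case False
      then have "k \<notin> Poly_Mapping.keys g" using lo(2)[OF nzg(1), of k] hi(2)[OF nzg(1), of k] lg lo0 by linarith
      then show ?thesis using False by (simp add: in_keys_iff lookup_one when_def)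
    qed
  qed
  then show ?thesis using g by simp
qed

text \<open>Evaluation at t = 1, a ring homomorphism to the integers.\<close>

definition eval1 :: "laurent \<Rightarrow> int" where
  "eval1 p = (\<Sum>k\<in>Poly_Mapping.keys p. Poly_Mapping.lookup p k)"

lemma eval1_superset:
  "finite T \<Longrightarrow> Poly_Mapping.keys p \<subseteq> T \<Longrightarrow> eval1 p = (\<Sum>k\<in>T. Poly_Mapping.lookup p k)"
  unfolding eval1_def by (intro sum.mono_neutral_left) (auto simp: in_keys_iff)

lemma eval1_add: "eval1 (p + q) = eval1 p + eval1 q"
  using keys_add[of p q]
  by (simp add: eval1_superset[of "Poly_Mapping.keys p \<union> Poly_Mapping.keys q"] lookup_add sum.distrib)

lemma eval1_single [simp]: "eval1 (Poly_Mapping.single k c) = c"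
  by (simp add: eval1_def)

lemma eval1_zero [simp]: "eval1 0 = 0"
  by (simp add: eval1_def)

lemma eval1_sum: "finite T \<Longrightarrow> eval1 (sum f T) = (\<Sum>x\<in>T. eval1 (f x))"
  by (induction T rule: finite_induct) (simp_all add: eval1_add)

lemma laurent_expansion: "p = (\<Sum>k\<in>Poly_Mapping.keys p. Poly_Mapping.single k (Poly_Mapping.lookup p k :: int))"
proof (rule poly_mapping_eqI)
  fix j
  show "Poly_Mapping.lookup p j = Poly_Mapping.lookup (\<Sum>k\<in>Poly_Mapping.keys p. Poly_Mapping.single k (Poly_Mapping.lookup p k)) j"
    by (simp add: lookup_sum lookup_single when_def in_keys_iff)
qed

lemma eval1_mult: "eval1 (p * q) = eval1 p * eval1 q"
proof -
  have "p * q = (\<Sum>k\<in>Poly_Mapping.keys p. \<Sum>l\<in>Poly_Mapping.keys q.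
      Poly_Mapping.single (k + l) (Poly_Mapping.lookup p k * Poly_Mapping.lookup q l))"
    by (subst (1) laurent_expansion[of p], subst (1) laurent_expansion[of q])
      (simp add: sum_product mult_single)
  then show ?thesis by (simp add: eval1_sum) (simp add: eval1_def sum_product)
qed

interpretation eval1: comm_ring_hom eval1
proof
  show "eval1 1 = 1" by (simp add: eval1_def)
qed (simp_all add: eval1_add eval1_mult)

section \<open>Positive cycles\<close>

text \<open>An averaging argument in place of a cycle decomposition: let n be a period of \<pi>. The
  closed walks of n steps from all starting points together run through every step exactly n times,
  and each walk has positive weight.\<close>

lemma positive_cycle_sum:
  fixes c :: "'a \<Rightarrow> 'a \<Rightarrow> int"
  assumes \<pi>: "\<pi> permutes S" and S: "finite S" "S \<noteq> {}"
    and pos: "\<And>i n. i \<in> S \<Longrightarrow> 0 < n \<Longrightarrow> (\<pi> ^^ n) i = i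
      \<Longrightarrow> 0 < (\<Sum>k<n. c ((\<pi> ^^ k) i) ((\<pi> ^^ Suc k) i))"
  shows "0 < (\<Sum>i\<in>S. c i (\<pi> i))"
proof -
  have "permutation \<pi>" using \<pi> S(1) by (auto simp: permutation_permutes)
  then obtain n where n: "0 < n" "\<pi> ^^ n = id" using permutation_is_nilpotent by blast
  have "(\<Sum>i\<in>S. \<Sum>k<n. c ((\<pi> ^^ k) i) ((\<pi> ^^ Suc k) i))
      = (\<Sum>k<n. \<Sum>i\<in>S. c ((\<pi> ^^ k) i) ((\<pi> ^^ Suc k) i))"
    by (rule sum.swap)
  also have "\<dots> = (\<Sum>k<n. \<Sum>i\<in>S. c i (\<pi> i))"
  proof (rule sum.cong[OF refl])
    fix k
    have "bij_betw (\<pi> ^^ k) S S" by (rule permutes_imp_bij[OF permutes_funpow[OF \<pi>]])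
    from sum.reindex_bij_betw[OF this, of "\<lambda>i. c i (\<pi> i)"]
    show "(\<Sum>i\<in>S. c ((\<pi> ^^ k) i) ((\<pi> ^^ Suc k) i)) = (\<Sum>i\<in>S. c i (\<pi> i))" by simp
  qed
  also have "\<dots> = int n * (\<Sum>i\<in>S. c i (\<pi> i))" by simp
  finally have "int n * (\<Sum>i\<in>S. c i (\<pi> i)) = (\<Sum>i\<in>S. \<Sum>k<n. c ((\<pi> ^^ k) i) ((\<pi> ^^ Suc k) i))" ..
  also have "\<dots> > 0" using pos[OF _ n(1)] n(2) by (intro sum_pos[OF S]) simp
  finally show ?thesis using n(1) by (simp add: zero_less_mult_iff)
qed

text \<open>In the Leibniz expansion the identity contributes a product of factors 1 or 1 - t^c with
  c > 0. Any other permutation contributes 0 or, up to sign, such a product times a monomial whose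
  exponent is the total weight of its cycles. A closed walk is encoded as an infinite walk
  \<open>f\<close> with \<open>f n = f 0\<close>, as iterating a permutation provides it.\<close>

lemma det_positive_cycles:
  fixes c :: "'x \<Rightarrow> 'x \<Rightarrow> int" and edge :: "'x \<Rightarrow> 'x \<Rightarrow> bool"
  assumes d: "distinct xs"
    and pc: "\<And>f n. 0 < n \<Longrightarrow> f n = f 0 \<Longrightarrow> (\<And>k. f k \<in> set xs) \<Longrightarrow> (\<And>k. edge (f k) (f (Suc k)))
      \<Longrightarrow> 0 < (\<Sum>k<n. c (f k) (f (Suc k)))"
  shows "pos (det (fmat xs xs (\<lambda>x y. idf x y - (if edge x y then Poly_Mapping.single (c x y) 1 else 0))) - 1)"
proof -
  define A where "A i j = (if edge (xs ! i) (xs ! j) then Poly_Mapping.single (c (xs ! i) (xs ! j)) 1 else 0 :: laurent)" for i j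
  define n where "n = length xs"
  let ?M = "fmat xs xs (\<lambda>x y. idf x y - (if edge x y then Poly_Mapping.single (c x y) 1 else 0 :: laurent))"
  have M: "?M $$ (i, j) = (if i = j then 1 - A i i else - A i j)" if "i < n" "j < n" for i j
    using that d by (auto simp: fmat_def idf_def A_def n_def nth_eq_iff_index_eq)
  let ?P = "{\<pi>. \<pi> permutes {0..<n}}"
  let ?t = "\<lambda>\<pi>. signof \<pi> * (\<Prod>i = 0..<n. ?M $$ (i, \<pi> i))"
  have det: "det ?M = (\<Sum>\<pi>\<in>?P. ?t \<pi>)"
    by (rule det_def') (simp add: n_def)
  \<comment> \<open>A loop is a closed walk of one step, so its weight is positive as well.\<close>
  have diag: "pos (1 - A i i - 1)" if "i < n" for i
  proof -
    have "0 < c (xs ! i) (xs ! i)" if "edge (xs ! i) (xs ! i)"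
      using pc[of 1 "\<lambda>_. xs ! i"] that \<open>i < n\<close> by (simp add: n_def)
    then show ?thesis by (simp add: A_def pos_def)
  qed
  have pos_t: "pos (?t \<pi>)" if \<pi>: "\<pi> permutes {0..<n}" "\<pi> \<noteq> id" for \<pi>
  proof -
    define S where "S = {i \<in> {0..<n}. \<pi> i \<noteq> i}"
    have S: "finite S" "S \<subseteq> {0..<n}" by (auto simp: S_def)
    have "\<exists>i. \<pi> i \<noteq> i" using \<pi>(2) by (auto simp: fun_eq_iff)
    then have Sne: "S \<noteq> {}" using permutes_not_in[OF \<pi>(1)] unfolding S_def by blast
    have \<pi>n: "\<pi> i < n" if "i < n" for i using permutes_in_image[OF \<pi>(1), of i] that by simp
    have \<pi>S: "\<pi> permutes S"
    proof (rule permutes_superset[OF \<pi>(1)])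
      show "\<pi> x = x" if "x \<in> {0..<n} - S" for x using that by (simp add: S_def)
    qed
    have "(\<Prod>i = 0..<n. ?M $$ (i, \<pi> i)) = (\<Prod>i\<in>S. ?M $$ (i, \<pi> i)) * (\<Prod>i\<in>{0..<n} - S. ?M $$ (i, \<pi> i))"
      by (subst prod.subset_diff[OF S(2)]) (simp_all add: mult.commute)
    also have "(\<Prod>i\<in>{0..<n} - S. ?M $$ (i, \<pi> i)) = (\<Prod>i\<in>{0..<n} - S. 1 - A i i)"
      by (intro prod.cong refl) (auto simp: S_def M)
    also have "(\<Prod>i\<in>S. ?M $$ (i, \<pi> i)) = (\<Prod>i\<in>S. - A i (\<pi> i))"
      by (intro prod.cong refl) (auto simp: S_def M \<pi>n)
    finally have e: "(\<Prod>i = 0..<n. ?M $$ (i, \<pi> i)) = (\<Prod>i\<in>S. - A i (\<pi> i)) * (\<Prod>i\<in>{0..<n} - S. 1 - A i i)" .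
    have "pos (\<Prod>i\<in>S. - A i (\<pi> i))"
    proof (cases "\<forall>i\<in>S. edge (xs ! i) (xs ! \<pi> i)")
      case False
      then obtain i where "i \<in> S" "- A i (\<pi> i) = 0" by (auto simp: A_def)
      then have "(\<Prod>i\<in>S. - A i (\<pi> i)) = 0" using S(1) by (meson prod_zero)
      then show ?thesis by simp
    next
      case True
      let ?c = "\<lambda>i j. c (xs ! i) (xs ! j)"
      have "(\<Prod>i\<in>S. - A i (\<pi> i)) = (\<Prod>i\<in>S. - Poly_Mapping.single (?c i (\<pi> i)) 1)"
        using True by (intro prod.cong refl) (simp add: A_def)
      also have "\<dots> = (- 1) ^ card S * Poly_Mapping.single (\<Sum>i\<in>S. ?c i (\<pi> i)) 1"
        by (rule prod_monomials[OF S(1)])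
      finally have p: "(\<Prod>i\<in>S. - A i (\<pi> i)) = (- 1) ^ card S * Poly_Mapping.single (\<Sum>i\<in>S. ?c i (\<pi> i)) 1" .
      have "0 < (\<Sum>i\<in>S. ?c i (\<pi> i))"
      proof (rule positive_cycle_sum[OF \<pi>S S(1) Sne])
        fix i m assume i: "i \<in> S" and m: "0 < m" "(\<pi> ^^ m) i = i"
        have iS: "(\<pi> ^^ k) i \<in> S" for k
          using permutes_in_image[OF permutes_funpow[OF \<pi>S], of k i] i by simp
        show "0 < (\<Sum>k<m. ?c ((\<pi> ^^ k) i) ((\<pi> ^^ Suc k) i))"
        proof (rule pc[of m "\<lambda>k. xs ! (\<pi> ^^ k) i"])
          show "xs ! (\<pi> ^^ k) i \<in> set xs" for k using iS[of k] S(2) by (auto simp: n_def)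
          show "edge (xs ! (\<pi> ^^ k) i) (xs ! (\<pi> ^^ Suc k) i)" for k using True iS[of k] by simp
        qed (use m in simp_all)
      qed
      then have "pos (Poly_Mapping.single (\<Sum>i\<in>S. ?c i (\<pi> i)) (1::int))" by (simp add: pos_def)
      then show ?thesis unfolding p by (cases "even (card S)") (simp_all add: pos_uminus)
    qed
    moreover have "pos ((\<Prod>i\<in>{0..<n} - S. 1 - A i i) - 1)"
      by (rule unit_prod) (use diag in simp)
    ultimately have "pos (\<Prod>i = 0..<n. ?M $$ (i, \<pi> i))" unfolding e by (rule pos_mult_unit)
    then show ?thesis by (cases "sign \<pi> = 1") (auto simp: sign_def pos_uminus)
  qed
  have "id \<in> ?P" by (simp add: permutes_id)
  then have 1: "det ?M - 1 = (?t id - 1) + (\<Sum>\<pi>\<in>?P - {id}. ?t \<pi>)"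
    unfolding det by (subst sum.remove[of ?P id]) (simp_all add: finite_permutations algebra_simps)
  have 2: "pos (?t id - 1)"
  proof -
    have "?t id = (\<Prod>i = 0..<n. 1 - A i i)" by (simp add: M)
    then show ?thesis using unit_prod[of "{0..<n}" "\<lambda>i. 1 - A i i"] diag by simp
  qed
  have "pos (\<Sum>\<pi>\<in>?P - {id}. ?t \<pi>)" by (rule pos_sum) (use pos_t in simp)
  from pos_add[OF 2 this] show ?thesis unfolding 1 .
qed

section \<open>The class of a projection in the cokernel\<close>

context shift_graph
begin

text \<open>The end vertex recovered from the edges. It is meaningful for nonempty paths, which is
  why levels start at 1.\<close>

definition tgt :: "'e list \<Rightarrow> 'v" where
  "tgt \<kappa> = head E (last \<kappa>)"

definition paths :: "nat \<Rightarrow> 'e list set" where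
  "paths N = {\<kappa>. length \<kappa> = N \<and> epath E \<kappa> (tgt \<kappa>)}"

text \<open>The higher block graph: \<open>y\<close> is \<open>x\<close> moved on by one edge. At
  length one the overlap is empty and the second clause states that the two edges compose.\<close>

definition edge :: "'e list \<Rightarrow> 'e list \<Rightarrow> bool" where
  "edge x y \<longleftrightarrow> tl x = butlast y \<and> tgt x = tail E (last y)"

lemma epath_tgt: "epath E \<kappa> v \<Longrightarrow> \<kappa> \<noteq> [] \<Longrightarrow> v = tgt \<kappa>"
  by (induction \<kappa>) (auto simp: tgt_def)

lemma epath_append:
  "epath E (p @ \<eta>) w \<longleftrightarrow> epath E p (pstart E \<eta> w) \<and> epath E \<eta> w"
proof (induction p)
  case Nil
  then show ?case using epath_pstart by auto
next
  case (Cons e p)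
  have "pstart E (p @ \<eta>) w = pstart E p (pstart E \<eta> w)" by (cases p) auto
  with Cons show ?case by auto
qed

lemma pstart_append: "pstart E (p @ \<eta>) w = pstart E p (pstart E \<eta> w)"
  by (cases p) auto

lemma finite_paths: "finite (paths N)"
proof -
  have "paths N \<subseteq> {q. set q \<subseteq> arcs E \<and> length q = N}"
    using epath_arcs by (auto simp: paths_def)
  then show ?thesis by (rule finite_subset) (rule finite_lists_length_eq[OF finite_arcs])
qed

lemma bb_isometry:
  "mm (tr (bb v s t)) (bb v s t) = dg (cyl v t)" "mm (bb v s t) (tr (bb v s t)) = dg (cyl v s)"
  by (simp_all add: tr_bb bb_bb bb_diag)

lemma mm_dg_mm_dg: "Z \<subseteq> Y \<Longrightarrow> mm (mm u (dg Y)) (dg Z) = mm u (dg Z)"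
  by (auto simp: mm_dg fun_eq_iff)

lemma sublabels_iff:
  "(v, j, q) \<in> sublabels M Y \<longleftrightarrow> epath E q v \<and> length q = M \<and> cyl v (j, q) \<subseteq> Y"
  by (auto simp: sublabels_def labels_def lcyl_def)

lemma cylindrical_sublabel:
  assumes "cylindrical M Y" "epath E q v" "length q = M" "c \<in> cyl v (j, q)" "c \<in> Y"
  shows "(v, j, q) \<in> sublabels M Y"
proof -
  obtain t where t: "t \<in> sublabels M Y" "c \<in> lcyl t"
    using assms(1,5) unfolding cylindrical_def by blast
  obtain v' j' q' where t': "t = (v', j', q')" by (cases t)
  have "c \<in> cyl v' (j', q')" "length q' = M" using t unfolding t' by (auto simp: lcyl_def sublabels_iff)
  then have "v = v' \<and> j = j' \<and> q = q'"
    using cyl_disjoint[of q q' v j v' j'] assms(3,4) by blast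
  with t t' show ?thesis by simp
qed

end

section \<open>Homogeneity at sufficiently high levels\<close>

context graded
begin

lemma hom_restrict:
  assumes "u \<in> stein E" "hmg d u" "dg Y \<in> stein E"
  shows "hmg d (mm u (dg Y))"
  using hom_mm[OF assms(1,3,2) hom_proj[OF assms(3)]] by simp

lemma hom_extend:
  assumes h: "hmg d (bb v (i, p) (j, q))" and p: "epath E p v" and q: "epath E q v"
    and \<eta>: "epath E \<eta> w" "pstart E \<eta> w = v"
  shows "hmg d (bb w (i, p @ \<eta>) (j, q @ \<eta>))"
proof -
  have "epath E (q @ \<eta>) w" using q \<eta> by (simp add: epath_append)
  from hom_restrict[OF bb_stein[OF p q] h cyl_stein[OF this, of j]]
  show ?thesis unfolding bb_extend[OF \<eta>] .
qed

lemma hom_bb_bb: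
  assumes "hmg d (bb v (i, p) (j, q))" "hmg d' (bb v (j, q) (k, r))"
    "epath E p v" "epath E q v" "epath E r v"
  shows "hmg (d + d') (bb v (i, p) (k, r))"
  using hom_mm[OF bb_stein[OF assms(3,4)] bb_stein[OF assms(4,5)] assms(1,2)] by (simp add: bb_bb)

lemma bb_nonzero: "v \<in> verts E \<Longrightarrow> bb v s t \<noteq> 0"
proof
  assume v: "v \<in> verts E" and 0: "bb v s t = 0"
  have "mm (tr 0) (0 :: 'e pt imat) = 0" by (simp add: mm_def fun_eq_iff)
  then have "dg (cyl v t) = 0" using bb_isometry(1)[of v s t] unfolding 0 by simp
  then show False using cyl_nonempty[OF v] by simp
qed

lemma hom_bb_unique:
  assumes "hmg d (bb v (i, p) (j, q))" "hmg d' (bb v (i, p) (j, q))" "epath E p v" "epath E q v"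
  shows "d = d'"
  using hom_unique[OF bb_stein[OF assms(3,4)] assms(1,2)] bb_nonzero[OF epath_verts[OF assms(3)]] by blast

text \<open>The source of \<open>s_p s_q*\<close> splits into finitely many projections on which it
  is homogeneous. From some level on these are unions of cylinders, so every smaller cylinder lies
  inside one of them.\<close>

lemma eventually_homogeneous:
  assumes p: "epath E p v" and q: "epath E q v"
  shows "\<exists>M. \<forall>\<eta> w. epath E \<eta> w \<longrightarrow> pstart E \<eta> w = v \<longrightarrow> M \<le> length \<eta>
    \<longrightarrow> (\<exists>d. hmg d (bb w (i, p @ \<eta>) (j, q @ \<eta>)))"
proof -
  let ?u = "bb v (i, p) (j, q)"
  have u: "?u \<in> stein E" by (rule bb_stein[OF p q])
  have "isproj (mm (tr ?u) ?u)" by (simp add: bb_isometry)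
  from hom_decomp[OF u this] obtain D Q where D: "finite D"
    "\<And>d. d \<in> D \<Longrightarrow> Q d \<in> stein E \<and> isproj (Q d) \<and> hmg d (mm ?u (Q d))"
    "(\<Sum>d\<in>D. Q d) = dg (cyl v (j, q))"
    unfolding bb_isometry by blast
  have "\<forall>d\<in>D. \<exists>Y M0. Q d = dg Y \<and> (\<forall>M\<ge>M0. cylindrical M Y)"
    using D(2) isproj_stein stein_cylindrical by metis
  then obtain Y M0 where YM: "\<And>d. d \<in> D \<Longrightarrow> Q d = dg (Y d)"
    "\<And>d M. d \<in> D \<Longrightarrow> M0 d \<le> M \<Longrightarrow> cylindrical M (Y d)" by metis
  define M where "M = Max (insert 0 (M0 ` D))"
  have M: "M0 d \<le> M" if "d \<in> D" for d
    unfolding M_def using that D(1) by (intro Max_ge) auto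
  have "\<exists>d. hmg d (bb w (i, p @ \<eta>) (j, q @ \<eta>))"
    if \<eta>: "epath E \<eta> w" "pstart E \<eta> w = v" "M \<le> length \<eta>" for \<eta> w
  proof -
    have q\<eta>: "epath E (q @ \<eta>) w" using q \<eta> by (simp add: epath_append)
    obtain c where c: "c \<in> cyl w (j, q @ \<eta>)" using cyl_nonempty[OF epath_verts[OF q\<eta>]] by blast
    then have "c \<in> cyl v (j, q)" using cyl_append_subset[OF \<eta>(1,2)] by blast
    \<comment> \<open>The pieces \<open>Q d\<close> add up to the source projection, so the point
      \<open>c\<close> lies in at least one of them.\<close>
    then have "(\<Sum>d\<in>D. Q d c c) = 1"
      using fun_cong[OF fun_cong[OF D(3), of c], of c] by (simp add: sum_fun_apply dg_def)
    then obtain d where d: "d \<in> D" "Q d c c \<noteq> 0" by (metis (no_types, lifting) sum.neutral zero_neq_one)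
    then have "c \<in> Y d" using YM(1)[OF d(1)] by (auto simp: dg_def split: if_splits)
    moreover have "cylindrical (length (q @ \<eta>)) (Y d)"
      using YM(2)[OF d(1)] M[OF d(1)] \<eta>(3) by simp
    ultimately have "(w, j, q @ \<eta>) \<in> sublabels (length (q @ \<eta>)) (Y d)"
      using cylindrical_sublabel[OF _ q\<eta> refl c] by blast
    then have sub: "cyl w (j, q @ \<eta>) \<subseteq> Y d" by (simp add: sublabels_iff)
    have m: "mm ?u (Q d) \<in> stein E" "hmg d (mm ?u (Q d))"
      using stein_mm[OF u] D(2)[OF d(1)] by blast+
    have "hmg d (mm (mm ?u (Q d)) (dg (cyl w (j, q @ \<eta>))))"
      by (rule hom_restrict[OF m cyl_stein[OF q\<eta>]])
    then have "hmg d (bb w (i, p @ \<eta>) (j, q @ \<eta>))"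
      unfolding YM(1)[OF d(1)] mm_dg_mm_dg[OF sub] bb_extend[OF \<eta>(1,2)] .
    then show ?thesis ..
  qed
  then show ?thesis by blast
qed

text \<open>\<open>bb (tgt \<eta>) (0, e # \<eta>) (0, \<eta>)\<close> prepends \<open>e\<close> to
  the paths that begin with \<eta>. At a good level the next \<open>N\<close> edges decide with
  which degree this happens.\<close>

definition good_level :: "nat \<Rightarrow> bool" where
  "good_level N \<longleftrightarrow> 1 \<le> N \<and> (\<forall>e \<eta>. \<eta> \<in> paths N \<longrightarrow> e \<in> arcs E \<longrightarrow> pstart E \<eta> (tgt \<eta>) = head E e
    \<longrightarrow> (\<exists>d. hmg d (bb (tgt \<eta>) (0, e # \<eta>) (0, \<eta>))))"

lemma ex_good_level: "\<exists>N. good_level N"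
proof -
  have "\<forall>e\<in>arcs E. \<exists>M. \<forall>\<eta> w. epath E \<eta> w \<longrightarrow> pstart E \<eta> w = head E e \<longrightarrow> M \<le> length \<eta>
    \<longrightarrow> (\<exists>d. hmg d (bb w (0, [e] @ \<eta>) (0, [] @ \<eta>)))"
    by (intro ballI eventually_homogeneous) auto
  then obtain m where m: "\<And>e \<eta> w. e \<in> arcs E \<Longrightarrow> epath E \<eta> w \<Longrightarrow> pstart E \<eta> w = head E e \<Longrightarrow> m e \<le> length \<eta>
    \<Longrightarrow> \<exists>d. hmg d (bb w (0, e # \<eta>) (0, \<eta>))" by (metis append_Cons append_Nil)
  define N where "N = Max (insert 1 (m ` arcs E))"
  have "1 \<le> N" unfolding N_def by (intro Max_ge) auto
  moreover have "m e \<le> N" if "e \<in> arcs E" for e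
    unfolding N_def using that by (intro Max_ge) auto
  ultimately have "good_level N" unfolding good_level_def using m by (auto simp: paths_def)
  then show ?thesis ..
qed

end

section \<open>Edge weights and the cokernel\<close>

locale graded_level = graded E hmg for E :: "('v, 'e) pre_digraph" and hmg +
  fixes N :: nat
  assumes good: "good_level N"
begin

lemma N_pos: "1 \<le> N" using good by (simp add: good_level_def)

text \<open>The last \<open>N\<close> edges are the type of a cylinder: it is equivalent to the
  cylinder of these edges in block 0 by the exchange of prefixes.\<close>

definition lst :: "'e list \<Rightarrow> 'e list" where
  "lst \<kappa> = drop (length \<kappa> - N) \<kappa>"

lemma lst_append: "N \<le> length \<eta> \<Longrightarrow> lst (p @ \<eta>) = lst \<eta>"
  by (simp add: lst_def)

lemma lst_id: "length \<kappa> = N \<Longrightarrow> lst \<kappa> = \<kappa>"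
  by (simp add: lst_def)

lemma length_lst: "N \<le> length \<kappa> \<Longrightarrow> length (lst \<kappa>) = N"
  by (simp add: lst_def)

lemma epath_lst: "epath E \<kappa> v \<Longrightarrow> epath E (lst \<kappa>) v"
  unfolding lst_def by (metis append_take_drop_id epath_append)

lemma lst_snoc:
  assumes "N \<le> length \<kappa>"
  shows "lst (\<kappa> @ [f]) = tl (lst \<kappa>) @ [f]"
proof -
  have "Suc (length \<kappa>) - N = Suc (length \<kappa> - N)" using assms by simp
  then have "lst (\<kappa> @ [f]) = drop (Suc (length \<kappa> - N)) (\<kappa> @ [f])" by (simp add: lst_def)
  also have "\<dots> = drop (Suc (length \<kappa> - N)) \<kappa> @ [f]" using assms N_pos by simp
  finally show ?thesis by (simp add: lst_def drop_Suc tl_drop)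
qed

text \<open>The weight of the step from \<open>butlast (e # \<eta>)\<close> to \<eta> in the higher
  block graph, namely the degree of prepending \<open>e\<close>. Uniqueness of degrees justifies the
  \<open>THE\<close>.\<close>

definition cc :: "'e \<Rightarrow> 'e list \<Rightarrow> int" where
  "cc e \<eta> = (THE d. hmg d (bb (tgt \<eta>) (0, e # \<eta>) (0, \<eta>)))"

lemma cc:
  assumes "\<eta> \<in> paths N" "e \<in> arcs E" "pstart E \<eta> (tgt \<eta>) = head E e"
  shows "hmg (cc e \<eta>) (bb (tgt \<eta>) (0, e # \<eta>) (0, \<eta>))"
proof -
  obtain d where d: "hmg d (bb (tgt \<eta>) (0, e # \<eta>) (0, \<eta>))"
    using good assms unfolding good_level_def by blast
  have "epath E \<eta> (tgt \<eta>)" using assms(1) by (simp add: paths_def)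
  moreover from this have "epath E (e # \<eta>) (tgt \<eta>)" using assms by simp
  ultimately have "cc e \<eta> = d"
    unfolding cc_def by (intro the_equality d) (rule hom_bb_unique[OF _ d])
  with d show ?thesis by simp
qed

definition homog :: "'v \<times> nat \<times> 'e list \<Rightarrow> bool" where
  "homog t = (case t of (v, i, \<kappa>) \<Rightarrow> epath E \<kappa> v \<and> N \<le> length \<kappa> \<and> (\<exists>d. hmg d (bb v (i, \<kappa>) (0, lst \<kappa>))))"

text \<open>The degree of the equivalence between a cylinder and its type; it becomes the exponent
  of t in the class of the cylinder.\<close>

definition dgr :: "'v \<times> nat \<times> 'e list \<Rightarrow> int" where
  "dgr t = (case t of (v, i, \<kappa>) \<Rightarrow> THE d. hmg d (bb v (i, \<kappa>) (0, lst \<kappa>)))"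

lemma dgr_eq:
  assumes "hmg d (bb v (i, \<kappa>) (0, lst \<kappa>))" "epath E \<kappa> v"
  shows "dgr (v, i, \<kappa>) = d"
  unfolding dgr_def prod.case
  by (intro the_equality assms(1)) (rule hom_bb_unique[OF _ assms(1) assms(2) epath_lst[OF assms(2)]])

lemma homog_dgr:
  assumes "homog (v, i, \<kappa>)"
  shows "hmg (dgr (v, i, \<kappa>)) (bb v (i, \<kappa>) (0, lst \<kappa>))"
  using assms dgr_eq unfolding homog_def by auto

text \<open>The first edges are removed one at a time, each with a weight \<open>cc\<close>, as long
  as \<open>N\<close> edges remain behind the removed one. At length \<open>N\<close> the path is
  its own type and the degree is that of a projection.\<close>

lemma homog_path:
  assumes "epath E \<kappa> v" "N \<le> length \<kappa>"
  shows "homog (v, 0, \<kappa>)"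
  using assms
proof (induction \<kappa>)
  case Nil
  then show ?case using N_pos by simp
next
  case (Cons e \<kappa>)
  show ?case
  proof (cases "N \<le> length \<kappa>")
    case False
    then have l: "lst (e # \<kappa>) = e # \<kappa>" using Cons.prems by (intro lst_id) simp
    have "hmg 0 (bb v (0, e # \<kappa>) (0, e # \<kappa>))"
      unfolding bb_diag by (rule hom_proj[OF cyl_stein[OF Cons.prems(1)]]) simp
    then show ?thesis using Cons.prems l by (auto simp: homog_def)
  next
    case True
    have \<kappa>: "epath E \<kappa> v" "e \<in> arcs E" "head E e = pstart E \<kappa> v" using Cons.prems by auto
    obtain \<eta> \<zeta> where \<eta>: "\<kappa> = \<eta> @ \<zeta>" "length \<eta> = N"
      using True by (metis append_take_drop_id length_take min_absorb2)
    have \<eta>ne: "\<eta> \<noteq> []" using \<eta>(2) N_pos by auto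
    have e\<eta>: "epath E \<eta> (pstart E \<zeta> v)" "epath E \<zeta> v" using \<kappa>(1) by (auto simp: \<eta>(1) epath_append)
    have t: "pstart E \<zeta> v = tgt \<eta>" by (rule epath_tgt[OF e\<eta>(1) \<eta>ne])
    have pe: "pstart E \<eta> (tgt \<eta>) = head E e" using \<kappa>(3) by (simp add: \<eta>(1) pstart_append t)
    have \<eta>P: "\<eta> \<in> paths N" using e\<eta>(1) \<eta>(2) by (simp add: paths_def t)
    have "epath E (e # \<eta>) (tgt \<eta>)" using e\<eta>(1) pe \<kappa>(2) t by simp
    from hom_extend[OF cc[OF \<eta>P \<kappa>(2) pe] this e\<eta>(1)[unfolded t] e\<eta>(2) t]
    have 1: "hmg (cc e \<eta>) (bb v (0, e # \<kappa>) (0, \<kappa>))" by (simp add: \<eta>(1))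
    obtain d where 2: "hmg d (bb v (0, \<kappa>) (0, lst \<kappa>))" using Cons.IH[OF \<kappa>(1) True] by (auto simp: homog_def)
    have l: "lst (e # \<kappa>) = lst \<kappa>" using lst_append[OF True, of "[e]"] by simp
    from hom_bb_bb[OF 1 2 Cons.prems(1) \<kappa>(1) epath_lst[OF \<kappa>(1)]]
    show ?thesis using Cons.prems l by (auto simp: homog_def)
  qed
qed

text \<open>\<open>good_level\<close> concerns block 0 only. The passage from block \<open>i\<close>
  to block 0 is homogeneous on long paths by \<open>eventually_homogeneous\<close>, with a bound
  that depends on \<open>i\<close>.\<close>

lemma ex_homog: "\<exists>M. \<forall>v \<kappa>. epath E \<kappa> v \<longrightarrow> M \<le> length \<kappa> \<longrightarrow> homog (v, i, \<kappa>)"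
proof -
  have "\<forall>v\<in>verts E. \<exists>M. \<forall>\<eta> w. epath E \<eta> w \<longrightarrow> pstart E \<eta> w = v \<longrightarrow> M \<le> length \<eta>
    \<longrightarrow> (\<exists>d. hmg d (bb w (i, [] @ \<eta>) (0, [] @ \<eta>)))"
    by (intro ballI eventually_homogeneous) auto
  then obtain m where m: "\<And>v \<eta> w. v \<in> verts E \<Longrightarrow> epath E \<eta> w \<Longrightarrow> pstart E \<eta> w = v \<Longrightarrow> m v \<le> length \<eta>
    \<Longrightarrow> \<exists>d. hmg d (bb w (i, \<eta>) (0, \<eta>))" by (metis append_Nil)
  define M where "M = Max (insert N (m ` verts E))"
  have NM: "N \<le> M" unfolding M_def by (intro Max_ge) auto
  have mM: "m v \<le> M" if "v \<in> verts E" for v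
    unfolding M_def using that by (intro Max_ge) auto
  have "homog (v, i, \<kappa>)" if \<kappa>: "epath E \<kappa> v" "M \<le> length \<kappa>" for v \<kappa>
  proof -
    have vs: "pstart E \<kappa> v \<in> verts E" by (rule epath_pstart[OF \<kappa>(1)])
    obtain d where 1: "hmg d (bb v (i, \<kappa>) (0, \<kappa>))"
      using m[OF vs \<kappa>(1) refl] mM[OF vs] \<kappa>(2) by auto
    have h: "homog (v, 0, \<kappa>)" using homog_path[OF \<kappa>(1)] \<kappa>(2) NM by simp
    from hom_bb_bb[OF 1 homog_dgr[OF h] \<kappa>(1) \<kappa>(1) epath_lst[OF \<kappa>(1)]]
    show ?thesis using \<kappa> NM by (auto simp: homog_def)
  qed
  then show ?thesis by blast
qed

text \<open>Appending \<open>f\<close> changes the type from \<open>e # \<nu>\<close> to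
  \<open>\<nu> @ [f]\<close>. Between \<open>e # \<nu> @ [f]\<close> and the new type there is one
  more edge to remove, and its weight is added to the degree.\<close>

lemma homog_snoc:
  assumes h: "homog (v, i, \<kappa>)" and f: "f \<in> out_arcs E v"
  shows "homog (head E f, i, \<kappa> @ [f])"
    and "dgr (head E f, i, \<kappa> @ [f]) = dgr (v, i, \<kappa>) + cc (hd (lst \<kappa>)) (tl (lst \<kappa>) @ [f])"
proof -
  have \<kappa>: "epath E \<kappa> v" "N \<le> length \<kappa>" using h by (auto simp: homog_def)
  have f': "epath E [f] (head E f)" "pstart E [f] (head E f) = v" using f by auto
  have \<kappa>f: "epath E (\<kappa> @ [f]) (head E f)" using \<kappa>(1) f' by (simp add: epath_append)
  have l: "epath E (lst \<kappa>) v" "length (lst \<kappa>) = N" using epath_lst[OF \<kappa>(1)] length_lst[OF \<kappa>(2)] by auto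
  obtain e \<nu> where e\<nu>: "lst \<kappa> = e # \<nu>" using l(2) N_pos by (cases "lst \<kappa>") auto
  let ?x = "\<nu> @ [f]"
  have lf: "lst (\<kappa> @ [f]) = ?x" using lst_snoc[OF \<kappa>(2)] e\<nu> by simp
  have 1: "hmg (dgr (v, i, \<kappa>)) (bb (head E f) (i, \<kappa> @ [f]) (0, e # ?x))"
    using hom_extend[OF homog_dgr[OF h] \<kappa>(1) l(1) f'] by (simp add: e\<nu>)
  have tx: "tgt ?x = head E f" by (simp add: tgt_def)
  have ex: "epath E (e # ?x) (head E f)"
    using l(1) f' epath_append[of "lst \<kappa>" "[f]" "head E f"] by (simp add: e\<nu>)
  then have ex': "epath E ?x (head E f)" "e \<in> arcs E" "pstart E ?x (head E f) = head E e" by simp_all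
  have "?x \<in> paths N" using ex'(1) l(2) tx by (simp add: paths_def e\<nu>)
  from cc[OF this ex'(2)] ex'(3) have 2: "hmg (cc e ?x) (bb (head E f) (0, e # ?x) (0, ?x))" by (simp add: tx)
  have 3: "hmg (dgr (v, i, \<kappa>) + cc e ?x) (bb (head E f) (i, \<kappa> @ [f]) (0, lst (\<kappa> @ [f])))"
    unfolding lf by (rule hom_bb_bb[OF 1 2 \<kappa>f ex ex'(1)])
  then show "homog (head E f, i, \<kappa> @ [f])" using \<kappa>f \<kappa>(2) by (auto simp: homog_def)
  show "dgr (head E f, i, \<kappa> @ [f]) = dgr (v, i, \<kappa>) + cc (hd (lst \<kappa>)) (tl (lst \<kappa>) @ [f])"
    using dgr_eq[OF 3 \<kappa>f] by (simp add: e\<nu>)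
qed

definition wt :: "'e list \<Rightarrow> 'e list \<Rightarrow> laurent" where
  "wt x y = (if edge x y then Poly_Mapping.single (cc (hd x) y) 1 else 0)"

definition M1 :: "'e list \<Rightarrow> 'e list \<Rightarrow> laurent" where
  "M1 x y = idf x y - wt x y"

text \<open>Equality in the cokernel of \<open>M1\<close> acting on row vectors: the difference is a
  combination of rows of \<open>M1\<close> with Laurent coefficients. Only the coordinates in
  \<open>paths N\<close> are compared.\<close>

definition vcong :: "('e list \<Rightarrow> laurent) \<Rightarrow> ('e list \<Rightarrow> laurent) \<Rightarrow> bool" (infix "\<sim>" 50) where
  "v \<sim> w \<longleftrightarrow> (\<exists>z. \<forall>y\<in>paths N. v y - w y = (\<Sum>x\<in>paths N. z x * M1 x y))"

lemma vcong_refl: "v \<sim> v"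
  unfolding vcong_def by (intro exI[of _ "\<lambda>_. 0"]) simp

lemma vcong_sym: "v \<sim> w \<Longrightarrow> w \<sim> v"
proof -
  assume "v \<sim> w"
  then obtain z where "\<forall>y\<in>paths N. v y - w y = (\<Sum>x\<in>paths N. z x * M1 x y)" by (auto simp: vcong_def)
  then have "\<forall>y\<in>paths N. w y - v y = (\<Sum>x\<in>paths N. (- z x) * M1 x y)"
    by (simp add: sum_negf) (metis minus_diff_eq)
  then show ?thesis unfolding vcong_def by (intro exI[of _ "\<lambda>x. - z x"])
qed

lemma vcong_add: "v \<sim> w \<Longrightarrow> v' \<sim> w' \<Longrightarrow> v + v' \<sim> w + w'"
proof -
  assume "v \<sim> w" "v' \<sim> w'"
  then obtain z z' where z: "\<forall>y\<in>paths N. v y - w y = (\<Sum>x\<in>paths N. z x * M1 x y)"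
    "\<forall>y\<in>paths N. v' y - w' y = (\<Sum>x\<in>paths N. z' x * M1 x y)" by (auto simp: vcong_def)
  have "\<forall>y\<in>paths N. (v + v') y - (w + w') y = (\<Sum>x\<in>paths N. (z x + z' x) * M1 x y)"
  proof
    fix y assume y: "y \<in> paths N"
    have "(v + v') y - (w + w') y = (v y - w y) + (v' y - w' y)" by simp
    also have "\<dots> = (\<Sum>x\<in>paths N. (z x + z' x) * M1 x y)"
      using z y by (simp add: distrib_right sum.distrib)
    finally show "(v + v') y - (w + w') y = (\<Sum>x\<in>paths N. (z x + z' x) * M1 x y)" .
  qed
  then show ?thesis unfolding vcong_def by (intro exI[of _ "\<lambda>x. z x + z' x"])
qed

lemma vcong_trans [trans]: "u \<sim> v \<Longrightarrow> v \<sim> w \<Longrightarrow> u \<sim> w"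
proof -
  assume "u \<sim> v" "v \<sim> w"
  from vcong_add[OF this] show "u \<sim> w" unfolding vcong_def by (simp add: algebra_simps)
qed

lemma vcong_sum: "(\<And>t. t \<in> T \<Longrightarrow> v t \<sim> w t) \<Longrightarrow> (\<Sum>t\<in>T. v t) \<sim> (\<Sum>t\<in>T. w t)"
  by (induction T rule: infinite_finite_induct) (auto intro: vcong_refl vcong_add)

definition smul :: "int \<Rightarrow> ('e list \<Rightarrow> laurent) \<Rightarrow> 'e list \<Rightarrow> laurent" where
  "smul d v = (\<lambda>y. Poly_Mapping.single d 1 * v y)"

lemma vcong_smul: "v \<sim> w \<Longrightarrow> smul d v \<sim> smul d w"
proof -
  assume "v \<sim> w"
  then obtain z where z: "\<forall>y\<in>paths N. v y - w y = (\<Sum>x\<in>paths N. z x * M1 x y)" by (auto simp: vcong_def)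
  then have "\<forall>y\<in>paths N. smul d v y - smul d w y = (\<Sum>x\<in>paths N. (Poly_Mapping.single d 1 * z x) * M1 x y)"
    by (simp add: smul_def right_diff_distrib[symmetric] sum_distrib_left mult.assoc)
  then show ?thesis unfolding vcong_def by (intro exI[of _ "\<lambda>x. Poly_Mapping.single d 1 * z x"])
qed

lemma smul_smul: "smul d (smul d' v) = smul (d + d') v"
  by (simp add: smul_def mult.assoc[symmetric] mult_single)

text \<open>The class of a single cylinder: the basis vector of its type, multiplied by t to the
  power of its degree.\<close>

definition lvec :: "'v \<times> nat \<times> 'e list \<Rightarrow> 'e list \<Rightarrow> laurent" where
  "lvec t = smul (dgr t) (idf (lst (snd (snd t))))"

lemma wt_sum:
  assumes x: "x \<in> paths N" and y: "y \<in> paths N"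
  shows "wt x y = (\<Sum>f\<in>out_arcs E (tgt x). Poly_Mapping.single (cc (hd x) (tl x @ [f])) 1 * idf (tl x @ [f]) y)"
proof -
  have yne: "y \<noteq> []" using y N_pos by (auto simp: paths_def)
  have ly: "last y \<in> arcs E"
    using y epath_arcs[of y "tgt y"] yne by (auto simp: paths_def)
  have "(\<Sum>f\<in>out_arcs E (tgt x). Poly_Mapping.single (cc (hd x) (tl x @ [f])) 1 * idf (tl x @ [f]) y :: laurent)
      = (\<Sum>f\<in>out_arcs E (tgt x). if f = last y then (if tl x = butlast y then Poly_Mapping.single (cc (hd x) y) 1 else 0) else 0)"
  proof (rule sum.cong[OF refl])
    fix f
    have "tl x @ [f] = y \<longleftrightarrow> f = last y \<and> tl x = butlast y" using yne by (metis append_butlast_last_id butlast_snoc last_snoc)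
    then show "Poly_Mapping.single (cc (hd x) (tl x @ [f])) 1 * idf (tl x @ [f]) y
      = (if f = last y then (if tl x = butlast y then Poly_Mapping.single (cc (hd x) y) 1 else 0) else (0::laurent))"
      by (auto simp: idf_def)
  qed
  also have "\<dots> = (if last y \<in> out_arcs E (tgt x) then (if tl x = butlast y then Poly_Mapping.single (cc (hd x) y) 1 else 0) else 0)"
    by (simp add: finite_out)
  also have "\<dots> = wt x y" using ly by (auto simp: wt_def edge_def)
  finally show ?thesis ..
qed

text \<open>Subdividing a cylinder by the next edge changes the vector by t^d times the row of
  \<open>M1\<close> that belongs to its type. This is where 1 - A_c comes from: its rows are the
  relations that make classes independent of the level.\<close>

lemma lvec_split:
  assumes h: "homog (v, i, \<kappa>)"
  shows "lvec (v, i, \<kappa>) \<sim> (\<Sum>f\<in>out_arcs E v. lvec (head E f, i, \<kappa> @ [f]))"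
proof -
  let ?x = "lst \<kappa>" and ?d = "dgr (v, i, \<kappa>)"
  have \<kappa>: "epath E \<kappa> v" "N \<le> length \<kappa>" using h by (auto simp: homog_def)
  have xne: "?x \<noteq> []" using length_lst[OF \<kappa>(2)] N_pos by auto
  have v: "v = tgt ?x" by (rule epath_tgt[OF epath_lst[OF \<kappa>(1)] xne])
  have x: "?x \<in> paths N" using epath_lst[OF \<kappa>(1)] length_lst[OF \<kappa>(2)] v by (simp add: paths_def)
  have "lvec (v, i, \<kappa>) y - (\<Sum>f\<in>out_arcs E v. lvec (head E f, i, \<kappa> @ [f])) y
      = (\<Sum>x\<in>paths N. (if x = ?x then Poly_Mapping.single ?d 1 else 0) * M1 x y)" if y: "y \<in> paths N" for y
  proof -
    have "(\<Sum>f\<in>out_arcs E v. lvec (head E f, i, \<kappa> @ [f])) y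
        = (\<Sum>f\<in>out_arcs E v. Poly_Mapping.single ?d 1 *
            (Poly_Mapping.single (cc (hd ?x) (tl ?x @ [f])) 1 * idf (tl ?x @ [f]) y))"
      unfolding sum_fun_apply
      by (rule sum.cong[OF refl])
         (simp add: lvec_def smul_def homog_snoc(2)[OF h] lst_snoc[OF \<kappa>(2)] mult.assoc[symmetric] mult_single)
    also have "\<dots> = Poly_Mapping.single ?d 1 * wt ?x y"
      unfolding wt_sum[OF x y] v[symmetric] by (rule sum_distrib_left[symmetric])
    finally have "lvec (v, i, \<kappa>) y - (\<Sum>f\<in>out_arcs E v. lvec (head E f, i, \<kappa> @ [f])) y
        = Poly_Mapping.single ?d 1 * M1 ?x y"
      by (simp add: lvec_def smul_def M1_def right_diff_distrib)
    also have "\<dots> = (\<Sum>x\<in>paths N. if x = ?x then Poly_Mapping.single ?d 1 * M1 x y else 0)"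
      using x finite_paths by simp
    also have "\<dots> = (\<Sum>x\<in>paths N. (if x = ?x then Poly_Mapping.single ?d 1 else 0) * M1 x y)"
      by (rule sum.cong) auto
    finally show ?thesis .
  qed
  then show ?thesis
    unfolding vcong_def by (intro exI[of _ "\<lambda>x. if x = ?x then Poly_Mapping.single ?d 1 else 0"] ballI)
qed

end

section \<open>Subdivision of cylinders\<close>

context shift_graph
begin

lemma lcyl_nonempty: "t \<in> labels M \<Longrightarrow> lcyl t \<noteq> {}"
  using cyl_nonempty epath_verts by (auto simp: labels_def lcyl_def)

lemma lcyl_disjoint:
  assumes "t \<in> labels M" "t' \<in> labels M" "c \<in> lcyl t" "c \<in> lcyl t'"
  shows "t = t'"
proof -
  obtain v j q v' j' q' where t: "t = (v, j, q)" "t' = (v', j', q')" by (cases t, cases t')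
  have "cyl v (j, q) \<inter> cyl v' (j', q') \<noteq> {}" using assms(3,4) by (auto simp: t lcyl_def)
  with cyl_disjoint[of q q' v j v' j'] show ?thesis using assms(1,2) by (simp add: t labels_def)
qed

lemma sublabels_labels: "t \<in> sublabels M Y \<Longrightarrow> t \<in> labels M" and
  sublabels_subset: "t \<in> sublabels M Y \<Longrightarrow> lcyl t \<subseteq> Y"
  by (auto simp: sublabels_def)

lemma cylindrical_in:
  assumes "cylindrical M Y" "t \<in> labels M" "c \<in> lcyl t" "c \<in> Y"
  shows "t \<in> sublabels M Y"
proof -
  obtain t' where t': "t' \<in> sublabels M Y" "c \<in> lcyl t'"
    using assms(1,4) unfolding cylindrical_def by blast
  with lcyl_disjoint[OF assms(2) sublabels_labels[OF t'(1)] assms(3)] show ?thesis by simp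
qed

definition child :: "('v \<times> nat \<times> 'e list) \<times> 'e \<Rightarrow> 'v \<times> nat \<times> 'e list" where
  "child = (\<lambda>((v, i, \<kappa>), f). (head E f, i, \<kappa> @ [f]))"

lemma sublabels_Suc:
  assumes "cylindrical M Y"
  shows "sublabels (Suc M) Y = child ` (SIGMA t:sublabels M Y. out_arcs E (fst t))"
proof (intro equalityI subsetI)
  fix t assume t: "t \<in> sublabels (Suc M) Y"
  obtain w i \<kappa>' where wi: "t = (w, i, \<kappa>')" by (cases t)
  have k: "epath E \<kappa>' w" "length \<kappa>' = Suc M" "cyl w (i, \<kappa>') \<subseteq> Y"
    using t by (auto simp: wi sublabels_iff)
  obtain \<kappa> f where \<kappa>: "\<kappa>' = \<kappa> @ [f]" using k(2) by (cases \<kappa>' rule: rev_cases) auto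
  have f: "epath E \<kappa> (tail E f)" "f \<in> arcs E" "head E f = w" using k(1) by (auto simp: \<kappa> epath_snoc)
  obtain c where c: "c \<in> cyl w (i, \<kappa>')" using cyl_nonempty[OF epath_verts[OF k(1)]] by blast
  have f': "epath E [f] w" "pstart E [f] w = tail E f" using f by auto
  have "c \<in> cyl (tail E f) (i, \<kappa>)" using cyl_append_subset[OF f'] c unfolding \<kappa> by blast
  then have "(tail E f, i, \<kappa>) \<in> sublabels M Y"
    using c k f by (intro cylindrical_in[OF assms, of _ c]) (auto simp: labels_def lcyl_def \<kappa>)
  moreover have "t = child ((tail E f, i, \<kappa>), f)" by (simp add: wi \<kappa> child_def f)
  ultimately show "t \<in> child ` (SIGMA t:sublabels M Y. out_arcs E (fst t))"
    using f(2) by (intro image_eqI[of _ _ "((tail E f, i, \<kappa>), f)"]) auto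
next
  fix t assume "t \<in> child ` (SIGMA t:sublabels M Y. out_arcs E (fst t))"
  then obtain v i \<kappa> f where *: "(v, i, \<kappa>) \<in> sublabels M Y" "f \<in> out_arcs E v" "t = (head E f, i, \<kappa> @ [f])"
    by (auto simp: child_def)
  have "cyl (head E f) (i, \<kappa> @ [f]) \<subseteq> cyl v (i, \<kappa>)"
    by (rule cyl_append_subset) (use *(2) in auto)
  with * show "t \<in> sublabels (Suc M) Y" by (auto simp: sublabels_iff epath_snoc)
qed

lemma child_inj_on: "inj_on child (SIGMA t:sublabels M Y. out_arcs E (fst t))"
proof (rule inj_onI)
  fix a b assume a: "a \<in> (SIGMA t:sublabels M Y. out_arcs E (fst t))"
    and b: "b \<in> (SIGMA t:sublabels M Y. out_arcs E (fst t))" and eq: "child a = child b"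
  obtain v i \<kappa> f v' i' \<kappa>' f' where ab: "a = ((v, i, \<kappa>), f)" "b = ((v', i', \<kappa>'), f')"
    by (metis prod.collapse)
  have "f \<in> out_arcs E v" "f' \<in> out_arcs E v'" using a b by (auto simp: ab)
  with eq show "a = b" by (auto simp: ab child_def)
qed

lemma cylindrical_Suc:
  assumes "cylindrical M Y"
  shows "cylindrical (Suc M) Y"
proof -
  have fin: "finite (sublabels M Y)" and Y: "Y = (\<Union>t\<in>sublabels M Y. lcyl t)"
    using assms by (auto simp: cylindrical_def)
  have "finite (sublabels (Suc M) Y)" unfolding sublabels_Suc[OF assms] using fin by auto
  moreover have "Y \<subseteq> (\<Union>t\<in>sublabels (Suc M) Y. lcyl t)"
  proof
    fix c assume "c \<in> Y"
    then obtain t where "t \<in> sublabels M Y" "c \<in> lcyl t" using Y by blast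
    then obtain v i \<kappa> where t: "(v, i, \<kappa>) \<in> sublabels M Y" "c \<in> cyl v (i, \<kappa>)"
      by (cases t) (auto simp: lcyl_def)
    then obtain f where f: "f \<in> out_arcs E v" "c \<in> cyl (head E f) (i, \<kappa> @ [f])"
      unfolding cyl_split[of v i \<kappa>] by blast
    have "child ((v, i, \<kappa>), f) \<in> sublabels (Suc M) Y"
      unfolding sublabels_Suc[OF assms] using t f by (intro imageI) auto
    then show "c \<in> (\<Union>t\<in>sublabels (Suc M) Y. lcyl t)"
      using f(2) by (intro UN_I[of "child ((v, i, \<kappa>), f)"]) (auto simp: child_def lcyl_def)
  qed
  ultimately show ?thesis unfolding cylindrical_def using sublabels_subset by blast
qed

lemma sum_sublabels_Suc:
  assumes "cylindrical M Y"
  shows "(\<Sum>t\<in>sublabels (Suc M) Y. g t) = (\<Sum>t\<in>sublabels M Y. \<Sum>f\<in>out_arcs E (fst t). g (child (t, f)))"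
proof -
  have fin: "finite (sublabels M Y)" using assms by (auto simp: cylindrical_def)
  have "(\<Sum>t\<in>sublabels (Suc M) Y. g t)
      = (\<Sum>x\<in>(SIGMA t:sublabels M Y. out_arcs E (fst t)). g (child x))"
    unfolding sublabels_Suc[OF assms] by (subst sum.reindex[OF child_inj_on]) simp
  also have "\<dots> = (\<Sum>t\<in>sublabels M Y. \<Sum>f\<in>out_arcs E (fst t). g (child (t, f)))"
    using sum.Sigma[of "sublabels M Y" "\<lambda>t. out_arcs E (fst t)" "\<lambda>t f. g (child (t, f))"] fin
    by (simp add: case_prod_unfold)
  finally show ?thesis .
qed

lemma cylindrical_Un:
  assumes "cylindrical M Y" "cylindrical M Y'"
  shows "cylindrical M (Y \<union> Y')" "sublabels M (Y \<union> Y') = sublabels M Y \<union> sublabels M Y'"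
proof -
  show *: "sublabels M (Y \<union> Y') = sublabels M Y \<union> sublabels M Y'"
  proof (intro equalityI subsetI)
    fix t assume t: "t \<in> sublabels M (Y \<union> Y')"
    obtain c where c: "c \<in> lcyl t" using lcyl_nonempty[OF sublabels_labels[OF t]] by blast
    then have "c \<in> Y \<or> c \<in> Y'" using sublabels_subset[OF t] by blast
    then show "t \<in> sublabels M Y \<union> sublabels M Y'"
      using cylindrical_in[OF assms(1) sublabels_labels[OF t] c]
        cylindrical_in[OF assms(2) sublabels_labels[OF t] c] by blast
  qed (auto simp: sublabels_def)
  show "cylindrical M (Y \<union> Y')"
    using assms unfolding cylindrical_def * by blast
qed

lemma sublabels_empty: "sublabels M {} = {}"
  using lcyl_nonempty by (auto simp: sublabels_def)

lemma sublabels_cyl: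
  assumes "epath E \<kappa> v"
  shows "sublabels (length \<kappa>) (cyl v (i, \<kappa>)) = {(v, i, \<kappa>)}"
proof (intro equalityI subsetI)
  fix t assume t: "t \<in> sublabels (length \<kappa>) (cyl v (i, \<kappa>))"
  obtain c where c: "c \<in> lcyl t" using lcyl_nonempty[OF sublabels_labels[OF t]] by blast
  have "(v, i, \<kappa>) \<in> labels (length \<kappa>)" using assms by (simp add: labels_def)
  moreover have "c \<in> lcyl (v, i, \<kappa>)" using sublabels_subset[OF t] c by (auto simp: lcyl_def)
  ultimately show "t \<in> {(v, i, \<kappa>)}" using lcyl_disjoint[OF sublabels_labels[OF t] _ c] by blast
qed (use assms in \<open>auto simp: sublabels_iff\<close>)

end

section \<open>The class of a compact open set\<close>

context graded_level
begin

text \<open>The levels at which \<open>Y\<close> is a finite union of cylinders that all have a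
  degree, so that its class is the sum of theirs.\<close>

definition adm :: "nat \<Rightarrow> 'e pt set \<Rightarrow> bool" where
  "adm M Y \<longleftrightarrow> cylindrical M Y \<and> N \<le> M \<and> (\<forall>t\<in>sublabels M Y. homog t)"

definition cls :: "nat \<Rightarrow> 'e pt set \<Rightarrow> 'e list \<Rightarrow> laurent" where
  "cls M Y = (\<Sum>t\<in>sublabels M Y. lvec t)"

text \<open>The bound for homogeneity depends on the block, but only finitely many blocks meet
  \<open>Y\<close>; they are read off at the level \<open>M1\<close>.\<close>

lemma ex_adm:
  assumes "dg Y \<in> stein E"
  shows "\<exists>M0. \<forall>M\<ge>M0. adm M Y"
proof -
  obtain M1 where M1: "\<And>M. M1 \<le> M \<Longrightarrow> cylindrical M Y" using stein_cylindrical[OF assms] by blast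
  obtain m where m: "\<And>i v \<kappa>. epath E \<kappa> v \<Longrightarrow> m i \<le> length \<kappa> \<Longrightarrow> homog (v, i, \<kappa>)"
    using ex_homog by metis
  define J where "J = (fst \<circ> snd) ` sublabels M1 Y"
  have J: "finite J" using M1[of M1] unfolding J_def cylindrical_def by simp
  define M0 where "M0 = Max (insert N (insert M1 (m ` J)))"
  have "x \<le> M0" if "x \<in> insert N (insert M1 (m ` J))" for x
    unfolding M0_def using J that by (intro Max_ge) simp_all
  then have le: "N \<le> M0" "M1 \<le> M0" "i \<in> J \<Longrightarrow> m i \<le> M0" for i by simp_all
  have "adm M Y" if M: "M0 \<le> M" for M
  proof -
    have "homog t" if t: "t \<in> sublabels M Y" for t
    proof -
      obtain v i \<kappa> where vi: "t = (v, i, \<kappa>)" by (cases t)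
      have k: "epath E \<kappa> v" "length \<kappa> = M" using t by (auto simp: vi sublabels_iff)
      obtain c where c: "c \<in> lcyl t" using lcyl_nonempty[OF sublabels_labels[OF t]] by blast
      then have "c \<in> Y" using sublabels_subset[OF t] by blast
      then obtain t' where t': "t' \<in> sublabels M1 Y" "c \<in> lcyl t'"
        using M1[of M1] unfolding cylindrical_def by blast
      have "fst c = i" using c by (auto simp: vi lcyl_def cyl_def)
      moreover have "fst c = fst (snd t')" using t'(2) by (auto simp: lcyl_def cyl_def)
      ultimately have "i \<in> J" using t'(1) by (auto simp: J_def)
      then show ?thesis unfolding vi using m[OF k(1)] le(3) k(2) M by fastforce
    qed
    then show ?thesis using M1 M le by (simp add: adm_def)
  qed
  then show ?thesis by blast
qed

lemma adm_Suc:
  assumes "adm M Y"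
  shows "adm (Suc M) Y" "cls M Y \<sim> cls (Suc M) Y"
proof -
  have cy: "cylindrical M Y" and h: "\<And>t. t \<in> sublabels M Y \<Longrightarrow> homog t" and NM: "N \<le> M"
    using assms by (auto simp: adm_def)
  have "homog t" if "t \<in> sublabels (Suc M) Y" for t
  proof -
    obtain v i \<kappa> f where *: "(v, i, \<kappa>) \<in> sublabels M Y" "f \<in> out_arcs E v" "t = (head E f, i, \<kappa> @ [f])"
      using \<open>t \<in> sublabels (Suc M) Y\<close> unfolding sublabels_Suc[OF cy] by (auto simp: child_def)
    show ?thesis unfolding *(3) by (rule homog_snoc(1)[OF h[OF *(1)] *(2)])
  qed
  then show "adm (Suc M) Y" using cylindrical_Suc[OF cy] NM by (simp add: adm_def)
  have "cls M Y \<sim> (\<Sum>t\<in>sublabels M Y. \<Sum>f\<in>out_arcs E (fst t). lvec (child (t, f)))"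
    unfolding cls_def
  proof (rule vcong_sum)
    fix t assume t: "t \<in> sublabels M Y"
    obtain v i \<kappa> where vi: "t = (v, i, \<kappa>)" by (cases t)
    show "lvec t \<sim> (\<Sum>f\<in>out_arcs E (fst t). lvec (child (t, f)))"
      using lvec_split[of v i \<kappa>] h[OF t] by (simp add: vi child_def)
  qed
  then show "cls M Y \<sim> cls (Suc M) Y" unfolding cls_def sum_sublabels_Suc[OF cy] .
qed

lemma adm_le:
  assumes "adm M Y" "M \<le> M'"
  shows "adm M' Y \<and> cls M Y \<sim> cls M' Y"
  using assms(2)
proof (induction M' rule: dec_induct)
  case base
  then show ?case using assms(1) vcong_refl by simp
next
  case (step n)
  then show ?case using adm_Suc[of n Y] vcong_trans by blast
qed

text \<open>\<open>v\<close> represents the class of the projection \<open>dg Y\<close> in the cokernel of \<open>M1\<close>.\<close>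

definition tau :: "'e pt set \<Rightarrow> ('e list \<Rightarrow> laurent) \<Rightarrow> bool" where
  "tau Y v \<longleftrightarrow> (\<exists>M. adm M Y \<and> v \<sim> cls M Y)"

lemma tau_exists: "dg Y \<in> stein E \<Longrightarrow> \<exists>v. tau Y v"
  using ex_adm vcong_refl unfolding tau_def by blast

lemma tau_adm:
  assumes "tau Y v" "adm M Y"
  shows "v \<sim> cls M Y"
proof -
  obtain M' where M': "adm M' Y" "v \<sim> cls M' Y" using assms(1) by (auto simp: tau_def)
  have 1: "cls M' Y \<sim> cls (max M M') Y" "cls M Y \<sim> cls (max M M') Y"
    using adm_le[OF M'(1)] adm_le[OF assms(2)] by simp_all
  show ?thesis using M'(2) 1 vcong_trans vcong_sym by blast
qed

lemma tau_unique: "tau Y v \<Longrightarrow> tau Y w \<Longrightarrow> v \<sim> w"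
proof -
  assume v: "tau Y v" and w: "tau Y w"
  then obtain M where "adm M Y" by (auto simp: tau_def)
  from tau_adm[OF v this] tau_adm[OF w this] show "v \<sim> w" using vcong_trans vcong_sym by blast
qed

lemma tau_cong: "tau Y v \<Longrightarrow> v \<sim> w \<Longrightarrow> tau Y w"
  unfolding tau_def using vcong_trans vcong_sym by blast

lemma tau_empty: "tau {} 0"
proof -
  have "adm N {}" by (simp add: adm_def cylindrical_def sublabels_empty)
  moreover have "cls N {} = 0" by (simp add: cls_def sublabels_empty)
  ultimately show ?thesis unfolding tau_def using vcong_refl by metis
qed

lemma tau_Un:
  assumes "tau Y v" "tau Y' v'" "Y \<inter> Y' = {}"
  shows "tau (Y \<union> Y') (v + v')"
proof -
  obtain M M' where M: "adm M Y" "adm M' Y'" using assms by (auto simp: tau_def)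
  define K where "K = max M M'"
  have a: "adm K Y" "adm K Y'" using adm_le[OF M(1)] adm_le[OF M(2)] by (simp_all add: K_def)
  then have cy: "cylindrical K Y" "cylindrical K Y'" by (auto simp: adm_def)
  have "adm K (Y \<union> Y')" using a cylindrical_Un[OF cy] by (auto simp: adm_def)
  moreover have "cls K (Y \<union> Y') = cls K Y + cls K Y'"
  proof -
    have "t \<notin> sublabels K Y'" if t: "t \<in> sublabels K Y" for t
      using lcyl_nonempty[OF sublabels_labels[OF t]] sublabels_subset[OF t] sublabels_subset[of t K Y'] assms(3)
      by blast
    then have "sublabels K Y \<inter> sublabels K Y' = {}" by blast
    then show ?thesis
      unfolding cls_def cylindrical_Un(2)[OF cy] using cy
      by (intro sum.union_disjoint) (auto simp: cylindrical_def)
  qed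
  ultimately show ?thesis
    unfolding tau_def using vcong_add[OF tau_adm[OF assms(1) a(1)] tau_adm[OF assms(2) a(2)]] by metis
qed

lemma tau_UN:
  assumes "finite T" "\<And>t. t \<in> T \<Longrightarrow> tau (Y t) (v t)"
    "\<And>t t'. t \<in> T \<Longrightarrow> t' \<in> T \<Longrightarrow> t \<noteq> t' \<Longrightarrow> Y t \<inter> Y t' = {}"
  shows "tau (\<Union>t\<in>T. Y t) (\<Sum>t\<in>T. v t)"
  using assms
proof (induction T rule: finite_induct)
  case empty
  show ?case using tau_empty by (simp only: UN_empty sum.empty)
next
  case (insert t T)
  have "tau (Y t \<union> (\<Union>t\<in>T. Y t)) (v t + (\<Sum>t\<in>T. v t))"
  proof (rule tau_Un)
    show "tau (Y t) (v t)" using insert.prems by blast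
    show "tau (\<Union>t\<in>T. Y t) (\<Sum>t\<in>T. v t)" using insert by blast
    show "Y t \<inter> (\<Union>t\<in>T. Y t) = {}" using insert.prems(2)[of t] insert.hyps(2) by blast
  qed
  then show ?case by (simp only: UN_insert sum.insert[OF insert.hyps(1,2)])
qed

lemma tau_cyl:
  assumes "homog (v, i, \<kappa>)"
  shows "tau (cyl v (i, \<kappa>)) (lvec (v, i, \<kappa>))"
proof -
  have k: "epath E \<kappa> v" "N \<le> length \<kappa>" using assms by (auto simp: homog_def)
  note s = sublabels_cyl[OF k(1), of i]
  have "adm (length \<kappa>) (cyl v (i, \<kappa>))"
    using assms k(2) by (simp add: adm_def cylindrical_def s lcyl_def)
  moreover have "cls (length \<kappa>) (cyl v (i, \<kappa>)) = lvec (v, i, \<kappa>)" by (simp add: cls_def s)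
  ultimately show ?thesis unfolding tau_def using vcong_refl by metis
qed

text \<open>A path of length \<open>N\<close> is its own type, and the equivalence with the type is
  a projection, hence of degree 0.\<close>

lemma tau_path:
  assumes "\<nu> \<in> paths N"
  shows "tau (cyl (tgt \<nu>) (0, \<nu>)) (idf \<nu>)"
proof -
  have k: "epath E \<nu> (tgt \<nu>)" "length \<nu> = N" using assms by (auto simp: paths_def)
  have h: "homog (tgt \<nu>, 0, \<nu>)" using homog_path[OF k(1)] k(2) by simp
  have l: "lst \<nu> = \<nu>" using k(2) by (rule lst_id)
  have "hmg 0 (bb (tgt \<nu>) (0, \<nu>) (0, lst \<nu>))"
    unfolding l bb_diag by (rule hom_proj[OF cyl_stein[OF k(1)]]) simp
  from dgr_eq[OF this k(1)] have "lvec (tgt \<nu>, 0, \<nu>) = idf \<nu>"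
    by (simp add: lvec_def smul_def l fun_eq_iff single_one[symmetric] del: single_one)
  with tau_cyl[OF h] show ?thesis by simp
qed

lemma smul_sum: "smul d (\<Sum>t\<in>T. v t) = (\<Sum>t\<in>T. smul d (v t))"
  by (simp add: smul_def sum_fun_apply sum_distrib_left fun_eq_iff)

text \<open>On small cylinders a homogeneous partial isometry of degree \<open>d\<close> exchanges a
  prefix \<open>q\<close> for a prefix \<open>p\<close> and keeps the remainder \<eta>. As \<eta>
  contains the last \<open>N\<close> edges, the type of each piece is preserved and its degree grows
  by \<open>d\<close>, which multiplies the class by t^d.\<close>

lemma tau_transport:
  assumes u: "u \<in> stein E" "mm (tr u) u = dg Y" "mm u (tr u) = dg Y'" "hmg d u" and v: "tau Y v"
  shows "tau Y' (smul d v)"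
proof -
  have Yst: "dg Y \<in> stein E" using stein_mm[OF stein_tr[OF u(1)] u(1)] u(2) by simp
  note pi = partial_isometry[OF stein_colfin[OF u(1)] u(2)]
  have Y': "Y' = {a. \<exists>c. u a c \<noteq> 0}" using pi(4) u(3) by (simp add: dg_inj)
  obtain M0 where M0: "\<And>M v j q. M0 \<le> M \<Longrightarrow> (v, j, q) \<in> sublabels M Y \<Longrightarrow>
    \<exists>i p. epath E p v \<and> 0 \<le> length p \<and>
      (mm u (dg (cyl v (j, q))) = bb v (i, p) (j, q) \<or> mm u (dg (cyl v (j, q))) = - bb v (i, p) (j, q))"
    using partial_isometry_local[OF u(1,2), of 0] by metis
  obtain M1 where M1: "\<And>M. M1 \<le> M \<Longrightarrow> cylindrical M Y" using stein_cylindrical[OF Yst] by blast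
  obtain M2 where M2: "\<And>M. M2 \<le> M \<Longrightarrow> adm M Y" using ex_adm[OF Yst] by blast
  define K where "K = max M0 M1"
  \<comment> \<open>At level \<open>K\<close> the isometry acts by an exchange of prefixes;
    \<open>N\<close> further edges make sure that the type lies behind the exchanged prefix.\<close>
  define M where "M = max (K + N) M2"
  have admM: "adm M Y" using M2 by (simp add: M_def)
  then have cyM: "finite (sublabels M Y)" "Y = (\<Union>t\<in>sublabels M Y. lcyl t)"
    by (auto simp: adm_def cylindrical_def)
  define R where "R t = {a. \<exists>c\<in>lcyl t. u a c \<noteq> 0}" for t
  have piece: "tau (R t) (smul d (lvec t))" if t: "t \<in> sublabels M Y" for t
  proof -
    obtain w j q' where wj: "t = (w, j, q')" by (cases t)
    have q': "epath E q' w" "length q' = M" "cyl w (j, q') \<subseteq> Y" using t by (auto simp: wj sublabels_iff)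
    define q \<eta> where "q = take K q'" and "\<eta> = drop K q'"
    have qe: "q' = q @ \<eta>" "length q = K" "N \<le> length \<eta>"
      using q'(2) by (auto simp: q_def \<eta>_def M_def)
    define v' where "v' = pstart E \<eta> w"
    have e: "epath E q v'" "epath E \<eta> w" using q'(1) by (auto simp: qe epath_append v'_def)
    have sub: "cyl w (j, q') \<subseteq> cyl v' (j, q)"
      unfolding qe(1) by (rule cyl_append_subset[OF e(2)]) (simp add: v'_def)
    obtain c where c: "c \<in> cyl w (j, q')" using cyl_nonempty[OF epath_verts[OF q'(1)]] by blast
    have "(v', j, q) \<in> sublabels K Y"
      using c sub q'(3) e(1) qe(2) M1[of K]
      by (intro cylindrical_in[of K Y _ c]) (auto simp: labels_def lcyl_def K_def)
    from M0[OF _ this] obtain i p where p: "epath E p v'"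
      and ip: "mm u (dg (cyl v' (j, q))) = bb v' (i, p) (j, q) \<or> mm u (dg (cyl v' (j, q))) = - bb v' (i, p) (j, q)"
      by (auto simp: K_def)
    have neg: "mm (- A) B = - mm A B" for A B :: "'e pt imat"
      by (simp add: mm_def fun_eq_iff sum_negf)
    have "mm u (dg (cyl w (j, q'))) = mm (mm u (dg (cyl v' (j, q)))) (dg (cyl w (j, q')))"
      by (rule mm_dg_mm_dg[OF sub, symmetric])
    then have b: "mm u (dg (cyl w (j, q'))) = bb w (i, p @ \<eta>) (j, q')
        \<or> mm u (dg (cyl w (j, q'))) = - bb w (i, p @ \<eta>) (j, q')"
      using ip bb_extend[OF e(2) v'_def[symmetric], of i p j q] by (auto simp: qe(1) neg)
    have p\<eta>: "epath E (p @ \<eta>) w" using p e(2) by (simp add: epath_append v'_def)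
    have bs: "bb w (i, p @ \<eta>) (j, q') \<in> stein E" by (rule bb_stein[OF p\<eta> q'(1)])
    have "hmg d (mm u (dg (cyl w (j, q'))))"
      by (rule hom_restrict[OF u(1,4) cyl_stein[OF q'(1)]])
    \<comment> \<open>A sign in front of the partial isometry affects neither its degree nor its
      range.\<close>
    then have hb: "hmg d (bb w (i, p @ \<eta>) (j, q'))"
      using b hom_uminus[OF stein_uminus[OF bs], of d] by auto
    have ht: "homog (w, j, q')" using admM t by (auto simp: adm_def wj)
    have l: "lst (p @ \<eta>) = lst q'" by (simp add: qe(1) lst_append[OF qe(3)])
    have h2: "hmg (d + dgr t) (bb w (i, p @ \<eta>) (0, lst (p @ \<eta>)))"
      unfolding l wj by (rule hom_bb_bb[OF hb homog_dgr[OF ht] p\<eta> q'(1) epath_lst[OF q'(1)]])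
    have hR: "homog (w, i, p @ \<eta>)" using h2 p\<eta> qe(3) by (auto simp: homog_def)
    have "lvec (w, i, p @ \<eta>) = smul d (lvec t)"
      using dgr_eq[OF h2 p\<eta>] l by (simp add: lvec_def smul_smul wj)
    moreover have "R t = cyl w (i, p @ \<eta>)"
    proof -
      have "u a c \<noteq> 0 \<and> c \<in> lcyl t \<longleftrightarrow> bb w (i, p @ \<eta>) (j, q') a c \<noteq> 0" for a c
      proof -
        have "mm u (dg (cyl w (j, q'))) a c \<noteq> 0 \<longleftrightarrow> bb w (i, p @ \<eta>) (j, q') a c \<noteq> 0"
          using b by auto
        then show ?thesis by (auto simp: mm_dg lcyl_def wj split: if_splits)
      qed
      then have R: "R t = {a. \<exists>c. bb w (i, p @ \<eta>) (j, q') a c \<noteq> 0}" unfolding R_def by blast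
      show ?thesis
      proof (intro equalityI subsetI)
        fix a assume "a \<in> R t"
        then show "a \<in> cyl w (i, p @ \<eta>)" unfolding R bb_nz cyl_def by auto
      next
        fix a assume "a \<in> cyl w (i, p @ \<eta>)"
        then obtain z k where "z \<in> X" "src E z = w" "a = (fst (i, p @ \<eta>), snd (i, p @ \<eta>) \<frown> z, k + int (length (snd (i, p @ \<eta>))))"
          by (rule cyl_cases)
        then show "a \<in> R t" unfolding R bb_nz by blast
      qed
    qed
    ultimately show ?thesis using tau_cyl[OF hR] by simp
  qed
  have disj: "R t \<inter> R t' = {}" if t: "t \<in> sublabels M Y" "t' \<in> sublabels M Y" "t \<noteq> t'" for t t'
  proof (rule ccontr)
    assume "R t \<inter> R t' \<noteq> {}"
    then obtain a c c' where *: "c \<in> lcyl t" "u a c \<noteq> 0" "c' \<in> lcyl t'" "u a c' \<noteq> 0"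
      unfolding R_def by blast
    have "c = c'" by (rule pi(3)[OF *(2,4)])
    then show False
      using lcyl_disjoint[OF sublabels_labels[OF t(1)] sublabels_labels[OF t(2)] *(1)] *(3) t(3) by simp
  qed
  have "(\<Union>t\<in>sublabels M Y. R t) = Y'"
  proof (intro equalityI subsetI)
    fix a assume "a \<in> Y'"
    then obtain c where c: "u a c \<noteq> 0" unfolding Y' by blast
    then have "c \<in> Y" using pi(1) by blast
    with c cyM(2) show "a \<in> (\<Union>t\<in>sublabels M Y. R t)" unfolding R_def by blast
  qed (auto simp: Y' R_def)
  with tau_UN[OF cyM(1), of R "\<lambda>t. smul d (lvec t)"] piece disj have "tau Y' (smul d (cls M Y))"
    by (simp add: smul_sum cls_def)
  then show ?thesis using vcong_smul[OF tau_adm[OF v admM]] vcong_sym tau_cong by blast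
qed

end

section \<open>Comparing two graphs\<close>

lemma dg_sum_UN:
  assumes "finite T" "\<And>t t'. t \<in> T \<Longrightarrow> t' \<in> T \<Longrightarrow> t \<noteq> t' \<Longrightarrow> W t \<inter> W t' = {}"
  shows "(\<Sum>t\<in>T. dg (W t)) = dg (\<Union>t\<in>T. W t)"
  using assms
proof (induction T rule: finite_induct)
  case empty
  show ?case by (simp only: sum.empty UN_empty dg_empty)
next
  case (insert t T)
  have "W t \<inter> (\<Union>t\<in>T. W t) = {}" using insert.prems[of t] insert.hyps(2) by blast
  then have "dg (W t) + dg (\<Union>t\<in>T. W t) = dg (W t \<union> (\<Union>t\<in>T. W t))"
    by (intro ext) (auto simp: dg_def)
  moreover have "(\<Sum>t\<in>T. dg (W t)) = dg (\<Union>t\<in>T. W t)" using insert by blast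
  ultimately show ?case by (simp only: sum.insert[OF insert.hyps(1,2)] UN_insert)
qed

context stein_isomorphism
begin

text \<open>The map of compact open sets induced by the isomorphism: projections go to projections,
  and these are the diagonal matrices of sets.\<close>

definition img :: "'e pt set \<Rightarrow> 'f pt set" where
  "img W = (SOME Z. \<psi> (dg W) = dg Z)"

lemma img: "dg W \<in> stein E \<Longrightarrow> \<psi> (dg W) = dg (img W)"
  unfolding img_def by (rule someI_ex) (rule F.isproj_stein[OF \<psi>_in], simp_all add: \<psi>_isproj)

lemma img_stein: "dg W \<in> stein E \<Longrightarrow> dg (img W) \<in> stein F"
  using \<psi>_in img by metis

lemma img_disjoint:
  assumes "dg W \<in> stein E" "dg W' \<in> stein E" "W \<inter> W' = {}"
  shows "img W \<inter> img W' = {}"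
proof -
  have "\<psi> (mm (dg W) (dg W')) = dg (img W \<inter> img W')"
    unfolding \<psi>_mm[OF assms(1,2)] img[OF assms(1)] img[OF assms(2)] by (rule dg_dg)
  then have "dg (img W \<inter> img W') = \<psi> (mm (dg W) (dg W'))" ..
  also have "\<dots> = 0" by (simp add: dg_dg assms(3) \<psi>_zero)
  finally show ?thesis by simp
qed

lemma img_UN:
  assumes T: "finite T" and W: "\<And>t. t \<in> T \<Longrightarrow> dg (W t) \<in> stein E"
    and d: "\<And>t t'. t \<in> T \<Longrightarrow> t' \<in> T \<Longrightarrow> t \<noteq> t' \<Longrightarrow> W t \<inter> W t' = {}"
  shows "img (\<Union>t\<in>T. W t) = (\<Union>t\<in>T. img (W t))"
proof -
  have s: "(\<Sum>t\<in>T. dg (W t)) = dg (\<Union>t\<in>T. W t)" by (rule dg_sum_UN[OF T]) (rule d)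
  have st: "dg (\<Union>t\<in>T. W t) \<in> stein E" unfolding s[symmetric] by (rule E.stein_sum) (rule W)
  have "dg (img (\<Union>t\<in>T. W t)) = \<psi> (\<Sum>t\<in>T. dg (W t))" unfolding s by (rule img[OF st, symmetric])
  also have "\<dots> = (\<Sum>t\<in>T. \<psi> (dg (W t)))" by (rule \<psi>_sum) (rule W)
  also have "\<dots> = (\<Sum>t\<in>T. dg (img (W t)))" by (rule sum.cong[OF refl]) (rule img[OF W])
  also have "\<dots> = dg (\<Union>t\<in>T. img (W t))"
    by (rule dg_sum_UN[OF T]) (rule img_disjoint[OF W W d])
  finally show ?thesis by (simp add: dg_inj)
qed

text \<open>Sending the basis vector of \<open>y\<close> to the class of the image of its cylinder
  gives a map from the cokernel of \<open>E\<close> to that of \<open>F\<close>. It respects the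
  relations because subdivisions go to subdivisions, and it is onto because every cylinder of
  \<open>F\<close> is the image of a compact open set of \<open>E\<close>. By \<open>compat\<close>
  the two gradings correspond, so powers of t match.\<close>

lemma det_dvd:
  assumes A: "graded_level E h1 N1" and B: "graded_level F h2 N2"
    and compat: "\<And>d S. S \<in> stein E \<Longrightarrow> h1 d S \<longleftrightarrow> h2 d (\<psi> S)"
    and xs: "distinct xs" "set xs = F.paths N2" and ys: "distinct ys" "set ys = E.paths N1"
  shows "det (fmat xs xs (graded_level.M1 F h2)) dvd det (fmat ys ys (graded_level.M1 E h1))"
proof -
  interpret A: graded_level E h1 N1 by (rule A)
  interpret B: graded_level F h2 N2 by (rule B)
  have transport: "B.tau (img W') (B.smul d v)"
    if "u \<in> stein E" "mm (tr u) u = dg W" "mm u (tr u) = dg W'" "h1 d u" "B.tau (img W) v" for u W W' d v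
  proof (rule B.tau_transport[OF \<psi>_in[OF that(1)] _ _ _ that(5)])
    have s: "tr u \<in> stein E" "dg W \<in> stein E" "dg W' \<in> stein E"
      using that(1) by (simp_all add: E.stein_tr E.stein_mm that(2,3)[symmetric])
    show "mm (tr (\<psi> u)) (\<psi> u) = dg (img W)"
      using \<psi>_mm[OF s(1) that(1)] \<psi>_tr[OF that(1)] img[OF s(2)] that(2) by simp
    show "mm (\<psi> u) (tr (\<psi> u)) = dg (img W')"
      using \<psi>_mm[OF that(1) s(1)] \<psi>_tr[OF that(1)] img[OF s(3)] that(3) by simp
    show "h2 d (\<psi> u)" using compat[OF that(1)] that(4) by simp
  qed
  \<comment> \<open>Row \<open>y\<close> is an arbitrary representative of the class; the ambiguity
    modulo rows of \<open>B.M1\<close> is absorbed by the matrices \<open>X'\<close> and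
    \<open>Z\<close>.\<close>
  define X where "X y = (SOME v. B.tau (img (E.cyl (E.tgt y) (0, y))) v)" for y
  have X: "B.tau (img (E.cyl (E.tgt y) (0, y))) (X y)" if "y \<in> E.paths N1" for y
  proof -
    have "dg (E.cyl (E.tgt y) (0, y)) \<in> stein E" using that by (intro E.cyl_stein) (simp add: E.paths_def)
    from B.tau_exists[OF img_stein[OF this]] show ?thesis unfolding X_def by (rule someI_ex)
  qed
  \<comment> \<open>The cylinder of \<open>y = e # \<nu>\<close> is cut by the next edge
    \<open>f\<close>. Prepending \<open>e\<close> to the cylinder of \<open>\<nu> @ [f]\<close>
    yields the piece, with degree \<open>cc e (\<nu> @ [f])\<close>; these powers of t are the
    entries of row \<open>y\<close> of A_c.\<close>
  have rel: "\<exists>z. \<forall>x\<in>F.paths N2. (\<Sum>y'\<in>E.paths N1. A.M1 y y' * X y' x) = (\<Sum>x'\<in>F.paths N2. z x' * B.M1 x' x)"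
    if y: "y \<in> E.paths N1" for y
  proof -
    have ep: "epath E y (E.tgt y)" "length y = N1" using y by (auto simp: E.paths_def)
    obtain e \<nu> where e\<nu>: "y = e # \<nu>" using ep(2) A.N_pos by (cases y) auto
    let ?O = "out_arcs E (E.tgt y)" and ?y' = "\<lambda>f. \<nu> @ [f]"
    have f: "?y' f \<in> E.paths N1" "E.tgt (?y' f) = head E f" "e \<in> arcs E" "pstart E (?y' f) (head E f) = head E e"
      "epath E (y @ [f]) (head E f)" "epath E (?y' f) (head E f)" if "f \<in> ?O" for f
    proof -
      show t: "E.tgt (?y' f) = head E f" by (simp add: E.tgt_def)
      have "epath E (y @ [f]) (head E f)" using ep(1) that by (simp add: E.epath_snoc)
      then show "epath E (y @ [f]) (head E f)" "epath E (?y' f) (head E f)" "e \<in> arcs E"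
        "pstart E (?y' f) (head E f) = head E e" by (simp_all add: e\<nu>)
      then show "?y' f \<in> E.paths N1" using ep(2) by (simp add: E.paths_def t e\<nu>)
    qed
    have t: "B.tau (img (E.cyl (head E f) (0, y @ [f]))) (B.smul (A.cc e (?y' f)) (X (?y' f)))" if "f \<in> ?O" for f
    proof (rule transport)
      note f = f[OF that]
      show "E.bb (head E f) (0, y @ [f]) (0, ?y' f) \<in> stein E" by (rule E.bb_stein[OF f(5,6)])
      show "mm (tr (E.bb (head E f) (0, y @ [f]) (0, ?y' f))) (E.bb (head E f) (0, y @ [f]) (0, ?y' f))
          = dg (E.cyl (E.tgt (?y' f)) (0, ?y' f))" unfolding f(2) by (rule E.bb_isometry)
      show "mm (E.bb (head E f) (0, y @ [f]) (0, ?y' f)) (tr (E.bb (head E f) (0, y @ [f]) (0, ?y' f)))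
          = dg (E.cyl (head E f) (0, y @ [f]))" by (rule E.bb_isometry)
      show "h1 (A.cc e (?y' f)) (E.bb (head E f) (0, y @ [f]) (0, ?y' f))"
        using A.cc[OF f(1,3)] f(2,4) by (simp add: e\<nu>)
      show "B.tau (img (E.cyl (E.tgt (?y' f)) (0, ?y' f))) (X (?y' f))" by (rule X[OF f(1)])
    qed
    have disj: "E.cyl (head E f) (0, y @ [f]) \<inter> E.cyl (head E f') (0, y @ [f']) = {}" if "f \<noteq> f'" for f f'
      using E.cyl_disjoint[of "y @ [f]" "y @ [f']" "head E f" 0 "head E f'" 0] that by auto
    have st: "dg (E.cyl (head E f) (0, y @ [f])) \<in> stein E" if "f \<in> ?O" for f
      by (rule E.cyl_stein[OF f(5)[OF that]])
    have "img (E.cyl (E.tgt y) (0, y)) = (\<Union>f\<in>?O. img (E.cyl (head E f) (0, y @ [f])))"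
      unfolding E.cyl_split[of _ 0 y] by (rule img_UN[OF E.finite_out st disj])
    moreover have "B.tau (\<Union>f\<in>?O. img (E.cyl (head E f) (0, y @ [f]))) (\<Sum>f\<in>?O. B.smul (A.cc e (?y' f)) (X (?y' f)))"
      by (rule B.tau_UN[OF E.finite_out t img_disjoint[OF st st disj]])
    ultimately have "B.vcong (X y) (\<Sum>f\<in>?O. B.smul (A.cc e (?y' f)) (X (?y' f)))"
      using B.tau_unique[OF X[OF y]] by simp
    then obtain z where z: "\<forall>x\<in>F.paths N2. X y x - (\<Sum>f\<in>?O. B.smul (A.cc e (?y' f)) (X (?y' f))) x
        = (\<Sum>x'\<in>F.paths N2. z x' * B.M1 x' x)" unfolding B.vcong_def by blast
    have "(\<Sum>y'\<in>E.paths N1. A.M1 y y' * X y' x) = X y x - (\<Sum>f\<in>?O. B.smul (A.cc e (?y' f)) (X (?y' f))) x" for x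
    proof -
      have pick: "(\<Sum>y'\<in>E.paths N1. idf a y' * X y' x) = X a x" if "a \<in> E.paths N1" for a
      proof -
        have "(\<Sum>y'\<in>E.paths N1. idf a y' * X y' x) = (\<Sum>y'\<in>E.paths N1. if a = y' then X y' x else 0)"
          by (intro sum.cong refl) (simp add: idf_def)
        then show ?thesis using that E.finite_paths by simp
      qed
      have "(\<Sum>y'\<in>E.paths N1. A.wt y y' * X y' x)
          = (\<Sum>y'\<in>E.paths N1. \<Sum>f\<in>?O. Poly_Mapping.single (A.cc e (?y' f)) 1 * (idf (?y' f) y' * X y' x))"
      proof (rule sum.cong[OF refl])
        fix y' assume "y' \<in> E.paths N1"
        from A.wt_sum[OF y this] have "A.wt y y' = (\<Sum>f\<in>?O. Poly_Mapping.single (A.cc e (?y' f)) 1 * idf (?y' f) y')"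
          by (simp add: e\<nu>)
        then show "A.wt y y' * X y' x = (\<Sum>f\<in>?O. Poly_Mapping.single (A.cc e (?y' f)) 1 * (idf (?y' f) y' * X y' x))"
          by (simp add: sum_distrib_right mult.assoc)
      qed
      also have "\<dots> = (\<Sum>f\<in>?O. \<Sum>y'\<in>E.paths N1. Poly_Mapping.single (A.cc e (?y' f)) 1 * (idf (?y' f) y' * X y' x))"
        by (rule sum.swap)
      also have "\<dots> = (\<Sum>f\<in>?O. B.smul (A.cc e (?y' f)) (X (?y' f)) x)"
        by (intro sum.cong refl) (simp add: sum_distrib_left[symmetric] pick[OF f(1)] B.smul_def)
      finally have w: "(\<Sum>y'\<in>E.paths N1. A.wt y y' * X y' x) = (\<Sum>f\<in>?O. B.smul (A.cc e (?y' f)) (X (?y' f)) x)" .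
      have "(\<Sum>y'\<in>E.paths N1. A.M1 y y' * X y' x)
          = (\<Sum>y'\<in>E.paths N1. idf y y' * X y' x) - (\<Sum>y'\<in>E.paths N1. A.wt y y' * X y' x)"
        by (simp add: A.M1_def left_diff_distrib sum_subtractf)
      then show ?thesis by (simp add: pick[OF y] w sum_fun_apply)
    qed
    with z show ?thesis by auto
  qed
  \<comment> \<open>The cylinder of \<open>x\<close> is the image of some set \<open>W\<close>.
    Cutting \<open>W\<close> at an admissible level writes the basis vector of \<open>x\<close> as a
    combination of rows of \<open>X\<close>, up to rows of \<open>B.M1\<close>.\<close>
  have gen: "\<exists>Y z. \<forall>x'\<in>F.paths N2. idf x x' = (\<Sum>y\<in>E.paths N1. Y y * X y x') + (\<Sum>x''\<in>F.paths N2. z x'' * B.M1 x'' x')"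
    if x: "x \<in> F.paths N2" for x
  proof -
    let ?C = "F.cyl (F.tgt x) (0, x)"
    have C: "dg ?C \<in> stein F" using x by (intro F.cyl_stein) (simp add: F.paths_def)
    obtain S where S: "S \<in> stein E" "\<psi> S = dg ?C" using \<psi>_surj[OF C] by blast
    then have "isproj S" using \<psi>_isproj[OF S(1)] by simp
    then obtain W where W: "S = dg W" using E.isproj_stein[OF S(1)] by blast
    have Wst: "dg W \<in> stein E" using S(1) W by simp
    have iW: "img W = ?C" using img[OF Wst] S(2) W by (simp add: dg_inj)
    obtain M where adm: "A.adm M W" using A.ex_adm[OF Wst] by blast
    let ?T = "E.sublabels M W" and ?l = "\<lambda>t :: 'v \<times> nat \<times> 'e list. A.lst (snd (snd t))"
    have T: "finite ?T" "W = (\<Union>t\<in>?T. E.lcyl t)" using adm by (auto simp: A.adm_def E.cylindrical_def)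
    have lp: "?l t \<in> E.paths N1" and t: "B.tau (img (E.lcyl t)) (B.smul (A.dgr t) (X (?l t)))"
      and st: "dg (E.lcyl t) \<in> stein E" if t: "t \<in> ?T" for t
    proof -
      obtain v i \<kappa> where vi: "t = (v, i, \<kappa>)" by (cases t)
      have h: "A.homog (v, i, \<kappa>)" using adm t by (auto simp: A.adm_def vi)
      then have k: "epath E \<kappa> v" "N1 \<le> length \<kappa>" by (auto simp: A.homog_def)
      have l: "epath E (A.lst \<kappa>) v" "length (A.lst \<kappa>) = N1" using A.epath_lst[OF k(1)] A.length_lst[OF k(2)] by auto
      have "A.lst \<kappa> \<noteq> []" using l(2) A.N_pos by auto
      from E.epath_tgt[OF l(1) this] have v: "E.tgt (A.lst \<kappa>) = v" by simp
      show lp: "?l t \<in> E.paths N1" using l by (simp add: E.paths_def v vi)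
      show "dg (E.lcyl t) \<in> stein E" by (simp add: vi E.lcyl_def E.cyl_stein[OF k(1)])
      show "B.tau (img (E.lcyl t)) (B.smul (A.dgr t) (X (?l t)))"
      proof (rule transport)
        show "E.bb v (i, \<kappa>) (0, A.lst \<kappa>) \<in> stein E" by (rule E.bb_stein[OF k(1) l(1)])
        show "mm (tr (E.bb v (i, \<kappa>) (0, A.lst \<kappa>))) (E.bb v (i, \<kappa>) (0, A.lst \<kappa>)) = dg (E.cyl (E.tgt (?l t)) (0, ?l t))"
          by (simp add: vi v E.bb_isometry)
        show "mm (E.bb v (i, \<kappa>) (0, A.lst \<kappa>)) (tr (E.bb v (i, \<kappa>) (0, A.lst \<kappa>))) = dg (E.lcyl t)"
          by (simp add: vi E.lcyl_def E.bb_isometry)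
        show "h1 (A.dgr t) (E.bb v (i, \<kappa>) (0, A.lst \<kappa>))" unfolding vi by (rule A.homog_dgr[OF h])
        show "B.tau (img (E.cyl (E.tgt (?l t)) (0, ?l t))) (X (?l t))" by (rule X[OF lp])
      qed
    qed
    have disj: "E.lcyl t \<inter> E.lcyl t' = {}" if "t \<in> ?T" "t' \<in> ?T" "t \<noteq> t'" for t t'
      using E.lcyl_disjoint[OF E.sublabels_labels[OF that(1)] E.sublabels_labels[OF that(2)]] that(3) by blast
    have "?C = (\<Union>t\<in>?T. img (E.lcyl t))"
      unfolding iW[symmetric] by (subst T(2)) (rule img_UN[OF T(1) st disj])
    moreover have "B.tau (\<Union>t\<in>?T. img (E.lcyl t)) (\<Sum>t\<in>?T. B.smul (A.dgr t) (X (?l t)))"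
      by (rule B.tau_UN[OF T(1) t img_disjoint[OF st st disj]])
    ultimately have "B.vcong (idf x) (\<Sum>t\<in>?T. B.smul (A.dgr t) (X (?l t)))"
      using B.tau_unique[OF B.tau_path[OF x]] by simp
    then obtain z where z: "\<forall>x'\<in>F.paths N2. idf x x' - (\<Sum>t\<in>?T. B.smul (A.dgr t) (X (?l t))) x'
        = (\<Sum>x''\<in>F.paths N2. z x'' * B.M1 x'' x')" unfolding B.vcong_def by blast
    define Y where "Y y = (\<Sum>t\<in>?T. if ?l t = y then Poly_Mapping.single (A.dgr t) (1::int) else 0)" for y
    have "(\<Sum>t\<in>?T. B.smul (A.dgr t) (X (?l t))) x' = (\<Sum>y\<in>E.paths N1. Y y * X y x')" for x'
    proof -
      have "(\<Sum>y\<in>E.paths N1. Y y * X y x')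
          = (\<Sum>y\<in>E.paths N1. \<Sum>t\<in>?T. if ?l t = y then Poly_Mapping.single (A.dgr t) 1 * X y x' else 0)"
        unfolding Y_def sum_distrib_right by (intro sum.cong refl) simp
      also have "\<dots> = (\<Sum>t\<in>?T. \<Sum>y\<in>E.paths N1. if ?l t = y then Poly_Mapping.single (A.dgr t) 1 * X y x' else 0)"
        by (rule sum.swap)
      also have "\<dots> = (\<Sum>t\<in>?T. B.smul (A.dgr t) (X (?l t)) x')"
        by (intro sum.cong refl) (simp add: lp E.finite_paths B.smul_def)
      finally show ?thesis by (simp add: sum_fun_apply)
    qed
    then have "\<forall>x'\<in>F.paths N2. idf x x' = (\<Sum>y\<in>E.paths N1. Y y * X y x') + (\<Sum>x''\<in>F.paths N2. z x'' * B.M1 x'' x')"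
      using z by (simp add: algebra_simps)
    then show ?thesis by blast
  qed
  have "\<forall>y\<in>E.paths N1. \<exists>z. \<forall>x\<in>F.paths N2. (\<Sum>y'\<in>E.paths N1. A.M1 y y' * X y' x) = (\<Sum>x'\<in>F.paths N2. z x' * B.M1 x' x)"
    using rel by blast
  from bchoice[OF this] obtain X' where X': "\<And>y x. y \<in> E.paths N1 \<Longrightarrow> x \<in> F.paths N2
      \<Longrightarrow> (\<Sum>y'\<in>E.paths N1. A.M1 y y' * X y' x) = (\<Sum>x'\<in>F.paths N2. X' y x' * B.M1 x' x)"
    by blast
  have "\<forall>x\<in>F.paths N2. \<exists>Y z. \<forall>x'\<in>F.paths N2. idf x x' = (\<Sum>y\<in>E.paths N1. Y y * X y x') + (\<Sum>x''\<in>F.paths N2. z x'' * B.M1 x'' x')"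
    using gen by blast
  from bchoice[OF this] obtain Y where "\<forall>x\<in>F.paths N2. \<exists>z. \<forall>x'\<in>F.paths N2.
      idf x x' = (\<Sum>y\<in>E.paths N1. Y x y * X y x') + (\<Sum>x''\<in>F.paths N2. z x'' * B.M1 x'' x')"
    by blast
  from bchoice[OF this] obtain Z where YZ: "\<And>x x'. x \<in> F.paths N2 \<Longrightarrow> x' \<in> F.paths N2
      \<Longrightarrow> idf x x' = (\<Sum>y\<in>E.paths N1. Y x y * X y x') + (\<Sum>x''\<in>F.paths N2. Z x x'' * B.M1 x'' x')"
    by blast
  show ?thesis
    by (rule det_fmat_dvd[OF xs(1) ys(1), of _ X X' _ Y Z]) (simp_all only: xs(2) ys(2) X' YZ)
qed

end

section \<open>Positivity of the cycle weights\<close>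

context graded_level
begin

context
  fixes f :: "nat \<Rightarrow> 'e list"
  assumes f: "\<And>k. f k \<in> paths N" and edges: "\<And>k. edge (f k) (f (Suc k))"
begin

text \<open>A walk in the higher block graph slides a window of \<open>N\<close> edges along a path
  of \<open>E\<close>; \<open>trail n @ f n\<close> is that path up to the end of the
  \<open>n\<close>th window.\<close>

definition trail :: "nat \<Rightarrow> 'e list" where
  "trail n = map (\<lambda>k. hd (f k)) [0..<n]"

lemma edge_step:
  obtains e \<nu> g where "f k = e # \<nu>" "f (Suc k) = \<nu> @ [g]" "g \<in> out_arcs E (tgt (f k))"
proof -
  have ne: "f k \<noteq> []" "f (Suc k) \<noteq> []" using f[of k] f[of "Suc k"] N_pos by (auto simp: paths_def)
  obtain e \<nu> where e: "f k = e # \<nu>" using ne(1) by (cases "f k") auto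
  have "butlast (f (Suc k)) = \<nu>" "tail E (last (f (Suc k))) = tgt (f k)"
    using edges[of k] by (auto simp: edge_def e)
  then have "f (Suc k) = \<nu> @ [last (f (Suc k))]" using ne(2) by (metis append_butlast_last_id)
  moreover have "last (f (Suc k)) \<in> arcs E"
    using f[of "Suc k"] epath_arcs ne(2) by (fastforce simp: paths_def)
  ultimately show ?thesis using e \<open>tail E _ = tgt _\<close> by (intro that) auto
qed

text \<open>Prepending the trail to \<open>f n\<close> is the product of its single steps, so the
  weights add up. That the path begins with the window \<open>f 0\<close> is what lets a closed walk
  overlap itself.\<close>

lemma trail_homogeneous:
  "epath E (trail n @ f n) (tgt (f n)) \<and> take N (trail n @ f n) = f 0 \<and>
    hmg (\<Sum>k<n. cc (hd (f k)) (f (Suc k))) (bb (tgt (f n)) (0, trail n @ f n) (0, f n))"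
proof (induction n)
  case 0
  have k: "epath E (f 0) (tgt (f 0))" "length (f 0) = N" using f[of 0] by (auto simp: paths_def)
  have "hmg 0 (bb (tgt (f 0)) (0, f 0) (0, f 0))"
    unfolding bb_diag by (rule hom_proj[OF cyl_stein[OF k(1)]]) simp
  then show ?case using k by (simp add: trail_def)
next
  case (Suc n)
  obtain e \<nu> g where *: "f n = e # \<nu>" "f (Suc n) = \<nu> @ [g]" "g \<in> out_arcs E (tgt (f n))"
    by (rule edge_step)
  let ?d = "\<Sum>k<n. cc (hd (f k)) (f (Suc k))"
  have IH: "epath E (trail n @ f n) (tgt (f n))" "take N (trail n @ f n) = f 0"
    "hmg ?d (bb (tgt (f n)) (0, trail n @ f n) (0, f n))" using Suc by auto
  have fn: "epath E (f n) (tgt (f n))" using f[of n] by (simp add: paths_def)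
  have ln: "length (f n) = N" using f[of n] by (simp add: paths_def)
  have tg: "tgt (f (Suc n)) = head E g" by (simp add: *(2) tgt_def)
  have eq: "trail (Suc n) @ f (Suc n) = (trail n @ f n) @ [g]" by (simp add: trail_def *)
  have g: "epath E [g] (head E g)" "pstart E [g] (head E g) = tgt (f n)" using *(3) by auto
  have 1: "epath E ((trail n @ f n) @ [g]) (head E g)" using IH(1) g epath_append by metis
  have 2: "epath E (f n @ [g]) (head E g)" using fn g epath_append by metis
  have 3: "epath E (f (Suc n)) (head E g)" "pstart E (f (Suc n)) (head E g) = head E e" "e \<in> arcs E"
    using 2 by (simp_all add: *)
  have "hmg ?d (bb (head E g) (0, (trail n @ f n) @ [g]) (0, f n @ [g]))"
    by (rule hom_extend[OF IH(3,1) fn g])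
  moreover have "hmg (cc e (f (Suc n))) (bb (head E g) (0, f n @ [g]) (0, f (Suc n)))"
  proof -
    have "e # f (Suc n) = f n @ [g]" by (simp add: *(1,2))
    with cc[OF f[of "Suc n"] 3(3)] 3(2) show ?thesis by (simp only: tg)
  qed
  ultimately have "hmg (?d + cc e (f (Suc n))) (bb (head E g) (0, (trail n @ f n) @ [g]) (0, f (Suc n)))"
    using hom_bb_bb 1 2 3(1) by blast
  moreover have "take N ((trail n @ f n) @ [g]) = f 0" using IH(2) ln by simp
  ultimately show ?case unfolding eq tg using 1 by (simp add: *(1))
qed

text \<open>Because of \<open>f n = f 0\<close>, the path \<open>\<gamma> @ \<mu>\<close> begins
  with \<mu>, so prepending \<gamma> maps the cylinder of \<mu> into itself. By branching the image
  is a proper subset, and a homogeneous contraction has positive degree.\<close>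

lemma closed_trail_positive:
  assumes branch: "\<And>v. v \<in> verts E \<Longrightarrow> \<exists>z z'. z \<in> X \<and> z' \<in> X \<and> src E z = v \<and> src E z' = v \<and> z \<noteq> z'"
    and n: "0 < n" "f n = f 0"
  shows "0 < (\<Sum>k<n. cc (hd (f k)) (f (Suc k)))"
proof -
  define \<mu> \<gamma> v where "\<mu> = f 0" and "\<gamma> = trail n" and "v = tgt \<mu>"
  have k: "epath E \<mu> v" "length \<mu> = N" using f[of 0] by (auto simp: paths_def \<mu>_def v_def)
  have lg: "0 < length \<gamma>" using n(1) by (simp add: \<gamma>_def trail_def)
  have T: "epath E (\<gamma> @ \<mu>) v" "take N (\<gamma> @ \<mu>) = \<mu>"
    "hmg (\<Sum>k<n. cc (hd (f k)) (f (Suc k))) (bb v (0, \<gamma> @ \<mu>) (0, \<mu>))"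
    using trail_homogeneous[of n] unfolding n(2) by (simp_all add: \<mu>_def \<gamma>_def v_def)
  let ?u = "bb v (0, \<gamma> @ \<mu>) (0, \<mu>)"
  have u: "?u \<in> stein E" by (rule bb_stein[OF T(1) k(1)])
  define \<zeta> where "\<zeta> = drop N (\<gamma> @ \<mu>)"
  have \<zeta>: "\<gamma> @ \<mu> = \<mu> @ \<zeta>" unfolding \<zeta>_def by (metis T(2) append_take_drop_id)
  have e\<zeta>: "epath E \<mu> (pstart E \<zeta> v)" "epath E \<zeta> v" using T(1) unfolding \<zeta> epath_append by auto
  have \<mu>ne: "\<mu> \<noteq> []" using k(2) N_pos by auto
  have ps: "pstart E \<zeta> v = v" using epath_tgt[OF e\<zeta>(1) \<mu>ne] by (simp add: v_def)
  have sub: "cyl v (0, \<gamma> @ \<mu>) \<subseteq> cyl v (0, \<mu>)"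
    unfolding \<zeta> by (rule cyl_append_subset[OF e\<zeta>(2) ps])
  have neq: "cyl v (0, \<gamma> @ \<mu>) \<noteq> cyl v (0, \<mu>)"
  proof
    assume eq: "cyl v (0, \<gamma> @ \<mu>) = cyl v (0, \<mu>)"
    \<comment> \<open>If the cylinders were equal, every path in the cylinder of \<mu> would be
      \<gamma> followed by another such path. As \<gamma> is nonempty, induction on the position
      would determine all its edges, and the cylinder would contain a single path.\<close>
    have unroll: "\<exists>z'. z' \<in> X \<and> src E z' = v \<and> \<mu> \<frown> z = \<gamma> \<frown> \<mu> \<frown> z'" if z: "z \<in> X" "src E z = v" for z
    proof -
      have "(0, \<mu> \<frown> z, 0) \<in> cyl v (0, \<mu>)" unfolding cyl_def using z by auto
      then have "(0, \<mu> \<frown> z, 0) \<in> cyl v (0, \<gamma> @ \<mu>)" unfolding eq .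
      then show ?thesis unfolding cyl_def by (auto simp: conc_conc)
    qed
    have same: "\<forall>z z'. z \<in> X \<and> src E z = v \<and> z' \<in> X \<and> src E z' = v \<longrightarrow> (\<mu> \<frown> z) i = (\<mu> \<frown> z') i" for i
    proof (induction i rule: less_induct)
      case (less i)
      show ?case
      proof (intro allI impI, elim conjE)
        fix z z' assume z: "z \<in> X" "src E z = v" "z' \<in> X" "src E z' = v"
        obtain w where w: "w \<in> X" "src E w = v" "\<mu> \<frown> z = \<gamma> \<frown> \<mu> \<frown> w" using unroll[OF z(1,2)] by blast
        obtain w' where w': "w' \<in> X" "src E w' = v" "\<mu> \<frown> z' = \<gamma> \<frown> \<mu> \<frown> w'" using unroll[OF z(3,4)] by blast
        show "(\<mu> \<frown> z) i = (\<mu> \<frown> z') i"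
        proof (cases "i < length \<gamma>")
          case True
          then show ?thesis unfolding w(3) w'(3) by (simp del: conc_conc)
        next
          case False
          then have "i - length \<gamma> < i" using lg by linarith
          from less[OF this] have "(\<mu> \<frown> w) (i - length \<gamma>) = (\<mu> \<frown> w') (i - length \<gamma>)"
            using w(1,2) w'(1,2) by blast
          then show ?thesis using False unfolding w(3) w'(3) by (simp del: conc_conc)
        qed
      qed
    qed
    obtain z z' where z: "z \<in> X" "z' \<in> X" "src E z = v" "src E z' = v" "z \<noteq> z'"
      using branch[OF epath_verts[OF k(1)]] by blast
    have "\<mu> \<frown> z = \<mu> \<frown> z'" by (rule ext) (use same z in blast)
    then show False using z(5) by simp
  qed
  show ?thesis
  proof (rule hom_contract[OF u _ T(3)])
    show "isproj (mm (tr ?u) ?u)" by (simp add: bb_isometry)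
    show "mm (mm ?u (tr ?u)) (mm (tr ?u) ?u) = mm ?u (tr ?u)"
      using sub by (simp add: bb_isometry dg_dg Int_absorb2)
    show "mm ?u (tr ?u) \<noteq> mm (tr ?u) ?u" using neq by (simp add: bb_isometry dg_inj)
  qed
qed

end

lemma det_M1_positive:
  assumes branch: "\<And>v. v \<in> verts E \<Longrightarrow> \<exists>z z'. z \<in> X \<and> z' \<in> X \<and> src E z = v \<and> src E z' = v \<and> z \<noteq> z'"
    and xs: "distinct xs" "set xs = paths N"
  shows "pos (det (fmat xs xs M1) - 1)"
proof -
  have M1: "M1 = (\<lambda>x y. idf x y - (if edge x y then Poly_Mapping.single (cc (hd x) y) 1 else 0))"
    by (simp add: M1_def wt_def fun_eq_iff)
  show ?thesis unfolding M1
    by (rule det_positive_cycles[OF xs(1)]) (rule closed_trail_positive[OF _ _ branch], simp_all add: xs(2))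
qed

end

section \<open>Strongly connected graphs\<close>

lemma reachable_epath:
  assumes "fin_digraph E" "v \<rightarrow>\<^sup>*\<^bsub>E\<^esub> u"
  shows "\<exists>\<eta>. epath E \<eta> u \<and> pstart E \<eta> u = v"
proof -
  interpret fin_digraph E by fact
  show ?thesis using assms(2)
  proof (induction rule: converse_reachable_induct)
    case base
    then show ?case using assms(2) by (intro exI[of _ "[]"]) (auto dest: reachable_in_verts)
  next
    case (step v v')
    then obtain \<eta> e where \<eta>: "epath E \<eta> u" "pstart E \<eta> u = v'"
      and e: "e \<in> arcs E" "tail E e = v" "head E e = v'"
      by (auto simp: arcs_ends_def arc_to_ends_def)
    then show ?case by (intro exI[of _ "e # \<eta>"]) auto
  qed
qed

lemma strongly_connected_shift_graph:
  assumes "fin_digraph E" "strongly_connected_graph E" "arcs E \<noteq> {}"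
  shows "shift_graph E"
proof -
  interpret fin_digraph E by fact
  obtain e where e: "e \<in> arcs E" using assms(3) by blast
  have "out_arcs E v \<noteq> {}" if v: "v \<in> verts E" for v
  proof -
    have "v \<rightarrow>\<^sup>*\<^bsub>E\<^esub> tail E e" using assms(2) v e by (simp add: strongly_connected_graph_def)
    then obtain \<eta> where \<eta>: "epath E \<eta> (tail E e)" "pstart E \<eta> (tail E e) = v"
      using reachable_epath[OF assms(1)] by blast
    show ?thesis
    proof (cases \<eta>)
      case Nil
      then show ?thesis using \<eta> e by auto
    next
      case (Cons a p)
      then show ?thesis using \<eta> by auto
    qed
  qed
  then show ?thesis using assms(3) by unfold_locales auto
qed

lemma strongly_connected_edgeless:
  assumes "fin_digraph E" "strongly_connected_graph E" "arcs E = {}"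
  shows "\<exists>v. verts E \<subseteq> {v}"
proof -
  have "v = w" if vw: "v \<in> verts E" "w \<in> verts E" for v w
  proof -
    have "v \<rightarrow>\<^sup>*\<^bsub>E\<^esub> w" using assms(2) vw by (simp add: strongly_connected_graph_def)
    then obtain \<eta> where \<eta>: "epath E \<eta> w" "pstart E \<eta> w = v" using reachable_epath[OF assms(1)] by blast
    then have "\<eta> = []" using assms(3) by (cases \<eta>) auto
    with \<eta> show ?thesis by simp
  qed
  then show ?thesis by blast
qed

lemma strongly_connected_regular:
  assumes "fin_digraph E" "strongly_connected_graph E"
  shows "regular_graph E"
proof (cases "arcs E = {}")
  case True
  interpret fin_digraph E by fact
  show ?thesis by unfold_locales (use True strongly_connected_edgeless[OF assms True] in auto)
next
  case False
  interpret shift_graph E by (rule strongly_connected_shift_graph[OF assms False])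
  show ?thesis by (rule regular_graph_axioms)
qed

section \<open>Determinants of higher block presentations\<close>

context shift_graph
begin

text \<open>The matrix 1 - A of the higher block graph, which is the value of \<open>M1\<close> at t
  = 1.\<close>

definition line_entry :: "'e list \<Rightarrow> 'e list \<Rightarrow> int" where
  "line_entry x y = idf x y - (if edge x y then 1 else 0)"

lemma epath_snoc_iff:
  assumes "x \<noteq> []" "epath E x (tgt x)" "e \<in> arcs E"
  shows "epath E (x @ [e]) (head E e) \<longleftrightarrow> tgt x = tail E e"
proof -
  have "epath E (x @ [e]) (head E e) \<longleftrightarrow> epath E x (tail E e)"
    using assms(3) by (simp add: epath_append)
  also have "\<dots> \<longleftrightarrow> tgt x = tail E e" using epath_tgt[OF _ assms(1)] assms(2) by metis
  finally show ?thesis .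
qed

text \<open>A path of length \<open>N + 1\<close> is a step from its \<open>butlast\<close> to its
  \<open>tl\<close>. With the incidence matrices \<open>?R\<close> and \<open>?S\<close>, the
  adjacency matrices of the two block graphs are R S and S R, and Sylvester's identity
  applies.\<close>

lemma det_line_entry_Suc:
  assumes N: "1 \<le> N" and xs: "distinct xs" "set xs = paths N"
    and ys: "distinct ys" "set ys = paths (Suc N)"
  shows "det (fmat xs xs line_entry) = det (fmat ys ys line_entry)"
proof -
  let ?R = "\<lambda>x \<kappa>. if butlast \<kappa> = x then 1 else 0 :: int"
  let ?S = "\<lambda>\<kappa> x. if tl \<kappa> = x then 1 else 0 :: int"
  have 1: "line_entry x x' = idf x x' - (\<Sum>\<kappa>\<in>set ys. ?R x \<kappa> * ?S \<kappa> x')"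
    if x: "x \<in> set xs" "x' \<in> set xs" for x x'
  proof -
    have ne: "x \<noteq> []" "x' \<noteq> []" and len: "length x = N" "length x' = N" using x xs N by (auto simp: paths_def)
    let ?k = "x @ [last x']"
    have *: "butlast \<kappa> = x \<and> tl \<kappa> = x' \<longleftrightarrow> \<kappa> = ?k \<and> tl x = butlast x'" if "\<kappa> \<in> set ys" for \<kappa>
    proof -
      have "length \<kappa> = Suc N" using that ys by (auto simp: paths_def)
      then have "\<kappa> = butlast \<kappa> @ [last (tl \<kappa>)]" "tl (butlast \<kappa>) = butlast (tl \<kappa>)"
        using N by (cases \<kappa>; force simp: butlast_tl)+
      then show ?thesis using ne by (metis butlast_snoc append_butlast_last_id tl_append2)
    qed
    have mem: "?k \<in> set ys \<longleftrightarrow> tgt x = tail E (last x')"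
    proof -
      have "epath E x (tgt x)" "epath E x' (tgt x')" using x xs by (auto simp: paths_def)
      moreover have "last x' \<in> arcs E" using epath_arcs[OF calculation(2)] ne by auto
      moreover have "tgt ?k = head E (last x')" by (simp add: tgt_def)
      ultimately show ?thesis using epath_snoc_iff[OF ne(1)] len unfolding ys(2) paths_def by simp
    qed
    have "(\<Sum>\<kappa>\<in>set ys. ?R x \<kappa> * ?S \<kappa> x') = (\<Sum>\<kappa>\<in>set ys. if \<kappa> = ?k then (if tl x = butlast x' then 1 else 0) else 0)"
    proof (rule sum.cong[OF refl])
      fix \<kappa> assume \<kappa>: "\<kappa> \<in> set ys"
      have "?R x \<kappa> * ?S \<kappa> x' = (if butlast \<kappa> = x \<and> tl \<kappa> = x' then 1 else 0)" by simp
      then show "?R x \<kappa> * ?S \<kappa> x' = (if \<kappa> = ?k then (if tl x = butlast x' then 1 else 0) else 0)"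
        unfolding *[OF \<kappa>] by simp
    qed
    also have "\<dots> = (if edge x x' then 1 else 0)" using mem by (simp add: edge_def)
    finally show ?thesis by (simp add: line_entry_def)
  qed
  have 2: "line_entry \<kappa> \<kappa>' = idf \<kappa> \<kappa>' - (\<Sum>x\<in>set xs. ?S \<kappa> x * ?R x \<kappa>')"
    if \<kappa>: "\<kappa> \<in> set ys" "\<kappa>' \<in> set ys" for \<kappa> \<kappa>'
  proof -
    have len: "length \<kappa> = Suc N" "length \<kappa>' = Suc N" using \<kappa> unfolding ys(2) paths_def by auto
    obtain e p where "\<kappa> = e # p" "length p = N" using len(1) by (cases \<kappa>) auto
    moreover from this have "p \<noteq> []" using N by auto
    ultimately have p: "\<kappa> = e # p" "p \<noteq> []" "length p = N" by blast+
    obtain q f where "\<kappa>' = q @ [f]" "length q = N" using len(2) by (cases \<kappa>' rule: rev_cases) auto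
    moreover from this have "q \<noteq> []" using N by auto
    ultimately have q: "\<kappa>' = q @ [f]" "q \<noteq> []" by blast+
    have mem: "p \<in> set xs" "p = q \<longrightarrow> head E (last q) = tail E f"
    proof -
      have "tgt (e # p) = tgt p" using p(2) by (simp add: tgt_def)
      then show "p \<in> set xs" using \<kappa>(1) p unfolding xs(2) ys(2) paths_def by simp
      have "epath E q (tail E f)" using \<kappa>(2) q unfolding ys(2) paths_def by (simp add: epath_append)
      from epath_tgt[OF this q(2)] show "p = q \<longrightarrow> head E (last q) = tail E f" by (simp add: tgt_def)
    qed
    have "(\<Sum>x\<in>set xs. ?S \<kappa> x * ?R x \<kappa>') = (\<Sum>x\<in>set xs. if x = p then (if p = q then 1 else 0) else 0)"
      using p q by (intro sum.cong refl) auto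
    also have "\<dots> = (if edge \<kappa> \<kappa>' then 1 else 0)" using mem p q by (auto simp: edge_def tgt_def)
    finally show ?thesis by (simp add: line_entry_def)
  qed
  have "det (fmat xs xs line_entry) = det (fmat xs xs (\<lambda>x x'. idf x x' - (\<Sum>\<kappa>\<in>set ys. ?R x \<kappa> * ?S \<kappa> x')))"
    by (rule arg_cong[of _ _ det], rule fmat_cong) (rule 1)
  also have "\<dots> = det (fmat ys ys (\<lambda>\<kappa> \<kappa>'. idf \<kappa> \<kappa>' - (\<Sum>x\<in>set xs. ?S \<kappa> x * ?R x \<kappa>')))"
    by (rule det_fmat_commute[OF xs(1) ys(1)])
  also have "\<dots> = det (fmat ys ys line_entry)"
    by (rule arg_cong[of _ _ det], rule fmat_cong) (rule 2[symmetric])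
  finally show ?thesis .
qed

text \<open>The same factorisation with vertices in place of the shorter paths: an edge is a step
  from its tail to its head. The sum over the edges counts parallel ones and so produces the
  multiplicities in \<open>adjacency\<close>.\<close>

lemma det_line_entry_1:
  assumes vs: "distinct vs" "set vs = verts E" and xs: "distinct xs" "set xs = paths 1"
  shows "det (fmat vs vs (\<lambda>v w. idf v w - int (adjacency E v w))) = det (fmat xs xs line_entry)"
proof -
  let ?R = "\<lambda>v \<kappa>. if tail E (hd \<kappa>) = v then 1 else 0 :: int"
  let ?S = "\<lambda>\<kappa> v. if tgt \<kappa> = v then 1 else 0 :: int"
  have p1: "paths 1 = (\<lambda>e. [e]) ` arcs E"
    by (auto simp: paths_def tgt_def length_Suc_conv)
  have 1: "int (adjacency E v w) = (\<Sum>\<kappa>\<in>set xs. ?R v \<kappa> * ?S \<kappa> w)" for v w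
  proof -
    have "(\<Sum>\<kappa>\<in>set xs. ?R v \<kappa> * ?S \<kappa> w) = (\<Sum>e\<in>arcs E. if tail E e = v \<and> head E e = w then 1 else 0)"
      unfolding xs(2) p1 by (subst sum.reindex) (auto simp: inj_on_def tgt_def intro!: sum.cong)
    also have "\<dots> = int (adjacency E v w)"
      by (simp add: adjacency_def sum.If_cases Int_def)
    finally show ?thesis by simp
  qed
  have 2: "line_entry \<kappa> \<kappa>' = idf \<kappa> \<kappa>' - (\<Sum>v\<in>set vs. ?S \<kappa> v * ?R v \<kappa>')"
    if \<kappa>: "\<kappa> \<in> set xs" "\<kappa>' \<in> set xs" for \<kappa> \<kappa>'
  proof -
    obtain e f where e: "\<kappa> = [e]" "\<kappa>' = [f]" "e \<in> arcs E" using \<kappa> unfolding xs(2) p1 by auto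
    have "(\<Sum>v\<in>set vs. ?S \<kappa> v * ?R v \<kappa>')
        = (\<Sum>v\<in>set vs. if v = head E e then (if head E e = tail E f then 1 else 0) else 0)"
      by (intro sum.cong refl) (auto simp: e tgt_def)
    also have "\<dots> = (if edge \<kappa> \<kappa>' then 1 else 0)" using e vs by (simp add: edge_def tgt_def)
    finally show ?thesis by (simp add: line_entry_def)
  qed
  have "det (fmat xs xs line_entry) = det (fmat xs xs (\<lambda>\<kappa> \<kappa>'. idf \<kappa> \<kappa>' - (\<Sum>v\<in>set vs. ?S \<kappa> v * ?R v \<kappa>')))"
    by (rule arg_cong[of _ _ det], rule fmat_cong) (rule 2)
  also have "\<dots> = det (fmat vs vs (\<lambda>v w. idf v w - (\<Sum>\<kappa>\<in>set xs. ?R v \<kappa> * ?S \<kappa> w)))"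
    by (rule det_fmat_commute[OF xs(1) vs(1)])
  finally show ?thesis by (simp add: 1)
qed

lemma det_line_entry:
  assumes vs: "distinct vs" "set vs = verts E" and N: "1 \<le> N" and xs: "distinct xs" "set xs = paths N"
  shows "det (fmat xs xs line_entry) = det (fmat vs vs (\<lambda>v w. idf v w - int (adjacency E v w)))"
  using N xs
proof (induction N arbitrary: xs rule: dec_induct)
  case base
  then show ?case using det_line_entry_1[OF vs] by simp
next
  case (step N)
  obtain ys where ys: "set ys = paths N" "distinct ys"
    using finite_distinct_list[OF finite_paths] by blast
  show ?case
    using det_line_entry_Suc[OF step.hyps(1) ys(2,1) step.prems] step.IH[OF ys(2,1)] by simp
qed

end

lemma (in graded_level) eval1_det_M1:
  assumes "distinct vs" "set vs = verts E" "distinct xs" "set xs = paths N"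
  shows "eval1 (det (fmat xs xs M1)) = det (fmat vs vs (\<lambda>v w. idf v w - int (adjacency E v w)))"
proof -
  have "eval1 (M1 x y) = line_entry x y" for x y
    unfolding M1_def line_entry_def eval1.hom_minus by (simp add: wt_def idf_def eval1.hom_one)
  then have "map_mat eval1 (fmat xs xs M1) = fmat xs xs line_entry"
    by (auto simp: fmat_def)
  then show ?thesis
    using eval1.hom_det[of "fmat xs xs M1"] det_line_entry[OF assms(1,2) N_pos assms(3,4)] by simp
qed

section \<open>Degenerate graphs\<close>

context shift_graph
begin

lemma projection_contains_cyl:
  assumes "dg Y \<in> stein E" "Y \<noteq> {}"
  obtains w j \<kappa> where "epath E \<kappa> w" "cyl w (j, \<kappa>) \<subseteq> Y"
proof -
  obtain M where M: "cylindrical M Y" using stein_cylindrical[OF assms(1)] by blast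
  with assms(2) obtain t where "t \<in> sublabels M Y" unfolding cylindrical_def by blast
  then show ?thesis using that by (cases t) (auto simp: sublabels_iff)
qed

lemma ex_closed_path:
  assumes "strongly_connected_graph E" "w \<in> verts E"
  obtains \<gamma> where "\<gamma> \<noteq> []" "epath E \<gamma> w" "pstart E \<gamma> w = w"
proof -
  obtain e where e: "e \<in> arcs E" "tail E e = w" using no_sinks assms(2) by fastforce
  then have "head E e \<rightarrow>\<^sup>*\<^bsub>E\<^esub> w" using assms by (simp add: strongly_connected_graph_def)
  from reachable_epath[OF fin_digraph_axioms this]
  obtain \<eta> where "epath E \<eta> w" "pstart E \<eta> w = head E e" by blast
  with e show ?thesis by (intro that[of "e # \<eta>"]) auto
qed

text \<open>A cylinder in \<open>Y\<close> can be prolonged by a closed path \<gamma> at its end,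
  and exchanging \<kappa> for \<open>\<kappa> @ \<gamma>\<close> is an element of the corner. Its
  degree is the length of \<gamma>, and a nonzero symmetric matrix cannot have a degree other than
  0.\<close>

lemma corner_not_symmetric:
  assumes "strongly_connected_graph E" "dg Y \<in> stein E" "Y \<noteq> {}"
  obtains T where "T \<in> stein E" "mm (dg Y) (mm T (dg Y)) = T" "tr T \<noteq> T"
proof -
  obtain w j \<kappa> where w: "epath E \<kappa> w" "cyl w (j, \<kappa>) \<subseteq> Y"
    by (rule projection_contains_cyl[OF assms(2,3)])
  have wv: "w \<in> verts E" using w(1) by (rule epath_verts)
  obtain \<gamma> where \<gamma>: "\<gamma> \<noteq> []" "epath E \<gamma> w" "pstart E \<gamma> w = w"
    by (rule ex_closed_path[OF assms(1) wv])
  let ?T = "bb w (j, \<kappa> @ \<gamma>) (j, \<kappa>)"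
  have \<kappa>\<gamma>: "epath E (\<kappa> @ \<gamma>) w" using \<gamma> w by (simp add: epath_append)
  have sub: "cyl w (j, \<kappa> @ \<gamma>) \<subseteq> Y" using cyl_append_subset[OF \<gamma>(2,3)] w(2) by blast
  have nz: "?T a c = 0" if "a \<notin> Y \<or> c \<notin> Y" for a c
  proof (rule ccontr)
    assume "?T a c \<noteq> 0"
    then have "a \<in> cyl w (j, \<kappa> @ \<gamma>) \<and> c \<in> cyl w (j, \<kappa>)" unfolding bb_nz cyl_def by auto
    with that sub w(2) show False by blast
  qed
  have "?T \<in> stein E" by (rule bb_stein[OF \<kappa>\<gamma> w(1)])
  moreover have "mm (dg Y) (mm ?T (dg Y)) = ?T"
  proof -
    have "mm ?T (dg Y) = ?T" unfolding mm_dg by (intro ext) (simp add: nz)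
    moreover have "mm (dg Y) ?T = ?T"
      unfolding dg_mm[OF stein_colfin[OF \<open>?T \<in> stein E\<close>]] by (intro ext) (simp add: nz)
    ultimately show ?thesis by simp
  qed
  moreover have "tr ?T \<noteq> ?T"
  proof
    assume eq: "tr ?T = ?T"
    obtain z where z: "z \<in> X" "src E z = w" by (rule ex_ipath[OF wv])
    let ?a = "(j, (\<kappa> @ \<gamma>) \<frown> z, int (length (\<kappa> @ \<gamma>)))" and ?c = "(j, \<kappa> \<frown> z, int (length \<kappa>))"
    have "?T ?a ?c \<noteq> 0" unfolding bb_nz using z by (auto intro!: exI[of _ z] exI[of _ 0])
    then have "tr ?T ?a ?c \<noteq> 0" unfolding eq .
    then have "bb w (j, \<kappa>) (j, \<kappa> @ \<gamma>) ?a ?c \<noteq> 0" by (simp add: tr_bb)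
    then have "length \<gamma> = 0" unfolding bb_nz by auto
    with \<gamma>(1) show False by simp
  qed
  ultimately show ?thesis by (rule that)
qed

lemma strongly_connected_branching:
  assumes sc: "strongly_connected_graph E"
    and z: "z \<in> X" "z' \<in> X" "src E z = src E z'" "z \<noteq> z'" and v: "v \<in> verts E"
  shows "\<exists>z z'. z \<in> X \<and> z' \<in> X \<and> src E z = v \<and> src E z' = v \<and> z \<noteq> z'"
proof -
  have "v \<rightarrow>\<^sup>*\<^bsub>E\<^esub> src E z"
    using sc v src_in_verts[OF z(1)] by (simp add: strongly_connected_graph_def)
  from reachable_epath[OF fin_digraph_axioms this]
  obtain \<eta> where \<eta>: "epath E \<eta> (src E z)" "pstart E \<eta> (src E z) = v" by blast
  then have "\<eta> \<frown> z \<in> X" "\<eta> \<frown> z' \<in> X" using z by (auto simp: conc_in_X)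
  moreover have "\<eta> \<frown> z \<noteq> \<eta> \<frown> z'"
    using z(4) suffix_conc_length[of \<eta> z] suffix_conc_length[of \<eta> z'] by metis
  ultimately show ?thesis using \<eta> z(3) src_conc by metis
qed

text \<open>For a strongly connected graph with edges, the negation says that no vertex starts two
  infinite paths, so that the graph is a single cycle.\<close>

definition branching :: bool where
  "branching \<longleftrightarrow> (\<forall>v\<in>verts E. \<exists>z z'. z \<in> X \<and> z' \<in> X \<and> src E z = v \<and> src E z' = v \<and> z \<noteq> z')"

lemma not_branching:
  assumes "strongly_connected_graph E" "\<not> branching" "z \<in> X" "z' \<in> X" "src E z = src E z'"
  shows "z = z'"
  using assms strongly_connected_branching[of z z'] unfolding branching_def by blast

text \<open>Two infinite paths from the end of a cylinder in \<open>Y\<close> separate after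
  finitely many edges. The points that follow the first path up to there form a smaller cylinder,
  which omits the second path.\<close>

lemma branching_subprojection:
  assumes br: branching and Y: "dg Y \<in> stein E" "Y \<noteq> {}"
  obtains Z where "dg Z \<in> stein E" "Z \<noteq> {}" "Z \<subset> Y"
proof -
  obtain w j \<kappa> where w: "epath E \<kappa> w" "cyl w (j, \<kappa>) \<subseteq> Y"
    by (rule projection_contains_cyl[OF Y])
  have "w \<in> verts E" using w(1) by (rule epath_verts)
  then obtain z z' where z: "z \<in> X" "z' \<in> X" "src E z = w" "src E z' = w" "z \<noteq> z'"
    using br unfolding branching_def by blast
  from z(5) obtain n where n: "z n \<noteq> z' n" by auto
  define \<eta> y where "\<eta> = prefix (Suc n) z" and "y = suffix (Suc n) z"
  then have zz: "\<eta> \<frown> y = z" and \<eta>n: "n < length \<eta>" "\<eta> ! n = z n" by (simp_all add: nth_append)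
  have y: "y \<in> X" "epath E \<eta> (src E y)"
    using conc_in_X[of \<eta> y] z(1) unfolding zz by blast+
  have st: "pstart E \<eta> (src E y) = w"
    using src_conc[of \<eta> y] z(1,3) unfolding zz by metis
  let ?Z = "cyl (src E y) (j, \<kappa> @ \<eta>)"
  have "dg ?Z \<in> stein E"
    by (rule cyl_stein) (use y st w in \<open>simp add: epath_append\<close>)
  moreover have "?Z \<noteq> {}" by (rule cyl_nonempty) (rule src_in_verts[OF y(1)])
  moreover have "?Z \<subseteq> Y" using cyl_append_subset[OF y(2) st] w(2) by blast
  moreover have "(j, \<kappa> \<frown> z', 0) \<in> Y" using w(2) z by (auto simp: cyl_def)
  moreover have "(j, \<kappa> \<frown> z', 0) \<notin> ?Z"
  proof
    assume "(j, \<kappa> \<frown> z', 0) \<in> ?Z"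
    then obtain x where "\<kappa> \<frown> z' = \<kappa> \<frown> \<eta> \<frown> x" unfolding cyl_def by (auto simp: conc_conc)
    then have "z' = \<eta> \<frown> x" by (metis conc_conc suffix_conc_length)
    then have "z' n = (\<eta> \<frown> x) n" by (rule arg_cong)
    then show False using n \<eta>n by (simp add: conc_def)
  qed
  ultimately show ?thesis using that by blast
qed

text \<open>The cylinder of a vertex consists of one path with all its degrees. A nonempty compact
  open set contains a cylinder, and cylinders contain their paths with all degrees.\<close>

lemma not_branching_minimal:
  assumes unique: "\<And>z z'. z \<in> X \<Longrightarrow> z' \<in> X \<Longrightarrow> src E z = src E z' \<Longrightarrow> z = z'"
    and Y: "dg Y \<in> stein E" "Y \<noteq> {}" "Y \<subseteq> cyl v (0, [])"
  shows "Y = cyl v (0, [])"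
proof
  obtain w j \<kappa> where w: "epath E \<kappa> w" "cyl w (j, \<kappa>) \<subseteq> Y"
    by (rule projection_contains_cyl[OF Y(1,2)])
  obtain z where z: "z \<in> X" "src E z = w" by (rule ex_ipath[OF epath_verts[OF w(1)]])
  have in_Y: "(j, \<kappa> \<frown> z, k) \<in> Y" for k using w(2) z by (auto simp: cyl_def)
  then have "(j, \<kappa> \<frown> z, 0) \<in> cyl v (0, [])" using Y(3) by blast
  then have \<kappa>z: "j = 0" "\<kappa> \<frown> z \<in> X" "src E (\<kappa> \<frown> z) = v" by (auto simp: cyl_def)
  show "cyl v (0, []) \<subseteq> Y"
  proof
    fix c assume "c \<in> cyl v (0, [])"
    then obtain y k where y: "y \<in> X" "src E y = v" "c = (0, y, k)" by (auto simp: cyl_def)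
    then have "y = \<kappa> \<frown> z" using unique \<kappa>z(2,3) by metis
    with in_Y \<kappa>z(1) y(3) show "c \<in> Y" by simp
  qed
qed (rule Y(3))

text \<open>Every vertex emits exactly one edge, so the rows of A sum to 1 and 1 - A annihilates the
  vector of ones.\<close>

lemma det_not_branching:
  assumes unique: "\<And>z z'. z \<in> X \<Longrightarrow> z' \<in> X \<Longrightarrow> src E z = src E z' \<Longrightarrow> z = z'"
    and vs: "distinct vs" "set vs = verts E"
  shows "det (fmat vs vs (\<lambda>v w. idf v w - int (adjacency E v w))) = 0"
proof -
  have card: "card (out_arcs E v) = 1" if v: "v \<in> verts E" for v
  proof -
    have "e = f" if ef: "e \<in> out_arcs E v" "f \<in> out_arcs E v" for e f
    proof -
      have "head E e \<in> verts E" "head E f \<in> verts E" using ef by auto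
      then obtain z z' where z: "z \<in> X" "src E z = head E e" "z' \<in> X" "src E z' = head E f"
        using ex_ipath by metis
      then have x: "[e] \<frown> z \<in> X" "[f] \<frown> z' \<in> X" using ef unfolding conc_in_X by auto
      moreover have "src E ([e] \<frown> z) = src E ([f] \<frown> z')"
        using x[THEN src_conc] ef by simp
      ultimately have "[e] \<frown> z = [f] \<frown> z'" by (rule unique)
      then have "([e] \<frown> z) 0 = ([f] \<frown> z') 0" by (rule arg_cong)
      then show ?thesis by simp
    qed
    moreover obtain e where "e \<in> out_arcs E v" using no_sinks v by blast
    ultimately have "out_arcs E v = {e}" by blast
    then show ?thesis by simp
  qed
  have row: "(\<Sum>w\<in>verts E. int (adjacency E v w)) = 1" if v: "v \<in> verts E" for v
  proof -
    have "(\<Sum>w\<in>verts E. adjacency E v w) = card (out_arcs E v)"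
    proof -
      have "out_arcs E v = (\<Union>w\<in>verts E. {e \<in> arcs E. tail E e = v \<and> head E e = w})"
        by (auto simp: out_arcs_def)
      then have "card (out_arcs E v) = (\<Sum>w\<in>verts E. card {e \<in> arcs E. tail E e = v \<and> head E e = w})"
        by (simp only:) (rule card_UN_disjoint, auto)
      then show ?thesis by (simp add: adjacency_def)
    qed
    then show ?thesis using card[OF v] by (metis of_nat_1 of_nat_sum)
  qed
  let ?n = "length vs"
  let ?A = "fmat vs vs (\<lambda>v w. idf v w - int (adjacency E v w))"
  let ?u = "vec ?n (\<lambda>_. 1 :: int)"
  have "?A *\<^sub>v ?u = 0\<^sub>v ?n"
  proof (rule eq_vecI)
    fix i assume "i < dim_vec (0\<^sub>v ?n :: int vec)"
    then have i: "i < ?n" by simp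
    then have vi: "vs ! i \<in> verts E" using nth_mem[OF i] vs(2) by simp
    have "(?A *\<^sub>v ?u) $ i = (\<Sum>k<?n. idf (vs ! i) (vs ! k) - int (adjacency E (vs ! i) (vs ! k)))"
      using i by (simp add: fmat_def scalar_prod_def atLeast0LessThan)
    also have "\<dots> = (\<Sum>w\<in>verts E. idf (vs ! i) w - int (adjacency E (vs ! i) w))"
      by (rule sum.reindex_bij_betw[OF bij_betw_nth[OF vs(1) refl vs(2)[symmetric]]])
    also have "\<dots> = 0" using row[OF vi] vi by (simp add: sum_subtractf idf_def)
    finally show "(?A *\<^sub>v ?u) $ i = 0\<^sub>v ?n $ i" using i by simp
  qed (simp add: fmat_def)
  moreover have "?u \<noteq> 0\<^sub>v ?n"
  proof -
    obtain e where "e \<in> arcs E" using has_arcs by blast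
    then have "tail E e \<in> set vs" by (simp add: vs(2))
    then have "0 < ?n" by (rule length_pos_if_in_set)
    then have "?u $ 0 \<noteq> 0\<^sub>v ?n $ 0" by simp
    then show ?thesis by metis
  qed
  ultimately show ?thesis
    using det_0_iff_vec_prod_zero[of ?A ?n] by (auto intro!: exI[of _ ?u])
qed

end

lemma edgeless_wact:
  assumes "arcs E = {}" "wact E w b = Some a"
  shows "a = b"
  using assms(2)
proof (induction w arbitrary: a)
  case (Cons g w)
  then obtain c where c: "wact E w b = Some c" "act E g c = Some a" by (auto simp: map_comp_Some_iff)
  then show ?case using Cons.IH[OF c(1)] assms(1) by (cases g; cases c) (auto split: if_splits)
qed simp

lemma edgeless_stein_diagonal:
  assumes "arcs E = {}" "T \<in> stein E" "a \<noteq> b"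
  shows "T (i, a) (j, b) = 0"
proof -
  obtain f where "T = (\<lambda>(i, a) (j, b). lin (wrep E) (f (i, j)) a b)"
    using assms(2) unfolding stein_def by blast
  moreover have "wrep E w a b = 0" for w
    using edgeless_wact[OF assms(1), of w b a] assms(3) by (auto simp: wrep_def pmat_def)
  ultimately show ?thesis by (simp add: lin_def)
qed

text \<open>For a single vertex, a matrix of the algebra can move only the block index, so the
  corner of one diagonal matrix unit consists of symmetric matrices. The corners of \<open>F\<close>
  do not. Without vertices the algebra is 0.\<close>

lemma not_stein_iso_edgeless:
  assumes E: "regular_graph E" "arcs E = {}" and F: "shift_graph F" "strongly_connected_graph F"
  shows "\<not> stein_iso \<psi> E F"
proof
  assume iso: "stein_iso \<psi> E F"
  interpret E: regular_graph E by (rule E)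
  interpret F: shift_graph F by (rule F)
  note d = iso[unfolded stein_iso_def]
  have mul: "\<psi> (mm S T) = mm (\<psi> S) (\<psi> T)" if "S \<in> stein E" "T \<in> stein E" for S T using d that by blast
  have star: "\<psi> (tr S) = tr (\<psi> S)" if "S \<in> stein E" for S using d that by blast
  have inj: "S = T" if "S \<in> stein E" "T \<in> stein E" "\<psi> S = \<psi> T" for S T
    using d that unfolding bij_betw_def inj_on_def by blast
  have surj: "\<exists>S\<in>stein E. \<psi> S = T" if "T \<in> stein F" for T
    using d that unfolding bij_betw_def by (metis imageE)
  have into: "\<psi> S \<in> stein F" if "S \<in> stein E" for S using d that unfolding bij_betw_def by blast
  have zero: "\<psi> 0 = 0"
  proof -
    have "\<psi> (0 + 0) = \<psi> 0 + \<psi> 0" using d E.stein_zero by blast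
    then show ?thesis by simp
  qed
  show False
  proof (cases "verts E = {}")
    case True
    have "S = 0" if S: "S \<in> stein E" for S
    proof -
      obtain f where f: "\<And>ij. f ij \<in> elems (semigroup_algebra (word_semigroup E))"
        "S = (\<lambda>(i, a) (j, b). lin (wrep E) (f (i, j)) a b)"
        using S unfolding stein_def by blast
      have "Poly_Mapping.keys (f ij) = {}" for ij using f(1)[of ij] E(2) True by (auto simp: E.WA_elems)
      then show ?thesis unfolding f(2) by (auto simp: lin_def fun_eq_iff)
    qed
    then have z: "T = 0" if "T \<in> stein F" for T using surj[OF that] zero by metis
    obtain e where e: "e \<in> arcs F" using F.has_arcs by blast
    then have "tail F e \<in> verts F" by simp
    then show False
      using z[OF F.cyl_stein[of "[]" "tail F e" 0]] F.cyl_nonempty[of "tail F e" "(0, [])"] by simp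
  next
    case False
    then obtain v where v: "v \<in> verts E" by blast
    let ?x = "\<lambda>_. undefined :: 'b"
    have sv: "src E ?x = v"
    proof -
      have "(SOME v. v \<in> verts E) \<in> verts E" using v by (rule someI)
      then show ?thesis using E.regular v E(2) by (auto simp: src_def)
    qed
    \<comment> \<open>The projection onto block 0: its corner leaves no freedom in the block
      index.\<close>
    let ?Y = "{0 :: nat} \<times> {?x} \<times> (UNIV :: int set)"
    let ?f = "\<lambda>ij. if ij = (0 :: nat, 0 :: nat) then monomial [Vertex v] else 0 :: _ \<Rightarrow>\<^sub>0 int"
    have w: "wrep E [Vertex v] a b = (if a = b \<and> fst b = ?x then 1 else 0)" for a b
      using E(2) sv by (cases a; cases b) (auto simp: wrep_def pmat_def map_comp_def ipaths_def)
    have P: "dg ?Y \<in> stein E"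
      unfolding stein_def
    proof (intro CollectI exI conjI allI impI)
      show "finite {(0 :: nat, 0 :: nat)}" by simp
      show "?f ij \<in> elems (semigroup_algebra (word_semigroup E))" for ij
        using v by (auto simp: E.WA_elems)
      show "dg ?Y = (\<lambda>(i, a) (j, b). lin (wrep E) (?f (i, j)) a b)"
        by (auto simp: fun_eq_iff lin_def w dg_def)
    qed auto
    have iP: "isproj (\<psi> (dg ?Y))"
      unfolding isproj_def by (simp add: dg_dg flip: mul[OF P P] star[OF P])
    obtain Z where Z: "\<psi> (dg ?Y) = dg Z" using F.isproj_stein[OF into[OF P] iP] by blast
    have "\<psi> (dg ?Y) \<noteq> \<psi> 0" using inj[OF P E.stein_zero] by auto
    then have "Z \<noteq> {}" using Z zero by auto
    moreover have "dg Z \<in> stein F" using into[OF P] Z by simp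
    ultimately obtain T where T: "T \<in> stein F" "mm (dg Z) (mm T (dg Z)) = T" "tr T \<noteq> T"
      using F.corner_not_symmetric[OF F(2)] by blast
    obtain S where S: "S \<in> stein E" "\<psi> S = T" using surj[OF T(1)] by blast
    have "\<psi> (mm (dg ?Y) (mm S (dg ?Y))) = \<psi> S"
      using T(2) S P by (simp add: mul E.stein_mm Z)
    then have eq: "mm (dg ?Y) (mm S (dg ?Y)) = S"
      by (intro inj) (use S P in \<open>simp_all add: E.stein_mm\<close>)
    have "S a b = S b a" for a b
    proof (cases "a = b")
      case False
      have "S a b = 0" if ne: "a \<noteq> b" for a b
      proof (rule ccontr)
        assume nz: "S a b \<noteq> 0"
        have "mm (dg ?Y) (mm S (dg ?Y)) a b \<noteq> 0" using nz by (simp add: eq)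
        then have "a \<in> ?Y" "b \<in> ?Y"
          using E.stein_colfin[OF E.stein_mm[OF S(1) P]] by (auto simp: dg_mm mm_dg split: if_splits)
        then obtain a' b' where ab: "a = (0, a')" "b = (0, b')" by blast
        then have "a' \<noteq> b'" using ne by simp
        from edgeless_stein_diagonal[OF E(2) S(1) this] show False using nz unfolding ab by blast
      qed
      with False show ?thesis by metis
    qed simp
    then have "tr S = S" by (simp add: tr_def fun_eq_iff)
    then show False using T(3) S star[OF S(1)] by simp
  qed
qed

text \<open>The vertex projection \<open>dg ?C\<close> is minimal in \<open>E\<close>. Its image
  would be minimal in \<open>F\<close>, where branching puts a smaller nonzero projection below
  every nonzero one.\<close>

lemma (in stein_isomorphism) not_branching_both:
  assumes E: "strongly_connected_graph E" "\<not> E.branching" and F: "F.branching"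
  shows False
proof -
  obtain e where "e \<in> arcs E" using E.has_arcs by blast
  then obtain v where v: "v \<in> verts E" using E.head_in_verts by blast
  let ?C = "E.cyl v (0, [])"
  have C: "dg ?C \<in> stein E" using v by (intro E.cyl_stein) simp
  obtain Y where Y: "\<psi> (dg ?C) = dg Y"
    using F.isproj_stein[OF \<psi>_in[OF C]] \<psi>_isproj[OF C] by auto
  have "\<psi> (dg ?C) \<noteq> \<psi> 0" using \<psi>_inj[OF C E.stein_zero] E.cyl_nonempty[OF v] by simp
  then have "Y \<noteq> {}" "dg Y \<in> stein F" using Y \<psi>_zero \<psi>_in[OF C] by auto
  then obtain Z where Z: "dg Z \<in> stein F" "Z \<noteq> {}" "Z \<subset> Y"
    using F.branching_subprojection[OF F _ _] by metis
  obtain S where S: "S \<in> stein E" "\<psi> S = dg Z" using \<psi>_surj[OF Z(1)] by blast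
  then obtain W where W: "S = dg W" using E.isproj_stein[OF S(1)] \<psi>_isproj[OF S(1)] by auto
  have "\<psi> (mm (dg W) (dg ?C)) = mm (dg Z) (dg Y)" using \<psi>_mm[OF S(1) C] S(2) unfolding W Y by simp
  also have "\<dots> = \<psi> (dg W)" using Z(3) S(2) unfolding W by (simp add: dg_dg Int_absorb2 less_imp_le)
  finally have "\<psi> (mm (dg W) (dg ?C)) = \<psi> (dg W)" .
  then have "W \<inter> ?C = W"
    using \<psi>_inj[of "mm (dg W) (dg ?C)" "dg W"] S C by (simp add: E.stein_mm W) (simp add: dg_dg dg_inj)
  then have "W \<subseteq> ?C" by blast
  moreover have "W \<noteq> {}"
  proof
    assume "W = {}"
    then have "dg Z = 0" using S(2) W \<psi>_zero by simp
    then show False using Z(2) by simp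
  qed
  ultimately have "W = ?C"
    using E.not_branching_minimal[of W v] E.not_branching[OF E] S(1) W by metis
  then have "dg Z = dg Y" using S W Y by simp
  then show False using Z(3) by (simp add: dg_inj)
qed

text \<open>A single grading is used on both sides: path length on \<open>F\<close> and its pullback
  along \<open>\<psi>\<close> on \<open>E\<close>. The second divisibility comes from the inverse
  isomorphism with the same pair of gradings.\<close>

lemma (in stein_isomorphism) det_eq:
  assumes br: "E.branching" "F.branching"
    and vs: "distinct vs" "set vs = verts E" and ws: "distinct ws" "set ws = verts F"
  shows "det (fmat vs vs (\<lambda>v w. idf v w - int (adjacency E v w)))
    = det (fmat ws ws (\<lambda>v w. idf v w - int (adjacency F v w)))"
proof -
  let ?h = "\<lambda>d S. deg_hom d (\<psi> S)"
  interpret EG: graded E ?h by (rule transport_graded[OF F.graded_deg])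
  interpret FG: graded F deg_hom by (rule F.graded_deg)
  obtain N1 where N1: "EG.good_level N1" using EG.ex_good_level by blast
  obtain N2 where N2: "FG.good_level N2" using FG.ex_good_level by blast
  interpret EL: graded_level E ?h N1 by unfold_locales (rule N1)
  interpret FL: graded_level F deg_hom N2 by unfold_locales (rule N2)
  have I: "stein_isomorphism F E (the_inv_into (stein E) \<psi>)"
    by (intro stein_isomorphism.intro stein_isomorphism_axioms.intro F.shift_graph_axioms E.shift_graph_axioms iso_inverse)
  obtain ys where ys: "set ys = E.paths N1" "distinct ys"
    using finite_distinct_list[OF E.finite_paths] by blast
  obtain xs where xs: "set xs = F.paths N2" "distinct xs"
    using finite_distinct_list[OF F.finite_paths] by blast
  have inv: "\<psi> (the_inv_into (stein E) \<psi> S) = S" if "S \<in> stein F" for S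
    by (rule f_the_inv_into_f_bij_betw[of \<psi> _ "stein F"]) (use iso that in \<open>auto simp: stein_iso_def\<close>)
  have "det (fmat xs xs FL.M1) dvd det (fmat ys ys EL.M1)"
    by (rule det_dvd[OF EL.graded_level_axioms FL.graded_level_axioms _ xs(2,1) ys(2,1)]) simp
  moreover have "det (fmat ys ys EL.M1) dvd det (fmat xs xs FL.M1)"
    by (rule stein_isomorphism.det_dvd[OF I FL.graded_level_axioms EL.graded_level_axioms _ ys(2,1) xs(2,1)]) (simp add: inv)
  moreover have "pos (det (fmat ys ys EL.M1) - 1)"
    by (rule EL.det_M1_positive[OF _ ys(2,1)]) (use br(1) in \<open>simp add: E.branching_def\<close>)
  moreover have "pos (det (fmat xs xs FL.M1) - 1)"
    by (rule FL.det_M1_positive[OF _ xs(2,1)]) (use br(2) in \<open>simp add: F.branching_def\<close>)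
  ultimately have "det (fmat ys ys EL.M1) = det (fmat xs xs FL.M1)" by (intro mutual_dvd_unit_eq)
  then show ?thesis
    using EL.eval1_det_M1[OF vs ys(2,1)] FL.eval1_det_M1[OF ws xs(2,1)] by metis
qed

section \<open>The determinant\<close>

lemma det_adjacency_transpose:
  assumes "distinct vs"
  shows "det (1\<^sub>m (length vs) - transpose_mat (adjacency_mat E vs))
    = det (fmat vs vs (\<lambda>v w. idf v w - int (adjacency E v w)))"
proof -
  have A: "adjacency_mat E vs = fmat vs vs (\<lambda>v w. int (adjacency E v w))"
    by (simp add: adjacency_mat_def fmat_def)
  have "1\<^sub>m (length vs) - transpose_mat (adjacency_mat E vs)
      = transpose_mat (1\<^sub>m (length vs) - adjacency_mat E vs)"
    by (rule eq_matI) (auto simp: adjacency_mat_def)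
  also have "det \<dots> = det (1\<^sub>m (length vs) - adjacency_mat E vs)"
    by (rule det_transpose[of _ "length vs"]) (simp add: adjacency_mat_def minus_carrier_mat)
  finally show ?thesis unfolding A by (simp add: fmat_one[OF assms] fmat_diff)
qed

lemma det_edgeless:
  assumes "arcs E = {}" "distinct vs"
  shows "det (fmat vs vs (\<lambda>v w. idf v w - int (adjacency E v w))) = 1"
proof -
  have "fmat vs vs (\<lambda>v w. idf v w - int (adjacency E v w)) = 1\<^sub>m (length vs)"
    using assms by (simp add: adjacency_def fmat_one)
  then show ?thesis by simp
qed

text \<open>The isomorphism preserves each of three classes. Without edges the determinant is 1, for
  single cycles it is 0, and the branching graphs are those compared by Laurent polynomials.\<close>

theorem det_adjacency_invariant:
  assumes E: "fin_digraph E" "strongly_connected_graph E"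
    and F: "fin_digraph F" "strongly_connected_graph F"
    and vs: "distinct vs" "set vs = verts E" and ws: "distinct ws" "set ws = verts F"
    and iso: "star_ring_isomorphic (leavitt_Z_stabilized E) (leavitt_Z_stabilized F)"
  shows "det (1\<^sub>m (length vs) - transpose_mat (adjacency_mat E vs))
    = det (1\<^sub>m (length ws) - transpose_mat (adjacency_mat F ws))"
proof -
  note rE = strongly_connected_regular[OF E] and rF = strongly_connected_regular[OF F]
  obtain \<psi> where \<psi>: "stein_iso \<psi> E F" using stein_iso_exists[OF rE rF iso] by blast
  note \<phi> = stein_iso_inverse[OF rE \<psi>]
  show ?thesis
  proof (cases "arcs E = {}")
    case True
    have "arcs F = {}"
      using not_stein_iso_edgeless[OF rE True _ F(2)] strongly_connected_shift_graph[OF F] \<psi> by blast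
    with True show ?thesis using vs(1) ws(1) by (simp add: det_adjacency_transpose det_edgeless)
  next
    case False
    note sE = strongly_connected_shift_graph[OF E False]
    have "arcs F \<noteq> {}" using not_stein_iso_edgeless[OF rF _ sE E(2)] \<phi> by blast
    note sF = strongly_connected_shift_graph[OF F this]
    interpret E: shift_graph E by (rule sE)
    interpret F: shift_graph F by (rule sF)
    have I: "stein_isomorphism E F \<psi>" and J: "stein_isomorphism F E (the_inv_into (stein E) \<psi>)"
      by (intro stein_isomorphism.intro stein_isomorphism_axioms.intro sE sF \<psi> \<phi>)+
    show ?thesis
    proof (cases "E.branching")
      case True
      then have "F.branching" using stein_isomorphism.not_branching_both[OF J F(2)] by blast
      with True show ?thesis using stein_isomorphism.det_eq[OF I _ _ vs ws] vs ws by (simp add: det_adjacency_transpose)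
    next
      case False
      then have F': "\<not> F.branching" using stein_isomorphism.not_branching_both[OF I E(2)] by blast
      have "det (fmat vs vs (\<lambda>v w. idf v w - int (adjacency E v w))) = 0"
        by (rule E.det_not_branching[OF _ vs]) (rule E.not_branching[OF E(2) False])
      moreover have "det (fmat ws ws (\<lambda>v w. idf v w - int (adjacency F v w))) = 0"
        by (rule F.det_not_branching[OF _ ws]) (rule F.not_branching[OF F(2) F'])
      ultimately show ?thesis using vs(1) ws(1) by (simp add: det_adjacency_transpose)
    qed
  qed
qed

section \<open>The graphs \<open>E2\<close> and \<open>E2_minus\<close>\<close>

lemma E2_fin: "fin_digraph E2"
  by unfold_locales (auto simp: E2_def)

lemma E2_minus_fin: "fin_digraph E2_minus"
  by unfold_locales (auto simp: E2_minus_def)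

lemma E2_strongly_connected: "strongly_connected_graph E2"
proof -
  interpret fin_digraph E2 by (rule E2_fin)
  have "v \<rightarrow>\<^sup>*\<^bsub>E2\<^esub> w" if "v \<in> verts E2" "w \<in> verts E2" for v w
    using reachable_refl[OF that(1)] that by (simp add: E2_def)
  then show ?thesis by (simp add: strongly_connected_graph_def)
qed

text \<open>Vertex 2 is joined to both other vertices in both directions, so all paths can be led
  through it.\<close>

lemma E2_minus_strongly_connected: "strongly_connected_graph E2_minus"
proof -
  interpret fin_digraph E2_minus by (rule E2_minus_fin)
  have arc: "v \<rightarrow>\<^sup>*\<^bsub>E2_minus\<^esub> w" if "(v, w, 0) \<in> arcs E2_minus" for v w
  proof -
    have "v \<rightarrow>\<^bsub>E2_minus\<^esub> w" using that
      by (auto simp: arcs_ends_def arc_to_ends_def image_iff E2_minus_def)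
    then show ?thesis by (rule reachable_adjI)
  qed
  have "1 \<rightarrow>\<^sup>*\<^bsub>E2_minus\<^esub> 2" "2 \<rightarrow>\<^sup>*\<^bsub>E2_minus\<^esub> 1" "2 \<rightarrow>\<^sup>*\<^bsub>E2_minus\<^esub> 3" "3 \<rightarrow>\<^sup>*\<^bsub>E2_minus\<^esub> 2"
    by (rule arc, simp add: E2_minus_def)+
  then have "v \<rightarrow>\<^sup>*\<^bsub>E2_minus\<^esub> 2 \<and> 2 \<rightarrow>\<^sup>*\<^bsub>E2_minus\<^esub> v" if "v \<in> verts E2_minus" for v
    using that reachable_refl[OF that] by (auto simp: E2_minus_def)
  then show ?thesis unfolding strongly_connected_graph_def by (blast intro: reachable_trans)
qed

lemma det_E2: "det (1\<^sub>m 1 - transpose_mat (adjacency_mat E2 [1])) = - 1"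
proof -
  have "{e \<in> arcs E2. tail E2 e = 1 \<and> head E2 e = 1} = {(1, 1, 0), (1, 1, 1)}" by (auto simp: E2_def)
  then have "adjacency E2 1 1 = 2" by (simp add: adjacency_def)
  then show ?thesis by (subst det_single) (auto simp: adjacency_mat_def intro!: minus_carrier_mat)
qed

lemma det_2:
  fixes A :: "'a :: comm_ring_1 mat"
  assumes A: "A \<in> carrier_mat 2 2"
  shows "det A = A $$ (0, 0) * A $$ (1, 1) - A $$ (0, 1) * A $$ (1, 0)"
proof -
  have "det A = (\<Sum>j<2. A $$ (0, j) * cofactor A 0 j)"
    by (rule laplace_expansion_row[OF A]) simp
  also have "\<dots> = A $$ (0, 0) * cofactor A 0 0 + A $$ (0, 1) * cofactor A 0 1"
    by (simp add: numeral_2_eq_2 lessThan_Suc)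
  also have "cofactor A 0 0 = A $$ (1, 1)"
    unfolding cofactor_def by (subst det_single) (use A in \<open>auto simp: mat_delete_def\<close>)
  also have "cofactor A 0 1 = - A $$ (1, 0)"
    unfolding cofactor_def by (subst det_single) (use A in \<open>auto simp: mat_delete_def\<close>)
  finally show ?thesis by simp
qed

lemma det_E2_minus: "det (1\<^sub>m 3 - transpose_mat (adjacency_mat E2_minus [1, 2, 3])) = 1"
proof -
  \<comment> \<open>The edges listed without repetition, so that adjacency numbers become lengths of
    filtered lists.\<close>
  let ?es = "[(1, 1, 0), (1, 1, 1), (2, 2, 0), (3, 3, 0), (1, 2, 0), (2, 1, 0), (2, 3, 0), (3, 2, 0)]
    :: (nat \<times> nat \<times> nat) list"
  have count: "adjacency E2_minus v w = length (filter (\<lambda>(v', w', _). v' = v \<and> w' = w) ?es)" for v w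
  proof -
    have "{e \<in> arcs E2_minus. tail E2_minus e = v \<and> head E2_minus e = w}
        = {e. case e of (v', w', _) \<Rightarrow> v' = v \<and> w' = w} \<inter> set ?es"
      by (auto simp: E2_minus_def)
    moreover have "distinct ?es" by simp
    note distinct_length_filter[OF this, of "\<lambda>(v', w', _). v' = v \<and> w' = w"]
    ultimately show ?thesis unfolding adjacency_def by (simp only:)
  qed
  have adj: "adjacency E2_minus 1 1 = 2" "adjacency E2_minus 1 2 = 1" "adjacency E2_minus 1 3 = 0"
    "adjacency E2_minus 2 1 = 1" "adjacency E2_minus 2 2 = 1" "adjacency E2_minus 2 3 = 1"
    "adjacency E2_minus 3 1 = 0" "adjacency E2_minus 3 2 = 1" "adjacency E2_minus 3 3 = 1"
    unfolding count by simp_all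
  let ?B = "mat_of_rows_list 3 [[-1, -1, 0], [-1, 0, -1], [0, -1, 0 :: int]]"
  have carrier: "mat_delete ?B 0 j \<in> carrier_mat 2 2" for j
    by (rule carrier_matI) (simp_all add: mat_delete_def mat_of_rows_list_def)
  have minors:
    "mat_delete ?B 0 0 $$ (0, 0) = 0" "mat_delete ?B 0 0 $$ (0, 1) = -1"
    "mat_delete ?B 0 0 $$ (1, 0) = -1" "mat_delete ?B 0 0 $$ (1, 1) = 0"
    "mat_delete ?B 0 1 $$ (0, 0) = -1" "mat_delete ?B 0 1 $$ (0, 1) = -1"
    "mat_delete ?B 0 1 $$ (1, 0) = 0" "mat_delete ?B 0 1 $$ (1, 1) = 0"
    by (simp_all add: mat_delete_def mat_of_rows_list_def)
  have eq: "1\<^sub>m 3 - transpose_mat (adjacency_mat E2_minus [1, 2, 3]) = ?B"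
  proof (rule eq_matI)
    fix i j assume "i < dim_row ?B" "j < dim_col ?B"
    then have "i = 0 \<or> i = 1 \<or> i = 2" "j = 0 \<or> j = 1 \<or> j = 2" by (auto simp: mat_of_rows_list_def)
    then show "(1\<^sub>m 3 - transpose_mat (adjacency_mat E2_minus [1, 2, 3])) $$ (i, j) = ?B $$ (i, j)"
      by (elim disjE) (simp_all add: adjacency_mat_def mat_of_rows_list_def adj nth_Cons' del: One_nat_def)
  qed (simp_all add: adjacency_mat_def mat_of_rows_list_def)
  have "det ?B = (\<Sum>j<3. ?B $$ (0, j) * cofactor ?B 0 j)"
    by (rule laplace_expansion_row) (auto intro: carrier_matI simp: mat_of_rows_list_def)
  also have "\<dots> = - cofactor ?B 0 0 - cofactor ?B 0 1"
    by (simp add: mat_of_rows_list_def eval_nat_numeral lessThan_Suc)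
  also have "\<dots> = 1"
    unfolding cofactor_def det_2[OF carrier] minors by simp
  finally show ?thesis unfolding eq .
qed

theorem corollary4p7:
  fixes E :: "('v, 'e) pre_digraph" and F :: "('w, 'f) pre_digraph"
    and vs :: "'v list" and ws :: "'w list"
  shows
    "(fin_digraph E \<and> strongly_connected_graph E \<and>
      fin_digraph F \<and> strongly_connected_graph F \<and>
      distinct vs \<and> set vs = verts E \<and> distinct ws \<and> set ws = verts F \<and>
      star_ring_isomorphic (leavitt_Z_stabilized E) (leavitt_Z_stabilized F)
      \<longrightarrow> det (1\<^sub>m (length vs) - transpose_mat (adjacency_mat E vs))
        = det (1\<^sub>m (length ws) - transpose_mat (adjacency_mat F ws)))
    \<and> \<not> star_ring_isomorphic (leavitt_Z_stabilized E2) (leavitt_Z_stabilized E2_minus)"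
proof (intro conjI impI notI)
  assume "star_ring_isomorphic (leavitt_Z_stabilized E2) (leavitt_Z_stabilized E2_minus)"
  then have "det (1\<^sub>m (length [1 :: nat]) - transpose_mat (adjacency_mat E2 [1 :: nat]))
      = det (1\<^sub>m (length [1, 2, 3 :: nat]) - transpose_mat (adjacency_mat E2_minus [1, 2, 3]))"
    by (intro det_adjacency_invariant E2_fin E2_strongly_connected E2_minus_fin E2_minus_strongly_connected)
      (auto simp: E2_def E2_minus_def)
  then show False using det_E2 det_E2_minus by (simp add: numeral_3_eq_3)
qed (use det_adjacency_invariant in blast)

end
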